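(* Let $\theta\in[0,1]$, let $\mathbf B^0$ satisfy $\mathrm{div}\,\mathbf B^0=0$, and let $\{\mathbf B_h^n\}_{n=0}^N\subset\mathcal E_h$ and $\{\widehat E_h^{n+\theta}\}_{n=0}^{N-1}\subset\mathcal V_{h,0}$ be a solution of the virtual element scheme: $\mathbf B_h^0=\mathcal I^{\mathcal E_h}\mathbf B^0$ and, for $0\le n\le N-1$ and all $(\mathbf w_h,v_h)\in\mathcal E_h\times\mathcal V_{h,0}$, $$\Big(\frac{\mathbf B_h^{n+1}-\mathbf B_h^n}{\Delta t},\mathbf w_h\Big)_{\mathcal E_h}+(\mathbf{rot}\,E_h^{n+\theta},\mathbf w_h)_{\mathcal E_h}=0,$$ $$(\widehat E_h^{n+\theta},v_h)_{\mathcal V_h}+\big(\mathcal I^{\mathcal V_h}(\mathbf u\times\Pi^{RT}\mathbf B_h^{n+\theta}),v_h\big)_{\mathcal V_h}-(\mathbf B_h^{n+\theta},\mathbf{rot}\,v_h)_{\mathcal E_h}=-\big(\mathcal I^{\mathcal V_h}(E_0^{n+\theta}),v_h\big)_{\mathcal V_h},$$ where $E_h^{n+\theta}=\widehat E_h^{n+\theta}+\mathcal I^{\mathcal V_h}(E_0^{n+\theta})$ and $\mathbf B_h^{n+\theta}=\theta\mathbf B_h^{n+1}+(1-\theta)\mathbf B_h^n$. Then $\mathrm{div}\,\mathbf B_h^n=0$ for every $0\le n\le N$.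
   Context: **Data.** $\Omega\subset\mathbb R^2$ is open, bounded, polygonal; $T>0$, $\Delta t=T/N$. For a scalar $v$, $\mathbf{rot}\,v=(\partial_y v,-\partial_x v)^T$; for a vector $\mathbf w=(w_x,w_y)^T$, $\mathrm{rot}\,\mathbf w=\partial_y w_x-\partial_x w_y$; $\mathbf u\times\mathbf B=u_xB_y-u_yB_x$. The velocity $\mathbf u\in[L^\infty(\Omega)]^2$ is given; $\sigma$ is a given coefficient with $0<\sigma_*\le\sigma(\mathbf x)\le\sigma^*$ a.e. $E_0$ is a given function carrying the boundary data of the electric field, regular enough to be interpolated; $E_0^{n+\theta}=E_0(\cdot,(n+\theta)\Delta t)$. The initial field $\mathbf B^0$ belongs to $H(\mathrm{div};\Omega)\cap(L^{2+s}(\Omega))^2$ for some $s>0$. **Meshes.** $\Omega_h=\{P\}$ are decompositions of $\Omega$ into polygons, $h_P$ the diameter of $P$, $h=\max_P h_P$, and there is $\rho>0$ independent of $h$ such that every $P$ is star-shaped with respect to every point of a disk of radius $\rho h_P$, and every edge $e$ of $P$ has length $h_e\ge\rho h_P$. **Nodal space.** $\mathcal V_h(P)=\{v\in H^1(P): v|_{\partial P}\in C^0(\partial P),\ v|_e\in\mathbb P_1(e)\ \forall e\subset\partial P,\ \Delta v=0\text{ in }P\}$; $\mathcal V_h=\{v\in H^1(\Omega):v|_P\in\mathcal V_h(P)\ \forall P\}$; $\mathcal V_{h,0}$ is the subspace of functions vanishing on $\partial\Omega$. Degrees of freedom: vertex values. $\Pi^{\mathcal V_h}_P$ is a linear operator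 from $\mathcal V_h(P)$ to $\mathbb P_1(P)$ (or, alternatively, to the continuous piecewise linear functions on the triangulation of $P$ obtained by joining an interior point to the vertices) that depends only on the vertex values, reproduces linear polynomials, and is bounded in $L^2(P)$ uniformly in $P$ and $h$. The inner product is $(v,w)_{\mathcal V_h}=\sum_P\big[(\sigma\Pi^{\mathcal V_h}_Pv,\Pi^{\mathcal V_h}_Pw)_P+\mathcal S^{\mathcal V_h}_P((1-\Pi^{\mathcal V_h}_P)v,(1-\Pi^{\mathcal V_h}_P)w)\big]$, where $\mathcal S^{\mathcal V_h}_P$ is a symmetric nonnegative bilinear form bounded below and above by positive constants (independent of $h$) times $\|\cdot\|_{0,P}^2$ on $\mathcal V_h(P)\cap\ker\Pi^{\mathcal V_h}_P$ (i.e. on functions $(1-\Pi^{\mathcal V_h}_P)v$, $v\in\mathcal V_h(P)$). **Edge space.** $\mathcal E_h(P)=\{\mathbf v\in H(\mathrm{div};P)\cap H(\mathrm{rot};P):\mathbf v\cdot\mathbf n|_e\in\mathbb P_0(e)\ \forall e\subset\partial P,\ \mathrm{div}\,\mathbf v\in\mathbb P_0(P),\ \mathrm{rot}\,\mathbf v=0\text{ in }P\}$; $\mathcal E_h$ is the space of $\mathbf v\in H(\mathrm{div};\Omega)\cap(L^{2+s}(\Omega))^2$ (some $s>0$) with $\mathbf v|_P\in\mathcal E_h(P)$ for all $P$. $\Pi^{\mathcal E_h}_P$ is the $L^2(P)$-orthogonal projection onto constant vector fields, and $(\mathbf v,\mathbf w)_{\mathcal E_h}=\sum_P\big[(\Pi^{\mathcal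 E_h}_P\mathbf v,\Pi^{\mathcal E_h}_P\mathbf w)_P+\mathcal S^{\mathcal E_h}_P((1-\Pi^{\mathcal E_h}_P)\mathbf v,(1-\Pi^{\mathcal E_h}_P)\mathbf w)\big]$, where $\mathcal S^{\mathcal E_h}_P$ is symmetric, nonnegative, bilinear, and bounded below and above by positive constants (independent of $h$) times $\|\cdot\|_{0,P}^2$ on $\mathcal E_h(P)\cap\ker\Pi^{\mathcal E_h}_P$; it is an inner product on $\mathcal E_h$. **Operators.** $\Pi^{RT}$ is, elementwise, the $L^2(P)$-orthogonal projection onto $\mathrm{RT}_0(P)=\{\mathbf a+b\mathbf x:\mathbf a\in\mathbb R^2,b\in\mathbb R\}$. $\mathcal I^{\mathcal V_h}$ is the linear nodal interpolation operator into $\mathcal V_h$ (it matches the values at mesh vertices), applied also to the functions $\mathbf u\times\Pi^{RT}\mathbf w_h$, $\mathbf w_h\in\mathcal E_h$. $\mathcal I^{\mathcal E_h}\mathbf w\in\mathcal E_h$ is defined by $\mathbf n_e\cdot\mathcal I^{\mathcal E_h}\mathbf w|_e=\frac1{|e|}\int_e\mathbf n_e\cdot\mathbf w\,dS$ for every mesh edge $e$. *)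

theory Defs
  imports "HOL-Analysis.Analysis"
begin

text \<open>
  Functions on the plane stand for their classes modulo null sets: every notion below that
  concerns a domain \<open>D\<close> looks at a function only through its values almost everywhere in \<open>D\<close>
  (except where continuity of a function is required explicitly).
\<close>

type_synonym pt = "real^2"
type_synonym edge = "pt \<times> pt"

text \<open>A polygon is the cyclic list of its vertices; a flat angle (a hanging node) is allowed.\<close>
type_synonym polygon = "pt list"


section \<open>Differential operators\<close>

text \<open>
  \<open>perp\<close> is the rotation by \<open>-\<pi>/2\<close>, so that the vector \<open>rot v = (\<partial>\<^sub>y v, -\<partial>\<^sub>x v)\<close> is
  \<open>perp (\<nabla> v)\<close>, and \<open>perp\<close> of a counterclockwise tangent is an outward normal.
\<close>
definition perp :: "pt \<Rightarrow> pt" where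
  "perp a = vector [a $ 2, - a $ 1]"

definition cross2 :: "pt \<Rightarrow> pt \<Rightarrow> real" where
  "cross2 a b = a $ 1 * b $ 2 - a $ 2 * b $ 1"

definition C1_grad :: "(pt \<Rightarrow> real) \<Rightarrow> (pt \<Rightarrow> pt) \<Rightarrow> bool" where
  "C1_grad \<phi> G \<longleftrightarrow> continuous_on UNIV G \<and> (\<forall>x. GDERIV \<phi> x :> G x)"

definition C1_jacobian :: "(pt \<Rightarrow> pt) \<Rightarrow> (pt \<Rightarrow> real^2^2) \<Rightarrow> bool" where
  "C1_jacobian \<psi> J \<longleftrightarrow>
     continuous_on UNIV J \<and> (\<forall>x. (\<psi> has_derivative (\<lambda>h. J x *v h)) (at x))"

text \<open>
  First-order weak derivatives are tested with compactly supported \<open>C\<^sup>1\<close> functions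
  (as in Gilbarg--Trudinger); by mollification this is the same as testing with
  compactly supported smooth functions.
\<close>
definition test_fun :: "pt set \<Rightarrow> (pt \<Rightarrow> real) \<Rightarrow> (pt \<Rightarrow> pt) \<Rightarrow> bool" where
  "test_fun D \<phi> G \<longleftrightarrow>
     C1_grad \<phi> G \<and> (\<exists>K. compact K \<and> K \<subseteq> D \<and> (\<forall>x. x \<notin> K \<longrightarrow> \<phi> x = 0))"

definition Lp :: "real \<Rightarrow> pt set \<Rightarrow> (pt \<Rightarrow> 'b::euclidean_space) set" where
  "Lp p D = {f. f \<in> borel_measurable (lebesgue_on D) \<and>
                integrable (lebesgue_on D) (\<lambda>x. norm (f x) powr p)}"

abbreviation L2 :: "pt set \<Rightarrow> (pt \<Rightarrow> 'b::euclidean_space) set" where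
  "L2 \<equiv> Lp 2"

definition Linfty :: "pt set \<Rightarrow> (pt \<Rightarrow> 'b::euclidean_space) set" where
  "Linfty D = {f. f \<in> borel_measurable (lebesgue_on D) \<and>
                  (\<exists>C. AE x in lebesgue_on D. norm (f x) \<le> C)}"

definition L2_inner :: "pt set \<Rightarrow> (pt \<Rightarrow> 'b::euclidean_space) \<Rightarrow> (pt \<Rightarrow> 'b) \<Rightarrow> real" where
  "L2_inner D f g = (LINT x|lebesgue_on D. f x \<bullet> g x)"

definition weak_grad :: "pt set \<Rightarrow> (pt \<Rightarrow> real) \<Rightarrow> (pt \<Rightarrow> pt) \<Rightarrow> bool" where
  "weak_grad D v g \<longleftrightarrow>
     (\<forall>\<phi> G. test_fun D \<phi> G \<longrightarrow>
        (LINT x|lebesgue_on D. v x *\<^sub>R G x) = - (LINT x|lebesgue_on D. \<phi> x *\<^sub>R g x))"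

definition weak_div :: "pt set \<Rightarrow> (pt \<Rightarrow> pt) \<Rightarrow> (pt \<Rightarrow> real) \<Rightarrow> bool" where
  "weak_div D w d \<longleftrightarrow>
     (\<forall>\<phi> G. test_fun D \<phi> G \<longrightarrow>
        (LINT x|lebesgue_on D. w x \<bullet> G x) = - (LINT x|lebesgue_on D. d x * \<phi> x))"

text \<open>\<open>rot w = \<partial>\<^sub>y w\<^sub>x - \<partial>\<^sub>x w\<^sub>y\<close>; note that \<open>w \<bullet> perp (\<nabla> \<phi>) = w\<^sub>x \<partial>\<^sub>y \<phi> - w\<^sub>y \<partial>\<^sub>x \<phi>\<close>.\<close>
definition weak_rot :: "pt set \<Rightarrow> (pt \<Rightarrow> pt) \<Rightarrow> (pt \<Rightarrow> real) \<Rightarrow> bool" where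
  "weak_rot D w r \<longleftrightarrow>
     (\<forall>\<phi> G. test_fun D \<phi> G \<longrightarrow>
        (LINT x|lebesgue_on D. w x \<bullet> perp (G x)) = - (LINT x|lebesgue_on D. r x * \<phi> x))"

definition H1 :: "pt set \<Rightarrow> (pt \<Rightarrow> real) set" where
  "H1 D = {v \<in> L2 D. \<exists>g \<in> L2 D. weak_grad D v g}"

definition Hdiv :: "pt set \<Rightarrow> (pt \<Rightarrow> pt) set" where
  "Hdiv D = {w \<in> L2 D. \<exists>d \<in> L2 D. weak_div D w d}"

definition Hrot :: "pt set \<Rightarrow> (pt \<Rightarrow> pt) set" where
  "Hrot D = {w \<in> L2 D. \<exists>r \<in> L2 D. weak_rot D w r}"

text \<open>A representative of the (almost everywhere unique) weak gradient of \<open>v \<in> H1 D\<close>.\<close>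
definition grad :: "pt set \<Rightarrow> (pt \<Rightarrow> real) \<Rightarrow> pt \<Rightarrow> pt" where
  "grad D v = (SOME g. g \<in> L2 D \<and> weak_grad D v g)"

definition vrot :: "pt set \<Rightarrow> (pt \<Rightarrow> real) \<Rightarrow> pt \<Rightarrow> pt" where
  "vrot D v = (\<lambda>x. perp (grad D v x))"


section \<open>Polygons and meshes\<close>

definition edges :: "polygon \<Rightarrow> edge set" where
  "edges P = set (zip P (rotate1 P))"

definition bdry :: "polygon \<Rightarrow> pt set" where
  "bdry P = (\<Union>(a, b)\<in>edges P. closed_segment a b)"

definition region :: "polygon \<Rightarrow> pt set" where
  "region P = inside (bdry P)"

text \<open>
  Distinct edges meet only in common endpoints. The last clause fixes the orientation:
  the region lies to the left of every edge, i.e. the vertices are listed counterclockwise.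
\<close>
definition simple_polygon :: "polygon \<Rightarrow> bool" where
  "simple_polygon P \<longleftrightarrow>
     3 \<le> length P \<and> distinct P \<and>
     (\<forall>(a, b)\<in>edges P. \<forall>(c, d)\<in>edges P. (a, b) \<noteq> (c, d) \<longrightarrow>
        closed_segment a b \<inter> closed_segment c d \<subseteq> {a, b} \<inter> {c, d}) \<and>
     (\<forall>(a, b)\<in>edges P. \<forall>\<^sub>F t in at_right 0. midpoint a b - t *\<^sub>R perp (b - a) \<in> region P)"

definition star_shaped_wrt :: "pt set \<Rightarrow> pt \<Rightarrow> bool" where
  "star_shaped_wrt D y \<longleftrightarrow> (\<forall>x\<in>D. closed_segment y x \<subseteq> D)"

definition shape_regular :: "real \<Rightarrow> polygon \<Rightarrow> bool" where
  "shape_regular \<rho> P \<longleftrightarrow>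
     (\<exists>c. \<forall>y \<in> ball c (\<rho> * diameter (region P)). star_shaped_wrt (region P) y) \<and>
     (\<forall>(a, b)\<in>edges P. dist a b \<ge> \<rho> * diameter (region P))"

text \<open>Polygonal open sets, possibly with holes, lying locally on one side of their boundary.\<close>
definition polygonal :: "pt set \<Rightarrow> bool" where
  "polygonal D \<longleftrightarrow> D = interior (closure D) \<and>
     (\<exists>\<Q>. finite \<Q> \<and> (\<forall>Q\<in>\<Q>. simple_polygon Q) \<and> disjoint_family_on bdry \<Q> \<and>
          frontier D = (\<Union>Q\<in>\<Q>. bdry Q))"

definition polygonal_mesh :: "pt set \<Rightarrow> real \<Rightarrow> polygon set \<Rightarrow> bool" where
  "polygonal_mesh \<Omega> \<rho> M \<longleftrightarrow>
     finite M \<and> (\<forall>P\<in>M. simple_polygon P \<and> shape_regular \<rho> P) \<and>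
     disjoint_family_on region M \<and> closure \<Omega> = (\<Union>P\<in>M. closure (region P))"


section \<open>Traces\<close>

definition edge_length :: "edge \<Rightarrow> real" where
  "edge_length e = dist (fst e) (snd e)"

definition edge_normal :: "edge \<Rightarrow> pt" where
  "edge_normal e = (1 / edge_length e) *\<^sub>R perp (snd e - fst e)"

definition edge_integral :: "edge \<Rightarrow> (pt \<Rightarrow> real) \<Rightarrow> real" where
  "edge_integral e f = edge_length e * integral {0..1} (\<lambda>t. f (linepath (fst e) (snd e) t))"

text \<open>
  The trace \<open>g\<close> on the boundary of \<open>v \<in> H1 (region P)\<close> is the function for which Green's formula
  \<open>\<integral>\<^sub>P (v div \<psi> + \<nabla>v \<bullet> \<psi>) = \<integral>\<^sub>\<partial>\<^sub>P g \<psi> \<bullet> n\<close> holds. We only need it for continuous \<open>g\<close>,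
  for which it determines \<open>g\<close>.
\<close>
definition has_trace :: "polygon \<Rightarrow> (pt \<Rightarrow> real) \<Rightarrow> (pt \<Rightarrow> real) \<Rightarrow> bool" where
  "has_trace P v g \<longleftrightarrow> v \<in> H1 (region P) \<and> continuous_on (bdry P) g \<and>
     (\<forall>\<psi> J. C1_jacobian \<psi> J \<longrightarrow>
        (LINT x|lebesgue_on (region P). v x * trace (J x) + grad (region P) v x \<bullet> \<psi> x) =
        (\<Sum>e\<in>edges P. edge_integral e (\<lambda>x. g x * (\<psi> x \<bullet> edge_normal e))))"

text \<open>
  The normal trace of \<open>w \<in> H(div)\<close> is likewise defined by Green's formula
  \<open>\<integral>\<^sub>P (w \<bullet> \<nabla>\<phi> + \<phi> div w) = \<langle>w \<bullet> n, \<phi>\<rangle>\<close>; here it is required to be the constant \<open>c e\<close> on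
  every edge \<open>e\<close> (with respect to the outward normal).
\<close>
definition has_const_normal_trace :: "polygon \<Rightarrow> (pt \<Rightarrow> pt) \<Rightarrow> (edge \<Rightarrow> real) \<Rightarrow> bool" where
  "has_const_normal_trace P w c \<longleftrightarrow> w \<in> L2 (region P) \<and>
     (\<exists>d \<in> L2 (region P). weak_div (region P) w d \<and>
       (\<forall>\<phi> G. C1_grad \<phi> G \<longrightarrow>
          (LINT x|lebesgue_on (region P). w x \<bullet> G x + d x * \<phi> x) =
          (\<Sum>e\<in>edges P. c e * edge_integral e \<phi>)))"

text \<open>
  The fluxes \<open>c e = \<integral>\<^sub>e w \<bullet> n dS\<close> of a field \<open>w \<in> H(div;P) \<inter> L\<^bsup>2+s\<^esup>(P)\<close>, \<open>s > 0\<close>. Such a field has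
  no pointwise values on an edge, but \<open>w \<mapsto> \<integral>\<^sub>e w \<bullet> n dS\<close> extends continuously from \<open>C\<^sup>1\<close> fields,
  which are dense, to this space. The approximating fields may therefore be taken to be the
  same for all edges of \<open>P\<close>, and the limits do not depend on their choice.
\<close>
definition has_edge_fluxes :: "polygon \<Rightarrow> (pt \<Rightarrow> pt) \<Rightarrow> (edge \<Rightarrow> real) \<Rightarrow> bool" where
  "has_edge_fluxes P w c \<longleftrightarrow>
     (\<exists>s > 0. w \<in> L2 (region P) \<inter> Lp (2 + s) (region P) \<and>
      (\<exists>d \<in> L2 (region P). weak_div (region P) w d \<and>
       (\<exists>W J. (\<forall>k::nat. C1_jacobian (W k) (J k)) \<and>
          (\<lambda>k. LINT x|lebesgue_on (region P). norm (W k x - w x) powr (2 + s)) \<longlonglongrightarrow> 0 \<and>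
          (\<lambda>k. LINT x|lebesgue_on (region P). (trace (J k x) - d x)\<^sup>2) \<longlonglongrightarrow> 0 \<and>
          (\<forall>e\<in>edges P. (\<lambda>k. edge_integral e (\<lambda>x. W k x \<bullet> edge_normal e)) \<longlonglongrightarrow> c e))))"


section \<open>Nodal space\<close>

definition nodal_local :: "polygon \<Rightarrow> (pt \<Rightarrow> real) set" where
  "nodal_local P = {v \<in> H1 (region P).
     (\<exists>g. has_trace P v g \<and>
          (\<forall>(a, b)\<in>edges P. \<forall>t\<in>{0..1}. g (linepath a b t) = (1 - t) * g a + t * g b)) \<and>
     weak_div (region P) (grad (region P) v) (\<lambda>x. 0)}"

definition nodal_space :: "pt set \<Rightarrow> polygon set \<Rightarrow> (pt \<Rightarrow> real) set" where
  "nodal_space \<Omega> M = {v \<in> H1 \<Omega>. \<forall>P\<in>M. v \<in> nodal_local P}"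

definition nodal_space0 :: "pt set \<Rightarrow> polygon set \<Rightarrow> (pt \<Rightarrow> real) set" where
  "nodal_space0 \<Omega> M = {v \<in> nodal_space \<Omega> M.
     \<forall>P\<in>M. \<exists>g. has_trace P v g \<and> (\<forall>x \<in> bdry P \<inter> frontier \<Omega>. g x = 0)}"

definition vertex_value :: "polygon \<Rightarrow> (pt \<Rightarrow> real) \<Rightarrow> pt \<Rightarrow> real" where
  "vertex_value P v a = (THE y. \<exists>g. has_trace P v g \<and> g a = y)"

definition affine_on :: "pt set \<Rightarrow> (pt \<Rightarrow> real) \<Rightarrow> bool" where
  "affine_on D p \<longleftrightarrow> (\<exists>\<alpha> \<beta>. \<forall>x\<in>D. p x = \<alpha> + \<beta> \<bullet> x)"

text \<open>
  Continuous and piecewise linear on the triangulation obtained by joining \<open>q\<close> to the vertices;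
  the first three conditions say that this is a triangulation.
\<close>
definition fan_affine :: "polygon \<Rightarrow> pt \<Rightarrow> (pt \<Rightarrow> real) \<Rightarrow> bool" where
  "fan_affine P q p \<longleftrightarrow>
     q \<in> region P \<and> star_shaped_wrt (region P) q \<and> (\<forall>(a, b)\<in>edges P. \<not> collinear {q, a, b}) \<and>
     continuous_on (region P) p \<and>
     (\<forall>(a, b)\<in>edges P. affine_on (convex hull {q, a, b} \<inter> region P) p)"

text \<open>The conditions on the operator \<open>\<pi>\<close> into (piecewise) linear functions; \<open>C\<close> is its \<open>L\<^sup>2\<close> bound.\<close>
definition nodal_projector ::
  "real \<Rightarrow> polygon \<Rightarrow> ((pt \<Rightarrow> real) \<Rightarrow> pt \<Rightarrow> real) \<Rightarrow> bool" where
  "nodal_projector C P \<pi> \<longleftrightarrow>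
     ((\<forall>v\<in>nodal_local P. affine_on (region P) (\<pi> v)) \<or>
      (\<exists>q. \<forall>v\<in>nodal_local P. fan_affine P q (\<pi> v))) \<and>
     (\<forall>v\<in>nodal_local P. \<forall>w\<in>nodal_local P. \<forall>a b. \<forall>x\<in>region P.
        \<pi> (\<lambda>y. a * v y + b * w y) x = a * \<pi> v x + b * \<pi> w x) \<and>
     (\<forall>v\<in>nodal_local P. \<forall>w\<in>nodal_local P.
        (\<forall>a\<in>set P. vertex_value P v a = vertex_value P w a) \<longrightarrow>
        (\<forall>x\<in>region P. \<pi> v x = \<pi> w x)) \<and>
     (\<forall>\<alpha> \<beta>. \<forall>x\<in>region P. \<pi> (\<lambda>y. \<alpha> + \<beta> \<bullet> y) x = \<alpha> + \<beta> \<bullet> x) \<and>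
     (\<forall>v\<in>nodal_local P.
        sqrt (L2_inner (region P) (\<pi> v) (\<pi> v)) \<le> C * sqrt (L2_inner (region P) v v))"

text \<open>The functions \<open>(1 - \<pi>) v\<close>, \<open>v \<in> V\<close>, on \<open>P\<close>, with arbitrary values outside \<open>P\<close>.\<close>
definition remainders ::
  "polygon \<Rightarrow> (pt \<Rightarrow> 'b::euclidean_space) set \<Rightarrow> ((pt \<Rightarrow> 'b) \<Rightarrow> pt \<Rightarrow> 'b) \<Rightarrow> (pt \<Rightarrow> 'b) set" where
  "remainders P V \<pi> = {z. \<exists>v\<in>V. \<forall>x\<in>region P. z x = v x - \<pi> v x}"

definition stabilization ::
  "real \<Rightarrow> real \<Rightarrow> polygon \<Rightarrow> (pt \<Rightarrow> 'b::euclidean_space) set \<Rightarrow>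
     ((pt \<Rightarrow> 'b) \<Rightarrow> (pt \<Rightarrow> 'b) \<Rightarrow> real) \<Rightarrow> bool" where
  "stabilization \<alpha> \<beta> P K S \<longleftrightarrow>
     (\<forall>y\<in>K. \<forall>z\<in>K. S y z = S z y) \<and>
     (\<forall>y\<in>K. \<forall>z\<in>K. \<forall>w\<in>K. \<forall>a b. S (\<lambda>x. a *\<^sub>R y x + b *\<^sub>R z x) w = a * S y w + b * S z w) \<and>
     (\<forall>z\<in>K. 0 \<le> S z z) \<and>
     (\<forall>z\<in>K. \<alpha> * L2_inner (region P) z z \<le> S z z \<and> S z z \<le> \<beta> * L2_inner (region P) z z)"

definition nodal_inner ::
  "polygon set \<Rightarrow> (pt \<Rightarrow> real) \<Rightarrow> (polygon \<Rightarrow> (pt \<Rightarrow> real) \<Rightarrow> pt \<Rightarrow> real) \<Rightarrow>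
     (polygon \<Rightarrow> (pt \<Rightarrow> real) \<Rightarrow> (pt \<Rightarrow> real) \<Rightarrow> real) \<Rightarrow> (pt \<Rightarrow> real) \<Rightarrow> (pt \<Rightarrow> real) \<Rightarrow> real" where
  "nodal_inner M \<sigma> \<pi> S v w = (\<Sum>P\<in>M.
     L2_inner (region P) (\<lambda>x. \<sigma> x * \<pi> P v x) (\<pi> P w) +
     S P (\<lambda>x. v x - \<pi> P v x) (\<lambda>x. w x - \<pi> P w x))"


section \<open>Edge space\<close>

definition edge_local :: "polygon \<Rightarrow> (pt \<Rightarrow> pt) set" where
  "edge_local P = {w \<in> Hdiv (region P) \<inter> Hrot (region P).
     (\<exists>c. has_const_normal_trace P w c) \<and>
     (\<exists>d. weak_div (region P) w (\<lambda>x. d)) \<and>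
     weak_rot (region P) w (\<lambda>x. 0)}"

definition edge_space :: "pt set \<Rightarrow> polygon set \<Rightarrow> (pt \<Rightarrow> pt) set" where
  "edge_space \<Omega> M = {w \<in> Hdiv \<Omega>. (\<exists>s > 0. w \<in> Lp (2 + s) \<Omega>) \<and> (\<forall>P\<in>M. w \<in> edge_local P)}"

text \<open>
  \<open>L\<^sup>2(P)\<close>-orthogonal projection onto a space \<open>V\<close> of polynomials, which are determined by their
  values on \<open>P\<close>.
\<close>
definition L2_proj :: "polygon \<Rightarrow> (pt \<Rightarrow> pt) set \<Rightarrow> (pt \<Rightarrow> pt) \<Rightarrow> pt \<Rightarrow> pt" where
  "L2_proj P V w = (THE p. p \<in> V \<and> (\<forall>q\<in>V. L2_inner (region P) (\<lambda>x. w x - p x) q = 0))"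

definition const_fields :: "(pt \<Rightarrow> pt) set" where
  "const_fields = {p. \<exists>a. p = (\<lambda>x. a)}"

definition RT0 :: "(pt \<Rightarrow> pt) set" where
  "RT0 = {p. \<exists>a b. p = (\<lambda>x. a + b *\<^sub>R x)}"

definition edge_proj :: "polygon \<Rightarrow> (pt \<Rightarrow> pt) \<Rightarrow> pt \<Rightarrow> pt" where
  "edge_proj P = L2_proj P const_fields"

definition RT_proj :: "polygon set \<Rightarrow> (pt \<Rightarrow> pt) \<Rightarrow> pt \<Rightarrow> pt" where
  "RT_proj M w x = (\<Sum>P\<in>M. if x \<in> region P then L2_proj P RT0 w x else 0)"

definition edge_inner ::
  "polygon set \<Rightarrow> (polygon \<Rightarrow> (pt \<Rightarrow> pt) \<Rightarrow> (pt \<Rightarrow> pt) \<Rightarrow> real) \<Rightarrow>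
     (pt \<Rightarrow> pt) \<Rightarrow> (pt \<Rightarrow> pt) \<Rightarrow> real" where
  "edge_inner M S v w = (\<Sum>P\<in>M.
     L2_inner (region P) (edge_proj P v) (edge_proj P w) +
     S P (\<lambda>x. v x - edge_proj P v x) (\<lambda>x. w x - edge_proj P w x))"


section \<open>Interpolation\<close>

text \<open>
  The functions to be interpolated are the continuous ones and the \<open>u \<times> \<Pi>\<^sup>R\<^sup>T w\<close>. The latter are
  merely bounded and need not have vertex values, so that all that is required of the operator on
  them is that it be linear with values in the nodal space.
\<close>
definition interpolated :: "pt set \<Rightarrow> polygon set \<Rightarrow> (pt \<Rightarrow> pt) \<Rightarrow> (pt \<Rightarrow> real) set" where
  "interpolated \<Omega> M u = {f. \<exists>g w. continuous_on (closure \<Omega>) g \<and> w \<in> edge_space \<Omega> M \<and>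
     f = (\<lambda>x. g x + cross2 (u x) (RT_proj M w x))}"

definition nodal_interpolation ::
  "pt set \<Rightarrow> polygon set \<Rightarrow> (pt \<Rightarrow> pt) \<Rightarrow> ((pt \<Rightarrow> real) \<Rightarrow> pt \<Rightarrow> real) \<Rightarrow> bool" where
  "nodal_interpolation \<Omega> M u I \<longleftrightarrow>
     (\<forall>f\<in>interpolated \<Omega> M u. I f \<in> nodal_space \<Omega> M) \<and>
     (\<forall>f\<in>interpolated \<Omega> M u. \<forall>g\<in>interpolated \<Omega> M u. \<forall>a b.
        AE x in lebesgue_on \<Omega>. I (\<lambda>y. a * f y + b * g y) x = a * I f x + b * I g x) \<and>
     (\<forall>f\<in>interpolated \<Omega> M u. continuous_on (closure \<Omega>) f \<longrightarrow>
        (\<forall>P\<in>M. \<forall>a\<in>set P. vertex_value P (I f) a = f a))"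

text \<open>
  \<open>wI\<close> is the edge interpolant of \<open>w\<close>. An interior edge is treated from both sides, each time with
  the normal pointing out of the polygon at hand; its sign cancels.
\<close>
definition is_edge_interpolant ::
  "pt set \<Rightarrow> polygon set \<Rightarrow> (pt \<Rightarrow> pt) \<Rightarrow> (pt \<Rightarrow> pt) \<Rightarrow> bool" where
  "is_edge_interpolant \<Omega> M w wI \<longleftrightarrow> wI \<in> edge_space \<Omega> M \<and>
     (\<forall>P\<in>M. \<exists>c. has_edge_fluxes P w c \<and>
        has_const_normal_trace P wI (\<lambda>e. c e / edge_length e))"

end

theory Submission imports Defs begin

text \<open>
  The residual of Faraday's law, \<open>(B (n+1) - B n) / \<Delta>t + rot E\<close>, lies in the edge space and is
  orthogonal to it in the discrete inner product, hence vanishes. Since \<open>rot E\<close> is solenoidal, the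
  divergence of \<open>B n\<close> is conserved; it vanishes for \<open>n = 0\<close> because on every cell the fluxes of
  \<open>B\<^sup>0\<close> sum to zero.

  The delicate point is that \<open>rot v\<close> belongs to the edge space for a nodal function \<open>v\<close>, more
  precisely that \<open>f = \<nabla>v\<close> is in \<open>L\<^bsup>2+s\<^esup>\<close> on a star-shaped cell for some \<open>s > 0\<close>. In the plane the
  energy of \<open>f\<close> is invariant under \<open>f \<mapsto> t f (y + t (x - y))\<close>. The pairing of \<open>f\<close> with its
  dilate is a boundary integral of the trace of \<open>v\<close>, which is piecewise linear, against the dilate
  of the solenoidal field \<open>f\<close>; therefore it depends on \<open>t\<close> with Hoelder exponent 1/2. Dilations about two
  different centres compose to a translation, so \<open>\<parallel>f (\<sqdot> - h) - f\<parallel>\<^sup>2 \<le> C |h|\<^bsup>1/2\<^esup>\<close>, and comparing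
  \<open>f\<close> with its mollification bounds the energy on \<open>{|f| > l}\<close> by a multiple of \<open>l\<^bsup>-1/2\<^esup>\<close>.
\<close>

section \<open>Square integrable functions on the plane\<close>

text \<open>The residual of Faraday's law can be used as a test function only if it belongs to
  \<open>edge_space\<close>, and membership there asks for some \<open>Lp (2 + s)\<close>; this is
  why mere square integrability of gradients is not enough. Two obstacles shape the proof. The
  gradient \<open>f\<close> of a nodal function is solenoidal only inside a cell, while Green's
  formula is given for C1 fields. So \<open>f\<close> is mollified, and the mollified field is used
  only on copies of the cell shrunk by a ratio below 1, where it is still solenoidal;
  star-shapedness about a whole disc supplies the margin, and ratio 1 is reached afterwards by
  continuity of dilations in the energy norm. The exponent 1/2 comes from Young's inequality with
  weight \<open>sqrt (t' - t)\<close>: the energy is multiplied by the weight, and the length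
  \<open>t' - t\<close> of the parameter interval is divided by it. The final gain 1/4 is a number
  below the decay rate 1/2 of the level set energies. Test functions are only C1, so the symmetry of
  second derivatives behind div rot = 0 cannot be invoked for them; averages over small squares
  provide approximants for which it can.\<close>

definition sq_int :: "(pt \<Rightarrow> 'b::euclidean_space) \<Rightarrow> bool" where
  "sq_int f \<longleftrightarrow> f \<in> borel_measurable borel \<and> integrable lborel (\<lambda>x. (norm (f x))\<^sup>2)"

text \<open>The squared norm is kept without a root: all estimates below lose only constant factors,
  such as the 2 in \<open>energy_add_le\<close>.\<close>

definition energy :: "(pt \<Rightarrow> 'b::euclidean_space) \<Rightarrow> real" where
  "energy f = (LINT x|lborel. (norm (f x))\<^sup>2)"

lemma sq_int_measurable [measurable_dest]: "sq_int f \<Longrightarrow> f \<in> borel_measurable borel"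
  by (simp add: sq_int_def)

lemma sq_int_integrable: "sq_int f \<Longrightarrow> integrable lborel (\<lambda>x. (norm (f x))\<^sup>2)"
  by (simp add: sq_int_def)

lemma energy_nonneg: "0 \<le> energy f"
  by (simp add: energy_def)

lemma norm_add_sq_le:
  fixes a b :: "'b::real_inner"
  shows "(norm (a + b))\<^sup>2 \<le> 2 * (norm a)\<^sup>2 + 2 * (norm b)\<^sup>2"
proof -
  have "(norm (a + b))\<^sup>2 + (norm (a - b))\<^sup>2 = 2 * (norm a)\<^sup>2 + 2 * (norm b)\<^sup>2"
    by (simp add: power2_norm_eq_inner inner_add inner_diff inner_commute)
  then show ?thesis
    by (smt (verit) zero_le_power2)
qed

lemma norm_diff_sq_le:
  fixes a b :: "'b::real_inner"
  shows "(norm (a - b))\<^sup>2 \<le> 2 * (norm a)\<^sup>2 + 2 * (norm b)\<^sup>2"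
  using norm_add_sq_le[of a "-b"] by simp

lemma abs_inner_le_sq:
  fixes a b :: "'b::real_inner"
  shows "\<bar>a \<bullet> b\<bar> \<le> (norm a)\<^sup>2 + (norm b)\<^sup>2"
proof -
  have "\<bar>a \<bullet> b\<bar> \<le> norm a * norm b" by (rule Cauchy_Schwarz_ineq2)
  also have "\<dots> \<le> (norm a)\<^sup>2 + (norm b)\<^sup>2"
  proof -
    have "0 \<le> (norm a - norm b)\<^sup>2" by simp
    then have "2 * (norm a * norm b) \<le> (norm a)\<^sup>2 + (norm b)\<^sup>2"
      by (simp add: power2_diff)
    moreover have "0 \<le> norm a * norm b" by simp
    ultimately show ?thesis by linarith
  qed
  finally show ?thesis .
qed

lemma sq_int_add:
  assumes "sq_int f" "sq_int g" shows "sq_int (\<lambda>x. f x + g x)"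
proof -
  note [measurable] = assms[THEN sq_int_measurable]
  have "integrable lborel (\<lambda>x. (norm (f x + g x))\<^sup>2)"
    by (rule Bochner_Integration.integrable_bound[where f="\<lambda>x. 2 * (norm (f x))\<^sup>2 + 2 * (norm (g x))\<^sup>2"])
       (use assms in \<open>auto simp: sq_int_integrable norm_add_sq_le\<close>)
  then show ?thesis using assms by (auto simp: sq_int_def)
qed

lemma sq_int_scaleR:
  assumes "sq_int f" shows "sq_int (\<lambda>x. c *\<^sub>R f x)"
  using assms by (auto simp: sq_int_def power_mult_distrib)

lemma sq_int_diff:
  assumes "sq_int f" "sq_int g" shows "sq_int (\<lambda>x. f x - g x)"
  using sq_int_add[OF assms(1) sq_int_scaleR[OF assms(2), of "-1"]] by simp

lemma energy_add_le:
  assumes "sq_int f" "sq_int g"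
  shows "energy (\<lambda>x. f x + g x) \<le> 2 * energy f + 2 * energy g"
proof -
  have "energy (\<lambda>x. f x + g x) \<le> (LINT x|lborel. 2 * (norm (f x))\<^sup>2 + 2 * (norm (g x))\<^sup>2)"
    unfolding energy_def
    by (rule integral_mono) (use assms sq_int_add[OF assms] in \<open>auto simp: sq_int_integrable norm_add_sq_le\<close>)
  also have "\<dots> = 2 * energy f + 2 * energy g"
    using assms by (simp add: energy_def sq_int_integrable)
  finally show ?thesis .
qed

lemma energy_diff_commute: "energy (\<lambda>x. f x - g x) = energy (\<lambda>x. g x - f x)"
  by (simp add: energy_def norm_minus_commute)

lemma energy_diff_triangle:
  assumes "sq_int f" "sq_int g" "sq_int h"
  shows "energy (\<lambda>x. f x - h x) \<le> 2 * energy (\<lambda>x. f x - g x) + 2 * energy (\<lambda>x. g x - h x)"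
  using energy_add_le[OF sq_int_diff[OF assms(1,2)] sq_int_diff[OF assms(2,3)]] by simp

lemma integrable_inner_sq_int:
  assumes "sq_int f" "sq_int g" shows "integrable lborel (\<lambda>x. f x \<bullet> g x)"
proof -
  note [measurable] = assms[THEN sq_int_measurable]
  show ?thesis
    by (rule Bochner_Integration.integrable_bound[where f="\<lambda>x. (norm (f x))\<^sup>2 + (norm (g x))\<^sup>2"])
       (use assms in \<open>auto simp: sq_int_integrable abs_inner_le_sq intro: order_trans[OF abs_inner_le_sq]\<close>)
qed

text \<open>Weighted Young inequality, from rescaling the two factors by \<open>sqrt \<mu>\<close>
  and its inverse. It replaces Cauchy-Schwarz, so that no roots of energies appear.\<close>

lemma integral_inner_le:
  fixes f g :: "pt \<Rightarrow> 'b::euclidean_space"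
  assumes "sq_int f" "sq_int g" "\<mu> > 0"
  shows "\<bar>LINT x|lborel. f x \<bullet> g x\<bar> \<le> \<mu> * energy f + energy g / \<mu>"
proof -
  have *: "\<bar>f x \<bullet> g x\<bar> \<le> \<mu> * (norm (f x))\<^sup>2 + (norm (g x))\<^sup>2 / \<mu>" for x
  proof -
    have "\<bar>(sqrt \<mu> *\<^sub>R f x) \<bullet> ((1 / sqrt \<mu>) *\<^sub>R g x)\<bar> \<le> (norm (sqrt \<mu> *\<^sub>R f x))\<^sup>2 + (norm ((1 / sqrt \<mu>) *\<^sub>R g x))\<^sup>2"
      by (rule abs_inner_le_sq)
    then show ?thesis using assms(3) by (simp add: power_mult_distrib power_divide)
  qed
  have "\<bar>LINT x|lborel. f x \<bullet> g x\<bar> \<le> (LINT x|lborel. \<bar>f x \<bullet> g x\<bar>)"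
    by (rule integral_abs_bound)
  also have "\<dots> \<le> (LINT x|lborel. \<mu> * (norm (f x))\<^sup>2 + (norm (g x))\<^sup>2 / \<mu>)"
    by (rule integral_mono) (use assms * in \<open>auto simp: sq_int_integrable integrable_inner_sq_int\<close>)
  also have "\<dots> = \<mu> * energy f + energy g / \<mu>"
    using assms by (simp add: energy_def sq_int_integrable)
  finally show ?thesis .
qed

lemma energy_diff_expand:
  assumes "sq_int f" "sq_int g"
  shows "energy (\<lambda>x. f x - g x) = energy f + energy g - 2 * (LINT x|lborel. f x \<bullet> g x)"
proof -
  have "(norm (f x - g x))\<^sup>2 = (norm (f x))\<^sup>2 + (norm (g x))\<^sup>2 - 2 * (f x \<bullet> g x)" for x
    by (simp add: power2_norm_eq_inner inner_diff inner_commute)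
  then show ?thesis
    using assms by (simp add: energy_def sq_int_integrable integrable_inner_sq_int)
qed

text \<open>The Jacobian is \<open>c\<^sup>2\<close> because the plane has dimension 2. This is the
  source of the scale invariance of the energy under multiplication by \<open>c\<close> and dilation
  by \<open>c\<close>.\<close>

lemma lborel_affine_pt:
  "c \<noteq> 0 \<Longrightarrow> (lborel :: pt measure) = density (distr lborel borel (\<lambda>x. p + c *\<^sub>R x)) (\<lambda>_. ennreal (c\<^sup>2))"
  using lborel_affine[of c p] by simp

lemma integrable_affine_pt:
  fixes f :: "pt \<Rightarrow> 'b::euclidean_space"
  assumes f: "integrable lborel f" and c: "c \<noteq> 0"
  shows "integrable lborel (\<lambda>x. f (p + c *\<^sub>R x))"
proof -
  note [measurable] = borel_measurable_integrable[OF f]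
  have "integrable (density (distr lborel borel (\<lambda>x. p + c *\<^sub>R x)) (\<lambda>_. ennreal (c\<^sup>2))) f"
    using f lborel_affine_pt[OF c, of p] by simp
  then have "integrable lborel (\<lambda>x. c\<^sup>2 *\<^sub>R f (p + c *\<^sub>R x))"
    by (simp add: integrable_density integrable_distr_eq)
  then have "integrable lborel (\<lambda>x. (1 / c\<^sup>2) *\<^sub>R (c\<^sup>2 *\<^sub>R f (p + c *\<^sub>R x)))"
    by (rule integrable_scaleR_right)
  then show ?thesis using c by simp
qed

lemma integral_affine_pt:
  fixes f :: "pt \<Rightarrow> 'b::euclidean_space"
  assumes [measurable]: "f \<in> borel_measurable borel" and c: "c \<noteq> 0"
  shows "(LINT x|lborel. f (p + c *\<^sub>R x)) = (1 / c\<^sup>2) *\<^sub>R (LINT x|lborel. f x)"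
proof -
  have "(LINT x|lborel. f x) = c\<^sup>2 *\<^sub>R (LINT x|lborel. f (p + c *\<^sub>R x))"
    by (subst lborel_affine_pt[OF c, of p]) (simp add: integral_density integral_distr)
  then show ?thesis using c by simp
qed

lemma
  fixes f :: "pt \<Rightarrow> 'b::euclidean_space"
  assumes f: "sq_int f" and c: "c \<noteq> 0"
  shows sq_int_affine: "sq_int (\<lambda>x. f (p + c *\<^sub>R x))"
    and energy_affine: "energy (\<lambda>x. f (p + c *\<^sub>R x)) = energy f / c\<^sup>2"
  using integrable_affine_pt[OF sq_int_integrable[OF f] c, of p] integral_affine_pt[of "\<lambda>x. (norm (f x))\<^sup>2" c p] f c
  by (auto simp: sq_int_def energy_def)

section \<open>Density of continuous functions and continuity of affine substitutions\<close>

lemma sq_int_continuous_compact: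
  fixes g :: "pt \<Rightarrow> 'b::euclidean_space"
  assumes "continuous_on UNIV g" "\<And>x. norm x > M \<Longrightarrow> g x = 0"
  shows "sq_int g"
proof -
  have [measurable]: "g \<in> borel_measurable borel"
    using assms(1) by (simp add: borel_measurable_continuous_onI)
  have "integrable lborel (\<lambda>x. indicator (cball 0 M) x *\<^sub>R (norm (g x))\<^sup>2)"
    by (rule borel_integrable_compact) (auto intro!: continuous_intros continuous_on_subset[OF assms(1)])
  also have "(\<lambda>x. indicator (cball 0 M) x *\<^sub>R (norm (g x))\<^sup>2) = (\<lambda>x. (norm (g x))\<^sup>2)"
    using assms(2) by (auto simp: fun_eq_iff indicator_def not_le)
  finally show ?thesis by (simp add: sq_int_def)
qed

lemma energy_dominated_convergence:
  fixes f :: "pt \<Rightarrow> 'b::euclidean_space"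
  assumes s [measurable]: "\<And>k. s k \<in> borel_measurable borel" and f [measurable]: "f \<in> borel_measurable borel"
    and w: "integrable lborel w"
    and lim: "AE x in lborel. (\<lambda>k. s k x) \<longlonglongrightarrow> f x"
    and bd: "\<And>k. AE x in lborel. (norm (s k x - f x))\<^sup>2 \<le> w x"
  shows "(\<lambda>k. energy (\<lambda>x. s k x - f x)) \<longlonglongrightarrow> 0"
proof -
  have "(\<lambda>k. LINT x|lborel. (norm (s k x - f x))\<^sup>2) \<longlonglongrightarrow> (LINT x|(lborel::pt measure). 0)"
  proof (rule integral_dominated_convergence[where w=w])
    show "AE x in lborel. (\<lambda>k. (norm (s k x - f x))\<^sup>2) \<longlonglongrightarrow> 0"
      using lim
    proof eventually_elim
      case (elim x)
      then have "(\<lambda>k. (norm (s k x - f x))\<^sup>2) \<longlonglongrightarrow> (norm (f x - f x))\<^sup>2"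
        by (intro tendsto_intros)
      then show ?case by simp
    qed
  qed (use w bd in auto)
  then show ?thesis by (simp add: energy_def)
qed

lemma LIMSEQ_ex_less:
  fixes X :: "nat \<Rightarrow> real"
  assumes "X \<longlonglongrightarrow> 0" "\<delta> > 0" shows "\<exists>n. X n < \<delta>"
  using order_tendstoD(2)[OF assms] by (auto simp: eventually_sequentially)

text \<open>A measurable function is an almost everywhere limit of continuous ones; clipping their
  values and cutting off their supports makes dominated convergence applicable. The single parameter
  \<open>M\<close> bounds both the values and the support.\<close>

lemma bounded_sq_int_approx_continuous:
  fixes f :: "pt \<Rightarrow> 'b::euclidean_space"
  assumes f: "sq_int f" and M: "0 < M" and bd: "\<And>x. norm (f x) \<le> M" and supp: "\<And>x. norm x > M \<Longrightarrow> f x = 0"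
    and \<delta>: "\<delta> > 0"
  shows "\<exists>g. continuous_on UNIV g \<and> (\<forall>x. norm x > M + 1 \<longrightarrow> g x = 0) \<and> energy (\<lambda>x. g x - f x) < \<delta>"
proof -
  note [measurable] = sq_int_measurable[OF f]
  have "f \<in> borel_measurable (lebesgue_on UNIV)"
    by (simp add: lebesgue_on_UNIV_eq measurable_completion)
  then have "f measurable_on UNIV"
    by (simp add: measurable_on_iff_borel_measurable)
  then obtain N g0 where N: "negligible N" and g0: "\<And>n. continuous_on UNIV (g0 n)"
    and lim: "\<And>x. x \<notin> N \<Longrightarrow> (\<lambda>n. g0 n x) \<longlonglongrightarrow> f x"
    unfolding measurable_on_def by auto
  \<comment> \<open>\<open>c\<close> retracts onto the ball of radius \<open>M\<close> and fixes the
    values of \<open>f\<close>; \<open>k\<close> is 1 where \<open>f\<close> may be nonzero and 0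
    outside radius \<open>M + 1\<close>. Neither changes the limit.\<close>
  define c where "c = closest_point (cball (0::'b) M)"
  define k where "k x = max 0 (min 1 (M + 1 - norm x))" for x :: pt
  define g where "g n x = k x *\<^sub>R c (g0 n x)" for n x
  have c_cont: "continuous_on A c" for A
    unfolding c_def using M by (intro continuous_on_closest_point) auto
  have c_bd: "norm (c z) \<le> M" for z
    using closest_point_in_set[of "cball (0::'b) M" z] M by (auto simp: c_def)
  have c_id: "c (f x) = f x" for x
    unfolding c_def by (rule closest_point_self) (use bd in auto)
  have cont: "continuous_on UNIV (g n)" for n
    unfolding g_def k_def
    by (intro continuous_intros continuous_on_compose2[OF c_cont g0]) auto
  have [measurable]: "g n \<in> borel_measurable borel" for n
    using cont by (simp add: borel_measurable_continuous_onI)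
  have kf: "k x *\<^sub>R f x = f x" for x
    using supp[of x] by (auto simp: k_def max_def min_def)
  have zero: "norm x > M + 1 \<Longrightarrow> g n x = 0" for n x
    by (simp add: g_def k_def)
  have "(\<lambda>n. energy (\<lambda>x. g n x - f x)) \<longlonglongrightarrow> 0"
  proof (rule energy_dominated_convergence[where w="\<lambda>x. indicator (cball 0 (M + 1)) x * (2 * M)\<^sup>2"])
    show "integrable lborel (\<lambda>x::pt. indicator (cball 0 (M + 1)) x * (2 * M)\<^sup>2)"
      by (intro integrable_mult_left integrable_real_indicator) (use emeasure_lborel_cball_finite[of "0::pt" "M + 1"] in auto)
    have "AE x in lebesgue. x \<notin> N"
      using N by (simp add: negligible_iff_null_sets AE_not_in)
    then have "AE x in lborel. x \<notin> N"
      by (simp add: AE_completion_iff)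
    then show "AE x in lborel. (\<lambda>n. g n x) \<longlonglongrightarrow> f x"
    proof eventually_elim
      case (elim x)
      have "(\<lambda>n. c (g0 n x)) \<longlonglongrightarrow> c (f x)"
        using c_cont[of UNIV] lim[OF elim]
        by (auto simp: continuous_on_eq_continuous_at isCont_def intro: isCont_tendsto_compose)
      then have "(\<lambda>n. k x *\<^sub>R c (g0 n x)) \<longlonglongrightarrow> k x *\<^sub>R f x"
        unfolding c_id by (intro tendsto_intros)
      then show ?case unfolding g_def kf .
    qed
    fix n
    have "(norm (g n x - f x))\<^sup>2 \<le> indicator (cball 0 (M + 1)) x * (2 * M)\<^sup>2" for x
    proof (cases "norm x > M + 1")
      case True
      then show ?thesis using supp[of x] zero[of x n] by simp
    next
      case False
      have "norm (g n x) \<le> 1 * M"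
        unfolding g_def norm_scaleR by (rule mult_mono) (auto simp: k_def c_bd)
      then have "norm (g n x - f x) \<le> 2 * M"
        using bd[of x] norm_triangle_ineq4[of "g n x" "f x"] by linarith
      then have "(norm (g n x - f x))\<^sup>2 \<le> (2 * M)\<^sup>2" by (intro power_mono) auto
      then show ?thesis using False by (simp add: indicator_def)
    qed
    then show "AE x in lborel. (norm (g n x - f x))\<^sup>2 \<le> indicator (cball 0 (M + 1)) x * (2 * M)\<^sup>2"
      by simp
  qed auto
  then obtain n where "energy (\<lambda>x. g n x - f x) < \<delta>"
    using LIMSEQ_ex_less[OF _ \<delta>] by blast
  then show ?thesis using cont zero by blast
qed

text \<open>Truncating values and positions at the same level \<open>Suc n\<close> reduces to the
  bounded case. The two errors \<open>\<delta> / 4\<close> are doubled by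
  \<open>energy_diff_triangle\<close>.\<close>

lemma sq_int_approx_continuous:
  fixes f :: "pt \<Rightarrow> 'b::euclidean_space"
  assumes f: "sq_int f" and \<delta>: "\<delta> > 0"
  obtains g M where "continuous_on UNIV g" "M > 0" "\<And>x. norm x > M \<Longrightarrow> g x = 0"
    "energy (\<lambda>x. g x - f x) < \<delta>"
proof -
  note [measurable] = sq_int_measurable[OF f]
  define h where "h n x = (if norm x \<le> real (Suc n) \<and> norm (f x) \<le> real (Suc n) then f x else 0)" for n x
  have [measurable]: "h n \<in> borel_measurable borel" for n
    unfolding h_def by measurable
  have "(\<lambda>n. energy (\<lambda>x. h n x - f x)) \<longlonglongrightarrow> 0"
  proof (rule energy_dominated_convergence[where w="\<lambda>x. (norm (f x))\<^sup>2"])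
    have "(\<lambda>n. h n x) \<longlonglongrightarrow> f x" for x
    proof (rule tendsto_eventually)
      obtain n where n: "max (norm x) (norm (f x)) \<le> real n" using real_arch_simple by blast
      show "\<forall>\<^sub>F m in sequentially. h m x = f x"
        using eventually_ge_at_top[of n]
        by eventually_elim (use n in \<open>auto simp: h_def\<close>)
    qed
    then show "AE x in lborel. (\<lambda>n. h n x) \<longlonglongrightarrow> f x" by simp
    show "AE x in lborel. (norm (h n x - f x))\<^sup>2 \<le> (norm (f x))\<^sup>2" for n
      by (auto simp: h_def)
  qed (use f in \<open>auto simp: sq_int_integrable\<close>)
  then obtain n where n: "energy (\<lambda>x. h n x - f x) < \<delta> / 4"
    using LIMSEQ_ex_less[of _ "\<delta> / 4"] \<delta> by fastforce
  have hs: "sq_int (h n)"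
  proof -
    have "integrable lborel (\<lambda>x. (norm (h n x))\<^sup>2)"
      by (rule Bochner_Integration.integrable_bound[OF sq_int_integrable[OF f]]) (auto simp: h_def)
    then show ?thesis by (simp add: sq_int_def)
  qed
  obtain g where g: "continuous_on UNIV g" "\<forall>x. norm x > real (Suc n) + 1 \<longrightarrow> g x = 0"
      "energy (\<lambda>x. g x - h n x) < \<delta> / 4"
  proof -
    have bd: "norm (h n x) \<le> real (Suc n)" "norm x > real (Suc n) \<Longrightarrow> h n x = 0" for x
      by (auto simp: h_def)
    have "0 < real (Suc n)" "0 < \<delta> / 4" using \<delta> by auto
    from bounded_sq_int_approx_continuous[OF hs this(1) bd this(2)] that show ?thesis by blast
  qed
  have gs: "sq_int g" by (rule sq_int_continuous_compact[OF g(1)]) (use g(2) in auto)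
  have "energy (\<lambda>x. g x - f x) < \<delta>"
    using energy_diff_triangle[OF gs hs f] n g(3) by linarith
  then show ?thesis using g(1,2) by (intro that[of g "real (Suc n) + 1"]) auto
qed

text \<open>For a compactly supported continuous function this is uniform continuity; density
  carries it over, since an affine substitution with ratio near 1 changes energies only by a bounded
  factor.\<close>

lemma energy_affine_continuous:
  fixes f :: "pt \<Rightarrow> 'b::euclidean_space"
  assumes f: "sq_int f" and \<delta>: "\<delta> > 0"
  shows "\<exists>d>0. \<forall>p c. norm p < d \<longrightarrow> \<bar>c - 1\<bar> < d \<longrightarrow> energy (\<lambda>x. f (p + c *\<^sub>R x) - f x) < \<delta>"
proof -
  \<comment> \<open>Error budget: \<open>2 * 4 * \<delta> / 24\<close>,
    \<open>4 * \<delta> / 16\<close> and \<open>4 * \<delta> / 24\<close> add up to three quarters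
    of \<open>\<delta>\<close>. The inner factor 4 of the first term is the largest value of
    \<open>1 / c\<^sup>2\<close> for \<open>c \<ge> 1/2\<close>.\<close>
  obtain g M where g: "continuous_on UNIV g" "M > 0" "\<And>x. norm x > M \<Longrightarrow> g x = 0"
    and fg: "energy (\<lambda>x. g x - f x) < \<delta> / 24"
    using sq_int_approx_continuous[OF f, of "\<delta> / 24"] \<delta> by auto
  have gs: "sq_int g" by (rule sq_int_continuous_compact[OF g(1,3)])
  define m where "m = measure lborel (cball (0::pt) (2 * M + 2))"
  define \<kappa> where "\<kappa> = sqrt (\<delta> / (16 * (m + 1)))"
  have m: "m \<ge> 0" by (simp add: m_def)
  have \<kappa>: "\<kappa> > 0" using \<delta> m by (simp add: \<kappa>_def)
  have "uniformly_continuous_on (cball 0 (4 * M + 4)) g"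
    by (intro compact_uniformly_continuous continuous_on_subset[OF g(1)]) auto
  then obtain d0 where d0: "d0 > 0"
    "\<And>x y. x \<in> cball 0 (4 * M + 4) \<Longrightarrow> y \<in> cball 0 (4 * M + 4) \<Longrightarrow> dist x y < d0 \<Longrightarrow> dist (g x) (g y) < \<kappa>"
    unfolding uniformly_continuous_on_def using \<kappa> by metis
  \<comment> \<open>The bound 1/2 keeps \<open>c\<close> between 1/2 and 3/2, so that points outside
    radius \<open>2 * M + 2\<close> stay outside the support. On the ball of that radius a point
    moves by less than \<open>d + d * (2 * M + 2)\<close>, which is at most
    \<open>d0\<close>.\<close>
  define d where "d = min (1/2) (d0 / (2 * M + 4))"
  show ?thesis
  proof (intro exI[of _ d] conjI allI impI)
    show "d > 0" using d0 g(2) by (simp add: d_def)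
    fix p :: pt and c :: real
    assume p: "norm p < d" and c: "\<bar>c - 1\<bar> < d"
    have "\<bar>c - 1\<bar> < 1/2" using c by (auto simp: d_def)
    then have c12: "1/2 \<le> c" "c \<le> 3/2" and c0: "c \<noteq> 0" by linarith+
    have p12: "norm p \<le> 1/2" using p by (auto simp: d_def)
    have pw: "(norm (g (p + c *\<^sub>R x) - g x))\<^sup>2 \<le> indicator (cball 0 (2 * M + 2)) x * \<kappa>\<^sup>2" for x
    proof (cases "norm x \<le> 2 * M + 2")
      case True
      have cx: "norm (c *\<^sub>R x) \<le> 3/2 * (2 * M + 2)"
        unfolding norm_scaleR using True c12 by (intro mult_mono) auto
      have 1: "norm (p + c *\<^sub>R x) \<le> 4 * M + 4"
        using norm_triangle_ineq[of p "c *\<^sub>R x"] cx p12 g(2) by simp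
      have "dist (p + c *\<^sub>R x) x = norm (p + (c - 1) *\<^sub>R x)"
        by (simp add: dist_norm algebra_simps)
      also have "\<dots> \<le> norm p + \<bar>c - 1\<bar> * norm x"
        using norm_triangle_ineq[of p "(c - 1) *\<^sub>R x"] by simp
      also have "\<dots> < d + d * (2 * M + 2)"
        using p c True g(2) by (intro add_less_le_mono mult_mono) auto
      also have "\<dots> \<le> d0"
      proof -
        have "d * (2 * M + 4) \<le> d0" using g(2) mult_right_mono[of d "d0 / (2 * M + 4)" "2 * M + 4"] by (simp add: d_def)
        moreover have "0 < d" using d0 g(2) by (simp add: d_def)
        ultimately show ?thesis by (simp add: algebra_simps)
      qed
      finally have "dist (g (p + c *\<^sub>R x)) (g x) < \<kappa>"
        using 1 True g(2) by (intro d0) auto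
      then have "(norm (g (p + c *\<^sub>R x) - g x))\<^sup>2 \<le> \<kappa>\<^sup>2"
        by (intro power_mono) (auto simp: dist_norm)
      then show ?thesis using True by (simp add: indicator_def)
    next
      case False
      have "norm x = norm ((1 / c) *\<^sub>R ((p + c *\<^sub>R x) - p))" using c0 by simp
      also have "\<dots> \<le> 2 * (norm (p + c *\<^sub>R x) + norm p)"
        unfolding norm_scaleR using c12 by (intro mult_mono norm_triangle_ineq4) (auto simp: field_simps)
      finally have "norm x \<le> 2 * norm (p + c *\<^sub>R x) + 2 * norm p" by simp
      moreover have "2 * M + 2 < norm x" using False by simp
      ultimately have "norm (p + c *\<^sub>R x) > M" using p12 g(2) by argo
      then show ?thesis using False g(2,3) by simp
    qed
    have gas: "sq_int (\<lambda>x. g (p + c *\<^sub>R x))" and fas: "sq_int (\<lambda>x. f (p + c *\<^sub>R x))"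
      by (rule sq_int_affine[OF gs c0] sq_int_affine[OF f c0])+
    have "energy (\<lambda>x. g (p + c *\<^sub>R x) - g x) \<le> (LINT x|lborel. indicator (cball (0::pt) (2 * M + 2)) x * \<kappa>\<^sup>2)"
      unfolding energy_def
    proof (rule integral_mono)
      show "integrable lborel (\<lambda>x. (norm (g (p + c *\<^sub>R x) - g x))\<^sup>2)"
        by (rule sq_int_integrable[OF sq_int_diff[OF gas gs]])
      show "integrable lborel (\<lambda>x::pt. indicator (cball 0 (2 * M + 2)) x * \<kappa>\<^sup>2)"
        using emeasure_lborel_cball_finite[of "0::pt" "2 * M + 2"]
        by (intro integrable_mult_left integrable_real_indicator) auto
    qed (rule pw)
    also have "\<dots> = m * \<kappa>\<^sup>2" by (simp add: m_def)
    also have "\<dots> \<le> (m + 1) * \<kappa>\<^sup>2" by (intro mult_right_mono) auto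
    also have "\<dots> = \<delta> / 16" using \<delta> m unfolding \<kappa>_def by (subst real_sqrt_pow2) (auto simp: divide_simps)
    finally have e1: "energy (\<lambda>x. g (p + c *\<^sub>R x) - g x) \<le> \<delta> / 16" .
    have "energy (\<lambda>x. f (p + c *\<^sub>R x) - g (p + c *\<^sub>R x)) = energy (\<lambda>x. f x - g x) / c\<^sup>2"
      by (rule energy_affine[OF sq_int_diff[OF f gs] c0])
    also have "\<dots> \<le> energy (\<lambda>x. f x - g x) / (1/2)\<^sup>2"
      using c12 by (intro divide_left_mono power_mono energy_nonneg mult_pos_pos) auto
    finally have e2: "energy (\<lambda>x. f (p + c *\<^sub>R x) - g (p + c *\<^sub>R x)) \<le> 4 * energy (\<lambda>x. g x - f x)"
      by (simp add: energy_diff_commute[of f g] power2_eq_square)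
    have "energy (\<lambda>x. f (p + c *\<^sub>R x) - f x)
        \<le> 2 * energy (\<lambda>x. f (p + c *\<^sub>R x) - g (p + c *\<^sub>R x)) + 2 * energy (\<lambda>x. g (p + c *\<^sub>R x) - f x)"
      by (rule energy_diff_triangle[OF fas gas f])
    moreover have "energy (\<lambda>x. g (p + c *\<^sub>R x) - f x)
        \<le> 2 * energy (\<lambda>x. g (p + c *\<^sub>R x) - g x) + 2 * energy (\<lambda>x. g x - f x)"
      by (rule energy_diff_triangle[OF gas gs f])
    ultimately show "energy (\<lambda>x. f (p + c *\<^sub>R x) - f x) < \<delta>"
      using e1 e2 fg \<delta> by linarith
  qed
qed

section \<open>Mollification\<close>

text \<open>The outer square makes the truncated paraboloid continuously differentiable across the
  unit circle, and C1 is all that \<open>test_fun\<close> asks for.\<close>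

definition bump :: "pt \<Rightarrow> real" where
  "bump x = (max 0 (1 - x \<bullet> x))\<^sup>2"

definition bump_grad :: "pt \<Rightarrow> pt" where
  "bump_grad x = (- 4 * max 0 (1 - x \<bullet> x)) *\<^sub>R x"

definition bump_mass :: real where
  "bump_mass = (LINT x|lborel. bump x)"

definition mkern :: "real \<Rightarrow> pt \<Rightarrow> real" where
  "mkern e x = bump ((1 / e) *\<^sub>R x) / (e\<^sup>2 * bump_mass)"

definition mkern_grad :: "real \<Rightarrow> pt \<Rightarrow> pt" where
  "mkern_grad e x = (1 / (e ^ 3 * bump_mass)) *\<^sub>R bump_grad ((1 / e) *\<^sub>R x)"

definition moll :: "real \<Rightarrow> (pt \<Rightarrow> 'b::euclidean_space) \<Rightarrow> pt \<Rightarrow> 'b" where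
  "moll e f x = (LINT z|lborel. mkern e (x - z) *\<^sub>R f z)"

lemma max_0_sq_deriv: "((\<lambda>r::real. (max 0 r)\<^sup>2) has_field_derivative 2 * max 0 r) (at r)"
proof -
  consider "r > 0" | "r < 0" | "r = 0" by linarith
  then show ?thesis
  proof cases
    case 1
    have "((\<lambda>r::real. r\<^sup>2) has_field_derivative 2 * r) (at r)"
      by (auto intro!: derivative_eq_intros)
    then have "((\<lambda>r::real. (max 0 r)\<^sup>2) has_field_derivative 2 * r) (at r)"
      by (rule has_field_derivative_transform_within_open[where S="{0<..}"]) (use 1 in auto)
    then show ?thesis using 1 by simp
  next
    case 2
    have "((\<lambda>r::real. 0) has_field_derivative 0) (at r)" by simp
    then have "((\<lambda>r::real. (max 0 r)\<^sup>2) has_field_derivative 0) (at r)"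
      by (rule has_field_derivative_transform_within_open[where S="{..<0}"]) (use 2 in auto)
    then show ?thesis using 2 by simp
  next
    case 3
    have "((\<lambda>h::real. (max 0 h)\<^sup>2 / h) \<longlongrightarrow> 0) (at 0)"
    proof (rule Lim_null_comparison)
      show "\<forall>\<^sub>F h in at 0. norm ((max 0 h)\<^sup>2 / h) \<le> \<bar>h\<bar>"
        by (intro always_eventually) (auto simp: max_def power2_eq_square)
      show "((\<lambda>h::real. \<bar>h\<bar>) \<longlongrightarrow> 0) (at 0)"
        by (intro tendsto_eq_intros) auto
    qed
    then show ?thesis using 3 by (simp add: has_field_derivative_iff)
  qed
qed

lemma bump_C1: "C1_grad bump bump_grad"
  unfolding C1_grad_def
proof (intro conjI allI)
  show "continuous_on UNIV bump_grad"
    unfolding bump_grad_def by (intro continuous_intros)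
  fix x
  have "((\<lambda>x::pt. 1 - x \<bullet> x) has_derivative (\<lambda>h. - (2 * (h \<bullet> x)))) (at x)"
    by (auto intro!: derivative_eq_intros simp: inner_commute)
  from has_derivative_compose[OF this max_0_sq_deriv[of "1 - x \<bullet> x", unfolded has_field_derivative_def]]
  show "GDERIV bump x :> bump_grad x"
    unfolding gderiv_def bump_def bump_grad_def by (simp add: algebra_simps)
qed

lemma bump_nonneg: "0 \<le> bump x" by (simp add: bump_def)
lemma bump_le_1: "bump x \<le> 1"
  unfolding bump_def by (rule power_le_one) (auto simp: max_def)
lemma bump_continuous: "continuous_on A bump"
  unfolding bump_def by (intro continuous_intros)
lemma bump_zero: "1 \<le> norm x \<Longrightarrow> bump x = 0"
  using one_le_power[of "norm x" 2] by (simp add: bump_def dot_square_norm)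

lemma bump_integrable: "integrable lborel bump"
proof -
  have [measurable]: "bump \<in> borel_measurable borel"
    by (rule borel_measurable_continuous_onI[OF bump_continuous])
  show ?thesis
  proof (rule Bochner_Integration.integrable_bound)
    show "integrable lborel (indicator (cball (0::pt) 1) :: pt \<Rightarrow> real)"
      using emeasure_lborel_cball_finite[of "0::pt" 1] by (intro integrable_real_indicator) auto
    show "AE x in lborel. norm (bump x) \<le> norm (indicator (cball 0 1) x :: real)"
      using bump_zero bump_le_1 bump_nonneg by (auto simp: indicator_def)
  qed auto
qed

lemma bump_mass_pos: "bump_mass > 0"
proof -
  have "0 < measure lborel (cball (0::pt) (1/2))"
    by (simp add: content_cball_pos)
  also have "\<dots> = (LINT x|lborel. indicator (cball (0::pt) (1/2)) x)"
    by simp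
  \<comment> \<open>On the ball of radius 1/2 the bump is at least \<open>(3/4)\<^sup>2\<close>,
    which exceeds 1/2.\<close>
  also have "\<dots> \<le> (LINT x|lborel. 2 * bump x)"
  proof (rule integral_mono)
    show "integrable lborel (indicator (cball (0::pt) (1/2)) :: pt \<Rightarrow> real)"
      using emeasure_lborel_cball_finite[of "0::pt" "1/2"] by (intro integrable_real_indicator) auto
    show "indicator (cball (0::pt) (1/2)) x \<le> 2 * bump x" for x
    proof (cases "norm x \<le> 1/2")
      case True
      then have "(norm x)\<^sup>2 \<le> (1/2)\<^sup>2" by (intro power_mono) auto
      then have "3/4 \<le> 1 - x \<bullet> x" by (simp add: dot_square_norm power2_eq_square[of "1/2"])
      then have "(3/4)\<^sup>2 \<le> bump x" unfolding bump_def by (intro power_mono) auto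
      then show ?thesis using True by (simp add: power2_eq_square)
    qed (use bump_nonneg in auto)
  qed (use bump_integrable in auto)
  finally show ?thesis by (simp add: bump_mass_def)
qed

section \<open>The scaled kernel and differentiation under the integral sign\<close>

lemma mkern_nonneg: "0 \<le> mkern e x"
  using bump_mass_pos bump_nonneg by (simp add: mkern_def)

lemma mkern_le: "mkern e x \<le> 1 / (e\<^sup>2 * bump_mass)"
  unfolding mkern_def using bump_le_1 bump_mass_pos by (intro divide_right_mono) auto

lemma mkern_zero: "0 < e \<Longrightarrow> e \<le> norm x \<Longrightarrow> mkern e x = 0"
  by (simp add: mkern_def bump_zero)

lemma mkern_continuous: "continuous_on A (mkern e)"
  unfolding mkern_def
  by (cases "e = 0") (auto intro!: continuous_intros continuous_on_compose2[OF bump_continuous[of UNIV]]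
      simp: bump_mass_pos[THEN less_imp_neq, symmetric])

lemma mkern_measurable [measurable]: "mkern e \<in> borel_measurable borel"
  by (rule borel_measurable_continuous_onI[OF mkern_continuous])

lemma mkern_integrable: "0 < e \<Longrightarrow> integrable lborel (mkern e)"
  using integrable_affine_pt[OF bump_integrable, of "1 / e" 0] by (simp add: mkern_def[abs_def] divide_inverse)

lemma integral_mkern: "0 < e \<Longrightarrow> (LINT x|lborel. mkern e x) = 1"
  using integral_affine_pt[of bump "1 / e" 0] bump_mass_pos bump_integrable
  by (simp add: mkern_def bump_mass_def[symmetric] power_divide borel_measurable_integrable)

lemma mkern_C1:
  assumes "0 < e" shows "C1_grad (mkern e) (mkern_grad e)"
  unfolding C1_grad_def
proof (intro conjI allI)
  have b: "continuous_on UNIV bump_grad" "GDERIV bump x :> bump_grad x" for x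
    using bump_C1 by (auto simp: C1_grad_def)
  show "continuous_on UNIV (mkern_grad e)"
    unfolding mkern_grad_def by (intro continuous_intros continuous_on_compose2[OF b(1)]) auto
  fix x
  have 1: "((\<lambda>x::pt. (1 / e) *\<^sub>R x) has_derivative (\<lambda>h. (1 / e) *\<^sub>R h)) (at x)"
    by (auto intro!: derivative_eq_intros)
  have "((\<lambda>x. bump ((1 / e) *\<^sub>R x)) has_derivative (\<lambda>h. ((1 / e) *\<^sub>R h) \<bullet> bump_grad ((1 / e) *\<^sub>R x))) (at x)"
    using has_derivative_compose[OF 1, of bump] b(2) unfolding gderiv_def by blast
  then have "((\<lambda>x. (1 / (e\<^sup>2 * bump_mass)) * bump ((1 / e) *\<^sub>R x)) has_derivative
      (\<lambda>h. (1 / (e\<^sup>2 * bump_mass)) * (((1 / e) *\<^sub>R h) \<bullet> bump_grad ((1 / e) *\<^sub>R x)))) (at x)"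
    by (rule has_derivative_mult_right)
  then show "GDERIV (mkern e) x :> mkern_grad e x"
    unfolding gderiv_def mkern_def mkern_grad_def
    by (simp add: power2_eq_square power3_eq_cube algebra_simps divide_simps)
qed

lemma mkern_grad_zero: "0 < e \<Longrightarrow> e \<le> norm x \<Longrightarrow> mkern_grad e x = 0"
proof -
  assume "0 < e" "e \<le> norm x"
  then have "1 \<le> ((1 / e) *\<^sub>R x) \<bullet> ((1 / e) *\<^sub>R x)"
    using power_mono[of 1 "norm x / e" 2] by (simp add: dot_square_norm power_divide)
  then show ?thesis by (simp add: mkern_grad_def bump_grad_def)
qed

lemma compact_support_uniformly_continuous:
  fixes k :: "pt \<Rightarrow> 'b::real_normed_vector"
  assumes k: "continuous_on UNIV k" "\<And>x. r \<le> norm x \<Longrightarrow> k x = 0" and "\<eta> > 0"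
  shows "\<exists>d>0. \<forall>x y. norm (x - y) < d \<longrightarrow> norm (k x - k y) < \<eta>"
proof -
  have "uniformly_continuous_on (cball 0 (\<bar>r\<bar> + 1)) k"
    by (intro compact_uniformly_continuous continuous_on_subset[OF k(1)]) auto
  then obtain d0 where d0: "d0 > 0"
    "\<And>x y. x \<in> cball 0 (\<bar>r\<bar> + 1) \<Longrightarrow> y \<in> cball 0 (\<bar>r\<bar> + 1) \<Longrightarrow> dist x y < d0 \<Longrightarrow> dist (k x) (k y) < \<eta>"
    unfolding uniformly_continuous_on_def using \<open>\<eta> > 0\<close> by metis
  show ?thesis
  proof (intro exI[of _ "min d0 1"] conjI allI impI)
    show "min d0 1 > 0" using d0 by simp
    fix x y :: pt assume xy: "norm (x - y) < min d0 1"
    show "norm (k x - k y) < \<eta>"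
    proof (cases "norm x \<le> \<bar>r\<bar> + 1 \<and> norm y \<le> \<bar>r\<bar> + 1")
      case True then show ?thesis using d0(2)[of x y] xy by (auto simp: dist_norm)
    next
      case False
      then have "r \<le> norm x" "r \<le> norm y"
        using xy norm_triangle_ineq2[of x y] norm_triangle_ineq2[of y x] norm_minus_commute[of x y] by auto
      then show ?thesis using k(2) \<open>\<eta> > 0\<close> by simp
    qed
  qed
qed

lemma compact_support_bounded:
  fixes k :: "pt \<Rightarrow> 'b::real_normed_vector"
  assumes k: "continuous_on UNIV k" "\<And>x. r \<le> norm x \<Longrightarrow> k x = 0"
  obtains K where "K > 0" "\<And>x. norm (k x) \<le> K"
proof -
  have "bounded (k ` cball 0 \<bar>r\<bar>)"
    by (intro compact_imp_bounded compact_continuous_image continuous_on_subset[OF k(1)]) auto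
  then obtain K where K: "K > 0" "\<And>x. x \<in> cball 0 \<bar>r\<bar> \<Longrightarrow> norm (k x) \<le> K"
    unfolding bounded_pos by blast
  have "norm (k x) \<le> K" for x
    using K k(2)[of x] by (cases "norm x \<le> \<bar>r\<bar>") auto
  then show thesis using that K(1) by blast
qed

lemma integrable_kernel:
  fixes k :: "pt \<Rightarrow> real" and f :: "pt \<Rightarrow> 'b::euclidean_space"
  assumes k: "continuous_on UNIV k" "\<And>x. r \<le> norm x \<Longrightarrow> k x = 0" and f: "integrable lborel f"
  shows "integrable lborel (\<lambda>z. k (x - z) *\<^sub>R f z)"
proof -
  obtain K where K: "\<And>x. norm (k x) \<le> K" using compact_support_bounded[OF k] by blast
  have [measurable]: "k \<in> borel_measurable borel" by (rule borel_measurable_continuous_onI[OF k(1)])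
  note [measurable] = borel_measurable_integrable[OF f]
  show ?thesis
    by (rule Bochner_Integration.integrable_bound[where f="\<lambda>z. K * norm (f z)"])
       (use f K in \<open>auto intro!: mult_right_mono order_trans[OF _ abs_ge_self]\<close>)
qed

lemma kernel_continuous:
  fixes k :: "pt \<Rightarrow> real" and f :: "pt \<Rightarrow> real"
  assumes k: "continuous_on UNIV k" "\<And>x. r \<le> norm x \<Longrightarrow> k x = 0" and f: "integrable lborel f"
  shows "continuous_on UNIV (\<lambda>x. LINT z|lborel. k (x - z) *\<^sub>R f z)"
  unfolding continuous_on_iff
proof (intro ballI allI impI)
  fix x :: pt and \<eta> :: real assume \<eta>: "\<eta> > 0"
  define I where "I = (LINT z|lborel. norm (f z))"
  have I: "I \<ge> 0" by (simp add: I_def)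
  have \<eta>I: "\<eta> / (I + 1) > 0" using \<eta> I by simp
  obtain d where d: "d > 0" "\<And>x y. norm (x - y) < d \<Longrightarrow> norm (k x - k y) < \<eta> / (I + 1)"
    using compact_support_uniformly_continuous[OF k \<eta>I] by metis
  have "dist (LINT z|lborel. k (y - z) *\<^sub>R f z) (LINT z|lborel. k (x - z) *\<^sub>R f z) < \<eta>" if "dist y x < d" for y
  proof -
    have "norm ((LINT z|lborel. k (y - z) *\<^sub>R f z) - (LINT z|lborel. k (x - z) *\<^sub>R f z))
        = norm (LINT z|lborel. k (y - z) *\<^sub>R f z - k (x - z) *\<^sub>R f z)"
      using integrable_kernel[OF k f, where x=x] integrable_kernel[OF k f, where x=y] by simp
    also have "\<dots> \<le> (LINT z|lborel. norm (k (y - z) *\<^sub>R f z - k (x - z) *\<^sub>R f z))"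
      by (rule integral_norm_bound)
    also have "\<dots> \<le> (LINT z|lborel. \<eta> / (I + 1) * norm (f z))"
    proof (rule integral_mono)
      show "integrable lborel (\<lambda>z. norm (k (y - z) *\<^sub>R f z - k (x - z) *\<^sub>R f z))"
        by (intro integrable_norm Bochner_Integration.integrable_diff integrable_kernel[OF k f])
      show "norm (k (y - z) *\<^sub>R f z - k (x - z) *\<^sub>R f z) \<le> \<eta> / (I + 1) * norm (f z)" for z
        unfolding scaleR_diff_left[symmetric] norm_scaleR
        using d(2)[of "y - z" "x - z"] that by (intro mult_right_mono) (auto simp: dist_norm less_imp_le)
    qed (use f in auto)
    also have "\<dots> = \<eta> / (I + 1) * I" by (simp add: I_def)
    also have "\<dots> < \<eta>" using \<eta> I by (simp add: field_simps)
    finally show ?thesis by (simp add: dist_norm)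
  qed
  then show "\<exists>d>0. \<forall>x'\<in>UNIV. dist x' x < d \<longrightarrow>
      dist (LINT z|lborel. k (x' - z) *\<^sub>R f z) (LINT z|lborel. k (x - z) *\<^sub>R f z) < \<eta>"
    using d(1) by blast
qed

text \<open>Uniform continuity of \<open>Dk\<close> bounds the first-order Taylor remainder of
  \<open>k\<close> uniformly in the base point; integrating this bound against the norm of
  \<open>f\<close> requires no more than integrability of \<open>f\<close>.\<close>

lemma kernel_has_derivative:
  fixes k :: "pt \<Rightarrow> real" and f :: "pt \<Rightarrow> 'b::euclidean_space"
  assumes C1: "C1_grad k Dk" and k: "\<And>x. r \<le> norm x \<Longrightarrow> k x = 0" and Dk: "\<And>x. r \<le> norm x \<Longrightarrow> Dk x = 0"
    and f: "integrable lborel f"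
  shows "((\<lambda>x. LINT z|lborel. k (x - z) *\<^sub>R f z) has_derivative
    (\<lambda>h. LINT z|lborel. (h \<bullet> Dk (x - z)) *\<^sub>R f z)) (at x)"
  unfolding has_derivative_at_alt
proof (intro conjI allI impI)
  have Dkc: "continuous_on UNIV Dk" and kd: "\<And>x. (k has_derivative (\<lambda>h. h \<bullet> Dk x)) (at x)"
    using C1 by (auto simp: C1_grad_def gderiv_def)
  have kc: "continuous_on UNIV k"
    using kd by (auto intro!: continuous_at_imp_continuous_on has_derivative_continuous)
  have hint: "integrable lborel (\<lambda>z. (h \<bullet> Dk (x - z)) *\<^sub>R f z)" for h x
    by (rule integrable_kernel[where k="\<lambda>x. h \<bullet> Dk x" and r=r])
       (use Dk f in \<open>auto intro!: continuous_intros Dkc\<close>)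
  obtain K where K: "K > 0" "\<And>x. norm (Dk x) \<le> K" using compact_support_bounded[OF Dkc Dk] by blast
  define I where "I = (LINT z|lborel. norm (f z))"
  have I: "I \<ge> 0" by (simp add: I_def)
  show "bounded_linear (\<lambda>h. LINT z|lborel. (h \<bullet> Dk (x - z)) *\<^sub>R f z)"
  proof (rule bounded_linear_intro[where K="K * I"])
    show "(LINT z|lborel. ((a + b) \<bullet> Dk (x - z)) *\<^sub>R f z) =
        (LINT z|lborel. (a \<bullet> Dk (x - z)) *\<^sub>R f z) + (LINT z|lborel. (b \<bullet> Dk (x - z)) *\<^sub>R f z)" for a b
      by (subst Bochner_Integration.integral_add[symmetric]) (auto simp: hint inner_add_left scaleR_add_left)
    show "(LINT z|lborel. ((c *\<^sub>R a) \<bullet> Dk (x - z)) *\<^sub>R f z) = c *\<^sub>R (LINT z|lborel. (a \<bullet> Dk (x - z)) *\<^sub>R f z)" for a c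
      by (subst integral_scaleR_right[symmetric]) auto
    show "norm (LINT z|lborel. (a \<bullet> Dk (x - z)) *\<^sub>R f z) \<le> norm a * (K * I)" for a
    proof -
      have "norm (LINT z|lborel. (a \<bullet> Dk (x - z)) *\<^sub>R f z) \<le> (LINT z|lborel. norm ((a \<bullet> Dk (x - z)) *\<^sub>R f z))"
        by (rule integral_norm_bound)
      also have "\<dots> \<le> (LINT z|lborel. (norm a * K) * norm (f z))"
      proof (rule integral_mono)
        show "norm ((a \<bullet> Dk (x - z)) *\<^sub>R f z) \<le> (norm a * K) * norm (f z)" for z
          unfolding norm_scaleR real_norm_def
          by (intro mult_right_mono order_trans[OF Cauchy_Schwarz_ineq2] mult_left_mono K(2)) auto
      qed (use f integrable_norm[OF hint[of a x]] in auto)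
      also have "\<dots> = norm a * (K * I)" by (simp add: I_def)
      finally show ?thesis .
    qed
  qed
  fix \<eta> :: real assume \<eta>: "\<eta> > 0"
  have \<eta>I: "\<eta> / (I + 1) > 0" using \<eta> I by simp
  obtain d where d: "d > 0" "\<And>x y. norm (x - y) < d \<Longrightarrow> norm (Dk x - Dk y) < \<eta> / (I + 1)"
    using compact_support_uniformly_continuous[OF Dkc Dk \<eta>I] by metis
  have taylor: "norm (k v - k u - (v - u) \<bullet> Dk u) \<le> norm (v - u) * (\<eta> / (I + 1))" if "norm (v - u) < d" for u v
  proof -
    have "norm (k v - k u - (\<lambda>h. h \<bullet> Dk u) (v - u)) \<le> norm (v - u) * (\<eta> / (I + 1))"
    proof (rule differentiable_bound_linearization[where S="ball u d" and f'="\<lambda>x h. h \<bullet> Dk x"])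
      show "u + t *\<^sub>R (v - u) \<in> ball u d" if "t \<in> {0..1}" for t
      proof -
        have "norm (t *\<^sub>R (v - u)) \<le> 1 * norm (v - u)"
          unfolding norm_scaleR using that by (intro mult_right_mono) auto
        then show ?thesis using \<open>norm (v - u) < d\<close> by (simp add: dist_norm)
      qed
      show "(k has_derivative (\<lambda>h. h \<bullet> Dk x)) (at x within ball u d)" for x
        using kd by (rule has_derivative_at_withinI)
      fix x assume "x \<in> ball u d"
      then have "norm (Dk x - Dk u) < \<eta> / (I + 1)"
        by (intro d(2)) (auto simp: dist_norm norm_minus_commute)
      then have "norm (i \<bullet> Dk x - i \<bullet> Dk u) \<le> \<eta> / (I + 1) * norm i" for i
        unfolding inner_diff_right[symmetric] real_norm_def
        using Cauchy_Schwarz_ineq2[of i "Dk x - Dk u"] mult_left_mono[of "norm (Dk x - Dk u)" "\<eta> / (I + 1)" "norm i"]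
        by (simp add: mult.commute)
      then show "onorm ((\<lambda>h. h \<bullet> Dk x) - (\<lambda>h. h \<bullet> Dk u)) \<le> \<eta> / (I + 1)"
        unfolding fun_diff_def by (rule onorm_le)
    qed (use d(1) in auto)
    then show ?thesis by simp
  qed
  have "norm ((LINT z|lborel. k (y - z) *\<^sub>R f z) - (LINT z|lborel. k (x - z) *\<^sub>R f z) -
      (LINT z|lborel. ((y - x) \<bullet> Dk (x - z)) *\<^sub>R f z)) \<le> \<eta> * norm (y - x)" if y: "norm (y - x) < d" for y
  proof -
    note ki = integrable_kernel[OF kc k f]
    have "norm ((LINT z|lborel. k (y - z) *\<^sub>R f z) - (LINT z|lborel. k (x - z) *\<^sub>R f z) -
      (LINT z|lborel. ((y - x) \<bullet> Dk (x - z)) *\<^sub>R f z)) =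
      norm (LINT z|lborel. k (y - z) *\<^sub>R f z - k (x - z) *\<^sub>R f z - ((y - x) \<bullet> Dk (x - z)) *\<^sub>R f z)"
      using ki hint by simp
    also have "\<dots> \<le> (LINT z|lborel. norm (k (y - z) *\<^sub>R f z - k (x - z) *\<^sub>R f z - ((y - x) \<bullet> Dk (x - z)) *\<^sub>R f z))"
      by (rule integral_norm_bound)
    also have "\<dots> \<le> (LINT z|lborel. (norm (y - x) * (\<eta> / (I + 1))) * norm (f z))"
    proof (rule integral_mono)
      show "norm (k (y - z) *\<^sub>R f z - k (x - z) *\<^sub>R f z - ((y - x) \<bullet> Dk (x - z)) *\<^sub>R f z)
          \<le> (norm (y - x) * (\<eta> / (I + 1))) * norm (f z)" for z
        unfolding scaleR_diff_left[symmetric] norm_scaleR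
        using taylor[of "y - z" "x - z"] y by (intro mult_right_mono) auto
    qed (use f ki hint in auto)
    also have "\<dots> = norm (y - x) * (\<eta> * (I / (I + 1)))" by (simp add: I_def)
    also have "\<dots> \<le> norm (y - x) * (\<eta> * 1)"
      using I \<eta> by (intro mult_left_mono) (auto simp: field_simps)
    finally show ?thesis by (simp add: mult.commute)
  qed
  then show "\<exists>d>0. \<forall>y. norm (y - x) < d \<longrightarrow>
      norm ((LINT z|lborel. k (y - z) *\<^sub>R f z) - (LINT z|lborel. k (x - z) *\<^sub>R f z) -
        (LINT z|lborel. ((y - x) \<bullet> Dk (x - z)) *\<^sub>R f z)) \<le> \<eta> * norm (y - x)"
    using d(1) by blast
qed

lemma mkern_grad_continuous: "0 < e \<Longrightarrow> continuous_on A (mkern_grad e)"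
  using mkern_C1[of e] by (auto simp: C1_grad_def intro: continuous_on_subset)

lemma integrable_mkern_mult:
  fixes f :: "pt \<Rightarrow> 'b::euclidean_space"
  shows "0 < e \<Longrightarrow> integrable lborel f \<Longrightarrow> integrable lborel (\<lambda>z. mkern e (x - z) *\<^sub>R f z)"
  by (rule integrable_kernel[where r=e]) (auto simp: mkern_continuous mkern_zero)

definition moll_jac :: "real \<Rightarrow> (pt \<Rightarrow> pt) \<Rightarrow> pt \<Rightarrow> real^2^2" where
  "moll_jac e f x = (\<chi> i j. LINT z|lborel. mkern_grad e (x - z) $ j *\<^sub>R f z $ i)"

lemma integrable_vec_nth:
  fixes f :: "pt \<Rightarrow> pt"
  shows "integrable M f \<Longrightarrow> integrable M (\<lambda>z. f z $ i)"
  by (simp add: cart_eq_inner_axis)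

lemma integral_vec_nth:
  fixes f :: "'a \<Rightarrow> pt"
  shows "integrable M f \<Longrightarrow> (LINT z|M. f z) $ i = (LINT z|M. f z $ i)"
  by (simp add: cart_eq_inner_axis)

lemma moll_C1_jacobian:
  fixes f :: "pt \<Rightarrow> pt"
  assumes e: "0 < e" and f: "integrable lborel f"
  shows "C1_jacobian (moll e f) (moll_jac e f)"
  unfolding C1_jacobian_def
proof (intro conjI allI)
  have gi: "integrable lborel (\<lambda>z. mkern_grad e (x - z) $ j *\<^sub>R f z $ i)" for x i j
    by (rule integrable_kernel[where k="\<lambda>x. mkern_grad e x $ j" and r=e])
       (use e f in \<open>auto intro!: continuous_intros mkern_grad_continuous integrable_vec_nth simp: mkern_grad_zero\<close>)
  have "continuous_on UNIV (\<lambda>x. LINT z|lborel. mkern_grad e (x - z) $ j *\<^sub>R f z $ i)" for i j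
    by (rule kernel_continuous[where k="\<lambda>x. mkern_grad e x $ j" and r=e])
       (use e f in \<open>auto intro!: continuous_intros mkern_grad_continuous integrable_vec_nth simp: mkern_grad_zero\<close>)
  then show "continuous_on UNIV (moll_jac e f)"
    unfolding moll_jac_def[abs_def] by (intro continuous_on_vec_lambda) auto
  fix x
  have 1: "(moll e f has_derivative (\<lambda>h. LINT z|lborel. (h \<bullet> mkern_grad e (x - z)) *\<^sub>R f z)) (at x)"
    unfolding moll_def
    by (rule kernel_has_derivative[where r=e]) (use e f in \<open>auto simp: mkern_zero mkern_grad_zero mkern_C1\<close>)
  have "(LINT z|lborel. (h \<bullet> mkern_grad e (x - z)) *\<^sub>R f z) = moll_jac e f x *v h" for h
  proof (subst vec_eq_iff, rule allI)
    fix i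
    have hi: "integrable lborel (\<lambda>z. (h \<bullet> mkern_grad e (x - z)) *\<^sub>R f z)"
      by (rule integrable_kernel[where k="\<lambda>x. h \<bullet> mkern_grad e x" and r=e])
         (use e f in \<open>auto intro!: continuous_intros mkern_grad_continuous simp: mkern_grad_zero\<close>)
    have "(LINT z|lborel. (h \<bullet> mkern_grad e (x - z)) *\<^sub>R f z) $ i
        = (LINT z|lborel. (\<Sum>j\<in>UNIV. (mkern_grad e (x - z) $ j *\<^sub>R f z $ i) * h $ j))"
      by (subst integral_vec_nth[OF hi]) (simp add: inner_vec_def sum_distrib_left algebra_simps)
    also have "\<dots> = (\<Sum>j\<in>UNIV. (LINT z|lborel. mkern_grad e (x - z) $ j *\<^sub>R f z $ i) * h $ j)"
      using gi by (subst Bochner_Integration.integral_sum) auto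
    also have "\<dots> = (moll_jac e f x *v h) $ i"
      by (simp add: matrix_vector_mult_def moll_jac_def)
    finally show "(LINT z|lborel. (h \<bullet> mkern_grad e (x - z)) *\<^sub>R f z) $ i = (moll_jac e f x *v h) $ i" .
  qed
  then show "(moll e f has_derivative (\<lambda>h. moll_jac e f x *v h)) (at x)"
    using 1 by simp
qed

text \<open>This writes the divergence of the mollified field as a pairing of the field with a
  translated kernel gradient, the form to which \<open>weak_div\<close> applies.\<close>

lemma trace_moll_jac:
  fixes f :: "pt \<Rightarrow> pt"
  assumes e: "0 < e" and f: "integrable lborel f"
  shows "trace (moll_jac e f x) = (LINT z|lborel. f z \<bullet> mkern_grad e (x - z))"
proof -
  have gi: "integrable lborel (\<lambda>z. mkern_grad e (x - z) $ j *\<^sub>R f z $ i)" for i j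
    by (rule integrable_kernel[where k="\<lambda>x. mkern_grad e x $ j" and r=e])
       (use e f in \<open>auto intro!: continuous_intros mkern_grad_continuous integrable_vec_nth simp: mkern_grad_zero\<close>)
  have "trace (moll_jac e f x) = (LINT z|lborel. (\<Sum>i\<in>UNIV. mkern_grad e (x - z) $ i *\<^sub>R f z $ i))"
    unfolding trace_def moll_jac_def using gi by (subst Bochner_Integration.integral_sum) auto
  then show ?thesis by (simp add: inner_vec_def mult.commute)
qed

text \<open>Through these test functions a weak identity on \<open>D\<close> becomes a pointwise
  identity for mollifications at points whose \<open>e\<close>-ball fits into \<open>D\<close>. The
  sign comes from differentiating in \<open>z\<close> rather than in \<open>x\<close>.\<close>

lemma mkern_test_fun:
  assumes e: "0 < e" and "cball x e \<subseteq> D"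
  shows "test_fun D (\<lambda>z. mkern e (x - z)) (\<lambda>z. - mkern_grad e (x - z))"
  unfolding test_fun_def C1_grad_def
proof (intro conjI allI exI[of _ "cball x e"] impI)
  have C1: "continuous_on UNIV (mkern_grad e)" "GDERIV (mkern e) y :> mkern_grad e y" for y
    using mkern_C1[OF e] by (auto simp: C1_grad_def)
  show "continuous_on UNIV (\<lambda>z. - mkern_grad e (x - z))"
    by (intro continuous_intros continuous_on_compose2[OF C1(1)]) auto
  show "GDERIV (\<lambda>z. mkern e (x - z)) y :> - mkern_grad e (x - y)" for y
  proof -
    have "((\<lambda>z. x - z) has_derivative (\<lambda>h. - h)) (at y)" by (auto intro!: derivative_eq_intros)
    from has_derivative_compose[OF this C1(2)[of "x - y", unfolded gderiv_def]]
    show ?thesis by (simp add: gderiv_def)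
  qed
  show "mkern e (x - z) = 0" if "z \<notin> cball x e" for z
    using that e by (intro mkern_zero) (auto simp: dist_norm)
qed (use assms in auto)

section \<open>Energy and supremum estimates for mollification\<close>

lemma moll_shift:
  fixes f :: "pt \<Rightarrow> 'b::euclidean_space"
  assumes [measurable]: "f \<in> borel_measurable borel"
  shows "moll e f x = (LINT z|lborel. mkern e z *\<^sub>R f (x - z))"
  using integral_affine_pt[of "\<lambda>z. mkern e (x - z) *\<^sub>R f z" "-1" x]
  by (simp add: moll_def)

text \<open>Jensen's inequality for the probability density \<open>mkern e\<close>, obtained from
  the nonnegative variance of \<open>norm (F z)\<close>.\<close>

lemma moll_jensen:
  fixes F :: "pt \<Rightarrow> 'b::euclidean_space"
  assumes e: "0 < e" and [measurable]: "F \<in> borel_measurable borel"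
    and int: "integrable lborel (\<lambda>z. mkern e z * (norm (F z))\<^sup>2)"
  shows "(norm (LINT z|lborel. mkern e z *\<^sub>R F z))\<^sup>2 \<le> (LINT z|lborel. mkern e z * (norm (F z))\<^sup>2)"
proof -
  have *: "norm (F z) \<le> 1 + (norm (F z))\<^sup>2" for z
    using zero_le_power2[of "norm (F z) - 1"] by (simp add: power2_diff) (smt (verit) norm_ge_zero)
  have i1: "integrable lborel (\<lambda>z. mkern e z * norm (F z))"
  proof (rule Bochner_Integration.integrable_bound)
    show "integrable lborel (\<lambda>z. mkern e z + mkern e z * (norm (F z))\<^sup>2)"
      using int mkern_integrable[OF e] by simp
    have "mkern e z * norm (F z) \<le> mkern e z * (1 + (norm (F z))\<^sup>2)" for z
      using * mkern_nonneg by (intro mult_left_mono)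
    then have "mkern e z * norm (F z) \<le> mkern e z + mkern e z * (norm (F z))\<^sup>2" for z
      by (simp add: algebra_simps)
    then show "AE z in lborel. norm (mkern e z * norm (F z)) \<le> norm (mkern e z + mkern e z * (norm (F z))\<^sup>2)"
      by (auto simp: mkern_nonneg)
  qed auto
  define a where "a = (LINT z|lborel. mkern e z * norm (F z))"
  have "0 \<le> (LINT z|lborel. mkern e z * (norm (F z) - a)\<^sup>2)"
    by (rule integral_nonneg_AE) (auto simp: mkern_nonneg)
  also have "\<dots> = (LINT z|lborel. mkern e z * (norm (F z))\<^sup>2 - 2 * a * (mkern e z * norm (F z)) + a\<^sup>2 * mkern e z)"
    by (simp add: power2_diff algebra_simps)
  also have "\<dots> = (LINT z|lborel. mkern e z * (norm (F z))\<^sup>2) - 2 * a * a + a\<^sup>2"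
    using int i1 mkern_integrable[OF e] by (simp add: integral_mkern[OF e] a_def)
  finally have "a\<^sup>2 \<le> (LINT z|lborel. mkern e z * (norm (F z))\<^sup>2)"
    by (simp add: power2_eq_square)
  moreover have "norm (LINT z|lborel. mkern e z *\<^sub>R F z) \<le> a"
    unfolding a_def
    by (rule order_trans[OF integral_norm_bound]) (simp add: mkern_nonneg)
  ultimately show ?thesis
    by (meson norm_ge_zero order_trans power_mono)
qed

text \<open>Jensen together with the supremum of the kernel. The bound on the norm grows like
  \<open>1 / e\<close>, and this rate links the mollification radius to the height of a level set
  below.\<close>

lemma norm_moll_sq_le:
  fixes f :: "pt \<Rightarrow> 'b::euclidean_space"
  assumes e: "0 < e" and f: "sq_int f"
  shows "(norm (moll e f x))\<^sup>2 \<le> energy f / (e\<^sup>2 * bump_mass)"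
proof -
  note [measurable] = sq_int_measurable[OF f]
  have fs: "sq_int (\<lambda>z. f (x - z))" and en: "energy (\<lambda>z. f (x - z)) = energy f"
    using sq_int_affine[OF f, of "-1" x] energy_affine[OF f, of "-1" x] by auto
  have bd: "mkern e z * (norm (f (x - z)))\<^sup>2 \<le> 1 / (e\<^sup>2 * bump_mass) * (norm (f (x - z)))\<^sup>2" for z
    by (intro mult_right_mono mkern_le) auto
  have int: "integrable lborel (\<lambda>z. mkern e z * (norm (f (x - z)))\<^sup>2)"
    by (rule Bochner_Integration.integrable_bound[where f="\<lambda>z. 1 / (e\<^sup>2 * bump_mass) * (norm (f (x - z)))\<^sup>2"])
       (use sq_int_integrable[OF fs] bd bump_mass_pos in \<open>auto simp: mkern_nonneg abs_mult\<close>)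
  have "(norm (moll e f x))\<^sup>2 \<le> (LINT z|lborel. mkern e z * (norm (f (x - z)))\<^sup>2)"
    unfolding moll_shift[OF sq_int_measurable[OF f]]
    by (rule moll_jensen[OF e _ int]) measurable
  also have "\<dots> \<le> (LINT z|lborel. 1 / (e\<^sup>2 * bump_mass) * (norm (f (x - z)))\<^sup>2)"
    by (rule integral_mono[OF int]) (use sq_int_integrable[OF fs] bd in auto)
  also have "\<dots> = energy f / (e\<^sup>2 * bump_mass)"
    using en unfolding energy_def by simp
  finally show ?thesis .
qed

lemma energy_nn_integral:
  fixes f :: "pt \<Rightarrow> 'b::euclidean_space"
  assumes "sq_int f" shows "(\<integral>\<^sup>+x. ennreal ((norm (f x))\<^sup>2) \<partial>lborel) = ennreal (energy f)"
  unfolding energy_def by (rule nn_integral_eq_integral) (use assms in \<open>auto simp: sq_int_def\<close>)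

text \<open>\<open>moll e f - f\<close> is the average of translation differences with density
  \<open>mkern e\<close>; Jensen and an interchange of integrals bound its energy by the worst
  translation energy over shifts shorter than \<open>e\<close>.\<close>

lemma sq_int_moll_diff:
  fixes f :: "pt \<Rightarrow> pt"
  assumes e: "0 < e" and f: "sq_int f" and fi: "integrable lborel f" and \<delta>: "0 \<le> \<delta>"
    and bd: "\<And>h. norm h < e \<Longrightarrow> energy (\<lambda>x. f (x - h) - f x) \<le> \<delta>"
  shows "sq_int (\<lambda>x. moll e f x - f x)" "energy (\<lambda>x. moll e f x - f x) \<le> \<delta>"
proof -
  note [measurable] = sq_int_measurable[OF f]
  have "continuous_on UNIV (moll e f)"
    using moll_C1_jacobian[OF e fi]
    by (auto simp: C1_jacobian_def intro!: continuous_at_imp_continuous_on has_derivative_continuous)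
  then have mm [measurable]: "moll e f \<in> borel_measurable borel"
    by (rule borel_measurable_continuous_onI)
  have fs: "sq_int (\<lambda>x. f (x - h))" for h
    using sq_int_affine[OF f, of 1 "-h"] by simp
  have fr: "sq_int (\<lambda>h. f (x - h))" for x
    using sq_int_affine[OF f, of "-1" x] by simp
  have pw: "ennreal ((norm (moll e f x - f x))\<^sup>2) \<le> (\<integral>\<^sup>+h. ennreal (mkern e h * (norm (f (x - h) - f x))\<^sup>2) \<partial>lborel)" for x
  proof -
    have bd2: "mkern e z * (norm (f (x - z) - f x))\<^sup>2
        \<le> 1 / (e\<^sup>2 * bump_mass) * (2 * (norm (f (x - z)))\<^sup>2) + 2 * (norm (f x))\<^sup>2 * mkern e z" for z
    proof -
      have "mkern e z * (norm (f (x - z) - f x))\<^sup>2 \<le> mkern e z * (2 * (norm (f (x - z)))\<^sup>2 + 2 * (norm (f x))\<^sup>2)"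
        by (intro mult_left_mono norm_diff_sq_le mkern_nonneg)
      moreover have "mkern e z * (2 * (norm (f (x - z)))\<^sup>2) \<le> 1 / (e\<^sup>2 * bump_mass) * (2 * (norm (f (x - z)))\<^sup>2)"
        by (intro mult_right_mono mkern_le) auto
      ultimately show ?thesis by (simp add: algebra_simps)
    qed
    have int: "integrable lborel (\<lambda>z. mkern e z * (norm (f (x - z) - f x))\<^sup>2)"
    proof (rule Bochner_Integration.integrable_bound)
      show "integrable lborel (\<lambda>z. 1 / (e\<^sup>2 * bump_mass) * (2 * (norm (f (x - z)))\<^sup>2) + 2 * (norm (f x))\<^sup>2 * mkern e z)"
        using sq_int_integrable[OF fr] mkern_integrable[OF e] by simp
      show "AE z in lborel. norm (mkern e z * (norm (f (x - z) - f x))\<^sup>2) \<le>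
         norm (1 / (e\<^sup>2 * bump_mass) * (2 * (norm (f (x - z)))\<^sup>2) + 2 * (norm (f x))\<^sup>2 * mkern e z)"
        using bd2 by (auto simp: mkern_nonneg intro: order_trans[OF _ abs_ge_self])
    qed auto
    have i1: "integrable lborel (\<lambda>z. mkern e z *\<^sub>R f (x - z))"
      using integrable_affine_pt[OF integrable_mkern_mult[OF e fi, of x], of "-1" x] by simp
    have "moll e f x - f x = (LINT z|lborel. mkern e z *\<^sub>R (f (x - z) - f x))"
      unfolding moll_shift[OF sq_int_measurable[OF f]] scaleR_diff_right
      using i1 mkern_integrable[OF e] by (simp add: integral_mkern[OF e])
    then have "(norm (moll e f x - f x))\<^sup>2 \<le> (LINT z|lborel. mkern e z * (norm (f (x - z) - f x))\<^sup>2)"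
      using moll_jensen[OF e _ int] by simp
    then show ?thesis
      by (subst nn_integral_eq_integral[OF int]) (auto simp: mkern_nonneg intro: ennreal_leI)
  qed
  have "(\<integral>\<^sup>+x. ennreal ((norm (moll e f x - f x))\<^sup>2) \<partial>lborel)
      \<le> (\<integral>\<^sup>+x. (\<integral>\<^sup>+h. ennreal (mkern e h * (norm (f (x - h) - f x))\<^sup>2) \<partial>lborel) \<partial>lborel)"
    by (intro nn_integral_mono pw)
  also have "\<dots> = (\<integral>\<^sup>+h. (\<integral>\<^sup>+x. ennreal (mkern e h * (norm (f (x - h) - f x))\<^sup>2) \<partial>lborel) \<partial>lborel)"
    by (rule lborel_pair.Fubini') measurable
  also have "\<dots> \<le> (\<integral>\<^sup>+h. ennreal (mkern e h) * ennreal \<delta> \<partial>lborel)"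
  proof (rule nn_integral_mono)
    fix h :: pt
    have "(\<integral>\<^sup>+x. ennreal (mkern e h * (norm (f (x - h) - f x))\<^sup>2) \<partial>lborel)
        = ennreal (mkern e h) * (\<integral>\<^sup>+x. ennreal ((norm (f (x - h) - f x))\<^sup>2) \<partial>lborel)"
      by (simp add: ennreal_mult mkern_nonneg nn_integral_cmult)
    also have "\<dots> = ennreal (mkern e h) * ennreal (energy (\<lambda>x. f (x - h) - f x))"
      by (subst energy_nn_integral) (auto intro: sq_int_diff fs f)
    also have "\<dots> \<le> ennreal (mkern e h) * ennreal \<delta>"
    proof (cases "norm h < e")
      case True then show ?thesis using bd by (intro mult_left_mono ennreal_leI) auto
    next
      case False then show ?thesis using mkern_zero[OF e, of h] by simp
    qed
    finally show "(\<integral>\<^sup>+x. ennreal (mkern e h * (norm (f (x - h) - f x))\<^sup>2) \<partial>lborel) \<le> ennreal (mkern e h) * ennreal \<delta>" .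
  qed
  also have "\<dots> = (\<integral>\<^sup>+h. ennreal (mkern e h) \<partial>lborel) * ennreal \<delta>"
    by (rule nn_integral_multc) simp
  also have "\<dots> = ennreal \<delta>"
    by (subst nn_integral_eq_integral[OF mkern_integrable[OF e]]) (auto simp: mkern_nonneg integral_mkern[OF e])
  finally have le: "(\<integral>\<^sup>+x. ennreal ((norm (moll e f x - f x))\<^sup>2) \<partial>lborel) \<le> ennreal \<delta>" .
  then have "integrable lborel (\<lambda>x. (norm (moll e f x - f x))\<^sup>2)"
    by (intro integrableI_bounded) (auto simp: top.not_eq_extremum intro: order.strict_trans1 ennreal_less_top)
  then show sq: "sq_int (\<lambda>x. moll e f x - f x)" by (simp add: sq_int_def)
  show "energy (\<lambda>x. moll e f x - f x) \<le> \<delta>"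
    using le \<delta> unfolding energy_nn_integral[OF sq] by simp
qed

lemma moll_tendsto:
  fixes f :: "pt \<Rightarrow> pt"
  assumes f: "sq_int f" and fi: "integrable lborel f" and \<delta>: "0 < \<delta>"
  shows "\<exists>d>0. \<forall>e. 0 < e \<longrightarrow> e < d \<longrightarrow>
    sq_int (\<lambda>x. moll e f x - f x) \<and> energy (\<lambda>x. moll e f x - f x) \<le> \<delta>"
proof -
  obtain d where d: "d > 0"
    "\<And>p c. norm p < d \<Longrightarrow> \<bar>c - 1\<bar> < d \<Longrightarrow> energy (\<lambda>x. f (p + c *\<^sub>R x) - f x) < \<delta>"
    using energy_affine_continuous[OF f \<delta>] by metis
  have "energy (\<lambda>x. f (x - h) - f x) \<le> \<delta>" if "norm h < d" for h
    using d(2)[of "-h" 1] d(1) that by (simp add: less_imp_le)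
  then show ?thesis
  proof (intro exI[of _ d] conjI allI impI)
    fix e assume e: "0 < e" "e < d"
    have b: "energy (\<lambda>x. f (x - h) - f x) \<le> \<delta>" if "norm h < e" for h
      using \<open>\<And>h. norm h < d \<Longrightarrow> energy (\<lambda>x. f (x - h) - f x) \<le> \<delta>\<close>[of h] that e by simp
    show "sq_int (\<lambda>x. moll e f x - f x)" "energy (\<lambda>x. moll e f x - f x) \<le> \<delta>"
      using sq_int_moll_diff[OF e(1) f fi less_imp_le[OF \<delta>] b] by auto
  qed (rule d(1))
qed

text \<open>The 10 is \<open>2 * 4 + 2\<close>: translation differences have at most four times the
  energy of \<open>f\<close>, and \<open>f\<close> is then added back.\<close>

lemma sq_int_moll:
  fixes f :: "pt \<Rightarrow> pt"
  assumes e: "0 < e" and f: "sq_int f" and fi: "integrable lborel f"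
  shows "sq_int (moll e f)" "energy (moll e f) \<le> 10 * energy f"
proof -
  have b: "energy (\<lambda>x. f (x - h) - f x) \<le> 4 * energy f" for h
  proof -
    have s: "sq_int (\<lambda>x. f (x - h))" "energy (\<lambda>x. f (x - h)) = energy f"
      using sq_int_affine[OF f, of 1 "-h"] energy_affine[OF f, of 1 "-h"] by auto
    have "energy (\<lambda>x. f (x - h) + (-1) *\<^sub>R f x) \<le> 2 * energy (\<lambda>x. f (x - h)) + 2 * energy (\<lambda>x. (-1) *\<^sub>R f x)"
      by (intro energy_add_le sq_int_scaleR s f)
    then show ?thesis using s(2) by (simp add: energy_def)
  qed
  note d = sq_int_moll_diff[OF e f fi _ b]
  have "0 \<le> 4 * energy f" using energy_nonneg[of f] by simp
  note d = d[OF this]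
  show "sq_int (moll e f)" using sq_int_add[OF d(1) f] by simp
  show "energy (moll e f) \<le> 10 * energy f" using energy_add_le[OF d(1) f] d(2) by simp
qed

section \<open>From translation moduli to higher integrability\<close>

text \<open>If the mollified field stays below \<open>l / 2\<close>, then wherever \<open>f\<close>
  exceeds \<open>l\<close> the error of mollification is at least half of \<open>norm (f x)\<close>;
  the translation modulus controls that error.\<close>

lemma super_level_set_energy:
  fixes f :: "pt \<Rightarrow> pt"
  assumes f: "sq_int f" and fi: "integrable lborel f" and C: "0 \<le> C"
    and bd: "\<And>h. norm h \<le> 1 \<Longrightarrow> energy (\<lambda>x. f (x - h) - f x) \<le> C * sqrt (norm h)"
    and K: "K = 2 * sqrt (energy f / bump_mass) + 1" and l: "K \<le> l"
  shows "(\<integral>\<^sup>+x. indicator {x. l < norm (f x)} x * ennreal ((norm (f x))\<^sup>2) \<partial>lborel) \<le> ennreal (4 * C * sqrt (K / l))"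
proof -
  note [measurable] = sq_int_measurable[OF f]
  have K0: "0 < K" using K energy_nonneg[of f] bump_mass_pos by (simp add: add_nonneg_pos)
  \<comment> \<open>The radius at which the supremum bound for the mollified field comes down to
    \<open>l / 2\<close>. The hypothesis \<open>K \<le> l\<close> keeps it within the range of
    \<open>bd\<close>.\<close>
  define e where "e = K / l"
  have e: "0 < e" "e \<le> 1" using K0 l by (auto simp: e_def)
  have eb: "energy (\<lambda>x. f (x - h) - f x) \<le> C * sqrt e" if "norm h < e" for h
    using bd[of h] that e mult_left_mono[OF _ C, of "sqrt (norm h)" "sqrt e"] by simp
  have d: "sq_int (\<lambda>x. moll e f x - f x)" "energy (\<lambda>x. moll e f x - f x) \<le> C * sqrt e"
    using sq_int_moll_diff[OF e(1) f fi _ eb] C e by auto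
  have sup: "norm (moll e f x) \<le> l / 2" for x
  proof (rule power2_le_imp_le)
    have "energy f / bump_mass = (sqrt (energy f / bump_mass))\<^sup>2"
      using energy_nonneg[of f] bump_mass_pos by simp
    also have "\<dots> \<le> (K / 2)\<^sup>2"
      using K energy_nonneg[of f] bump_mass_pos by (intro power_mono) auto
    finally have "energy f / bump_mass / e\<^sup>2 \<le> (K / 2)\<^sup>2 / e\<^sup>2" by (rule divide_right_mono) simp
    also have "\<dots> = (l / 2)\<^sup>2" using K0 l by (simp add: e_def power_divide field_simps)
    finally show "(norm (moll e f x))\<^sup>2 \<le> (l / 2)\<^sup>2"
      using norm_moll_sq_le[OF e(1) f, of x] by (simp add: mult.commute)
  qed (use K0 l in auto)
  have "(\<integral>\<^sup>+x. indicator {x. l < norm (f x)} x * ennreal ((norm (f x))\<^sup>2) \<partial>lborel)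
      \<le> (\<integral>\<^sup>+x. 4 * ennreal ((norm (moll e f x - f x))\<^sup>2) \<partial>lborel)"
  proof (rule nn_integral_mono)
    fix x
    show "indicator {x. l < norm (f x)} x * ennreal ((norm (f x))\<^sup>2) \<le> 4 * ennreal ((norm (moll e f x - f x))\<^sup>2)"
    proof (cases "l < norm (f x)")
      case True
      then have "norm (f x) \<le> 2 * norm (moll e f x - f x)"
        using sup[of x] norm_triangle_ineq2[of "f x" "moll e f x"] by (simp add: norm_minus_commute)
      then have "(norm (f x))\<^sup>2 \<le> (2 * norm (moll e f x - f x))\<^sup>2" by (intro power_mono) auto
      then have "ennreal ((norm (f x))\<^sup>2) \<le> ennreal (4 * (norm (moll e f x - f x))\<^sup>2)"
        by (intro ennreal_leI) (simp add: power_mult_distrib)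
      then show ?thesis using True by (simp add: ennreal_mult')
    qed simp
  qed
  also have "\<dots> = 4 * (\<integral>\<^sup>+x. ennreal ((norm (moll e f x - f x))\<^sup>2) \<partial>lborel)"
    using sq_int_measurable[OF d(1)] by (intro nn_integral_cmult) simp
  also have "\<dots> = ennreal (4 * energy (\<lambda>x. moll e f x - f x))"
    by (simp add: energy_nn_integral[OF d(1)] ennreal_mult' energy_nonneg)
  also have "\<dots> \<le> ennreal (4 * C * sqrt (K / l))"
    using d(2) by (intro ennreal_leI) (simp add: e_def)
  finally show ?thesis .
qed

text \<open>Layer decomposition along geometric levels: the level set energies decay like the power
  -1/2 of the level, so that an additional power 1/4 of \<open>norm (f x)\<close> leaves a
  convergent geometric series.\<close>

lemma higher_integrability:
  fixes f :: "pt \<Rightarrow> pt"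
  assumes f: "sq_int f" and fi: "integrable lborel f" and C: "0 \<le> C"
    and bd: "\<And>h. norm h \<le> 1 \<Longrightarrow> energy (\<lambda>x. f (x - h) - f x) \<le> C * sqrt (norm h)"
  shows "integrable lborel (\<lambda>x. norm (f x) powr (2 + 1/4))"
proof -
  note [measurable] = sq_int_measurable[OF f]
  define K where "K = 2 * sqrt (energy f / bump_mass) + 1"
  have K0: "0 < K" using energy_nonneg[of f] bump_mass_pos by (simp add: K_def add_nonneg_pos)
  \<comment> \<open>With ratio 16 the weight \<open>l (Suc k) powr (1/4)\<close> doubles in each
    step while the level set bound is divided by 4, so the terms decay like
    \<open>(1/2) ^ k\<close>.\<close>
  define l where "l k = K * 16 ^ k" for k :: nat
  have lK: "K \<le> l k" for k using K0 by (simp add: l_def)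
  note level = super_level_set_energy[OF f fi C bd K_def lK]
  define u where "u k x = ennreal (l (Suc k) powr (1/4)) * (indicator {x. l k < norm (f x)} x * ennreal ((norm (f x))\<^sup>2))" for k x
  have pw: "ennreal (norm (f x) powr (2 + 1/4)) \<le> ennreal (K powr (1/4)) * ennreal ((norm (f x))\<^sup>2) + (\<Sum>k. u k x)" for x
  proof (cases "f x = 0")
    case False
    have split: "norm (f x) powr (2 + 1/4) = norm (f x) powr (1/4) * (norm (f x))\<^sup>2"
    proof -
      have "norm (f x) powr 2 = (norm (f x))\<^sup>2" using False by simp
      then show ?thesis by (simp only: powr_add mult.commute)
    qed
    show ?thesis
    proof (cases "norm (f x) \<le> K")
      case True
      then have "norm (f x) powr (2 + 1/4) \<le> K powr (1/4) * (norm (f x))\<^sup>2"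
        unfolding split by (intro mult_right_mono powr_mono2) auto
      then have "ennreal (norm (f x) powr (2 + 1/4)) \<le> ennreal (K powr (1/4)) * ennreal ((norm (f x))\<^sup>2)"
        by (subst ennreal_mult[symmetric]) (auto intro: ennreal_leI)
      then show ?thesis by (rule order_trans) simp
    next
      case gt: False
      obtain m where m: "norm (f x) / K < 16 ^ m"
        using real_arch_pow[of 16 "norm (f x) / K"] by auto
      \<comment> \<open>The least level above \<open>norm (f x)\<close>. It is not level 0, which
        equals \<open>K\<close>, so it has a predecessor \<open>k\<close>, and \<open>u k x\<close>
        alone dominates the left-hand side.\<close>
      define n where "n = (LEAST m. norm (f x) \<le> l m)"
      have ln: "norm (f x) \<le> l n"
        unfolding n_def by (rule LeastI[of _ m]) (use m K0 in \<open>simp add: l_def field_simps\<close>)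
      have "n \<noteq> 0" using ln gt by (intro notI) (simp add: l_def)
      then obtain k where k: "n = Suc k" by (cases n) auto
      have lk: "l k < norm (f x)"
        using not_less_Least[of k "\<lambda>m. norm (f x) \<le> l m"] k n_def by auto
      have "norm (f x) powr (2 + 1/4) \<le> l (Suc k) powr (1/4) * (norm (f x))\<^sup>2"
        unfolding split using ln k by (intro mult_right_mono powr_mono2) auto
      then have "ennreal (norm (f x) powr (2 + 1/4)) \<le> u k x"
        unfolding u_def using lk by (simp add: ennreal_mult[symmetric] ennreal_leI)
      also have "\<dots> \<le> (\<Sum>k. u k x)"
        using sum_le_suminf[OF summableI, of "{k}" "\<lambda>k. u k x"] by simp
      finally show ?thesis by (rule order_trans) simp
    qed
  qed simp
  have "(\<integral>\<^sup>+x. ennreal (norm (f x) powr (2 + 1/4)) \<partial>lborel)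
      \<le> (\<integral>\<^sup>+x. ennreal (K powr (1/4)) * ennreal ((norm (f x))\<^sup>2) + (\<Sum>k. u k x) \<partial>lborel)"
    by (intro nn_integral_mono pw)
  also have "\<dots> = ennreal (K powr (1/4)) * ennreal (energy f) + (\<Sum>k. \<integral>\<^sup>+x. u k x \<partial>lborel)"
    unfolding u_def
    by (subst nn_integral_add) (auto simp: nn_integral_cmult energy_nn_integral[OF f] nn_integral_suminf)
  also have "\<dots> < top"
  proof -
    define c where "c = K powr (1/4) * (8 * C)"
    have "(\<integral>\<^sup>+x. u k x \<partial>lborel) \<le> ennreal (c * (1/2) ^ k)" for k
    proof -
      have "(\<integral>\<^sup>+x. u k x \<partial>lborel)
          = ennreal (l (Suc k) powr (1/4)) * (\<integral>\<^sup>+x. indicator {x. l k < norm (f x)} x * ennreal ((norm (f x))\<^sup>2) \<partial>lborel)"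
        unfolding u_def by (rule nn_integral_cmult) simp
      also have "\<dots> \<le> ennreal (l (Suc k) powr (1/4)) * ennreal (4 * C * sqrt (K / l k))"
        by (intro mult_left_mono level) auto
      also have "\<dots> = ennreal (l (Suc k) powr (1/4) * (4 * C * sqrt (K / l k)))"
        by (simp add: ennreal_mult')
      also have "l (Suc k) powr (1/4) * (4 * C * sqrt (K / l k)) = c * (1/2) ^ k"
      proof -
        have 1: "((16::real) ^ j) powr (1/4) = 2 ^ j" for j
        proof -
          have "(16::real) ^ j = (2 ^ 4) ^ j" by simp
          also have "\<dots> = (2 ^ j) ^ 4" by (simp only: power_mult[symmetric] mult.commute)
          also have "\<dots> = (2 ^ j) powr 4" by (subst powr_numeral) auto
          finally show ?thesis by (simp only: powr_powr) simp
        qed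
        have 2: "sqrt (16 ^ j) = 4 ^ j" for j
        proof (rule real_sqrt_unique)
          have "((4::real) ^ j)\<^sup>2 = (4\<^sup>2) ^ j" by (simp only: power_mult[symmetric] mult.commute)
          then show "((4::real) ^ j)\<^sup>2 = 16 ^ j" by simp
        qed simp
        have "l (Suc k) powr (1/4) = K powr (1/4) * 2 ^ Suc k"
          unfolding l_def using K0 1[of "Suc k"] by (subst powr_mult) auto
        moreover have "sqrt (K / l k) = 1 / 4 ^ k"
          using K0 by (simp add: l_def real_sqrt_divide 2)
        moreover have "(4::real) ^ k = 2 ^ k * 2 ^ k" by (simp add: power_mult_distrib[symmetric])
        ultimately show ?thesis by (simp add: c_def power_divide)
      qed
      finally show ?thesis .
    qed
    then have "(\<Sum>k. \<integral>\<^sup>+x. u k x \<partial>lborel) \<le> (\<Sum>k. ennreal (c * (1/2) ^ k))"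
      by (intro suminf_le summableI)
    also have "\<dots> = ennreal (\<Sum>k. c * (1/2) ^ k)"
      by (rule suminf_ennreal2) (auto simp: c_def C intro!: summable_mult summable_geometric)
    also have "\<dots> < top" by simp
    finally show ?thesis
      by (simp add: ennreal_mult_less_top less_top[symmetric] ennreal_mult_eq_top_iff)
  qed
  finally show ?thesis
    by (intro integrableI_bounded) auto
qed

section \<open>Functions on a domain\<close>

text \<open>The bridge between the definitions, which integrate over \<open>lebesgue_on D\<close>,
  and the analysis on the plane, which uses \<open>lborel\<close> for Fubini and affine
  substitutions.\<close>

lemma lebesgue_on_eq_lborel:
  fixes H :: "pt \<Rightarrow> 'b::euclidean_space"
  assumes D: "open D" and H: "H \<in> borel_measurable borel" and zero: "\<And>x. x \<notin> D \<Longrightarrow> H x = 0"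
  shows integral_lebesgue_on_eq_lborel: "(LINT x|lebesgue_on D. H x) = (LINT x|lborel. H x)"
    and integrable_lebesgue_on_iff_lborel: "integrable (lebesgue_on D) H \<longleftrightarrow> integrable lborel H"
proof -
  have DL: "D \<inter> space lebesgue \<in> sets lebesgue" using D by simp
  have eq: "(\<lambda>x. indicator D x *\<^sub>R H x) = H" using zero by (auto simp: fun_eq_iff indicator_def)
  show "(LINT x|lebesgue_on D. H x) = (LINT x|lborel. H x)"
    using integral_restrict_space[OF DL, of H] H by (simp add: eq integral_completion)
  show "integrable (lebesgue_on D) H \<longleftrightarrow> integrable lborel H"
    using integrable_restrict_space[OF DL, of H] H by (simp add: eq integrable_completion)
qed

text \<open>A Lebesgue measurable function has a Borel representative in each coordinate; these are
  recombined and cut off by the indicator of \<open>D\<close>, so that the result can be translated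
  and dilated freely.\<close>

lemma L2_borel_representative:
  fixes g :: "pt \<Rightarrow> 'b::euclidean_space"
  assumes g: "g \<in> L2 D" and D: "open D"
  obtains f where "sq_int f" "\<And>x. x \<notin> D \<Longrightarrow> f x = 0" "AE x in lebesgue_on D. f x = g x"
proof -
  have DL: "D \<inter> space lebesgue \<in> sets lebesgue" using D by simp
  have gm: "g \<in> borel_measurable (lebesgue_on D)" and gi: "integrable (lebesgue_on D) (\<lambda>x. norm (g x) powr 2)"
    using g by (auto simp: Lp_def)
  have gm': "(\<lambda>x. indicator D x *\<^sub>R g x) \<in> borel_measurable lebesgue"
    using borel_measurable_restrict_space_iff[OF DL, of g] gm by simp
  have "\<exists>h\<in>borel_measurable lborel. AE x in lborel. (indicator D x *\<^sub>R g x) \<bullet> b = h x" for b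
    using gm' by (intro completion_ex_borel_measurable_real borel_measurable_inner) auto
  then have "\<forall>b. \<exists>h. h \<in> borel_measurable lborel \<and> (AE x in lborel. (indicator D x *\<^sub>R g x) \<bullet> b = h x)"
    by blast
  from choice[OF this] obtain h where h: "\<forall>b. h b \<in> borel_measurable lborel \<and>
      (AE x in lborel. (indicator D x *\<^sub>R g x) \<bullet> b = h b x)" ..
  have hm: "h b \<in> borel_measurable lborel" and hAE: "AE x in lborel. (indicator D x *\<^sub>R g x) \<bullet> b = h b x" for b
    using h by blast+
  have [measurable]: "h b \<in> borel_measurable borel" for b using hm[of b] by simp
  define f where "f x = indicator D x *\<^sub>R (\<Sum>b\<in>Basis. h b x *\<^sub>R b)" for x
  have [measurable]: "D \<in> sets borel" using D by simp
  have [measurable]: "f \<in> borel_measurable borel" unfolding f_def by measurable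
  have "AE x in lborel. \<forall>b\<in>Basis. (indicator D x *\<^sub>R g x) \<bullet> b = h b x"
    by (subst AE_finite_all) (use hAE in auto)
  then have "AE x in lborel. f x = indicator D x *\<^sub>R g x"
  proof eventually_elim
    case (elim x)
    then have "(\<Sum>b\<in>Basis. h b x *\<^sub>R b) = (\<Sum>b\<in>Basis. ((indicator D x *\<^sub>R g x) \<bullet> b) *\<^sub>R b)"
      by (intro sum.cong) auto
    then show ?case by (simp only: f_def euclidean_representation) (simp add: indicator_def)
  qed
  then have AEf: "AE x in lebesgue. f x = indicator D x *\<^sub>R g x" by (rule AE_completion)
  then have "AE x in lebesgue. x \<in> D \<longrightarrow> f x = g x" by eventually_elim simp
  then have AED: "AE x in lebesgue_on D. f x = g x"
    using D by (subst AE_restrict_space_iff) auto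
  have zero: "\<And>x. x \<notin> D \<Longrightarrow> f x = 0" by (simp add: f_def)
  have "integrable (lebesgue_on D) (\<lambda>x. (norm (f x))\<^sup>2)"
  proof (rule integrable_cong_AE_imp[OF gi])
    have "f \<in> borel_measurable lebesgue" by (simp add: measurable_completion)
    then have "f \<in> borel_measurable (lebesgue_on D)" by (rule measurable_restrict_space1)
    then show "(\<lambda>x. (norm (f x))\<^sup>2) \<in> borel_measurable (lebesgue_on D)" by simp
    show "AE x in lebesgue_on D. norm (g x) powr 2 = (norm (f x))\<^sup>2"
      using AED by eventually_elim (simp add: powr_numeral)
  qed
  then have "integrable lborel (\<lambda>x. (norm (f x))\<^sup>2)"
    by (subst (asm) integrable_lebesgue_on_iff_lborel[OF D]) (auto simp: zero)
  then have "sq_int f" by (simp add: sq_int_def)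
  then show thesis using that zero AED by blast
qed

lemma sq_int_bounded_support_integrable:
  fixes f :: "pt \<Rightarrow> 'b::euclidean_space"
  assumes f: "sq_int f" and D: "bounded D" and zero: "\<And>x. x \<notin> D \<Longrightarrow> f x = 0"
  shows "integrable lborel f"
proof -
  note [measurable] = sq_int_measurable[OF f]
  obtain r where r: "D \<subseteq> cball 0 r" by (metis D ball_subset_cball bounded_subset_ballD order_trans)
  show ?thesis
  proof (rule Bochner_Integration.integrable_bound)
    show "integrable lborel (\<lambda>x. indicator (cball (0::pt) r) x + (norm (f x))\<^sup>2)"
    proof -
      have "integrable lborel (\<lambda>x. indicator (cball (0::pt) r) x :: real)"
        by (rule integrable_real_indicator[OF _ emeasure_lborel_cball_finite]) simp
      then show ?thesis using sq_int_integrable[OF f] by simp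
    qed
    have "norm (f x) \<le> indicator (cball 0 r) x + (norm (f x))\<^sup>2" for x
    proof (cases "x \<in> D")
      case True
      have "0 \<le> (norm (f x) - 1)\<^sup>2" by simp
      then have "2 * norm (f x) \<le> 1 + (norm (f x))\<^sup>2" by (simp add: power2_diff)
      then have "norm (f x) \<le> 1 + (norm (f x))\<^sup>2" using norm_ge_zero[of "f x"] by linarith
      then show ?thesis using True r by (auto simp: indicator_def)
    qed (simp add: zero)
    then show "AE x in lborel. norm (f x) \<le> norm (indicator (cball 0 r) x + (norm (f x))\<^sup>2)"
      by (auto intro: order_trans[OF _ abs_ge_self])
  qed simp
qed

text \<open>The fundamental lemma of the calculus of variations. Testing with translated kernels
  makes the mollification vanish away from the boundary, and mollifications converge to
  \<open>f\<close> in energy.\<close>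

lemma AE_zero_if_test_fun:
  fixes g :: "pt \<Rightarrow> pt"
  assumes g: "g \<in> L2 D" and D: "open D" "bounded D"
    and test: "\<And>\<phi> G. test_fun D \<phi> G \<Longrightarrow> (LINT x|lebesgue_on D. \<phi> x *\<^sub>R g x) = 0"
  shows "AE x in lebesgue_on D. g x = 0"
proof -
  obtain f where f: "sq_int f" and f0: "\<And>x. x \<notin> D \<Longrightarrow> f x = 0" and fg: "AE x in lebesgue_on D. f x = g x"
    using L2_borel_representative[OF g D(1)] by blast
  note [measurable] = sq_int_measurable[OF f]
  have fi: "integrable lborel f" by (rule sq_int_bounded_support_integrable[OF f D(2) f0])
  have fL: "f \<in> borel_measurable (lebesgue_on D)"
    by (intro measurable_restrict_space1 measurable_completion) simp
  have gL: "g \<in> borel_measurable (lebesgue_on D)" using g by (simp add: Lp_def)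
  have m0: "moll e f x = 0" if e: "0 < e" and x: "cball x e \<subseteq> D" for e x
  proof -
    have mL: "(\<lambda>z. mkern e (x - z)) \<in> borel_measurable (lebesgue_on D)"
      by (intro measurable_restrict_space1 measurable_completion) simp
    have "moll e f x = (LINT z|lebesgue_on D. mkern e (x - z) *\<^sub>R f z)"
      unfolding moll_def by (rule integral_lebesgue_on_eq_lborel[OF D(1), symmetric]) (auto simp: f0)
    also have "\<dots> = (LINT z|lebesgue_on D. mkern e (x - z) *\<^sub>R g z)"
      by (rule integral_cong_AE) (use fg fL gL mL in \<open>auto elim!: eventually_mono\<close>)
    also have "\<dots> = 0" by (rule test[OF mkern_test_fun[OF e x]])
    finally show ?thesis .
  qed
  \<comment> \<open>\<open>infdist\<close> to the empty set is 0 by convention, and then the sets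
    \<open>S n\<close> below would not exhaust \<open>D\<close>.\<close>
  have nD: "- D \<noteq> {}"
  proof
    assume "- D = {}"
    then have "D = UNIV" by auto
    then show False using D(2) not_bounded_UNIV by metis
  qed
  \<comment> \<open>Points with margin more than \<open>1 / Suc n\<close>: every kernel of radius at
    most \<open>1 / Suc n\<close> centred there is an admissible test function.\<close>
  define S where "S n = {x. 1 / real (Suc n) < infdist x (- D)}" for n
  have So: "open (S n)" for n
    unfolding S_def by (intro open_Collect_less continuous_intros)
  have AS: "AE x in lborel. x \<in> S n \<longrightarrow> f x = 0" for n
  proof -
    define k where "k x = indicator (S n) x *\<^sub>R f x" for x
    have [measurable]: "S n \<in> sets borel" using So by simp
    have [measurable]: "k \<in> borel_measurable borel" unfolding k_def by measurable
    have ki: "integrable lborel (\<lambda>x. (norm (k x))\<^sup>2)"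
      by (rule Bochner_Integration.integrable_bound[OF sq_int_integrable[OF f]]) (auto simp: k_def indicator_def)
    have "energy k \<le> \<delta>" if \<delta>: "\<delta> > 0" for \<delta>
    proof -
      obtain d where d: "d > 0" "\<And>e. 0 < e \<Longrightarrow> e < d \<Longrightarrow>
        sq_int (\<lambda>x. moll e f x - f x) \<and> energy (\<lambda>x. moll e f x - f x) \<le> \<delta>"
        using moll_tendsto[OF f fi \<delta>] by blast
      define e where "e = min (d / 2) (1 / real (Suc n))"
      have e: "0 < e" "e < d" "e \<le> 1 / real (Suc n)" using d(1) by (auto simp: e_def)
      have "(norm (k x))\<^sup>2 \<le> (norm (moll e f x - f x))\<^sup>2" for x
      proof (cases "x \<in> S n")
        case True
        have "cball x e \<subseteq> D"
        proof
          fix y assume y: "y \<in> cball x e"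
          show "y \<in> D"
          proof (rule ccontr)
            assume "y \<notin> D"
            then have "infdist x (- D) \<le> dist x y" by (intro infdist_le) auto
            then show False using y e True by (auto simp: S_def)
          qed
        qed
        then show ?thesis using m0[OF e(1)] by (simp add: k_def indicator_def)
      qed (simp add: k_def)
      then have "energy k \<le> energy (\<lambda>x. moll e f x - f x)"
        unfolding energy_def using ki sq_int_integrable d(2)[OF e(1,2)] by (intro integral_mono) auto
      then show ?thesis using d(2)[OF e(1,2)] by linarith
    qed
    then have "energy k \<le> 0" by (rule dense_ge) auto
    then have "energy k = 0" using energy_nonneg[of k] by linarith
    then have "AE x in lborel. (norm (k x))\<^sup>2 = 0"
      unfolding energy_def using ki by (subst (asm) integral_nonneg_eq_0_iff_AE) auto
    then show ?thesis by eventually_elim (auto simp: k_def)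
  qed
  have "AE x in lborel. \<forall>n. x \<in> S n \<longrightarrow> f x = 0" by (subst AE_all_countable) (use AS in blast)
  then have "AE x in lborel. f x = 0"
  proof eventually_elim
    case (elim x)
    show ?case
    proof (cases "x \<in> D")
      case True
      have "infdist x (- D) > 0"
        using True D(1) nD by (subst infdist_pos_not_in_closed) (auto simp: closed_Compl)
      then obtain n where "1 / real (Suc n) < infdist x (- D)"
        using nat_approx_posE by blast
      then show ?thesis using elim by (auto simp: S_def)
    qed (simp add: f0)
  qed
  then have "AE x in lebesgue. f x = 0" by (rule AE_completion)
  then have "AE x in lebesgue. x \<in> D \<longrightarrow> f x = 0" by eventually_elim simp
  then have "AE x in lebesgue_on D. f x = 0"
    using D by (subst AE_restrict_space_iff) auto
  then show ?thesis using fg by eventually_elim simp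
qed

section \<open>The divergence formula on a fan\<close>

lemma perp_component [simp]: "perp a $ 1 = a $ 2" "perp a $ 2 = - a $ 1"
  by (simp_all add: perp_def)

lemma inner_pt: "(a::pt) \<bullet> b = a $ 1 * b $ 1 + a $ 2 * b $ 2"
  by (simp add: inner_vec_def sum_2)

lemma pt_eq_iff: "(a::pt) = b \<longleftrightarrow> a $ 1 = b $ 1 \<and> a $ 2 = b $ 2"
  by (simp add: vec_eq_iff forall_2)

lemma inner_perp: "a \<bullet> perp b = cross2 a b"
  by (simp add: inner_pt cross2_def)

lemma perp_inner: "perp a \<bullet> b = - (a \<bullet> perp b)"
  by (simp add: inner_pt)

lemma perp_inner_perp: "perp a \<bullet> perp b = a \<bullet> b"
  by (simp add: inner_pt)

lemma norm_perp [simp]: "norm (perp a) = norm a"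
  by (simp add: norm_eq_sqrt_inner perp_inner_perp)

lemma perp_linear: "perp (a + b) = perp a + perp b" "perp (c *\<^sub>R a) = c *\<^sub>R perp a"
  "perp (a - b) = perp a - perp b" "perp (- a) = - perp a" "perp 0 = 0"
  by (simp_all add: pt_eq_iff)

lemma bounded_linear_perp: "bounded_linear perp"
  by (rule bounded_linear_intro[where K=1]) (simp_all add: perp_linear)

lemma bounded_bilinear_cross2: "bounded_bilinear cross2"
proof
  show "cross2 (a + a') b = cross2 a b + cross2 a' b" "cross2 a (b + b') = cross2 a b + cross2 a b'"
    "cross2 (r *\<^sub>R a) b = r *\<^sub>R cross2 a b" "cross2 a (r *\<^sub>R b) = r *\<^sub>R cross2 a b" for a a' b b' r
    by (simp_all add: cross2_def algebra_simps)
  show "\<exists>K. \<forall>a b. norm (cross2 a b) \<le> norm a * norm b * K"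
    using Cauchy_Schwarz_ineq2[of _ "perp _"] by (intro exI[of _ 1]) (simp add: inner_perp[symmetric])
qed

lemma abs_cross2_le: "\<bar>cross2 a b\<bar> \<le> norm a * norm b"
  using Cauchy_Schwarz_ineq2[of a "perp b"] by (simp add: inner_perp)

lemmas continuous_on_cross2 [continuous_intros] =
  bounded_bilinear.continuous_on[OF bounded_bilinear_cross2]

text \<open>The derivative of the determinant: by antisymmetry of \<open>cross2\<close> the left
  side is \<open>cross2 (A *v a) b + cross2 a (A *v b)\<close>. It is the algebraic core of the
  divergence formula.\<close>

lemma cross2_trace:
  "cross2 (A *v a) b - cross2 (A *v b) a = trace (A :: real^2^2) * cross2 a b"
  by (simp add: cross2_def trace_def matrix_vector_mult_def sum_2 algebra_simps)

lemma finite_edges [simp]: "finite (edges P)"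
  by (simp add: edges_def)

lemma sum_edges_telescope:
  fixes q :: "pt \<Rightarrow> real"
  assumes "distinct P" shows "(\<Sum>(a, b)\<in>edges P. q b - q a) = 0"
proof -
  \<comment> \<open>\<open>edges P\<close> is a set; distinctness guarantees that no summand is lost
    in passing to the list of edges.\<close>
  have d: "distinct (zip P (rotate1 P))" using assms by (rule distinct_zipI1)
  have l: "length (rotate1 P) = length P" by simp
  have "(\<Sum>(a, b)\<in>edges P. q b - q a) = sum_list (map (\<lambda>(a, b). q b - q a) (zip P (rotate1 P)))"
    unfolding edges_def by (rule sum.distinct_set_conv_list[OF d])
  also have "\<dots> = sum_list (map (\<lambda>e. q (snd e)) (zip P (rotate1 P))) - sum_list (map (\<lambda>e. q (fst e)) (zip P (rotate1 P)))"
    by (simp add: sum_list_subtractf[symmetric] case_prod_unfold)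
  also have "map (\<lambda>e. q (snd e)) (zip P (rotate1 P)) = map q (map snd (zip P (rotate1 P)))" by (simp only: map_map comp_def)
  also have "map snd (zip P (rotate1 P)) = rotate1 P" by simp
  also have "map (\<lambda>e. q (fst e)) (zip P (rotate1 P)) = map q (map fst (zip P (rotate1 P)))" by (simp only: map_map comp_def)
  also have "map fst (zip P (rotate1 P)) = P" by simp
  also have "sum_list (map q (rotate1 P)) = sum_list (map q P)"
    by (cases P) (simp_all add: add.commute)
  finally show ?thesis by simp
qed

lemma C1_jacobian_continuous:
  assumes "C1_jacobian F J" shows "continuous_on A F" "continuous_on A J"
proof -
  show "continuous_on A F"
    using assms unfolding C1_jacobian_def
    by (intro continuous_at_imp_continuous_on ballI has_derivative_continuous) blast
  show "continuous_on A J"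
    using assms unfolding C1_jacobian_def by (blast intro: continuous_on_subset)
qed

lemma continuous_on_trace [continuous_intros]:
  "continuous_on A J \<Longrightarrow> continuous_on A (\<lambda>x. trace (J x :: real^2^2))"
  unfolding trace_def by (intro continuous_intros)

lemma continuous_on_matrix_vector [continuous_intros]:
  "continuous_on A J \<Longrightarrow> continuous_on A v \<Longrightarrow> continuous_on A (\<lambda>x. (J x :: real^2^2) *v v x)"
  unfolding matrix_vector_mult_def by (intro continuous_intros)

text \<open>The position on the edge is taken relative to the centre \<open>y\<close>, so that
  \<open>y + s *\<^sub>R ray y e t\<close> runs through the homothetic copy of the edge with ratio
  \<open>s\<close>.\<close>

definition ray :: "pt \<Rightarrow> edge \<Rightarrow> real \<Rightarrow> pt" where
  "ray y e t = fst e + t *\<^sub>R (snd e - fst e) - y"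

lemma ray_continuous [continuous_intros]:
  "continuous_on A t \<Longrightarrow> continuous_on A (\<lambda>x. ray y e (t x))"
  unfolding ray_def by (intro continuous_intros)

lemma linepath_eq_ray: "linepath (fst e) (snd e) t = y + ray y e t"
  by (simp add: linepath_def ray_def algebra_simps)

text \<open>Twice the signed area of the triangle with apex \<open>y\<close> over the edge; positive
  when \<open>y\<close> lies to the left of the edge.\<close>

definition fan_det :: "pt \<Rightarrow> edge \<Rightarrow> real" where
  "fan_det y e = cross2 (fst e - y) (snd e - y)"

text \<open>The dependence on \<open>t\<close> cancels, because \<open>ray\<close> changes only
  along the edge. Hence the Jacobian of the fan coordinates is
  \<open>s * fan_det y e\<close>.\<close>

lemma cross2_ray: "cross2 (ray y e t) (snd e - fst e) = fan_det y e"
  by (simp add: cross2_def fan_det_def ray_def algebra_simps)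

text \<open>
  Piola transform of the map \<open>(s, t) \<mapsto> y + s * ray y e t\<close> onto the triangle spanned by \<open>y\<close> and
  the edge \<open>e\<close>; the last two terms are fluxes through the sides that meet in \<open>y\<close>.
\<close>
lemma edge_flux_deriv:
  fixes F :: "pt \<Rightarrow> pt" and y :: pt and e :: edge and ga gb :: real
  assumes F: "C1_jacobian F J"
  defines "X \<equiv> \<lambda>s t. y + s *\<^sub>R ray y e t"
  shows "((\<lambda>s. s * integral {0..1} (\<lambda>t. ((1 - t) * ga + t * gb) * cross2 (F (X s t)) (snd e - fst e)))
    has_real_derivative
      integral {0..1} (\<lambda>t. ((1 - t) * ga + t * gb) * (s * fan_det y e * trace (J (X s t))))
      - (gb - ga) * integral {0..1} (\<lambda>t. cross2 (F (X s t)) (ray y e t))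
      + (gb * cross2 (F (X s 1)) (ray y e 1) - ga * cross2 (F (X s 0)) (ray y e 0))) (at s)"
proof -
  define \<beta> where "\<beta> = snd e - fst e"
  define n where "n t = (1 - t) * ga + t * gb" for t :: real
  note cF = C1_jacobian_continuous[OF F]
  have dF: "(F has_derivative (\<lambda>h. J x *v h)) (at x)" for x using F by (simp add: C1_jacobian_def)
  have cn [continuous_intros]: "continuous_on A n" for A unfolding n_def by (intro continuous_intros)
  have cX: "continuous_on A (\<lambda>z. X (f z) (g z))" if "continuous_on A f" "continuous_on A g" for A and f g :: "real \<times> real \<Rightarrow> real"
    unfolding X_def using that by (intro continuous_intros)
  have cX1: "continuous_on A (\<lambda>t. X s t)" for A s unfolding X_def by (intro continuous_intros)
  have cFX [continuous_intros]: "continuous_on A (\<lambda>t. F (X s t))" "continuous_on A (\<lambda>t. J (X s t))" for A s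
    by (rule continuous_on_compose2[OF cF(1)[of UNIV] cX1] continuous_on_compose2[OF cF(2)[of UNIV] cX1]; simp)+
  have cFX2 [continuous_intros]: "continuous_on A (\<lambda>z. F (X (fst z) (snd z)))" "continuous_on A (\<lambda>z. J (X (fst z) (snd z)))" for A
    by (rule continuous_on_compose2[OF cF(1)[of UNIV] cX] continuous_on_compose2[OF cF(2)[of UNIV] cX];
        auto intro!: continuous_intros)+
  define d where "d s t = n t * (cross2 (F (X s t)) \<beta> + s * cross2 (J (X s t) *v ray y e t) \<beta>)" for s t
  have ds: "((\<lambda>s. F (X s t)) has_vector_derivative J (X s t) *v ray y e t) (at s within S)" for s t S
  proof -
    have "((\<lambda>s. X s t) has_derivative (\<lambda>h. h *\<^sub>R ray y e t)) (at s within S)"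
      unfolding X_def by (auto intro!: derivative_eq_intros)
    from has_derivative_compose[OF this dF]
    show ?thesis unfolding has_vector_derivative_def by (simp add: matrix_vector_mult_scaleR)
  qed
  have dt: "((\<lambda>t. F (X s t)) has_vector_derivative s *\<^sub>R (J (X s t) *v \<beta>)) (at t within S)" for s t S
  proof -
    have "((\<lambda>t. X s t) has_derivative (\<lambda>h. h *\<^sub>R (s *\<^sub>R \<beta>))) (at t within S)"
      unfolding X_def ray_def \<beta>_def by (auto intro!: derivative_eq_intros simp: algebra_simps)
    from has_derivative_compose[OF this dF]
    show ?thesis unfolding has_vector_derivative_def by (simp add: matrix_vector_mult_scaleR)
  qed
  have 1: "((\<lambda>s. integral (cbox 0 1) (\<lambda>t. s * (n t * cross2 (F (X s t)) \<beta>))) has_field_derivative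
      integral (cbox 0 1) (d s)) (at s within UNIV)"
  proof (rule leibniz_rule_field_derivative)
    show "((\<lambda>s. s * (n t * cross2 (F (X s t)) \<beta>)) has_field_derivative d s t) (at s within UNIV)" for s t
    proof -
      have "((\<lambda>s. cross2 (F (X s t)) \<beta>) has_vector_derivative cross2 (J (X s t) *v ray y e t) \<beta>) (at s)"
        by (rule bounded_linear.has_vector_derivative[OF bounded_bilinear.bounded_linear_left[OF bounded_bilinear_cross2] ds])
      then have "((\<lambda>s. cross2 (F (X s t)) \<beta>) has_real_derivative cross2 (J (X s t) *v ray y e t) \<beta>) (at s)"
        by (simp add: has_real_derivative_iff_has_vector_derivative)
      then show ?thesis
        unfolding d_def by (auto intro!: derivative_eq_intros simp: algebra_simps)
    qed
    show "(\<lambda>t. s * (n t * cross2 (F (X s t)) \<beta>)) integrable_on cbox 0 1" for s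
      by (intro integrable_continuous continuous_intros)
    show "continuous_on (UNIV \<times> cbox 0 1) (\<lambda>(s, t). d s t)"
      unfolding d_def case_prod_unfold
      by (intro continuous_intros continuous_on_compose2[OF cn[of UNIV]]) auto
  qed auto
  define A where "A t = n t * (s * fan_det y e * trace (J (X s t)))" for t
  define B where "B t = cross2 (F (X s t)) (ray y e t)" for t
  have AI: "A integrable_on {0..1}" unfolding A_def by (intro integrable_continuous_real continuous_intros)
  have BI: "(\<lambda>t. (gb - ga) * B t) integrable_on {0..1}"
    unfolding B_def by (intro integrable_continuous_real continuous_intros)
  \<comment> \<open>Integration by parts in \<open>t\<close>: by \<open>cross2_trace\<close> the
    \<open>s\<close>-derivative \<open>d\<close> of the integrand differs from the divergence term
    \<open>A\<close> and the slope term exactly by the \<open>t\<close>-derivative of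
    \<open>Q\<close>. The end values of \<open>Q\<close> are the contributions of the two sides
    through \<open>y\<close>.\<close>
  define Q where "Q t = n t * B t" for t
  have Qd: "(Q has_real_derivative d s t - A t + (gb - ga) * B t) (at t within {0..1})" for t
  proof -
    have r: "((\<lambda>t. ray y e t) has_vector_derivative \<beta>) (at t within {0..1})"
      unfolding ray_def \<beta>_def by (auto intro!: derivative_eq_intros)
    have "(B has_vector_derivative cross2 (F (X s t)) \<beta> + cross2 (s *\<^sub>R (J (X s t) *v \<beta>)) (ray y e t)) (at t within {0..1})"
      unfolding B_def by (rule bounded_bilinear.has_vector_derivative[OF bounded_bilinear_cross2 dt r])
    then have Bd: "(B has_real_derivative cross2 (F (X s t)) \<beta> + cross2 (s *\<^sub>R (J (X s t) *v \<beta>)) (ray y e t)) (at t within {0..1})"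
      by (simp add: has_real_derivative_iff_has_vector_derivative)
    have nd: "(n has_real_derivative gb - ga) (at t within {0..1})"
      unfolding n_def by (auto intro!: derivative_eq_intros)
    have "d s t - A t + (gb - ga) * B t =
        (gb - ga) * B t + (cross2 (F (X s t)) \<beta> + cross2 (s *\<^sub>R (J (X s t) *v \<beta>)) (ray y e t)) * n t"
      using cross2_trace[of "J (X s t)" "ray y e t" \<beta>]
      unfolding d_def A_def cross2_ray[of y e t, folded \<beta>_def, symmetric]
        bounded_bilinear.scaleR_left[OF bounded_bilinear_cross2]
      by (simp add: algebra_simps)
    then show ?thesis unfolding Q_def using DERIV_mult[OF nd Bd] by (simp only:)
  qed
  have "((\<lambda>t. d s t - A t + (gb - ga) * B t) has_integral (Q 1 - Q 0)) {0..1}"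
    by (rule fundamental_theorem_of_calculus)
       (use Qd in \<open>auto simp: has_real_derivative_iff_has_vector_derivative\<close>)
  from has_integral_diff[OF has_integral_add[OF this integrable_integral[OF AI]] integrable_integral[OF BI]]
  have "(d s has_integral (Q 1 - Q 0 + integral {0..1} A - integral {0..1} (\<lambda>t. (gb - ga) * B t))) {0..1}"
    by simp
  then have 2: "integral {0..1} (d s) = Q 1 - Q 0 + integral {0..1} A - (gb - ga) * integral {0..1} B"
    by (simp add: integral_unique)
  have Q01: "Q 1 = gb * cross2 (F (X s 1)) (ray y e 1)" "Q 0 = ga * cross2 (F (X s 0)) (ray y e 0)"
    by (simp_all add: Q_def n_def B_def)
  have 3: "(\<lambda>s. integral {0..1} (\<lambda>t. s * (n t * cross2 (F (X s t)) \<beta>))) =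
      (\<lambda>s. s * integral {0..1} (\<lambda>t. n t * cross2 (F (X s t)) \<beta>))"
    by simp
  have "((\<lambda>s. s * integral {0..1} (\<lambda>t. n t * cross2 (F (X s t)) \<beta>)) has_real_derivative
      integral {0..1} A - (gb - ga) * integral {0..1} B + (Q 1 - Q 0)) (at s)"
    using 1 unfolding box_real 3 2 by (rule DERIV_cong) simp
  then show ?thesis
    unfolding Q01 unfolding A_def B_def n_def \<beta>_def .
qed

text \<open>Boundary pairing of the linear interpolant of the vertex values of \<open>g\<close> with
  the dilate of \<open>F\<close>. The edge vector is not scaled, so it is
  \<open>s * fan_flux P g y F s\<close> that measures the flux of \<open>F\<close> itself through
  the boundary shrunk by \<open>s\<close>.\<close>

definition fan_flux :: "polygon \<Rightarrow> (pt \<Rightarrow> real) \<Rightarrow> pt \<Rightarrow> (pt \<Rightarrow> pt) \<Rightarrow> real \<Rightarrow> real" where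
  "fan_flux P g y F s = (\<Sum>e\<in>edges P. integral {0..1}
     (\<lambda>t. ((1 - t) * g (fst e) + t * g (snd e)) * cross2 (F (y + s *\<^sub>R ray y e t)) (snd e - fst e)))"

text \<open>Neighbouring triangles share a side through \<open>y\<close> and the vertex value of
  \<open>g\<close> there, so the contributions of those sides telescope around the polygon.\<close>

lemma fan_flux_deriv:
  assumes F: "C1_jacobian F J" and P: "distinct P"
  shows "((\<lambda>s. s * fan_flux P g y F s) has_real_derivative
     (\<Sum>e\<in>edges P.
        integral {0..1} (\<lambda>t. ((1 - t) * g (fst e) + t * g (snd e)) *
          (s * fan_det y e * trace (J (y + s *\<^sub>R ray y e t))))
        - (g (snd e) - g (fst e)) * integral {0..1} (\<lambda>t. cross2 (F (y + s *\<^sub>R ray y e t)) (ray y e t))))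
     (at s)"
proof -
  \<comment> \<open>The weighted flux density at ratio \<open>s\<close> on the side joining
    \<open>y\<close> to the vertex \<open>p\<close>; it appears once with each sign.\<close>
  define q where "q p = g p * cross2 (F (y + s *\<^sub>R (p - y))) (p - y)" for p
  have r: "ray y e 1 = snd e - y" "ray y e 0 = fst e - y" for e by (simp_all add: ray_def)
  have "((\<lambda>s. \<Sum>e\<in>edges P. s * integral {0..1}
     (\<lambda>t. ((1 - t) * g (fst e) + t * g (snd e)) * cross2 (F (y + s *\<^sub>R ray y e t)) (snd e - fst e)))
    has_real_derivative
     (\<Sum>e\<in>edges P.
        integral {0..1} (\<lambda>t. ((1 - t) * g (fst e) + t * g (snd e)) *
          (s * fan_det y e * trace (J (y + s *\<^sub>R ray y e t))))
        - (g (snd e) - g (fst e)) * integral {0..1} (\<lambda>t. cross2 (F (y + s *\<^sub>R ray y e t)) (ray y e t))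
        + (q (snd e) - q (fst e)))) (at s)"
    by (rule DERIV_sum, unfold q_def r[symmetric], rule edge_flux_deriv[OF F])
  moreover have "(\<Sum>e\<in>edges P. q (snd e) - q (fst e)) = 0"
    using sum_edges_telescope[OF P, of q] by (simp add: case_prod_unfold)
  ultimately show ?thesis
    unfolding fan_flux_def by (simp add: sum.distrib sum_distrib_left)
qed

section \<open>Star-shaped polygons\<close>

text \<open>A whole disc of centres is kept, not a single one: it makes open segments to boundary
  points interior, forces strict positivity of \<open>fan_det\<close>, and provides the two centres
  whose dilations combine to a translation.\<close>

locale star_polygon =
  fixes P :: polygon and c :: pt and r :: real
  assumes simple: "simple_polygon P" and r: "r > 0"
    and star: "\<And>y. y \<in> ball c r \<Longrightarrow> star_shaped_wrt (region P) y"

lemma edge_endpoints_in_set: "e \<in> edges P \<Longrightarrow> fst e \<in> set P \<and> snd e \<in> set P"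
  unfolding edges_def by (metis prod.collapse set_rotate1 set_zip_leftD set_zip_rightD)

lemma edge_nth: "e \<in> edges P \<longleftrightarrow> (\<exists>i<length P. e = (P ! i, P ! (Suc i mod length P)))"
  unfolding edges_def by (auto simp: set_zip nth_rotate1)

lemma compact_bdry: "compact (bdry P)"
  unfolding bdry_def by (auto intro!: compact_UN)

lemma open_region: "open (region P)"
  unfolding region_def by (intro open_inside compact_imp_closed compact_bdry)

lemma bounded_region: "bounded (region P)"
  unfolding region_def by (intro bounded_inside compact_imp_bounded compact_bdry)

lemma frontier_region_subset: "frontier (region P) \<subseteq> bdry P"
  unfolding region_def by (intro frontier_inside_subset compact_imp_closed compact_bdry)

lemma region_Int_bdry: "region P \<inter> bdry P = {}"
  unfolding region_def by simp

lemma edge_subset_bdry: "e \<in> edges P \<Longrightarrow> closed_segment (fst e) (snd e) \<subseteq> bdry P"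
  unfolding bdry_def by force

lemma negligible_bdry: "negligible (bdry P)"
proof -
  have "negligible (closed_segment a b)" for a b :: pt
    by (rule negligible_convex_interior[THEN iffD2]) (auto simp: interior_closed_segment_ge2)
  then show ?thesis unfolding bdry_def by (auto intro!: negligible_Union)
qed

lemma simple_polygon_edge_nonempty: "simple_polygon P \<Longrightarrow> edges P \<noteq> {}"
proof -
  assume "simple_polygon P"
  then have "(P ! 0, P ! (Suc 0 mod length P)) \<in> edges P"
    unfolding edge_nth simple_polygon_def by (intro exI[of _ 0]) auto
  then show ?thesis by auto
qed

lemma simple_polygon_edge_distinct:
  assumes "simple_polygon P" "e \<in> edges P" shows "fst e \<noteq> snd e"
proof -
  obtain i where i: "i < length P" "e = (P ! i, P ! (Suc i mod length P))" using assms(2) by (auto simp: edge_nth)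
  have l: "3 \<le> length P" "distinct P" using assms(1) by (auto simp: simple_polygon_def)
  have "Suc i mod length P \<noteq> i"
    using i(1) l(1) by (cases "Suc i = length P") auto
  moreover have "Suc i mod length P < length P" using i(1) by (intro mod_less_divisor) auto
  ultimately show ?thesis using i l nth_eq_iff_index_eq[of P i "Suc i mod length P"] by simp
qed

lemma simple_polygon_start_unique:
  assumes "simple_polygon P" "e \<in> edges P" "e' \<in> edges P" "fst e = fst e'" shows "e = e'"
  using assms by (auto simp: edge_nth simple_polygon_def nth_eq_iff_index_eq)

lemma simple_polygon_edges_Int:
  assumes "simple_polygon P" "e \<in> edges P" "e' \<in> edges P" "e \<noteq> e'"
  shows "closed_segment (fst e) (snd e) \<inter> closed_segment (fst e') (snd e') \<subseteq> {fst e, snd e} \<inter> {fst e', snd e'}"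
  using assms unfolding simple_polygon_def case_prod_unfold prod.collapse by blast

lemma edge_next:
  assumes "e \<in> edges P" shows "\<exists>e'\<in>edges P. fst e' = snd e"
proof -
  obtain i where i: "i < length P" "P ! i = snd e"
    using edge_endpoints_in_set[OF assms] by (auto simp: in_set_conv_nth)
  then have "(P ! i, P ! (Suc i mod length P)) \<in> edges P" unfolding edge_nth by blast
  then show ?thesis using i(2) by (intro bexI) auto
qed

lemma region_nonempty:
  assumes "simple_polygon P" shows "region P \<noteq> {}"
proof -
  obtain a b where "(a, b) \<in> edges P" using simple_polygon_edge_nonempty[OF assms] by auto
  then have "\<forall>\<^sub>F t in at_right 0. midpoint a b - t *\<^sub>R perp (b - a) \<in> region P"
    using assms by (auto simp: simple_polygon_def)
  then show ?thesis using eventually_happens[of _ "at_right (0::real)"] by force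
qed

lemma diameter_region_pos:
  assumes "simple_polygon P" shows "diameter (region P) > 0"
proof -
  obtain x where x: "x \<in> region P" using region_nonempty[OF assms] by auto
  then obtain d where d: "d > 0" "ball x d \<subseteq> region P" using open_region open_contains_ball by blast
  have "x + (d / 2) *\<^sub>R axis 1 1 \<in> region P"
    using d by (intro subsetD[OF d(2)]) (auto simp: dist_norm norm_axis_1)
  then have "dist (x + (d / 2) *\<^sub>R axis 1 1) x \<le> diameter (region P)"
    using x by (intro diameter_bounded_bound bounded_region)
  then show ?thesis using d(1) by (simp add: dist_norm norm_axis_1)
qed

lemma shape_regular_star_polygon:
  assumes "simple_polygon P" "shape_regular \<rho> P" "\<rho> > 0"
  shows "\<exists>c r. star_polygon P c r"
proof -
  obtain c where "\<forall>y \<in> ball c (\<rho> * diameter (region P)). star_shaped_wrt (region P) y"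
    using assms(2) by (auto simp: shape_regular_def)
  then have "star_polygon P c (\<rho> * diameter (region P))"
    using assms diameter_region_pos[OF assms(1)] by unfold_locales auto
  then show ?thesis by blast
qed

lemma fan_det_add: "fan_det (x + k) e = fan_det x e - cross2 k (snd e - fst e)"
  by (simp add: fan_det_def cross2_def algebra_simps)

lemma fan_det_linear_comb: "fan_det (x + \<mu> *\<^sub>R (y - x)) e = (1 - \<mu>) * fan_det x e + \<mu> * fan_det y e"
  by (simp add: fan_det_def cross2_def algebra_simps)

lemma cross2_perp_self: "cross2 (perp b) b = (norm b)\<^sup>2"
  by (simp add: cross2_def power2_norm_eq_inner inner_pt)

lemma fan_det_midpoint: "fan_det (midpoint (fst e) (snd e) - t *\<^sub>R perp (snd e - fst e)) e = t * (norm (snd e - fst e))\<^sup>2"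
  unfolding power2_norm_eq_inner
  by (simp add: fan_det_def cross2_def midpoint_def inner_pt field_simps)

lemma fan_det_zero_on_line:
  assumes "fan_det x e = 0" "fst e \<noteq> snd e"
  shows "x = fst e + (((x - fst e) \<bullet> (snd e - fst e)) / (norm (snd e - fst e))\<^sup>2) *\<^sub>R (snd e - fst e)"
proof -
  define v where "v = x - fst e"
  define b where "b = snd e - fst e"
  have b: "b \<bullet> b \<noteq> 0" using assms(2) by (simp add: b_def)
  have "cross2 v b = 0" using assms(1) by (simp add: fan_det_def v_def b_def cross2_def algebra_simps)
  then have "(b \<bullet> b) *\<^sub>R v = (v \<bullet> b) *\<^sub>R b"
    unfolding pt_eq_iff inner_pt cross2_def by simp algebra
  then have "v = ((v \<bullet> b) / (b \<bullet> b)) *\<^sub>R b"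
    using b by (metis divide_inverse_commute real_vector.scale_left_imp_eq scaleR_scaleR right_inverse scaleR_one mult.commute)
  then show ?thesis by (simp add: v_def b_def power2_norm_eq_inner algebra_simps)
qed

section \<open>Rays, boundary and orientation of a star-shaped polygon\<close>

context star_polygon
begin

lemma distinct_P: "distinct P"
  using simple by (simp add: simple_polygon_def)

lemma center_in_region:
  assumes "y \<in> ball c r" shows "y \<in> region P"
proof -
  obtain x where "x \<in> region P" using region_nonempty[OF simple] by auto
  then show ?thesis using star[OF assms] unfolding star_shaped_wrt_def by auto
qed

lemma segment_in_region:
  assumes "y \<in> ball c r" "x \<in> region P" "0 \<le> s" "s \<le> 1"
  shows "y + s *\<^sub>R (x - y) \<in> region P"
proof -
  have "y + s *\<^sub>R (x - y) \<in> closed_segment y x"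
    unfolding in_segment using assms(3,4) by (intro exI[of _ s]) (auto simp: algebra_simps)
  then show ?thesis using star[OF assms(1)] assms(2) unfolding star_shaped_wrt_def by auto
qed

text \<open>Replace \<open>a\<close> by a nearby point \<open>a'\<close> of the region and shift the
  centre to \<open>y'\<close> so that the same point lies at ratio \<open>s\<close> on the segment
  from \<open>y'\<close> to \<open>a'\<close>; the disc of centres leaves room for the
  shift.\<close>

lemma ray_in_region:
  assumes y: "y \<in> ball c r" and a: "a \<in> closure (region P)" and s: "0 \<le> s" "s < 1"
  shows "y + s *\<^sub>R (a - y) \<in> region P"
proof -
  \<comment> \<open>An error below \<open>d\<close> in \<open>a\<close> moves the centre by less
    than \<open>d / (1 - s)\<close>, which is the distance of \<open>y\<close> from the rim of the
    disc.\<close>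
  define d where "d = (r - dist c y) * (1 - s)"
  have d: "d > 0" using y s by (simp add: d_def)
  obtain a' where a': "a' \<in> region P" "dist a' a < d" using a d closure_approachable by blast
  define y' where "y' = y + (s / (1 - s)) *\<^sub>R (a - a')"
  have "norm ((s / (1 - s)) *\<^sub>R (a - a')) \<le> (1 / (1 - s)) * norm (a - a')"
    unfolding norm_scaleR using s by (intro mult_right_mono) (auto simp: divide_right_mono)
  also have "\<dots> < (1 / (1 - s)) * d"
    using a'(2) s by (intro mult_strict_left_mono) (auto simp: dist_norm norm_minus_commute)
  also have "\<dots> = r - dist c y" using s by (simp add: d_def)
  finally have "norm ((s / (1 - s)) *\<^sub>R (a - a')) < r - dist c y" .
  moreover have "dist c y' \<le> dist c y + dist y y'" by (rule dist_triangle)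
  moreover have "dist y y' = norm ((s / (1 - s)) *\<^sub>R (a - a'))" by (simp add: y'_def dist_norm)
  ultimately have "y' \<in> ball c r" by simp
  then have "y' + s *\<^sub>R (a' - y') \<in> region P" using a'(1) s by (intro segment_in_region) auto
  moreover have "y' + s *\<^sub>R (a' - y') = y + s *\<^sub>R (a - y)"
  proof -
    have "y' + s *\<^sub>R (a' - y') = (1 - s) *\<^sub>R y' + s *\<^sub>R a'" by (simp add: algebra_simps)
    also have "(1 - s) *\<^sub>R y' = (1 - s) *\<^sub>R y + s *\<^sub>R (a - a')"
      unfolding y'_def scaleR_add_right scaleR_scaleR using s by simp
    finally show ?thesis by (simp add: algebra_simps)
  qed
  ultimately show ?thesis by simp
qed

text \<open>
  The points of an open edge that lie in the closure of the region form a clopen subset of the edge: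
  near such a point the boundary is a straight line, and a half disc that meets the region is
  contained in it.
\<close>
lemma open_edge_subset_closure:
  assumes e: "e \<in> edges P"
  shows "open_segment (fst e) (snd e) \<subseteq> closure (region P)"
proof -
  define S where "S = open_segment (fst e) (snd e)"
  define \<beta> where "\<beta> = snd e - fst e"
  define L where "L x = cross2 (x - fst e) \<beta>" for x
  have ne: "fst e \<noteq> snd e" by (rule simple_polygon_edge_distinct[OF simple e])
  have L_perp: "L (x + t *\<^sub>R perp \<beta>) = L x + t * (norm \<beta>)\<^sup>2" for x t
    unfolding cross2_perp_self[symmetric] by (simp add: L_def cross2_def algebra_simps)
  have n\<beta>: "(norm \<beta>)\<^sup>2 > 0" using ne by (simp add: \<beta>_def)
  have L_seg: "L x = 0" if x: "x \<in> closed_segment (fst e) (snd e)" for x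
  proof -
    obtain v where xv: "x = (1 - v) *\<^sub>R fst e + v *\<^sub>R snd e" using x unfolding in_segment by blast
    show ?thesis unfolding xv by (simp add: L_def \<beta>_def cross2_def algebra_simps)
  qed
  have "S \<inter> closure (region P) = {} \<or> S \<inter> closure (region P) = S"
  proof -
    have "closedin (top_of_set S) (S \<inter> closure (region P))"
      by (simp add: closedin_closed_Int)
    moreover have "openin (top_of_set S) (S \<inter> closure (region P))"
      unfolding openin_contains_ball
    proof (intro conjI ballI)
      fix p assume p: "p \<in> S \<inter> closure (region P)"
      define O' where "O' = (\<Union>e'\<in>edges P - {e}. closed_segment (fst e') (snd e'))"
      have clO: "closed O'" unfolding O'_def by (intro closed_UN) auto
      have "p \<notin> O'"
      proof
        assume "p \<in> O'"
        then obtain e' where e': "e' \<in> edges P" "e' \<noteq> e" "p \<in> closed_segment (fst e') (snd e')"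
          by (auto simp: O'_def)
        have "closed_segment (fst e) (snd e) \<inter> closed_segment (fst e') (snd e')
            \<subseteq> {fst e, snd e} \<inter> {fst e', snd e'}"
          by (rule simple_polygon_edges_Int[OF simple e e'(1) e'(2)[symmetric]])
        then show False using p e'(3) by (auto simp: S_def open_segment_def)
      qed
      then obtain d where d: "d > 0" "ball p d \<subseteq> - O'"
        using clO open_contains_ball[of "- O'"] by (auto simp: open_Compl)
      have bd: "L x = 0" if x: "x \<in> ball p d" "x \<in> bdry P" for x
      proof -
        obtain e' where e': "e' \<in> edges P" "x \<in> closed_segment (fst e') (snd e')"
          using x(2) unfolding bdry_def by auto
        have "x \<notin> O'" using x(1) d(2) by auto
        then have "e' = e" using e' unfolding O'_def by blast
        then show ?thesis using e'(2) L_seg by simp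
      qed
      \<comment> \<open>For \<open>\<sigma>\<close> equal to 1 or -1 these are the two halves into
        which the line of the edge cuts the disc.\<close>
      define H where "H \<sigma> = {x \<in> ball p d. 0 < \<sigma> * L x}" for \<sigma> :: real
      have H_conv: "convex (H \<sigma>)" for \<sigma>
      proof -
        have "H \<sigma> = ball p d \<inter> {x. (\<sigma> *\<^sub>R perp \<beta>) \<bullet> x > (\<sigma> *\<^sub>R perp \<beta>) \<bullet> fst e}"
          by (auto simp: H_def L_def inner_perp[symmetric] inner_diff algebra_simps inner_commute)
        then show ?thesis by (simp only:) (intro convex_Int convex_ball convex_halfspace_gt)
      qed
      obtain x0 where x0: "x0 \<in> region P" "dist x0 p < d"
        using p d(1) closure_approachable by blast
      have op: "open (ball p d \<inter> region P)" using open_region by auto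
      have "x0 \<in> ball p d \<inter> region P" using x0 by (simp add: dist_commute)
      then obtain d1 where d1: "d1 > 0" "ball x0 d1 \<subseteq> ball p d \<inter> region P"
        by (rule openE[OF op])
      \<comment> \<open>The region is open and cannot be confined to a line, so it meets one of the
        open half discs.\<close>
      have "\<exists>x1 \<in> ball p d \<inter> region P. L x1 \<noteq> 0"
      proof (cases "L x0 = 0")
        case True
        define t where "t = d1 / (2 * norm \<beta>)"
        have t: "t > 0" using d1 n\<beta> by (simp add: t_def)
        have "norm (t *\<^sub>R perp \<beta>) = d1 / 2" using d1 n\<beta> by (simp add: t_def)
        then have "x0 + t *\<^sub>R perp \<beta> \<in> ball x0 d1" using d1(1) by (simp add: dist_norm)
        moreover have "L (x0 + t *\<^sub>R perp \<beta>) \<noteq> 0" using True t n\<beta> by (simp add: L_perp)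
        ultimately show ?thesis using d1(2) by blast
      next
        case False then show ?thesis using x0 by (intro bexI[of _ x0]) (auto simp: dist_commute)
      qed
      then obtain x1 where x1: "x1 \<in> ball p d" "x1 \<in> region P" "L x1 \<noteq> 0" by blast
      define \<sigma> where "\<sigma> = sgn (L x1)"
      have \<sigma>: "\<sigma> * \<sigma> = 1" "0 < \<sigma> * L x1" using x1(3) by (auto simp: \<sigma>_def sgn_if)
      \<comment> \<open>The half disc is connected, meets the region and misses its frontier,
        because inside the disc the boundary lies on \<open>L x = 0\<close>.\<close>
      have HR: "H \<sigma> \<subseteq> region P"
      proof (rule ccontr)
        assume "\<not> H \<sigma> \<subseteq> region P"
        then have "H \<sigma> \<inter> frontier (region P) \<noteq> {}"
          using x1 \<sigma> by (intro connected_Int_frontier convex_connected H_conv) (auto simp: H_def)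
        then show False using frontier_region_subset bd by (force simp: H_def)
      qed
      have "q \<in> closure (region P)" if q: "q \<in> ball p d \<inter> S" for q
        unfolding closure_approachable
      proof (intro allI impI)
        fix \<epsilon> :: real assume \<epsilon>: "\<epsilon> > 0"
        define t where "t = min \<epsilon> (d - dist p q) / (2 * norm \<beta>)"
        have t: "t > 0" using q n\<beta> \<epsilon> by (simp add: t_def)
        have nt: "norm ((\<sigma> * t) *\<^sub>R perp \<beta>) = min \<epsilon> (d - dist p q) / 2"
          using q n\<beta> \<epsilon> x1(3) by (simp add: t_def abs_mult \<sigma>_def abs_sgn_eq)
        define z where "z = q + (\<sigma> * t) *\<^sub>R perp \<beta>"
        have dz: "dist z q = min \<epsilon> (d - dist p q) / 2" using nt by (simp add: z_def dist_norm)
        then have "dist p z < d" using dist_triangle[of p z q] q by (auto simp: dist_commute)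
        moreover have "L q = 0" using q segment_open_subset_closed by (intro L_seg) (auto simp: S_def)
        then have "\<sigma> * L z = (\<sigma> * \<sigma>) * t * (norm \<beta>)\<^sup>2" by (simp add: z_def L_perp)
        then have "0 < \<sigma> * L z" using \<sigma> t n\<beta> by simp
        ultimately have "z \<in> region P" using HR by (auto simp: H_def)
        moreover have "dist z q < \<epsilon>" using dz \<epsilon> q by (simp add: min_def split: if_splits)
        ultimately show "\<exists>y\<in>region P. dist y q < \<epsilon>" by blast
      qed
      then show "\<exists>\<epsilon>>0. ball p \<epsilon> \<inter> S \<subseteq> S \<inter> closure (region P)" using d(1) by blast
    qed simp
    moreover have "connected S" unfolding S_def by (intro convex_connected convex_open_segment)
    ultimately show ?thesis unfolding connected_clopen by blast
  qed
  \<comment> \<open>The orientation clause of \<open>simple_polygon\<close> excludes the empty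
    alternative.\<close>
  moreover have "midpoint (fst e) (snd e) \<in> S \<inter> closure (region P)"
  proof
    show "midpoint (fst e) (snd e) \<in> S" using ne by (simp add: S_def)
    have "\<forall>\<^sub>F t in at_right 0. midpoint (fst e) (snd e) - t *\<^sub>R perp \<beta> \<in> region P"
      using simple e unfolding simple_polygon_def \<beta>_def by (auto simp: case_prod_unfold)
    then have ev: "\<forall>\<^sub>F t in at_right 0. midpoint (fst e) (snd e) - t *\<^sub>R perp \<beta> \<in> closure (region P)"
      by eventually_elim (use closure_subset in blast)
    have "((\<lambda>t. midpoint (fst e) (snd e) - t *\<^sub>R perp \<beta>) \<longlongrightarrow> midpoint (fst e) (snd e) - 0 *\<^sub>R perp \<beta>) (at_right 0)"
      by (intro tendsto_intros)
    from Lim_in_closed_set[OF closed_closure ev _ this]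
    show "midpoint (fst e) (snd e) \<in> closure (region P)" by simp
  qed
  ultimately show ?thesis unfolding S_def by blast
qed

lemma bdry_subset_closure: "bdry P \<subseteq> closure (region P)"
proof -
  have "closed_segment (fst e) (snd e) \<subseteq> closure (region P)" if e: "e \<in> edges P" for e
  proof -
    have "closure (open_segment (fst e) (snd e)) \<subseteq> closure (region P)"
      by (rule closure_minimal[OF open_edge_subset_closure[OF e]]) simp
    then show ?thesis using simple_polygon_edge_distinct[OF simple e] by simp
  qed
  then show ?thesis unfolding bdry_def by force
qed

text \<open>If \<open>y\<close> were strictly to the right of the edge, the segment to
  \<open>y\<close> from a point just inside the midpoint would cross the edge near its midpoint. By
  star-shapedness the crossing would lie in the region, which is disjoint from the boundary.\<close>

lemma fan_det_nonneg:
  assumes e: "e \<in> edges P" and y: "y \<in> ball c r"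
  shows "0 \<le> fan_det y e"
proof (rule ccontr)
  assume "\<not> 0 \<le> fan_det y e"
  then have neg: "fan_det y e < 0" by simp
  define \<beta> where "\<beta> = snd e - fst e"
  define m where "m = midpoint (fst e) (snd e)"
  have ne: "fst e \<noteq> snd e" by (rule simple_polygon_edge_distinct[OF simple e])
  have n\<beta>: "(norm \<beta>)\<^sup>2 > 0" using ne by (simp add: \<beta>_def)
  define z where "z t = m - t *\<^sub>R perp \<beta>" for t
  \<comment> \<open>Solves \<open>fan_det (x t) e = 0\<close>, so \<open>x t\<close> is where the
    segment from \<open>z t\<close> to \<open>y\<close> crosses the line of the edge. As
    \<open>t\<close> tends to 0 so does \<open>\<mu> t\<close>, and the crossing tends to the
    midpoint.\<close>
  define \<mu> where "\<mu> t = t * (norm \<beta>)\<^sup>2 / (t * (norm \<beta>)\<^sup>2 - fan_det y e)" for t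
  define x where "x t = z t + \<mu> t *\<^sub>R (y - z t)" for t
  define \<tau> where "\<tau> t = ((x t - fst e) \<bullet> \<beta>) / (norm \<beta>)\<^sup>2" for t
  have 1: "\<forall>\<^sub>F t in at_right 0. z t \<in> region P"
    using simple e unfolding simple_polygon_def z_def m_def \<beta>_def by (auto simp: case_prod_unfold)
  have \<mu>0: "(\<mu> \<longlongrightarrow> 0 * (norm \<beta>)\<^sup>2 / (0 * (norm \<beta>)\<^sup>2 - fan_det y e)) (at_right 0)"
    unfolding \<mu>_def using neg by (intro tendsto_intros) auto
  have z0: "(z \<longlongrightarrow> m - 0 *\<^sub>R perp \<beta>) (at_right 0)"
    unfolding z_def by (intro tendsto_intros)
  have "(x \<longlongrightarrow> m + 0 *\<^sub>R (y - m)) (at_right 0)"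
    unfolding x_def using \<mu>0 z0 by (intro tendsto_intros) auto
  then have "(\<tau> \<longlongrightarrow> ((m - fst e) \<bullet> \<beta>) / (norm \<beta>)\<^sup>2) (at_right 0)"
    unfolding \<tau>_def using n\<beta> by (intro tendsto_intros) auto
  also have "m - fst e = (1/2) *\<^sub>R \<beta>" by (simp add: pt_eq_iff m_def \<beta>_def midpoint_def field_simps)
  also have "((1/2) *\<^sub>R \<beta>) \<bullet> \<beta> / (norm \<beta>)\<^sup>2 = 1/2" using n\<beta> by (simp add: power2_norm_eq_inner)
  finally have \<tau>l: "(\<tau> \<longlongrightarrow> 1/2) (at_right 0)" .
  have 2: "\<forall>\<^sub>F t in at_right 0. 0 < \<tau> t" "\<forall>\<^sub>F t in at_right 0. \<tau> t < 1"
    using order_tendstoD[OF \<tau>l] by auto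
  have 3: "\<forall>\<^sub>F t in at_right 0. (0::real) < t" by (rule eventually_at_right_less)
  have "\<forall>\<^sub>F t in at_right (0::real). False"
    using 1 2 3
  proof eventually_elim
    case (elim t)
    have tb: "0 < t * (norm \<beta>)\<^sup>2" using elim n\<beta> by simp
    have \<mu>: "0 \<le> \<mu> t" "\<mu> t \<le> 1" using tb neg by (auto simp: \<mu>_def)
    have "x t = y + (1 - \<mu> t) *\<^sub>R (z t - y)" by (simp add: x_def algebra_simps)
    then have xR: "x t \<in> region P" using segment_in_region[OF y elim(1), of "1 - \<mu> t"] \<mu> by simp
    have "fan_det (z t) e = t * (norm \<beta>)\<^sup>2"
      unfolding z_def m_def \<beta>_def by (rule fan_det_midpoint)
    then have "fan_det (x t) e = 0"
      using tb neg unfolding x_def fan_det_linear_comb by (simp add: \<mu>_def field_simps)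
    then have "x t = fst e + \<tau> t *\<^sub>R \<beta>"
      using fan_det_zero_on_line[OF _ ne, of "x t"] by (simp add: \<tau>_def \<beta>_def)
    then have "x t \<in> closed_segment (fst e) (snd e)"
      unfolding in_segment using elim by (intro exI[of _ "\<tau> t"]) (auto simp: \<beta>_def algebra_simps)
    then show False using edge_subset_bdry[OF e] xR region_Int_bdry by blast
  qed
  then show False by simp
qed

text \<open>If the value were zero, moving the centre slightly along the outward normal, still
  within the disc, would make it negative.\<close>

lemma fan_det_pos:
  assumes e: "e \<in> edges P" and y: "y \<in> ball c r"
  shows "0 < fan_det y e"
proof (rule ccontr)
  assume "\<not> 0 < fan_det y e"
  then have 0: "fan_det y e \<le> 0" by simp
  define \<beta> where "\<beta> = snd e - fst e"
  have n\<beta>: "norm \<beta> > 0" using simple_polygon_edge_distinct[OF simple e] by (simp add: \<beta>_def)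
  define t where "t = (r - dist c y) / (2 * norm \<beta>)"
  have t: "t > 0" using y n\<beta> by (simp add: t_def)
  have "norm (t *\<^sub>R perp \<beta>) = (r - dist c y) / 2" using y n\<beta> by (simp add: t_def)
  then have "y + t *\<^sub>R perp \<beta> \<in> ball c r"
    using y dist_triangle[of c "y + t *\<^sub>R perp \<beta>" y] by (auto simp: dist_norm)
  then have "0 \<le> fan_det (y + t *\<^sub>R perp \<beta>) e" by (rule fan_det_nonneg[OF e])
  moreover have "cross2 (t *\<^sub>R perp \<beta>) \<beta> = t * (norm \<beta>)\<^sup>2"
    unfolding cross2_perp_self[symmetric] by (simp add: cross2_def algebra_simps)
  ultimately have "t * (norm \<beta>)\<^sup>2 \<le> 0" using 0 by (simp add: fan_det_add \<beta>_def)
  then show False using t n\<beta> by (simp add: mult_le_0_iff)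
qed

text \<open>Of two boundary points on one ray from \<open>y\<close> the nearer one would lie in the
  region by \<open>ray_in_region\<close>.\<close>

lemma bdry_ray_unique:
  assumes y: "y \<in> ball c r" and p: "p \<in> bdry P" "p' \<in> bdry P" and s: "0 < s" "0 < s'"
    and eq: "s *\<^sub>R (p - y) = s' *\<^sub>R (p' - y)"
  shows "s = s' \<and> p = p'"
proof -
  have *: False if "p \<in> bdry P" "p' \<in> bdry P" "0 < s" "s < s'" "s *\<^sub>R (p - y) = s' *\<^sub>R (p' - y)" for p p' s s'
  proof -
    have "p' - y = (s / s') *\<^sub>R (p - y)"
    proof -
      have "(s / s') *\<^sub>R (p - y) = (1 / s') *\<^sub>R (s *\<^sub>R (p - y))" by simp
      also have "\<dots> = p' - y" unfolding that(5) using that(3,4) by simp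
      finally show ?thesis by simp
    qed
    then have "p' = y + (s / s') *\<^sub>R (p - y)" by (simp add: algebra_simps)
    moreover have "y + (s / s') *\<^sub>R (p - y) \<in> region P"
      using that bdry_subset_closure by (intro ray_in_region[OF y]) auto
    ultimately show False using that(2) region_Int_bdry by auto
  qed
  have "s = s'" using *[OF p s(1) _ eq] *[OF p(2,1) s(2) _ eq[symmetric]] by (cases s s' rule: linorder_cases) auto
  then show ?thesis using eq s by simp
qed

section \<open>Polar coordinates on the fan of triangles over the edges\<close>

definition fan_map :: "pt \<Rightarrow> edge \<Rightarrow> pt \<Rightarrow> pt" where
  "fan_map y e z = y + z $ 1 *\<^sub>R ray y e (z $ 2)"

text \<open>The first coordinate avoids the centre and the boundary. The second is half-open, so
  that the ray through a vertex belongs only to the edge starting there and the images for different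
  edges are disjoint.\<close>

definition fan_square :: "pt set" where
  "fan_square = {z. 0 < z $ 1 \<and> z $ 1 < 1 \<and> 0 \<le> z $ 2 \<and> z $ 2 < 1}"

lemma ray_bdry:
  assumes "e \<in> edges P" "0 \<le> t" "t \<le> 1" shows "y + ray y e t \<in> bdry P"
proof -
  have "y + ray y e t \<in> closed_segment (fst e) (snd e)"
    unfolding linepath_eq_ray[where y=y, symmetric] using linepath_in_path assms by auto
  then show ?thesis using edge_subset_bdry[OF assms(1)] by blast
qed

text \<open>Equal images lie on one ray, so ratio and boundary point agree. Different edges share at
  most endpoints, the half-open parameter turns a shared point into the start of both edges, and an
  edge is determined by its start.\<close>

lemma fan_map_eq_iff:
  assumes y: "y \<in> ball c r" and e: "e \<in> edges P" "e' \<in> edges P"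
    and z: "z \<in> fan_square" "z' \<in> fan_square" and eq: "fan_map y e z = fan_map y e' z'"
  shows "e = e' \<and> z = z'"
proof -
  define p where "p = y + ray y e (z $ 2)"
  define p' where "p' = y + ray y e' (z' $ 2)"
  have pb: "p \<in> bdry P" "p' \<in> bdry P"
    using z e by (auto simp: p_def p'_def fan_square_def intro!: ray_bdry)
  have "z $ 1 = z' $ 1 \<and> p = p'"
    using eq z by (intro bdry_ray_unique[OF y pb]) (auto simp: fan_map_def p_def p'_def fan_square_def)
  then have z1: "z $ 1 = z' $ 1" and pp: "p = p'" by auto
  have pl: "p = linepath (fst e) (snd e) (z $ 2)" "p' = linepath (fst e') (snd e') (z' $ 2)"
    by (simp_all only: p_def p'_def linepath_eq_ray[where y=y])
  have lin: "linepath a b t = linepath a b t' \<Longrightarrow> a \<noteq> b \<Longrightarrow> t = t'" for a b :: pt and t t'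
  proof -
    assume "linepath a b t = linepath a b t'" "a \<noteq> b"
    then have "(t - t') *\<^sub>R (b - a) = 0" by (simp add: linepath_def algebra_simps)
    then show "t = t'" using \<open>a \<noteq> b\<close> by simp
  qed
  have start: "t = 0" if "linepath a b t \<in> {a, b}" "0 \<le> t" "t < 1" "a \<noteq> b" for a b :: pt and t
    using lin[of a b t 0] lin[of a b t 1] that by (auto simp: linepath_0' linepath_1')
  note d = simple_polygon_edge_distinct[OF simple e(1)] simple_polygon_edge_distinct[OF simple e(2)]
  have "e = e'"
  proof (rule ccontr)
    assume ne: "e \<noteq> e'"
    have "p \<in> closed_segment (fst e) (snd e)" "p' \<in> closed_segment (fst e') (snd e')"
      unfolding pl using z by (auto simp: fan_square_def intro!: linepath_in_path)
    moreover have "closed_segment (fst e) (snd e) \<inter> closed_segment (fst e') (snd e')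
            \<subseteq> {fst e, snd e} \<inter> {fst e', snd e'}"
      by (rule simple_polygon_edges_Int[OF simple e ne])
    ultimately have "p \<in> {fst e, snd e}" "p' \<in> {fst e', snd e'}" using pp by auto
    then have "z $ 2 = 0" "z' $ 2 = 0"
      using start[of "fst e" "snd e" "z $ 2"] start[of "fst e'" "snd e'" "z' $ 2"] z d
      by (auto simp: pl fan_square_def)
    then have "fst e = fst e'" using pp pl by (simp add: linepath_0')
    then show False using simple_polygon_start_unique[OF simple e] ne by simp
  qed
  moreover have "z $ 2 = z' $ 2"
    using lin[of "fst e" "snd e" "z $ 2" "z' $ 2"] pp pl d \<open>e = e'\<close> by simp
  ultimately show ?thesis using z1 by (simp add: pt_eq_iff)
qed

text \<open>A point other than \<open>y\<close> is reached by following its ray to the frontier; the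
  exit ratio \<open>d\<close> exceeds 1 because points at smaller ratios are interior, and
  \<open>1 / d\<close> is the radial coordinate.\<close>

lemma region_fan_decomposition:
  assumes y: "y \<in> ball c r"
  shows "region P = insert y (\<Union>e\<in>edges P. fan_map y e ` fan_square)"
proof
  show "insert y (\<Union>e\<in>edges P. fan_map y e ` fan_square) \<subseteq> region P"
  proof -
    have "fan_map y e z \<in> region P" if "e \<in> edges P" "z \<in> fan_square" for e z
      using that ray_in_region[OF y, of "y + ray y e (z $ 2)" "z $ 1"] bdry_subset_closure ray_bdry[of e "z $ 2" y]
      by (auto simp: fan_map_def fan_square_def)
    then show ?thesis using center_in_region[OF y] by auto
  qed
  show "region P \<subseteq> insert y (\<Union>e\<in>edges P. fan_map y e ` fan_square)"
  proof
    fix x assume x: "x \<in> region P"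
    show "x \<in> insert y (\<Union>e\<in>edges P. fan_map y e ` fan_square)"
    proof (cases "x = y")
      case False
      have "y \<in> interior (region P)" using center_in_region[OF y] open_region by (simp add: interior_open)
      then obtain d where d: "0 < d" "y + d *\<^sub>R (x - y) \<in> frontier (region P)"
        using ray_to_frontier[OF bounded_region, of y P "x - y"] False by auto
      have fr: "frontier (region P) \<inter> region P = {}" using open_region by (metis Int_commute frontier_disjoint_eq)
      have "d > 1"
      proof (rule ccontr)
        assume "\<not> d > 1"
        then have "y + d *\<^sub>R (x - y) \<in> region P" using d by (intro segment_in_region[OF y x]) auto
        then show False using d(2) fr by auto
      qed
      have "y + d *\<^sub>R (x - y) \<in> bdry P" using d(2) frontier_region_subset by auto
      then obtain e t0 where e0: "e \<in> edges P" "0 \<le> t0" "t0 \<le> 1" "y + d *\<^sub>R (x - y) = linepath (fst e) (snd e) t0"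
        unfolding bdry_def path_image_linepath[symmetric] path_image_def by auto
      \<comment> \<open>A hit at the end of an edge is reassigned to the next edge with parameter 0,
        as the half-open square requires.\<close>
      have "\<exists>e\<in>edges P. \<exists>t. 0 \<le> t \<and> t < 1 \<and> y + d *\<^sub>R (x - y) = linepath (fst e) (snd e) t"
      proof (cases "t0 = 1")
        case True
        obtain e' where e': "e' \<in> edges P" "fst e' = snd e" using edge_next[OF e0(1)] by auto
        show ?thesis
          using e' e0(4) True by (intro bexI[of _ e'] exI[of _ 0]) (auto simp: linepath_0' linepath_1')
      next
        case False then show ?thesis using e0 by force
      qed
      then obtain e t where e: "e \<in> edges P" "0 \<le> t" "t < 1" "y + d *\<^sub>R (x - y) = y + ray y e t"
        unfolding linepath_eq_ray[where y=y] by blast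
      have "fan_map y e (vector [1 / d, t]) = y + (1 / d) *\<^sub>R (d *\<^sub>R (x - y))"
        using e(4) by (simp add: fan_map_def)
      then have "x = fan_map y e (vector [1 / d, t])" using d(1) by simp
      moreover have "(vector [1 / d, t] :: pt) \<in> fan_square"
        using e \<open>d > 1\<close> by (simp add: fan_square_def)
      ultimately show ?thesis using e(1) by blast
    qed simp
  qed
qed

end

lemma has_integral_negligible_symdiff:
  fixes f :: "'n::euclidean_space \<Rightarrow> 'a::banach"
  assumes "(f has_integral y) S" "negligible (S - T)" "negligible (T - S)"
  shows "(f has_integral y) T"
proof -
  have "negligible {x \<in> S - T. f x \<noteq> 0}" "negligible {x \<in> T - S. f x \<noteq> 0}"
    using assms(2,3) by (auto elim: negligible_subset)
  then show ?thesis using assms(1) has_integral_spike_set_eq by blast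
qed

text \<open>The iterated integral is computed for pairs of reals and transported to vectors by the
  measure-preserving coordinate map \<open>g\<close>.\<close>

lemma has_integral_pt_iterated:
  fixes k :: "real \<Rightarrow> real \<Rightarrow> real"
  assumes k: "continuous_on UNIV (\<lambda>p. k (fst p) (snd p))"
  shows "((\<lambda>z::pt. k (z $ 1) (z $ 2)) has_integral integral {0..1} (\<lambda>s. integral {0..1} (k s))) (cbox 0 1)"
proof -
  define g where "g z = (z $ 1, z $ 2)" for z :: pt
  define h where "h p = (vector [fst p, snd p] :: pt)" for p :: "real \<times> real"
  have hg: "h (g z) = z" for z by (simp add: g_def h_def pt_eq_iff)
  have gh: "g (h p) = p" for p by (simp add: g_def h_def)
  have gbox: "g ` cbox u v = cbox (u $ 1, u $ 2) (v $ 1, v $ 2)" for u v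
  proof
    show "g ` cbox u v \<subseteq> cbox (u $ 1, u $ 2) (v $ 1, v $ 2)"
      by (auto simp: g_def mem_box_cart forall_2)
    show "cbox (u $ 1, u $ 2) (v $ 1, v $ 2) \<subseteq> g ` cbox u v"
    proof
      fix p assume "p \<in> cbox (u $ 1, u $ 2) (v $ 1, v $ 2)"
      then have "h p \<in> cbox u v" by (cases p) (auto simp: h_def mem_box_cart forall_2)
      then show "p \<in> g ` cbox u v" using gh[of p] by (metis imageI)
    qed
  qed
  have hbox: "h ` cbox u v = cbox (h u) (h v)" for u v
  proof -
    have "h ` cbox u v = h ` (g ` cbox (h u) (h v))" by (cases u; cases v) (simp add: gbox h_def)
    then show ?thesis by (simp add: image_image hg)
  qed
  have r: "measure lborel (g ` cbox u v) = 1 * measure lborel (cbox u v)" for u v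
  proof -
    have "cbox u v = {} \<longleftrightarrow> v $ 1 < u $ 1 \<or> v $ 2 < u $ 2"
      unfolding interval_eq_empty_cart using forall_2[of "\<lambda>i. \<not> v $ i < u $ i"] by blast
    then show ?thesis
      by (auto simp: gbox content_Pair content_cbox_if_cart UNIV_2)
  qed
  have int: "((\<lambda>p. k (fst p) (snd p)) has_integral integral {0..1} (\<lambda>s. integral {0..1} (k s))) (cbox (0, 0) (1, 1))"
  proof -
    have c: "continuous_on (cbox (0, 0) (1, 1)) (\<lambda>p. k (fst p) (snd p))"
      using k by (rule continuous_on_subset) simp
    have "integral (cbox (0, 0) (1, 1)) (\<lambda>p. k (fst p) (snd p)) = integral {0..1} (\<lambda>s. integral {0..1} (k s))"
      using integral_prod_continuous[OF c] by simp
    then show ?thesis using integrable_integral[OF integrable_continuous[OF c]] by simp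
  qed
  have cg: "continuous (at z) g" for z
    unfolding g_def by (intro continuous_intros)
  have "((\<lambda>z. k (fst (g z)) (snd (g z))) has_integral (1 / 1) *\<^sub>R integral {0..1} (\<lambda>s. integral {0..1} (k s)))
      (h ` cbox (0, 0) (1, 1))"
    by (rule has_integral_twiddle[where f="\<lambda>p. k (fst p) (snd p)", OF zero_less_one hg gh cg _ _ r int])
       (auto simp: gbox hbox)
  moreover have "h ` cbox (0, 0) (1, 1) = cbox 0 1"
    unfolding hbox by (rule arg_cong2[where f=cbox]) (simp_all add: h_def pt_eq_iff)
  ultimately show ?thesis by (simp add: g_def)
qed

section \<open>Change of variables on the fan\<close>

context star_polygon
begin

lemma fan_square_subset: "fan_square \<subseteq> cbox 0 1"
  by (auto simp: fan_square_def mem_box_cart forall_2)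

lemma fan_square_sets: "fan_square \<in> sets lebesgue"
proof -
  have "fan_square = {z::pt. 0 < z $ 1} \<inter> {z. z $ 1 < 1} \<inter> {z. 0 \<le> z $ 2} \<inter> {z. z $ 2 < 1}"
    by (auto simp: fan_square_def)
  also have "\<dots> \<in> sets borel"
    by (intro sets.Int borel_open borel_closed open_Collect_less closed_Collect_le continuous_intros)
  finally show ?thesis by simp
qed

lemma negligible_cbox_fan_square: "negligible (cbox 0 1 - fan_square)"
proof (rule negligible_subset)
  show "negligible ({z::pt. z $ 1 = 0} \<union> {z. z $ 1 = 1} \<union> {z. z $ 2 = 1})"
    unfolding cart_eq_inner_axis by (intro negligible_Un negligible_standard_hyperplane) auto
  show "cbox 0 1 - fan_square \<subseteq> {z::pt. z $ 1 = 0} \<union> {z. z $ 1 = 1} \<union> {z. z $ 2 = 1}"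
    by (auto simp: fan_square_def mem_box_cart forall_2)
qed

lemma fan_map_derivative:
  "(fan_map y e has_derivative (\<lambda>h. h $ 1 *\<^sub>R ray y e (z $ 2) + (z $ 1 * h $ 2) *\<^sub>R (snd e - fst e))) (at z within S)"
  unfolding fan_map_def ray_def
  by (auto intro!: derivative_eq_intros bounded_linear.has_derivative[OF bounded_linear_vec_nth] simp: algebra_simps)

lemma fan_map_det:
  "det (matrix (\<lambda>h::pt. h $ 1 *\<^sub>R ray y e (z $ 2) + (z $ 1 * h $ 2) *\<^sub>R (snd e - fst e))) = z $ 1 * fan_det y e"
  unfolding cross2_ray[of y e "z $ 2", symmetric]
  by (simp add: det_2 matrix_def axis_def cross2_def algebra_simps)

text \<open>Change of variables along \<open>fan_map\<close>, injective by
  \<open>fan_map_eq_iff\<close>; positivity of \<open>fan_det\<close> removes the absolute value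
  from the Jacobian.\<close>

lemma fan_triangle_integral:
  assumes y: "y \<in> ball c r" and e: "e \<in> edges P" and h: "continuous_on UNIV h"
  shows "(h has_integral integral {0..1} (\<lambda>s. integral {0..1} (\<lambda>t. s * fan_det y e * h (y + s *\<^sub>R ray y e t))))
    (fan_map y e ` fan_square)"
proof -
  define k where "k s t = s * fan_det y e * h (y + s *\<^sub>R ray y e t)" for s t
  define I where "I = integral {0..1} (\<lambda>s. integral {0..1} (k s))"
  have "continuous_on UNIV (\<lambda>p. k (fst p) (snd p))"
    unfolding k_def by (intro continuous_intros continuous_on_compose2[OF h]) auto
  then have kI: "((\<lambda>z::pt. k (z $ 1) (z $ 2)) has_integral I) (cbox 0 1)"
    unfolding I_def by (rule has_integral_pt_iterated)
  have kc: "continuous_on A (\<lambda>z::pt. k (z $ 1) (z $ 2))" for A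
    unfolding k_def by (intro continuous_intros continuous_on_compose2[OF h]) auto
  \<comment> \<open>The change of variables theorem is applied to a vector-valued integrand, hence
    the passage through \<open>real^1\<close>.\<close>
  define f where "f x = (vec (h x) :: real^1)" for x
  have blv: "bounded_linear (\<lambda>x. vec x :: real^1)"
    by (rule bounded_linear_intro[where K=1]) (auto simp: vec_eq_iff norm_vec_def L2_set_def)
  define F where "F z = \<bar>det (matrix (\<lambda>h::pt. h $ 1 *\<^sub>R ray y e (z $ 2) + (z $ 1 * h $ 2) *\<^sub>R (snd e - fst e)))\<bar> *\<^sub>R f (fan_map y e z)" for z
  have Fk: "F z = vec (k (z $ 1) (z $ 2))" if "z \<in> fan_square" for z
    using that fan_det_pos[OF e y]
    by (simp add: F_def fan_map_det f_def k_def fan_map_def fan_square_def vec_eq_iff abs_mult)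
  have "(\<lambda>z::pt. vec (k (z $ 1) (z $ 2)) :: real^1) absolutely_integrable_on cbox 0 1"
    by (rule absolutely_integrable_continuous) (intro bounded_linear.continuous_on[OF blv] kc)
  then have ac: "(\<lambda>z::pt. vec (k (z $ 1) (z $ 2)) :: real^1) absolutely_integrable_on fan_square"
    by (rule set_integrable_subset[OF _ fan_square_sets fan_square_subset])
  have I1: "((\<lambda>z::pt. vec (k (z $ 1) (z $ 2)) :: real^1) has_integral vec I) fan_square"
  proof -
    have "((\<lambda>z::pt. vec (k (z $ 1) (z $ 2)) :: real^1) has_integral vec I) (cbox 0 1)"
      using has_integral_linear[OF kI blv] by (simp add: o_def)
    then show ?thesis
      by (rule has_integral_negligible_symdiff[OF _ negligible_cbox_fan_square])
         (use fan_square_subset in \<open>simp add: Diff_eq_empty_iff[THEN iffD2]\<close>)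
  qed
  have "F absolutely_integrable_on fan_square \<and> integral fan_square F = vec I"
  proof
    show "F absolutely_integrable_on fan_square"
      by (rule absolutely_integrable_spike[OF ac negligible_empty]) (simp add: Fk)
    show "integral fan_square F = vec I"
    proof -
      have "integral fan_square F = integral fan_square (\<lambda>z. vec (k (z $ 1) (z $ 2)))"
        by (rule integral_cong) (simp add: Fk)
      then show ?thesis using I1 by (simp add: integral_unique)
    qed
  qed
  then have "f absolutely_integrable_on (fan_map y e ` fan_square) \<and> integral (fan_map y e ` fan_square) f = vec I"
    unfolding F_def
    by (subst (asm) has_absolute_integral_change_of_variables[OF fan_square_sets fan_map_derivative])
       (auto intro!: inj_onI dest: fan_map_eq_iff[OF y e e])
  then have "(f has_integral vec I) (fan_map y e ` fan_square)"
    by (metis set_lebesgue_integral_eq_integral(1) has_integral_integral)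
  from has_integral_linear[OF this bounded_linear_vec_nth[of 1]]
  have "(h has_integral I) (fan_map y e ` fan_square)" by (simp add: o_def f_def)
  then show ?thesis unfolding I_def k_def .
qed

lemma region_fan_integral:
  assumes y: "y \<in> ball c r" and h: "continuous_on UNIV h"
  shows "(h has_integral (\<Sum>e\<in>edges P. integral {0..1} (\<lambda>s. integral {0..1}
    (\<lambda>t. s * fan_det y e * h (y + s *\<^sub>R ray y e t))))) (region P)"
proof -
  have "(h has_integral (\<Sum>e\<in>edges P. integral {0..1} (\<lambda>s. integral {0..1}
    (\<lambda>t. s * fan_det y e * h (y + s *\<^sub>R ray y e t))))) (\<Union>e\<in>edges P. fan_map y e ` fan_square)"
  proof (rule has_integral_UN[OF finite_edges fan_triangle_integral[OF y _ h]])
    show "pairwise (\<lambda>e e'. negligible (fan_map y e ` fan_square \<inter> fan_map y e' ` fan_square)) (edges P)"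
    proof (intro pairwiseI)
      fix e e' assume "e \<in> edges P" "e' \<in> edges P" "e \<noteq> e'"
      then have "fan_map y e ` fan_square \<inter> fan_map y e' ` fan_square = {}"
        using fan_map_eq_iff[OF y] by blast
      then show "negligible (fan_map y e ` fan_square \<inter> fan_map y e' ` fan_square)" by simp
    qed
  qed
  then show ?thesis
    unfolding region_fan_decomposition[OF y]
    by (rule has_integral_negligible_symdiff) (auto intro: negligible_subset[of "{y}"])
qed

end

section \<open>Divergence theorem and variation of the boundary flux\<close>

lemma continuous_integrable_lebesgue_on:
  fixes h :: "pt \<Rightarrow> 'b::euclidean_space"
  assumes h: "continuous_on UNIV h" and D: "open D" "bounded D"
  shows "integrable (lebesgue_on D) h"
proof -
  obtain a where a: "D \<subseteq> cbox (- a) a" using D(2) bounded_subset_cbox_symmetric by blast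
  have "h absolutely_integrable_on cbox (- a) a"
    by (rule absolutely_integrable_continuous[OF continuous_on_subset[OF h]]) simp
  then have "h absolutely_integrable_on D"
    by (rule set_integrable_subset) (use a D in auto)
  then show ?thesis
    using D(1) by (simp add: set_integrable_def integrable_restrict_space)
qed

lemma continuous_on_iterated:
  fixes k :: "real \<Rightarrow> real \<Rightarrow> real"
  assumes "continuous_on UNIV (\<lambda>p. k (fst p) (snd p))"
  shows "continuous_on A (\<lambda>s. integral {0..1} (k s))"
proof -
  have "continuous_on (A \<times> cbox 0 1) (\<lambda>(s, t). k s t)"
    unfolding case_prod_unfold using assms by (rule continuous_on_subset) simp
  from integral_continuous_on_param[OF this] show ?thesis by simp
qed

lemma edge_integral_normal:
  assumes "fst e \<noteq> snd e"
  shows "edge_integral e (\<lambda>x. g x * (F x \<bullet> edge_normal e)) =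
    integral {0..1} (\<lambda>t. g (linepath (fst e) (snd e) t) * cross2 (F (linepath (fst e) (snd e) t)) (snd e - fst e))"
proof -
  have "edge_length e \<noteq> 0" using assms by (simp add: edge_length_def)
  moreover have "edge_integral e (\<lambda>x. g x * (F x \<bullet> edge_normal e)) = edge_length e * integral {0..1}
      (\<lambda>t. (1 / edge_length e) * (g (linepath (fst e) (snd e) t) * cross2 (F (linepath (fst e) (snd e) t)) (snd e - fst e)))"
    by (simp add: edge_integral_def edge_normal_def inner_perp mult.assoc mult.left_commute)
  ultimately show ?thesis by (simp only: integral_mult_right) simp
qed

lemma edge_integral_const: "edge_integral e (\<lambda>x. 1) = edge_length e"
  by (simp add: edge_integral_def)

lemma fan_flux_eq_edge_integral:
  assumes P: "simple_polygon P"
    and g: "\<And>e t. e \<in> edges P \<Longrightarrow> t \<in> {0..1} \<Longrightarrow>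
      g (linepath (fst e) (snd e) t) = (1 - t) * g (fst e) + t * g (snd e)"
  shows "(\<Sum>e\<in>edges P. edge_integral e (\<lambda>x. g x * (F (y + s *\<^sub>R (x - y)) \<bullet> edge_normal e))) = fan_flux P g y F s"
  unfolding fan_flux_def
proof (rule sum.cong[OF refl])
  fix e assume e: "e \<in> edges P"
  show "edge_integral e (\<lambda>x. g x * (F (y + s *\<^sub>R (x - y)) \<bullet> edge_normal e)) =
    integral {0..1} (\<lambda>t. ((1 - t) * g (fst e) + t * g (snd e)) * cross2 (F (y + s *\<^sub>R ray y e t)) (snd e - fst e))"
    unfolding edge_integral_normal[OF simple_polygon_edge_distinct[OF P e], of g "\<lambda>x. F (y + s *\<^sub>R (x - y))"]
  proof (rule integral_cong)
    fix t :: real assume t: "t \<in> {0..1}"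
    show "g (linepath (fst e) (snd e) t) *
         cross2 (F (y + s *\<^sub>R (linepath (fst e) (snd e) t - y))) (snd e - fst e) =
         ((1 - t) * g (fst e) + t * g (snd e)) * cross2 (F (y + s *\<^sub>R ray y e t)) (snd e - fst e)"
    proof -
      have "linepath (fst e) (snd e) t - y = ray y e t" by (simp add: linepath_eq_ray[where y=y])
      then show ?thesis by (simp only: g[OF e t])
    qed
  qed
qed

context star_polygon
begin

text \<open>For \<open>g = 1\<close> the slope terms in \<open>fan_flux_deriv\<close> disappear;
  integrating over \<open>s\<close> from 0 to 1 yields the area integral in fan coordinates, and the
  factor \<open>s\<close> kills the lower limit.\<close>

lemma divergence_theorem:
  assumes F: "C1_jacobian F J"
  shows "(LINT x|lebesgue_on (region P). trace (J x)) = (\<Sum>e\<in>edges P. edge_integral e (\<lambda>x. F x \<bullet> edge_normal e))"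
proof -
  note cF = C1_jacobian_continuous[OF F]
  have ctr: "continuous_on UNIV (\<lambda>x. trace (J x))" by (intro continuous_intros cF)
  define k where "k e s t = s * fan_det c e * trace (J (c + s *\<^sub>R ray c e t))" for e s t
  have kc: "continuous_on UNIV (\<lambda>p. k e (fst p) (snd p))" for e
    unfolding k_def by (intro continuous_intros continuous_on_compose2[OF cF(2)[of UNIV]]) auto
  have ki: "(\<lambda>s. integral {0..1} (k e s)) integrable_on {0..1}" for e
    by (intro integrable_continuous_real continuous_on_iterated kc)
  have "((\<lambda>s. s * fan_flux P (\<lambda>x. 1) c F s) has_real_derivative (\<Sum>e\<in>edges P. integral {0..1} (k e s))) (at s within {0..1})" for s
  proof -
    have "(\<Sum>e\<in>edges P. integral {0..1} (\<lambda>t. ((1 - t) * 1 + t * 1) * (s * fan_det c e * trace (J (c + s *\<^sub>R ray c e t))))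
        - (1 - 1) * integral {0..1} (\<lambda>t. cross2 (F (c + s *\<^sub>R ray c e t)) (ray c e t)))
        = (\<Sum>e\<in>edges P. integral {0..1} (k e s))"
      unfolding k_def by (intro sum.cong) simp_all
    with fan_flux_deriv[OF F distinct_P, where g="\<lambda>x. 1" and y=c and s=s]
    show ?thesis by (simp only: has_field_derivative_at_within)
  qed
  then have "((\<lambda>s. \<Sum>e\<in>edges P. integral {0..1} (k e s)) has_integral
      (1 * fan_flux P (\<lambda>x. 1) c F 1 - 0 * fan_flux P (\<lambda>x. 1) c F 0)) {0..1}"
    by (intro fundamental_theorem_of_calculus) (auto simp: has_real_derivative_iff_has_vector_derivative)
  moreover have "((\<lambda>s. \<Sum>e\<in>edges P. integral {0..1} (k e s)) has_integral
      (\<Sum>e\<in>edges P. integral {0..1} (\<lambda>s. integral {0..1} (k e s)))) {0..1}"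
    by (intro has_integral_sum integrable_integral ki finite_edges)
  ultimately have "fan_flux P (\<lambda>x. 1) c F 1 = (\<Sum>e\<in>edges P. integral {0..1} (\<lambda>s. integral {0..1} (k e s)))"
    by (auto dest: has_integral_unique)
  also have "\<dots> = integral (region P) (\<lambda>x. trace (J x))"
  proof -
    have "c \<in> ball c r" using r by simp
    from integral_unique[OF region_fan_integral[OF this ctr]] show ?thesis unfolding k_def[abs_def] ..
  qed
  also have "\<dots> = (LINT x|lebesgue_on (region P). trace (J x))"
    by (rule lebesgue_integral_eq_integral[symmetric])
       (auto intro!: continuous_integrable_lebesgue_on ctr bounded_region simp: open_region)
  finally have "(LINT x|lebesgue_on (region P). trace (J x)) = fan_flux P (\<lambda>x. 1) c F 1" ..
  also have "\<dots> = (\<Sum>e\<in>edges P. edge_integral e (\<lambda>x. 1 * (F (c + 1 *\<^sub>R (x - c)) \<bullet> edge_normal e)))"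
    by (rule fan_flux_eq_edge_integral[OF simple, symmetric]) simp
  finally show ?thesis by simp
qed

text \<open>
  For a solenoidal field \<open>F\<close> only the jumps of \<open>g\<close> along the edges contribute to the derivative of
  \<open>s * fan_flux P g y F s\<close>; Young's inequality and the change of variables on the fan bound it.
\<close>
lemma fan_flux_variation:
  assumes y: "y \<in> ball c r"
  shows "\<exists>K\<ge>0. \<forall>F J t t'. C1_jacobian F J \<longrightarrow> sq_int F \<longrightarrow> 1/2 \<le> t \<longrightarrow> t < t' \<longrightarrow> t' \<le> 1 \<longrightarrow>
    (\<forall>e\<in>edges P. \<forall>\<tau>\<in>{0..1}. \<forall>s\<in>{t..t'}. trace (J (y + s *\<^sub>R ray y e \<tau>)) = 0) \<longrightarrow>
    \<bar>t' * fan_flux P g y F t' - t * fan_flux P g y F t\<bar> \<le> K * sqrt (t' - t) * (1 + energy F)"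
proof -
  \<comment> \<open>The smallest Jacobian factor over the edges. For \<open>s \<ge> 1/2\<close> the
    area element \<open>s * fan_det y e\<close> is at least \<open>m / 2\<close>, whence the
    \<open>2 / m\<close> in \<open>K\<close>.\<close>
  define m where "m = Min (fan_det y ` edges P)"
  have ne: "edges P \<noteq> {}" by (rule simple_polygon_edge_nonempty[OF simple])
  have m: "m > 0" unfolding m_def using ne fan_det_pos[OF _ y] by (subst Min_gr_iff) auto
  have mle: "m \<le> fan_det y e" if "e \<in> edges P" for e unfolding m_def using that by (intro Min_le) auto
  define W where "W e = \<bar>g (snd e) - g (fst e)\<bar> * (norm (fst e) + norm (snd e - fst e) + norm y)" for e
  define M where "M = (\<Sum>e\<in>edges P. W e)"
  have W0: "0 \<le> W e" for e by (simp add: W_def)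
  have WM: "W e \<le> M" if "e \<in> edges P" for e
    unfolding M_def using that W0 by (intro member_le_sum) auto
  have M0: "0 \<le> M" unfolding M_def using W0 by (intro sum_nonneg)
  define K where "K = M * (2 / m + real (card (edges P)))"
  show ?thesis
  proof (intro exI[of _ K] conjI allI impI)
    show "0 \<le> K" using M0 m by (simp add: K_def)
    fix F J t t'
    assume F: "C1_jacobian F J" and sq: "sq_int F" and t: "1/2 \<le> (t::real)" "t < t'" "t' \<le> 1"
      and tr: "\<forall>e\<in>edges P. \<forall>\<tau>\<in>{0..1}. \<forall>s\<in>{t..t'}. trace (J (y + s *\<^sub>R ray y e \<tau>)) = 0"
    note cF = C1_jacobian_continuous[OF F]
    have cFX: "continuous_on UNIV (\<lambda>p. F (y + fst p *\<^sub>R ray y e (snd p)))" for e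
      by (intro continuous_intros continuous_on_compose2[OF cF(1)[of UNIV]]) auto
    \<comment> \<open>The weight in \<open>a \<le> q * a\<^sup>2 + 1 / q\<close>. The interval of
      \<open>s\<close> has length \<open>q * q\<close>, so the constant term integrates to
      \<open>q\<close> and both terms are of order \<open>sqrt (t' - t)\<close>.\<close>
    define q where "q = sqrt (t' - t)"
    have q: "q > 0" "q * q = t' - t" using t by (auto simp: q_def)
    define k where "k e s \<tau> = cross2 (F (y + s *\<^sub>R ray y e \<tau>)) (ray y e \<tau>)" for e s \<tau>
    define n where "n e s \<tau> = (norm (F (y + s *\<^sub>R ray y e \<tau>)))\<^sup>2" for e s \<tau>
    have kc: "continuous_on UNIV (\<lambda>p. k e (fst p) (snd p))" for e
      unfolding k_def by (intro continuous_intros cFX)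
    have nc: "continuous_on UNIV (\<lambda>p. n e (fst p) (snd p))" for e
      unfolding n_def by (intro continuous_intros cFX)
    have kc1: "continuous_on A (k e s)" for A e s
      by (rule continuous_on_compose2[OF kc[of e], of A "\<lambda>\<tau>. (s, \<tau>)", simplified]) (intro continuous_intros)
    have nc1: "continuous_on A (n e s)" for A e s
      by (rule continuous_on_compose2[OF nc[of e], of A "\<lambda>\<tau>. (s, \<tau>)", simplified]) (intro continuous_intros)
    have ki: "(\<lambda>s. integral {0..1} (k e s)) integrable_on {a..b}" for e a b
      by (intro integrable_continuous_real continuous_on_iterated kc)
    have ni: "(\<lambda>s. integral {0..1} (n e s)) integrable_on {a..b}" for e a b
      by (intro integrable_continuous_real continuous_on_iterated nc)
    have n0: "0 \<le> integral {0..1} (n e s)" for e s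
      by (intro integral_nonneg integrable_continuous_real nc1) (simp add: n_def)
    have "((\<lambda>s. s * fan_flux P g y F s) has_real_derivative
        (\<Sum>e\<in>edges P. - (g (snd e) - g (fst e)) * integral {0..1} (k e s))) (at s within {t..t'})"
      if s: "s \<in> {t..t'}" for s
    proof -
      have "integral {0..1} (\<lambda>\<tau>. ((1 - \<tau>) * g (fst e) + \<tau> * g (snd e)) *
          (s * fan_det y e * trace (J (y + s *\<^sub>R ray y e \<tau>)))) = integral {0..1::real} (\<lambda>\<tau>. 0)" if "e \<in> edges P" for e
        by (rule integral_cong) (use tr that s in auto)
      then have "(\<Sum>e\<in>edges P.
        integral {0..1} (\<lambda>\<tau>. ((1 - \<tau>) * g (fst e) + \<tau> * g (snd e)) *
          (s * fan_det y e * trace (J (y + s *\<^sub>R ray y e \<tau>))))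
        - (g (snd e) - g (fst e)) * integral {0..1} (\<lambda>\<tau>. cross2 (F (y + s *\<^sub>R ray y e \<tau>)) (ray y e \<tau>)))
        = (\<Sum>e\<in>edges P. - (g (snd e) - g (fst e)) * integral {0..1} (k e s))"
        unfolding k_def[abs_def] by (intro sum.cong) (simp_all add: algebra_simps)
      then show ?thesis
        using fan_flux_deriv[OF F distinct_P, where g=g and y=y and s=s]
        by (simp only: has_field_derivative_at_within)
    qed
    then have hi: "((\<lambda>s. \<Sum>e\<in>edges P. - (g (snd e) - g (fst e)) * integral {0..1} (k e s)) has_integral
        (t' * fan_flux P g y F t' - t * fan_flux P g y F t)) {t..t'}"
      using t by (intro fundamental_theorem_of_calculus) (auto simp: has_real_derivative_iff_has_vector_derivative)
    have pw: "\<bar>\<Sum>e\<in>edges P. - (g (snd e) - g (fst e)) * integral {0..1} (k e s)\<bar>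
        \<le> (\<Sum>e\<in>edges P. M * (q * integral {0..1} (n e s) + 1 / q))" if s: "s \<in> {t..t'}" for s
    proof -
      have "\<bar>- (g (snd e) - g (fst e)) * integral {0..1} (k e s)\<bar> \<le> M * (q * integral {0..1} (n e s) + 1 / q)"
        if e: "e \<in> edges P" for e
      proof -
        have "norm (integral {0..1} (\<lambda>\<tau>. (g (snd e) - g (fst e)) * k e s \<tau>))
            \<le> integral {0..1} (\<lambda>\<tau>. M * (q * n e s \<tau> + 1 / q))"
        proof (rule integral_norm_bound_integral)
          show "(\<lambda>\<tau>. (g (snd e) - g (fst e)) * k e s \<tau>) integrable_on {0..1}"
            by (intro integrable_continuous_real continuous_intros kc1)
          show "(\<lambda>\<tau>. M * (q * n e s \<tau> + 1 / q)) integrable_on {0..1}"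
            by (intro integrable_continuous_real continuous_intros nc1)
          fix \<tau> :: real assume \<tau>: "\<tau> \<in> {0..1}"
          define a where "a = norm (F (y + s *\<^sub>R ray y e \<tau>))"
          have "norm (ray y e \<tau>) \<le> norm (fst e) + norm (\<tau> *\<^sub>R (snd e - fst e)) + norm y"
            unfolding ray_def using norm_triangle_ineq4[of "fst e + \<tau> *\<^sub>R (snd e - fst e)" y]
              norm_triangle_ineq[of "fst e" "\<tau> *\<^sub>R (snd e - fst e)"] by linarith
          also have "norm (\<tau> *\<^sub>R (snd e - fst e)) \<le> 1 * norm (snd e - fst e)"
            unfolding norm_scaleR using \<tau> by (intro mult_right_mono) auto
          finally have ray: "norm (ray y e \<tau>) \<le> norm (fst e) + norm (snd e - fst e) + norm y" by simp
          have "norm ((g (snd e) - g (fst e)) * k e s \<tau>) \<le> \<bar>g (snd e) - g (fst e)\<bar> * (a * norm (ray y e \<tau>))"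
            unfolding real_norm_def abs_mult k_def a_def by (intro mult_left_mono abs_cross2_le) auto
          also have "\<dots> \<le> W e * a"
            unfolding W_def using mult_left_mono[OF ray, of "\<bar>g (snd e) - g (fst e)\<bar> * a"]
            by (simp add: a_def algebra_simps)
          also have "\<dots> \<le> M * a" using WM[OF e] by (intro mult_right_mono) (auto simp: a_def)
          also have "\<dots> \<le> M * (q * a\<^sup>2 + 1 / q)"
          proof (rule mult_left_mono[OF _ M0])
            have "0 \<le> (q * a - 1)\<^sup>2 / q" using q by simp
            also have "(q * a - 1)\<^sup>2 / q = q * a\<^sup>2 - 2 * a + 1 / q"
              using q(1) by (simp add: power2_eq_square field_simps)
            finally have "2 * a \<le> q * a\<^sup>2 + 1 / q" by simp
            moreover have "0 \<le> a" by (simp add: a_def)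
            ultimately show "a \<le> q * a\<^sup>2 + 1 / q" by linarith
          qed
          finally show "norm ((g (snd e) - g (fst e)) * k e s \<tau>) \<le> M * (q * n e s \<tau> + 1 / q)"
            by (simp add: n_def a_def)
        qed
        also have "integral {0..1} (\<lambda>\<tau>. M * (q * n e s \<tau> + 1 / q)) = M * (q * integral {0..1} (n e s) + 1 / q)"
        proof -
          have "((\<lambda>\<tau>. M * (q * n e s \<tau> + 1 / q)) has_integral M * (q * integral {0..1} (n e s) + 1 / q)) {0..1}"
            using has_integral_const_real[of "1 / q" 0 1]
            by (intro has_integral_mult_right has_integral_add integrable_integral integrable_continuous_real nc1) auto
          then show ?thesis by (rule integral_unique)
        qed
        finally show ?thesis by (simp add: abs_mult abs_minus_commute)
      qed
      then show ?thesis by (intro order_trans[OF sum_abs] sum_mono)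
    qed
    have hb: "((\<lambda>s. \<Sum>e\<in>edges P. M * (q * integral {0..1} (n e s) + 1 / q)) has_integral
        (\<Sum>e\<in>edges P. M * (q * integral {t..t'} (\<lambda>s. integral {0..1} (n e s)) + (1 / q) * (t' - t)))) {t..t'}"
    proof (intro has_integral_sum has_integral_mult_right has_integral_add integrable_integral ni finite_edges)
      show "((\<lambda>s. 1 / q) has_integral 1 / q * (t' - t)) {t..t'}"
        using has_integral_const_real[of "1 / q" t t'] t by (simp add: mult.commute)
    qed
    have "\<bar>t' * fan_flux P g y F t' - t * fan_flux P g y F t\<bar>
        \<le> (\<Sum>e\<in>edges P. M * (q * integral {t..t'} (\<lambda>s. integral {0..1} (n e s)) + (1 / q) * (t' - t)))"
      using integral_norm_bound_integral[OF has_integral_integrable[OF hi] has_integral_integrable[OF hb]] pw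
      by (simp only: integral_unique[OF hi] integral_unique[OF hb] real_norm_def)
    also have "\<dots> = M * (q * (\<Sum>e\<in>edges P. integral {t..t'} (\<lambda>s. integral {0..1} (n e s))) + real (card (edges P)) * q)"
    proof -
      have "(1 / q) * (t' - t) = q" using q by (simp add: field_simps)
      then show ?thesis by (simp add: sum_distrib_left sum.distrib distrib_left)
    qed
    also have "\<dots> \<le> M * (q * (2 / m * energy F) + real (card (edges P)) * q)"
    proof -
      \<comment> \<open>Return to area measure: inserting the Jacobian costs the factor
        \<open>2 / m\<close>, after which the range of \<open>s\<close> may be enlarged to the whole
        triangle.\<close>
      have "integral {t..t'} (\<lambda>s. integral {0..1} (n e s))
          \<le> 2 / m * integral {0..1} (\<lambda>s. integral {0..1} (\<lambda>\<tau>. s * fan_det y e * n e s \<tau>))" if e: "e \<in> edges P" for e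
      proof -
        have i2: "(\<lambda>s. 2 / m * (s * fan_det y e * integral {0..1} (n e s))) integrable_on {a..b}" for a b
          by (intro integrable_continuous_real continuous_intros continuous_on_iterated nc)
        have d0: "0 \<le> fan_det y e" using fan_det_pos[OF e y] by simp
        have "integral {t..t'} (\<lambda>s. integral {0..1} (n e s))
            \<le> integral {t..t'} (\<lambda>s. 2 / m * (s * fan_det y e * integral {0..1} (n e s)))"
        proof (rule integral_le[OF ni i2])
          fix s assume s: "s \<in> {t..t'}"
          have "1/2 * m \<le> s * fan_det y e" using s t m mle[OF e] by (intro mult_mono) auto
          then have "1 \<le> 2 / m * (s * fan_det y e)" using m by (simp add: field_simps)
          then have "1 * integral {0..1} (n e s) \<le> 2 / m * (s * fan_det y e) * integral {0..1} (n e s)"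
            by (intro mult_right_mono n0)
          then show "integral {0..1} (n e s) \<le> 2 / m * (s * fan_det y e * integral {0..1} (n e s))"
            by (simp add: mult.assoc)
        qed
        also have "\<dots> \<le> integral {0..1} (\<lambda>s. 2 / m * (s * fan_det y e * integral {0..1} (n e s)))"
          using t m d0 n0 by (intro integral_subset_le i2) auto
        also have "\<dots> = 2 / m * integral {0..1} (\<lambda>s. integral {0..1} (\<lambda>\<tau>. s * fan_det y e * n e s \<tau>))"
          by simp
        finally show ?thesis .
      qed
      then have "(\<Sum>e\<in>edges P. integral {t..t'} (\<lambda>s. integral {0..1} (n e s)))
          \<le> 2 / m * (\<Sum>e\<in>edges P. integral {0..1} (\<lambda>s. integral {0..1} (\<lambda>\<tau>. s * fan_det y e * n e s \<tau>)))"
        unfolding sum_distrib_left by (rule sum_mono)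
      also have "(\<Sum>e\<in>edges P. integral {0..1} (\<lambda>s. integral {0..1} (\<lambda>\<tau>. s * fan_det y e * n e s \<tau>)))
          = integral (region P) (\<lambda>x. (norm (F x))\<^sup>2)"
      proof -
        have "continuous_on UNIV (\<lambda>x. (norm (F x))\<^sup>2)" by (intro continuous_intros cF)
        from region_fan_integral[OF y this] show ?thesis unfolding n_def by (simp only: integral_unique)
      qed
      also have "\<dots> = (LINT x|lebesgue_on (region P). (norm (F x))\<^sup>2)"
        by (rule lebesgue_integral_eq_integral[symmetric])
           (auto intro!: continuous_integrable_lebesgue_on continuous_intros cF bounded_region simp: open_region)
      also have "\<dots> \<le> energy F"
      proof -
        have "(LINT x|lebesgue_on (region P). (norm (F x))\<^sup>2) = (LINT x|lebesgue. indicator (region P) x * (norm (F x))\<^sup>2)"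
          using integral_restrict_space[of "region P" lebesgue "\<lambda>x. (norm (F x))\<^sup>2"] open_region by simp
        also have "\<dots> = (LINT x|lborel. indicator (region P) x * (norm (F x))\<^sup>2)"
          using sq_int_measurable[OF sq] open_region by (intro integral_completion) auto
        also have "\<dots> \<le> energy F"
          unfolding energy_def
        proof (rule integral_mono')
          show "integrable lborel (\<lambda>x. (norm (F x))\<^sup>2)" by (rule sq_int_integrable[OF sq])
        qed (auto simp: indicator_def)
        finally show ?thesis .
      qed
      finally have "(\<Sum>e\<in>edges P. integral {t..t'} (\<lambda>s. integral {0..1} (n e s))) \<le> 2 / m * energy F"
        using m by (simp add: divide_right_mono)
      then show ?thesis using M0 q by (intro mult_left_mono add_right_mono) auto
    qed
    also have "\<dots> \<le> K * sqrt (t' - t) * (1 + energy F)"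
    proof -
      have "M * (q * (2 / m * energy F) + real (card (edges P)) * q) = M * q * (2 / m * energy F + real (card (edges P)))"
        by (simp add: algebra_simps)
      also have "\<dots> \<le> M * q * ((2 / m + real (card (edges P))) * (1 + energy F))"
      proof (rule mult_left_mono)
        show "2 / m * energy F + real (card (edges P)) \<le> (2 / m + real (card (edges P))) * (1 + energy F)"
          using m energy_nonneg[of F] by (simp add: distrib_right distrib_left)
      qed (use M0 q in auto)
      finally show ?thesis by (simp add: K_def q_def mult_ac)
    qed
    finally show "\<bar>t' * fan_flux P g y F t' - t * fan_flux P g y F t\<bar> \<le> K * sqrt (t' - t) * (1 + energy F)" .
  qed
qed

end

section \<open>Higher integrability of the gradients of nodal functions\<close>

lemma H1_grad:
  assumes "v \<in> H1 D" shows grad_L2: "grad D v \<in> L2 D" and weak_grad_grad: "weak_grad D v (grad D v)"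
proof -
  have "\<exists>g. g \<in> L2 D \<and> weak_grad D v g" using assms by (auto simp: H1_def)
  from someI_ex[OF this] show "grad D v \<in> L2 D" "weak_grad D v (grad D v)" by (auto simp: grad_def)
qed

lemma borel_measurable_lebesgue_on:
  fixes f :: "pt \<Rightarrow> 'b::euclidean_space"
  assumes "f \<in> borel_measurable borel" shows "f \<in> borel_measurable (lebesgue_on D)"
  using assms by (intro measurable_restrict_space1 measurable_completion) simp

lemma L2_measurable: "g \<in> L2 D \<Longrightarrow> g \<in> borel_measurable (lebesgue_on D)"
  by (simp add: Lp_def)

lemma integral_inner_representative:
  fixes f g \<psi> :: "pt \<Rightarrow> 'b::euclidean_space"
  assumes D: "open D" and g: "g \<in> L2 D" and f: "f \<in> borel_measurable borel" "\<And>x. x \<notin> D \<Longrightarrow> f x = 0"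
    and fg: "AE x in lebesgue_on D. f x = g x" and \<psi>: "\<psi> \<in> borel_measurable borel"
  shows "(LINT x|lebesgue_on D. g x \<bullet> \<psi> x) = (LINT x|lborel. f x \<bullet> \<psi> x)"
proof -
  have "(LINT x|lebesgue_on D. g x \<bullet> \<psi> x) = (LINT x|lebesgue_on D. f x \<bullet> \<psi> x)"
    using fg by (intro integral_cong_AE borel_measurable_inner L2_measurable[OF g]
        borel_measurable_lebesgue_on[OF f(1)] borel_measurable_lebesgue_on[OF \<psi>]) (auto elim: eventually_mono)
  also have "\<dots> = (LINT x|lborel. f x \<bullet> \<psi> x)"
    by (rule integral_lebesgue_on_eq_lborel[OF D]) (use f \<psi> in auto)
  finally show ?thesis .
qed

lemma C1_jacobian_dilation:
  assumes F: "C1_jacobian F J"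
  shows "C1_jacobian (\<lambda>x. F (y + t *\<^sub>R (x - y))) (\<lambda>x. t *\<^sub>R J (y + t *\<^sub>R (x - y)))"
  unfolding C1_jacobian_def
proof (intro conjI allI)
  show "continuous_on UNIV (\<lambda>x. t *\<^sub>R J (y + t *\<^sub>R (x - y)))"
    by (intro continuous_intros continuous_on_compose2[OF C1_jacobian_continuous(2)[OF F, of UNIV]]) auto
  fix x
  have "((\<lambda>x. y + t *\<^sub>R (x - y)) has_derivative (\<lambda>h. t *\<^sub>R h)) (at x)"
    by (auto intro!: derivative_eq_intros)
  moreover have "(F has_derivative (\<lambda>h. J (y + t *\<^sub>R (x - y)) *v h)) (at (y + t *\<^sub>R (x - y)))"
    using F by (simp add: C1_jacobian_def)
  ultimately have "((\<lambda>x. F (y + t *\<^sub>R (x - y))) has_derivative (\<lambda>h. J (y + t *\<^sub>R (x - y)) *v (t *\<^sub>R h))) (at x)"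
    by (rule has_derivative_compose)
  then show "((\<lambda>x. F (y + t *\<^sub>R (x - y))) has_derivative (\<lambda>h. (t *\<^sub>R J (y + t *\<^sub>R (x - y))) *v h)) (at x)"
    by (simp add: matrix_vector_mult_scaleR scaleR_matrix_vector_assoc)
qed

lemma dilation_eq: "y + t *\<^sub>R (x - y) = (1 - t) *\<^sub>R y + t *\<^sub>R (x::pt)"
  by (simp add: algebra_simps)

text \<open>The field \<open>f\<close> is a Borel representative of \<open>\<nabla>v\<close>, extended by zero to the plane.\<close>
locale harmonic_trace = star_polygon +
  fixes v g :: "pt \<Rightarrow> real" and f :: "pt \<Rightarrow> pt"
  assumes tr: "has_trace P v g"
    and lin: "\<And>e t. e \<in> edges P \<Longrightarrow> t \<in> {0..1} \<Longrightarrow>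
      g (linepath (fst e) (snd e) t) = (1 - t) * g (fst e) + t * g (snd e)"
    and harmonic: "weak_div (region P) (grad (region P) v) (\<lambda>x. 0)"
    and f: "sq_int f" and f0: "\<And>x. x \<notin> region P \<Longrightarrow> f x = 0"
    and fg: "AE x in lebesgue_on (region P). f x = grad (region P) v x"
begin

lemma v_H1: "v \<in> H1 (region P)" using tr by (simp add: has_trace_def)

lemma f_borel [measurable]: "f \<in> borel_measurable borel" by (rule sq_int_measurable[OF f])

lemma f_int: "integrable lborel f"
  by (rule sq_int_bounded_support_integrable[OF f bounded_region f0])

text \<open>The trace formula with the term containing \<open>v\<close> removed: the interior
  pairing with a solenoidal field sees only the boundary values \<open>g\<close>.\<close>

lemma green:
  assumes \<psi>: "C1_jacobian \<psi> J" and J0: "\<And>x. x \<in> region P \<Longrightarrow> trace (J x) = 0"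
  shows "(LINT x|lborel. f x \<bullet> \<psi> x) = (\<Sum>e\<in>edges P. edge_integral e (\<lambda>x. g x * (\<psi> x \<bullet> edge_normal e)))"
proof -
  have "(LINT x|lborel. f x \<bullet> \<psi> x) = (LINT x|lebesgue_on (region P). grad (region P) v x \<bullet> \<psi> x)"
    by (rule integral_inner_representative[OF open_region grad_L2[OF v_H1] f_borel f0 fg, symmetric])
       (auto intro: borel_measurable_continuous_onI C1_jacobian_continuous[OF \<psi>])
  also have "\<dots> = (LINT x|lebesgue_on (region P). v x * trace (J x) + grad (region P) v x \<bullet> \<psi> x)"
    by (rule Bochner_Integration.integral_cong) (auto simp: J0)
  also have "\<dots> = (\<Sum>e\<in>edges P. edge_integral e (\<lambda>x. g x * (\<psi> x \<bullet> edge_normal e)))"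
    using tr \<psi> by (simp add: has_trace_def)
  finally show ?thesis .
qed

text \<open>The kernel centred at \<open>x\<close> is an admissible test function for the
  harmonicity of \<open>v\<close> as long as its closed ball fits into the cell.\<close>

lemma trace_moll_jac_zero:
  assumes e: "0 < e" and x: "cball x e \<subseteq> region P"
  shows "trace (moll_jac e f x) = 0"
proof -
  have "(LINT z|lborel. f z \<bullet> - mkern_grad e (x - z)) = (LINT z|lebesgue_on (region P). grad (region P) v z \<bullet> - mkern_grad e (x - z))"
    by (rule integral_inner_representative[OF open_region grad_L2[OF v_H1] f_borel f0 fg, symmetric])
       (auto intro!: borel_measurable_continuous_onI continuous_intros continuous_on_compose2[OF mkern_grad_continuous[OF e, of UNIV]])
  also have "\<dots> = 0"
    using harmonic mkern_test_fun[OF e x] unfolding weak_div_def by fastforce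
  finally show ?thesis by (simp add: trace_moll_jac[OF e f_int])
qed

text \<open>The inner product of \<open>f\<close> with its energy-preserving dilate; the prefactor
  \<open>t\<close> normalises the dilation. Half the squared distance of the two is
  \<open>energy f - pairing y t\<close>.\<close>

definition pairing :: "pt \<Rightarrow> real \<Rightarrow> real" where
  "pairing y t = t * (LINT x|lborel. f (y + t *\<^sub>R (x - y)) \<bullet> f x)"

lemma sq_int_dilation:
  assumes "t \<noteq> 0" "sq_int (F :: pt \<Rightarrow> pt)" shows "sq_int (\<lambda>x. F (y + t *\<^sub>R (x - y)))"
    "energy (\<lambda>x. F (y + t *\<^sub>R (x - y))) = energy F / t\<^sup>2"
  unfolding dilation_eq using sq_int_affine[OF assms(2,1)] energy_affine[OF assms(2,1)] by auto

text \<open>The closure dilated by \<open>t < 1\<close> is a compact subset of the open region and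
  contains all dilates with smaller ratio, so one \<open>\<epsilon>\<close> serves for all of
  them.\<close>

lemma inner_region_margin:
  assumes y: "y \<in> ball c r" and t: "0 < t" "t < 1"
  shows "\<exists>\<epsilon>>0. \<forall>s x. 0 \<le> s \<longrightarrow> s \<le> t \<longrightarrow> x \<in> closure (region P) \<longrightarrow> cball (y + s *\<^sub>R (x - y)) \<epsilon> \<subseteq> region P"
proof -
  define K where "K = (\<lambda>x. y + t *\<^sub>R (x - y)) ` closure (region P)"
  have "compact K"
    unfolding K_def by (intro compact_continuous_image continuous_intros) (simp add: bounded_region)
  moreover have "K \<subseteq> region P" using ray_in_region[OF y] t by (auto simp: K_def)
  ultimately obtain \<epsilon> where \<epsilon>: "\<epsilon> > 0" "(\<Union>x\<in>K. cball x \<epsilon>) \<subseteq> region P"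
    using compact_subset_open_imp_cball_epsilon_subset[OF _ open_region] by metis
  \<comment> \<open>A dilation by \<open>s < t\<close> is the dilation by \<open>t\<close> applied
    to a point already dilated by \<open>s / t\<close>.\<close>
  have "y + s *\<^sub>R (x - y) \<in> K" if s: "0 \<le> s" "s \<le> t" and x: "x \<in> closure (region P)" for s x
  proof (cases "s = t")
    case False
    then have "y + (s / t) *\<^sub>R (x - y) \<in> closure (region P)"
      using closure_subset by (intro subsetD[OF closure_subset] ray_in_region[OF y x]) (use s t in auto)
    moreover have "y + s *\<^sub>R (x - y) = y + t *\<^sub>R ((y + (s / t) *\<^sub>R (x - y)) - y)" using t by simp
    ultimately show ?thesis unfolding K_def by blast
  next
    case True
    then show ?thesis unfolding K_def using x by blast
  qed
  then show ?thesis using \<epsilon> by (intro exI[of _ \<epsilon>]) blast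
qed

text \<open>For the mollified field in place of the dilated factor, \<open>green\<close> turns the
  pairing into \<open>s * fan_flux\<close>, whose variation is known. Since \<open>t' < 1\<close>, a
  small mollification radius keeps the field solenoidal on all dilates involved, and the resulting
  constant does not depend on that radius.\<close>

lemma pairing_variation:
  assumes y: "y \<in> ball c r"
  shows "\<exists>K\<ge>0. \<forall>t t'. 1/2 \<le> t \<longrightarrow> t < t' \<longrightarrow> t' < 1 \<longrightarrow> \<bar>pairing y t' - pairing y t\<bar> \<le> K * sqrt (t' - t)"
proof -
  obtain K0 where K0: "K0 \<ge> 0" and var: "\<And>F J t t'. C1_jacobian F J \<Longrightarrow> sq_int F \<Longrightarrow> 1/2 \<le> t \<Longrightarrow> t < t' \<Longrightarrow> t' \<le> 1 \<Longrightarrow>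
    (\<forall>e\<in>edges P. \<forall>\<tau>\<in>{0..1}. \<forall>s\<in>{t..t'}. trace (J (y + s *\<^sub>R ray y e \<tau>)) = 0) \<Longrightarrow>
    \<bar>t' * fan_flux P g y F t' - t * fan_flux P g y F t\<bar> \<le> K0 * sqrt (t' - t) * (1 + energy F)"
    using fan_flux_variation[OF y, of g] by blast
  define K where "K = K0 * (1 + 10 * energy f)"
  show ?thesis
  proof (intro exI[of _ K] conjI allI impI)
    show "0 \<le> K" using K0 energy_nonneg[of f] by (simp add: K_def)
    fix t t' :: real assume t: "1/2 \<le> t" "t < t'" "t' < 1"
    obtain \<epsilon> where \<epsilon>: "\<epsilon> > 0" and marg: "\<And>s x. 0 \<le> s \<Longrightarrow> s \<le> t' \<Longrightarrow> x \<in> closure (region P) \<Longrightarrow> cball (y + s *\<^sub>R (x - y)) \<epsilon> \<subseteq> region P"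
      using inner_region_margin[OF y, of t'] t by auto
    have "\<bar>pairing y t' - pairing y t\<bar> \<le> K * sqrt (t' - t) + \<eta>" if \<eta>: "\<eta> > 0" for \<eta>
    proof -
      \<comment> \<open>Replacing \<open>pairing\<close> by the flux costs at most
        \<open>\<delta> * (energy f + 4)\<close> at each of the two ratios; this choice makes the
        sum \<open>\<eta>\<close>.\<close>
      define \<delta> where "\<delta> = \<eta> / (2 * (energy f + 4))"
      have \<delta>: "\<delta> > 0" using \<eta> energy_nonneg[of f] by (simp add: \<delta>_def)
      then have \<delta>2: "\<delta>\<^sup>2 > 0" by simp
      obtain d where d: "d > 0" "\<And>e. 0 < e \<Longrightarrow> e < d \<Longrightarrow>
        sq_int (\<lambda>x. moll e f x - f x) \<and> energy (\<lambda>x. moll e f x - f x) \<le> \<delta>\<^sup>2"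
        using moll_tendsto[OF f f_int \<delta>2] by blast
      \<comment> \<open>\<open>d\<close> controls the energy error of mollification,
        \<open>\<epsilon>\<close> keeps the kernel balls of dilated points inside the cell.\<close>
      define e where "e = min (d / 2) \<epsilon>"
      have e: "0 < e" "e < d" "e \<le> \<epsilon>" using d(1) \<epsilon> by (auto simp: e_def)
      define F where "F = moll e f"
      define J where "J = moll_jac e f"
      have FJ: "C1_jacobian F J" unfolding F_def J_def by (rule moll_C1_jacobian[OF e(1) f_int])
      have Fs: "sq_int F" "energy F \<le> 10 * energy f" unfolding F_def by (rule sq_int_moll[OF e(1) f f_int])+
      have Fd: "sq_int (\<lambda>x. F x - f x)" "energy (\<lambda>x. F x - f x) \<le> \<delta>\<^sup>2" using d(2)[OF e(1,2)] by (auto simp: F_def)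
      have J0: "trace (J (y + s *\<^sub>R (x - y))) = 0" if "0 \<le> s" "s \<le> t'" "x \<in> closure (region P)" for s x
        unfolding J_def
      proof (rule trace_moll_jac_zero[OF e(1)])
        show "cball (y + s *\<^sub>R (x - y)) e \<subseteq> region P"
          using marg[OF that] subset_cball[OF e(3), of "y + s *\<^sub>R (x - y)"] by blast
      qed
      have J0': "\<forall>ed\<in>edges P. \<forall>\<tau>\<in>{0..1}. \<forall>s\<in>{t..t'}. trace (J (y + s *\<^sub>R ray y ed \<tau>)) = 0"
      proof (intro ballI)
        fix ed \<tau> s assume "ed \<in> edges P" "\<tau> \<in> {0..1::real}" "s \<in> {t..t'}"
        then have "y + ray y ed \<tau> \<in> closure (region P)" "0 \<le> s" "s \<le> t'"
          using ray_bdry[of ed \<tau> y] bdry_subset_closure t by auto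
        from J0[OF this(2,3,1)] show "trace (J (y + s *\<^sub>R ray y ed \<tau>)) = 0" by simp
      qed
      \<comment> \<open>For \<open>s \<le> t'\<close> the dilated field is solenoidal on the cell,
        so \<open>green\<close> applies to it.\<close>
      have flux: "(LINT x|lborel. f x \<bullet> F (y + s *\<^sub>R (x - y))) = fan_flux P g y F s" if s: "0 \<le> s" "s \<le> t'" for s
      proof -
        have "(LINT x|lborel. f x \<bullet> F (y + s *\<^sub>R (x - y))) =
          (\<Sum>e\<in>edges P. edge_integral e (\<lambda>x. g x * (F (y + s *\<^sub>R (x - y)) \<bullet> edge_normal e)))"
        proof (rule green[OF C1_jacobian_dilation[OF FJ]])
          fix x assume "x \<in> region P"
          then have "trace (J (y + s *\<^sub>R (x - y))) = 0" using s closure_subset by (intro J0) auto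
          then show "trace (s *\<^sub>R J (y + s *\<^sub>R (x - y))) = 0"
            by (simp add: trace_def scaleR_vec_def sum_distrib_left[symmetric])
        qed
        also have "\<dots> = fan_flux P g y F s"
          by (rule fan_flux_eq_edge_integral[OF simple lin])
        finally show ?thesis .
      qed
      have close: "\<bar>pairing y s - s * fan_flux P g y F s\<bar> \<le> \<delta> * (energy f + 4)" if s: "1/2 \<le> s" "s \<le> t'" for s
      proof -
        have s0: "s \<noteq> 0" "0 \<le> s" using s by auto
        note D1 = sq_int_dilation[OF s0(1) Fd(1), of y]
        note D2 = sq_int_dilation(1)[OF s0(1) f, of y] and D3 = sq_int_dilation(1)[OF s0(1) Fs(1), of y]
        have "s * fan_flux P g y F s - pairing y s = s * (LINT x|lborel. f x \<bullet> (F (y + s *\<^sub>R (x - y)) - f (y + s *\<^sub>R (x - y))))"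
          unfolding pairing_def flux[OF s0(2) s(2), symmetric] inner_diff_right
          using integrable_inner_sq_int[OF f D2] integrable_inner_sq_int[OF f D3]
          by (simp add: right_diff_distrib inner_commute)
        then have "\<bar>pairing y s - s * fan_flux P g y F s\<bar> = \<bar>s * (LINT x|lborel. f x \<bullet> (F (y + s *\<^sub>R (x - y)) - f (y + s *\<^sub>R (x - y))))\<bar>"
          by linarith
        also have "\<dots> = s * \<bar>LINT x|lborel. f x \<bullet> (F (y + s *\<^sub>R (x - y)) - f (y + s *\<^sub>R (x - y)))\<bar>"
          using s0 by (simp only: abs_mult abs_of_nonneg)
        also have "\<dots> \<le> 1 * \<bar>LINT x|lborel. f x \<bullet> (F (y + s *\<^sub>R (x - y)) - f (y + s *\<^sub>R (x - y)))\<bar>"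
          using s t by (intro mult_right_mono) auto
        also have "\<dots> \<le> 1 * (\<delta> * energy f + energy (\<lambda>x. F (y + s *\<^sub>R (x - y)) - f (y + s *\<^sub>R (x - y))) / \<delta>)"
          by (intro mult_left_mono integral_inner_le f D1 \<delta>) auto
        also have "energy (\<lambda>x. F (y + s *\<^sub>R (x - y)) - f (y + s *\<^sub>R (x - y))) \<le> 4 * \<delta>\<^sup>2"
        proof -
          have "(1/2)\<^sup>2 \<le> s\<^sup>2" using s by (intro power_mono) auto
          then have "1/4 \<le> s\<^sup>2" by (simp add: power2_eq_square)
          then have "energy (\<lambda>x. F x - f x) / s\<^sup>2 \<le> \<delta>\<^sup>2 / (1/4)"
            using Fd(2) by (intro frac_le) auto
          then show ?thesis unfolding D1(2) by simp
        qed
        then have "1 * (\<delta> * energy f + energy (\<lambda>x. F (y + s *\<^sub>R (x - y)) - f (y + s *\<^sub>R (x - y))) / \<delta>)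
            \<le> 1 * (\<delta> * energy f + 4 * \<delta>\<^sup>2 / \<delta>)"
          using \<delta> by (intro mult_left_mono add_left_mono divide_right_mono) auto
        also have "\<dots> = \<delta> * (energy f + 4)" using \<delta> by (simp add: power2_eq_square algebra_simps)
        finally show ?thesis .
      qed
      have "\<bar>t' * fan_flux P g y F t' - t * fan_flux P g y F t\<bar> \<le> K0 * sqrt (t' - t) * (1 + energy F)"
        by (rule var[OF FJ Fs(1) t(1,2) _ J0']) (use t in simp)
      also have "\<dots> \<le> K0 * sqrt (t' - t) * (1 + 10 * energy f)"
        using K0 t Fs(2) by (intro mult_left_mono) auto
      also have "\<dots> = K * sqrt (t' - t)" by (simp add: K_def)
      finally have "\<bar>pairing y t' - pairing y t\<bar> \<le> K * sqrt (t' - t) + 2 * (\<delta> * (energy f + 4))"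
        using close[of t] close[of t'] t by linarith
      also have "2 * (\<delta> * (energy f + 4)) = \<eta>"
      proof -
        have "0 < energy f + 4" using energy_nonneg[of f] by linarith
        then have "2 * (energy f + 4) \<noteq> 0" by simp
        then have "\<delta> * (2 * (energy f + 4)) = \<eta>"
          unfolding \<delta>_def times_divide_eq_left by (rule nonzero_mult_div_cancel_right)
        then show ?thesis by (simp add: algebra_simps)
      qed
      finally show ?thesis .
    qed
    then show "\<bar>pairing y t' - pairing y t\<bar> \<le> K * sqrt (t' - t)" by (rule field_le_epsilon)
  qed
qed

text \<open>At ratio 1 the pairing equals \<open>energy f\<close>. This endpoint lies outside
  \<open>pairing_variation\<close> and is approached through ratios \<open>t'\<close> close to 1,
  using continuity of dilations.\<close>

lemma energy_sub_pairing_le: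
  assumes y: "y \<in> ball c r"
  shows "\<exists>K\<ge>0. \<forall>t. 1/2 \<le> t \<longrightarrow> t < 1 \<longrightarrow> energy f - pairing y t \<le> K * sqrt (1 - t)"
proof -
  obtain K where K: "K \<ge> 0" and var: "\<And>t t'. 1/2 \<le> t \<Longrightarrow> t < t' \<Longrightarrow> t' < 1 \<Longrightarrow> \<bar>pairing y t' - pairing y t\<bar> \<le> K * sqrt (t' - t)"
    using pairing_variation[OF y] by blast
  show ?thesis
  proof (intro exI[of _ K] conjI allI impI K)
    fix t :: real assume t: "1/2 \<le> t" "t < 1"
    show "energy f - pairing y t \<le> K * sqrt (1 - t)"
    proof (rule field_le_epsilon)
      fix \<eta> :: real assume \<eta>: "\<eta> > 0"
      \<comment> \<open>Chosen so that \<open>2 * \<mu> * energy f + 2 * \<mu>\<close> equals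
        \<open>\<eta>\<close>; the summand 2 covers the case of zero energy.\<close>
      define \<mu> where "\<mu> = \<eta> / (2 * energy f + 2)"
      have \<mu>: "\<mu> > 0" using \<eta> energy_nonneg[of f] by (simp add: \<mu>_def add_nonneg_pos)
      then have \<mu>2: "\<mu>\<^sup>2 > 0" by simp
      obtain d where d: "d > 0"
        "\<And>p a. norm p < d \<Longrightarrow> \<bar>a - 1\<bar> < d \<Longrightarrow> energy (\<lambda>x. f (p + a *\<^sub>R x) - f x) < \<mu>\<^sup>2"
        using energy_affine_continuous[OF f \<mu>2] by blast
      \<comment> \<open>The three bounds ensure \<open>t < t'\<close>, smallness of both the shift
        \<open>(1 - t') *\<^sub>R y\<close> and the ratio change against \<open>d\<close>, and a
        loss from the prefactor \<open>t'\<close> of at most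
        \<open>\<mu> * energy f\<close>.\<close>
      define \<alpha> where "\<alpha> = min ((1 - t) / 2) (min (d / (2 * (norm y + 1))) (\<mu> / 2))"
      have \<alpha>: "0 < \<alpha>" "\<alpha> \<le> (1 - t) / 2" "\<alpha> \<le> d / (2 * (norm y + 1))" "\<alpha> \<le> \<mu> / 2"
      proof -
        show "0 < \<alpha>" using t d(1) \<mu> by (auto simp: \<alpha>_def add_nonneg_pos)
        show "\<alpha> \<le> (1 - t) / 2" unfolding \<alpha>_def by (rule min.cobounded1)
        show "\<alpha> \<le> d / (2 * (norm y + 1))" "\<alpha> \<le> \<mu> / 2"
          unfolding \<alpha>_def by (meson min.cobounded1 min.cobounded2 order_trans)+
      qed
      define t' where "t' = 1 - \<alpha>"
      have t': "t < t'" "t' < 1" "0 < t'" using \<alpha> t by (auto simp: t'_def)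
      have "\<alpha> * (norm y + 1) \<le> d / (2 * (norm y + 1)) * (norm y + 1)"
        using \<alpha>(3) by (intro mult_right_mono) auto
      also have "\<dots> = d / 2"
      proof -
        have "norm y + 1 \<noteq> 0" using norm_ge_zero[of y] by linarith
        then show ?thesis by (simp add: field_simps)
      qed
      finally have \<alpha>d: "\<alpha> * norm y + \<alpha> \<le> d / 2" by (simp add: distrib_left)
      have "0 \<le> \<alpha> * norm y" using \<alpha>(1) by simp
      then have "\<alpha> * norm y < d" "\<alpha> < d" using \<alpha>d \<alpha>(1) d(1) by linarith+
      then have "norm ((1 - t') *\<^sub>R y) < d" "\<bar>t' - 1\<bar> < d"
        using \<alpha>(1) by (auto simp: t'_def)
      then have en: "energy (\<lambda>x. f (y + t' *\<^sub>R (x - y)) - f x) < \<mu>\<^sup>2"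
        unfolding dilation_eq by (rule d(2))
      have t0: "t' \<noteq> 0" using t' by simp
      note D = sq_int_dilation(1)[OF t0 f, of y]
      have "(LINT x|lborel. f (y + t' *\<^sub>R (x - y)) \<bullet> f x) = energy f + (LINT x|lborel. f x \<bullet> (f (y + t' *\<^sub>R (x - y)) - f x))"
        using integrable_inner_sq_int[OF f D] integrable_inner_sq_int[OF f f]
        by (simp add: inner_diff_right energy_def power2_norm_eq_inner inner_commute)
      moreover have "\<bar>LINT x|lborel. f x \<bullet> (f (y + t' *\<^sub>R (x - y)) - f x)\<bar> \<le> \<mu> * energy f + energy (\<lambda>x. f (y + t' *\<^sub>R (x - y)) - f x) / \<mu>"
        by (rule integral_inner_le[OF f sq_int_diff[OF D f] \<mu>])
      moreover have "energy (\<lambda>x. f (y + t' *\<^sub>R (x - y)) - f x) / \<mu> \<le> \<mu>"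
        using en \<mu> by (simp add: field_simps power2_eq_square)
      ultimately have "energy f - (\<mu> * energy f + \<mu>) \<le> (LINT x|lborel. f (y + t' *\<^sub>R (x - y)) \<bullet> f x)"
        by linarith
      then have "t' * (energy f - (\<mu> * energy f + \<mu>)) \<le> pairing y t'"
        unfolding pairing_def using t' by (intro mult_left_mono) auto
      moreover have "energy f - \<alpha> * energy f - (\<mu> * energy f + \<mu>) \<le> t' * (energy f - (\<mu> * energy f + \<mu>))"
      proof -
        have "0 \<le> \<alpha> * (\<mu> * energy f + \<mu>)" using \<alpha> \<mu> energy_nonneg[of f] by simp
        then show ?thesis by (simp add: t'_def algebra_simps)
      qed
      moreover have "\<alpha> * energy f \<le> \<mu> * energy f"
        using \<alpha>(4) \<mu> energy_nonneg[of f] by (intro mult_right_mono) auto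
      moreover have "\<mu> * energy f + (\<mu> * energy f + \<mu>) \<le> \<eta>"
      proof -
        have "\<mu> * (2 * energy f + 2) = \<eta>" using energy_nonneg[of f] by (simp add: \<mu>_def)
        then show ?thesis using \<mu> by (simp add: algebra_simps)
      qed
      ultimately have 1: "energy f - pairing y t' \<le> \<eta>" by linarith
      have "\<bar>pairing y t' - pairing y t\<bar> \<le> K * sqrt (t' - t)" by (rule var[OF t(1) t'(1,2)])
      also have "\<dots> \<le> K * sqrt (1 - t)" using K t' by (intro mult_left_mono) auto
      finally show "energy f - pairing y t \<le> K * sqrt (1 - t) + \<eta>" using 1 by linarith
    qed
  qed
qed

text \<open>Expanding the square: \<open>f\<close> and its normalised dilate have the same energy,
  so their squared distance is \<open>2 * (energy f - pairing y t)\<close>.\<close>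

lemma dilation_modulus:
  assumes y: "y \<in> ball c r"
  shows "\<exists>K\<ge>0. \<forall>t. 1/2 \<le> t \<longrightarrow> t < 1 \<longrightarrow> energy (\<lambda>x. t *\<^sub>R f (y + t *\<^sub>R (x - y)) - f x) \<le> K * sqrt (1 - t)"
proof -
  obtain K where K: "K \<ge> 0" and le: "\<And>t. 1/2 \<le> t \<Longrightarrow> t < 1 \<Longrightarrow> energy f - pairing y t \<le> K * sqrt (1 - t)"
    using energy_sub_pairing_le[OF y] by blast
  have "energy (\<lambda>x. t *\<^sub>R f (y + t *\<^sub>R (x - y)) - f x) \<le> 2 * K * sqrt (1 - t)" if t: "1/2 \<le> t" "t < 1" for t
  proof -
    have t0: "t \<noteq> 0" using t by simp
    note D = sq_int_dilation[OF t0 f, of y]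
    have "energy (\<lambda>x. t *\<^sub>R f (y + t *\<^sub>R (x - y))) = t\<^sup>2 * energy (\<lambda>x. f (y + t *\<^sub>R (x - y)))"
      by (simp add: energy_def power_mult_distrib)
    also have "\<dots> = energy f" using D(2) t0 by simp
    finally have "energy (\<lambda>x. t *\<^sub>R f (y + t *\<^sub>R (x - y)) - f x) = 2 * (energy f - pairing y t)"
      using energy_diff_expand[OF sq_int_scaleR[OF D(1), of t] f] by (simp add: pairing_def)
    then show ?thesis using le[OF t] by simp
  qed
  then show ?thesis using K by (intro exI[of _ "2 * K"]) auto
qed

text \<open>Dilating about one centre and back about another one yields a translation.\<close>
lemma translation_modulus_direction:
  assumes y: "y \<in> ball c r" "y' \<in> ball c r"
  shows "\<exists>K\<ge>0. \<forall>a. 0 < a \<longrightarrow> a \<le> 1/2 \<longrightarrow> energy (\<lambda>x. f (x + a *\<^sub>R (y - y')) - f x) \<le> K * sqrt a"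
proof -
  obtain K where K: "K \<ge> 0" and le: "\<And>t. 1/2 \<le> t \<Longrightarrow> t < 1 \<Longrightarrow> energy (\<lambda>x. t *\<^sub>R f (y + t *\<^sub>R (x - y)) - f x) \<le> K * sqrt (1 - t)"
    using dilation_modulus[OF y(1)] by blast
  obtain K' where K': "K' \<ge> 0" and le': "\<And>t. 1/2 \<le> t \<Longrightarrow> t < 1 \<Longrightarrow> energy (\<lambda>x. t *\<^sub>R f (y' + t *\<^sub>R (x - y')) - f x) \<le> K' * sqrt (1 - t)"
    using dilation_modulus[OF y(2)] by blast
  have "energy (\<lambda>x. f (x + a *\<^sub>R (y - y')) - f x) \<le> (2 * K + 2 * K') * sqrt a" if a: "0 < a" "a \<le> 1/2" for a
  proof -
    define t where "t = 1 - a"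
    have t: "1/2 \<le> t" "t < 1" "t \<noteq> 0" "1 - t = a" using a by (auto simp: t_def)
    note S = sq_int_scaleR[OF sq_int_dilation(1)[OF t(3) f, of y], of t]
    note S' = sq_int_scaleR[OF sq_int_dilation(1)[OF t(3) f, of y'], of t]
    define h where "h x = f (x + a *\<^sub>R (y - y')) - f x" for x
    have hs: "sq_int h"
      unfolding h_def using sq_int_affine[OF f, of 1 "a *\<^sub>R (y - y')"] by (intro sq_int_diff f) (simp add: add.commute)
    \<comment> \<open>With \<open>a = 1 - t\<close>, the two dilations differ by the fixed shift
      \<open>a *\<^sub>R (y - y')\<close>. The difference of the dilates is therefore the normalised
      dilate of \<open>h\<close> about \<open>y'\<close>, and has the energy of
      \<open>h\<close>.\<close>
    have "energy (\<lambda>x. t *\<^sub>R f (y + t *\<^sub>R (x - y)) - t *\<^sub>R f (y' + t *\<^sub>R (x - y'))) = energy (\<lambda>x. t *\<^sub>R h (a *\<^sub>R y' + t *\<^sub>R x))"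
    proof (rule arg_cong[where f=energy], rule ext)
      fix x
      have "y + t *\<^sub>R (x - y) = (a *\<^sub>R y' + t *\<^sub>R x) + a *\<^sub>R (y - y')" "y' + t *\<^sub>R (x - y') = a *\<^sub>R y' + t *\<^sub>R x"
        by (simp_all add: t_def algebra_simps)
      then show "t *\<^sub>R f (y + t *\<^sub>R (x - y)) - t *\<^sub>R f (y' + t *\<^sub>R (x - y')) = t *\<^sub>R h (a *\<^sub>R y' + t *\<^sub>R x)"
        by (simp only: h_def scaleR_diff_right)
    qed
    also have "\<dots> = t\<^sup>2 * energy (\<lambda>x. h (a *\<^sub>R y' + t *\<^sub>R x))"
      by (simp add: energy_def power_mult_distrib)
    also have "\<dots> = energy h" using energy_affine[OF hs t(3)] t(3) by simp
    finally have "energy h = energy (\<lambda>x. t *\<^sub>R f (y + t *\<^sub>R (x - y)) - t *\<^sub>R f (y' + t *\<^sub>R (x - y')))" ..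
    also have "\<dots> \<le> 2 * energy (\<lambda>x. t *\<^sub>R f (y + t *\<^sub>R (x - y)) - f x) + 2 * energy (\<lambda>x. f x - t *\<^sub>R f (y' + t *\<^sub>R (x - y')))"
      by (rule energy_diff_triangle[OF S f S'])
    also have "energy (\<lambda>x. f x - t *\<^sub>R f (y' + t *\<^sub>R (x - y'))) = energy (\<lambda>x. t *\<^sub>R f (y' + t *\<^sub>R (x - y')) - f x)"
      by (rule energy_diff_commute)
    finally show ?thesis using le[OF t(1,2)] le'[OF t(1,2)] unfolding h_def t(4) by (simp add: algebra_simps)
  qed
  then show ?thesis using K K' by (intro exI[of _ "2 * K + 2 * K'"]) auto
qed

text \<open>The centres are \<open>c\<close> and a point at distance \<open>r / 2\<close> from it
  along the axis. Long steps are covered by the trivial energy bound, negative ones by translating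
  the difference back.\<close>

lemma translation_modulus_axis:
  "\<exists>K\<ge>0. \<forall>a. energy (\<lambda>x. f (x + a *\<^sub>R axis i 1) - f x) \<le> K * sqrt \<bar>a\<bar>"
proof -
  define b where "b = r / 2"
  have b: "b > 0" using r by (simp add: b_def)
  have "c + b *\<^sub>R axis i 1 \<in> ball c r" "c \<in> ball c r"
    using r by (auto simp: dist_norm norm_axis_1 b_def)
  from translation_modulus_direction[OF this] obtain K where K: "K \<ge> 0"
    and le: "\<And>a. 0 < a \<Longrightarrow> a \<le> 1/2 \<Longrightarrow> energy (\<lambda>x. f (x + (a * b) *\<^sub>R axis i 1) - f x) \<le> K * sqrt a"
    by auto
  \<comment> \<open>The first term rescales a step \<open>a\<close> to the ratio
    \<open>a / b\<close>, admissible up to 1/2; the second absorbs the bound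
    \<open>4 * energy f\<close> for steps longer than \<open>b / 2\<close>.\<close>
  define K' where "K' = K / sqrt b + 4 * energy f / sqrt (b / 2)"
  have K'0: "0 \<le> K'" using K b energy_nonneg[of f] by (simp add: K'_def)
  have sh: "sq_int (\<lambda>x. f (x + p))" "energy (\<lambda>x. f (x + p)) = energy f" for p
    using sq_int_affine[OF f, of 1 p] energy_affine[OF f, of 1 p] by (auto simp: add.commute)
  have pos: "energy (\<lambda>x. f (x + a *\<^sub>R axis i 1) - f x) \<le> K' * sqrt a" if a: "0 < a" for a
  proof (cases "a \<le> b / 2")
    case True
    have "energy (\<lambda>x. f (x + ((a / b) * b) *\<^sub>R axis i 1) - f x) \<le> K * sqrt (a / b)"
      using True a b by (intro le) (auto simp: field_simps)
    then have "energy (\<lambda>x. f (x + a *\<^sub>R axis i 1) - f x) \<le> K / sqrt b * sqrt a"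
      using b by (simp add: real_sqrt_divide)
    also have "\<dots> \<le> K' * sqrt a"
      unfolding K'_def using b a energy_nonneg[of f] by (intro mult_right_mono) auto
    finally show ?thesis .
  next
    case False
    have "energy (\<lambda>x. f (x + a *\<^sub>R axis i 1) + (-1) *\<^sub>R f x) \<le> 2 * energy (\<lambda>x. f (x + a *\<^sub>R axis i 1)) + 2 * energy (\<lambda>x. (-1) *\<^sub>R f x)"
      by (intro energy_add_le sh sq_int_scaleR f)
    then have "energy (\<lambda>x. f (x + a *\<^sub>R axis i 1) - f x) \<le> 4 * energy f"
      by (simp add: sh(2)) (simp add: energy_def)
    also have "\<dots> = 4 * energy f / sqrt (b / 2) * sqrt (b / 2)" using b by simp
    also have "\<dots> \<le> K' * sqrt a"
      using False b K K'0 energy_nonneg[of f] by (intro mult_mono) (auto simp: K'_def)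
    finally show ?thesis .
  qed
  have "energy (\<lambda>x. f (x + a *\<^sub>R axis i 1) - f x) \<le> K' * sqrt \<bar>a\<bar>" for a
  proof -
    consider "a = 0" | "0 < a" | "a < 0" by linarith
    then show ?thesis
    proof cases
      case 3
      define h where "h x = f (x + (- a) *\<^sub>R axis i 1) - f x" for x
      have "sq_int h" unfolding h_def by (intro sq_int_diff sh f)
      from energy_affine[OF this, of 1 "a *\<^sub>R axis i 1"]
      have "energy h = energy (\<lambda>x. f x - f (x + a *\<^sub>R axis i 1))" by (simp add: h_def add.commute)
      also have "\<dots> = energy (\<lambda>x. f (x + a *\<^sub>R axis i 1) - f x)" by (rule energy_diff_commute)
      finally have "energy (\<lambda>x. f (x + a *\<^sub>R axis i 1) - f x) = energy h" ..
      also have "\<dots> \<le> K' * sqrt \<bar>a\<bar>" using pos[of "- a"] 3 unfolding h_def[abs_def] by simp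
      finally show ?thesis .
    qed (use pos in \<open>auto simp: energy_def\<close>)
  qed
  then show ?thesis using K'0 by blast
qed

text \<open>An arbitrary translation is split into two axis-parallel ones, which yields the modulus
  required by \<open>higher_integrability\<close>.\<close>

lemma grad_higher_integrability: "grad (region P) v \<in> Lp (2 + 1/4) (region P)"
proof -
  obtain K1 where K1: "K1 \<ge> 0" "\<And>a. energy (\<lambda>x. f (x + a *\<^sub>R axis 1 1) - f x) \<le> K1 * sqrt \<bar>a\<bar>"
    using translation_modulus_axis[of 1] by blast
  obtain K2 where K2: "K2 \<ge> 0" "\<And>a. energy (\<lambda>x. f (x + a *\<^sub>R axis 2 1) - f x) \<le> K2 * sqrt \<bar>a\<bar>"
    using translation_modulus_axis[of 2] by blast
  have sh: "sq_int (\<lambda>x. f (x + p))" for p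
    using sq_int_affine[OF f, of 1 p] by (simp add: add.commute)
  have "energy (\<lambda>x. f (x - h) - f x) \<le> (2 * K1 + 2 * K2) * sqrt (norm h)" for h :: pt
  proof -
    define p where "p = (- h $ 2) *\<^sub>R (axis 2 1 :: pt)"
    define q where "q = (- h $ 1) *\<^sub>R (axis 1 1 :: pt)"
    have hpq: "- h = q + p" by (simp add: p_def q_def pt_eq_iff axis_def)
    define k where "k x = f (x + q) - f x" for x
    have ks: "sq_int k" unfolding k_def by (intro sq_int_diff sh f)
    have "energy (\<lambda>x. f (x - h) - f x) = energy (\<lambda>x. f ((x + p) + q) - f x)"
    proof -
      have "x - h = (x + p) + q" for x using hpq by (metis add.commute add.left_commute diff_conv_add_uminus)
      then show ?thesis by (simp only:)
    qed
    also have "\<dots> \<le> 2 * energy (\<lambda>x. f ((x + p) + q) - f (x + p)) + 2 * energy (\<lambda>x. f (x + p) - f x)"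
      using energy_diff_triangle[OF sh[of "p + q"] sh[of p] f] by (simp add: add.assoc)
    also have "energy (\<lambda>x. f ((x + p) + q) - f (x + p)) = energy k"
      using energy_affine[OF ks, of 1 p] by (simp add: k_def add.commute)
    also have "energy k \<le> K1 * sqrt \<bar>- h $ 1\<bar>" unfolding k_def q_def by (rule K1(2))
    also have "\<dots> \<le> K1 * sqrt (norm h)"
      using K1(1) component_le_norm_cart[of h 1] by (intro mult_left_mono) auto
    also have "energy (\<lambda>x. f (x + p) - f x) \<le> K2 * sqrt \<bar>- h $ 2\<bar>" unfolding p_def by (rule K2(2))
    also have "\<dots> \<le> K2 * sqrt (norm h)"
      using K2(1) component_le_norm_cart[of h 2] by (intro mult_left_mono) auto
    finally show ?thesis by (simp add: algebra_simps)
  qed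
  then have "integrable lborel (\<lambda>x. norm (f x) powr (2 + 1/4))"
    using K1(1) K2(1) by (intro higher_integrability[OF f f_int, of "2 * K1 + 2 * K2"]) auto
  then have fi: "integrable (lebesgue_on (region P)) (\<lambda>x. norm (f x) powr (2 + 1/4))"
    by (subst integrable_lebesgue_on_iff_lborel[OF open_region]) (auto simp: f0)
  have gm: "grad (region P) v \<in> borel_measurable (lebesgue_on (region P))"
    by (rule L2_measurable[OF grad_L2[OF v_H1]])
  have "integrable (lebesgue_on (region P)) (\<lambda>x. norm (grad (region P) v x) powr (2 + 1/4))"
    using fg gm by (intro integrable_cong_AE_imp[OF fi]) (auto elim!: eventually_mono)
  then show ?thesis using gm by (simp add: Lp_def)
qed

end

text \<open>The exponent does not depend on the cell, so all cells of a mesh share one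
  \<open>Lp\<close> space.\<close>

lemma grad_nodal_higher_integrability:
  assumes "star_polygon P c r" "v \<in> nodal_local P"
  shows "grad (region P) v \<in> Lp (2 + 1/4) (region P)"
proof -
  from assms(2) obtain g where v: "v \<in> H1 (region P)" "has_trace P v g"
      "\<forall>(a, b)\<in>edges P. \<forall>t\<in>{0..1}. g (linepath a b t) = (1 - t) * g a + t * g b"
      "weak_div (region P) (grad (region P) v) (\<lambda>x. 0)"
    by (auto simp: nodal_local_def)
  obtain f where f: "sq_int f" "\<And>x. x \<notin> region P \<Longrightarrow> f x = 0" "AE x in lebesgue_on (region P). f x = grad (region P) v x"
    using L2_borel_representative[OF grad_L2[OF v(1)] open_region] by blast
  interpret star_polygon P c r by fact
  interpret harmonic_trace P c r v g f
  proof
    show "g (linepath (fst e) (snd e) t) = (1 - t) * g (fst e) + t * g (snd e)" if "e \<in> edges P" "t \<in> {0..1}" for e t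
      using bspec[OF v(3) that(1)] that(2) by (simp add: case_prod_unfold)
  qed (rule v(2) v(4) f; assumption?)+
  show ?thesis by (rule grad_higher_integrability)
qed

section \<open>Linearity and locality of the weak operators\<close>

lemma Lp_lincomb:
  fixes f g :: "pt \<Rightarrow> 'b::euclidean_space"
  assumes f: "f \<in> Lp p D" and g: "g \<in> Lp p D" and p: "0 \<le> p"
  shows "(\<lambda>x. a *\<^sub>R f x + b *\<^sub>R g x) \<in> Lp p D"
proof -
  have fm [measurable]: "f \<in> borel_measurable (lebesgue_on D)" and gm [measurable]: "g \<in> borel_measurable (lebesgue_on D)"
    and fi: "integrable (lebesgue_on D) (\<lambda>x. norm (f x) powr p)" and gi: "integrable (lebesgue_on D) (\<lambda>x. norm (g x) powr p)"
    using f g by (auto simp: Lp_def)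
  define C where "C = (\<bar>a\<bar> + \<bar>b\<bar>) powr p"
  have "norm (a *\<^sub>R f x + b *\<^sub>R g x) powr p \<le> C * (norm (f x) powr p + norm (g x) powr p)" for x
  proof -
    define m where "m = max (norm (f x)) (norm (g x))"
    have "norm (a *\<^sub>R f x + b *\<^sub>R g x) \<le> \<bar>a\<bar> * norm (f x) + \<bar>b\<bar> * norm (g x)"
      using norm_triangle_ineq[of "a *\<^sub>R f x" "b *\<^sub>R g x"] by simp
    also have "\<dots> \<le> \<bar>a\<bar> * m + \<bar>b\<bar> * m" by (intro add_mono mult_left_mono) (auto simp: m_def)
    finally have "norm (a *\<^sub>R f x + b *\<^sub>R g x) \<le> (\<bar>a\<bar> + \<bar>b\<bar>) * m" by (simp add: distrib_right)
    then have "norm (a *\<^sub>R f x + b *\<^sub>R g x) powr p \<le> ((\<bar>a\<bar> + \<bar>b\<bar>) * m) powr p" by (intro powr_mono2 p) auto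
    also have "\<dots> = C * m powr p" unfolding C_def by (rule powr_mult)
    also have "\<dots> \<le> C * (norm (f x) powr p + norm (g x) powr p)"
      by (intro mult_left_mono) (auto simp: m_def max_def C_def)
    finally show ?thesis .
  qed
  then have pw: "norm (a *\<^sub>R f x + b *\<^sub>R g x) powr p \<le> C * (norm (f x) powr p + norm (g x) powr p)" for x .
  have nn: "\<bar>C * (norm (f x) powr p + norm (g x) powr p)\<bar> = C * (norm (f x) powr p + norm (g x) powr p)" for x
    by (rule abs_of_nonneg) (simp add: C_def)
  have "integrable (lebesgue_on D) (\<lambda>x. norm (a *\<^sub>R f x + b *\<^sub>R g x) powr p)"
  proof (rule Bochner_Integration.integrable_bound[where f="\<lambda>x. C * (norm (f x) powr p + norm (g x) powr p)"])
    show "AE x in lebesgue_on D. norm (norm (a *\<^sub>R f x + b *\<^sub>R g x) powr p) \<le> norm (C * (norm (f x) powr p + norm (g x) powr p))"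
      unfolding real_norm_def nn using pw by (intro AE_I2) simp
  qed (use fi gi in simp_all)
  then show ?thesis by (simp add: Lp_def)
qed

lemma L2_lincomb:
  fixes f g :: "pt \<Rightarrow> 'b::euclidean_space"
  shows "f \<in> L2 D \<Longrightarrow> g \<in> L2 D \<Longrightarrow> (\<lambda>x. a *\<^sub>R f x + b *\<^sub>R g x) \<in> L2 D"
  by (rule Lp_lincomb) simp_all

lemma L2_iff: "f \<in> L2 D \<longleftrightarrow> f \<in> borel_measurable (lebesgue_on D) \<and> integrable (lebesgue_on D) (\<lambda>x. (norm (f x))\<^sup>2)"
  by (simp add: Lp_def)

text \<open>On a bounded set the dominating function \<open>1 + norm (f x) powr q\<close> is
  integrable. Needed because elements of \<open>edge_space\<close> may come with different
  exponents.\<close>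

lemma Lp_mono_exponent:
  fixes f :: "pt \<Rightarrow> 'b::euclidean_space"
  assumes f: "f \<in> Lp q D" and D: "open D" "bounded D" and p: "0 \<le> p" "p \<le> q"
  shows "f \<in> Lp p D"
proof -
  have fm [measurable]: "f \<in> borel_measurable (lebesgue_on D)" and fi: "integrable (lebesgue_on D) (\<lambda>x. norm (f x) powr q)"
    using f by (auto simp: Lp_def)
  have c: "integrable (lebesgue_on D) (\<lambda>x. 1 :: real)"
    by (rule continuous_integrable_lebesgue_on[OF _ D]) simp
  have "norm (f x) powr p \<le> 1 + norm (f x) powr q" for x
  proof (cases "norm (f x) \<le> 1")
    case True
    then have "norm (f x) powr p \<le> 1 powr p" by (intro powr_mono2 p) auto
    moreover have "0 \<le> norm (f x) powr q" "1 powr p = (1::real)" by simp_all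
    ultimately show ?thesis by linarith
  next
    case False
    then have "norm (f x) powr p \<le> norm (f x) powr q" by (intro powr_mono p) auto
    then show ?thesis by simp
  qed
  then have pw: "norm (f x) powr p \<le> 1 + norm (f x) powr q" for x .
  have nn: "\<bar>1 + norm (f x) powr q\<bar> = 1 + norm (f x) powr q" for x
    by (rule abs_of_nonneg) simp
  have "integrable (lebesgue_on D) (\<lambda>x. norm (f x) powr p)"
  proof (rule Bochner_Integration.integrable_bound[where f="\<lambda>x. 1 + norm (f x) powr q"])
    show "AE x in lebesgue_on D. norm (norm (f x) powr p) \<le> norm (1 + norm (f x) powr q)"
      unfolding real_norm_def nn using pw by (intro AE_I2) simp
  qed (use fi c in simp_all)
  then show ?thesis by (simp add: Lp_def)
qed

lemma integrable_L2_inner: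
  fixes f g :: "pt \<Rightarrow> 'b::euclidean_space"
  assumes "f \<in> L2 D" "g \<in> L2 D" shows "integrable (lebesgue_on D) (\<lambda>x. f x \<bullet> g x)"
  by (rule Bochner_Integration.integrable_bound[where f="\<lambda>x. (norm (f x))\<^sup>2 + (norm (g x))\<^sup>2"])
     (use assms in \<open>auto simp: L2_iff intro: order_trans[OF abs_inner_le_sq]\<close>)

lemma integrable_L2_mult:
  fixes f g :: "pt \<Rightarrow> real"
  shows "f \<in> L2 D \<Longrightarrow> g \<in> L2 D \<Longrightarrow> integrable (lebesgue_on D) (\<lambda>x. f x * g x)"
  using integrable_L2_inner[of f D g] by simp

lemma integrable_L2_scaleR:
  fixes f :: "pt \<Rightarrow> real" and g :: "pt \<Rightarrow> 'b::euclidean_space"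
  assumes f: "f \<in> L2 D" and g: "g \<in> L2 D"
  shows "integrable (lebesgue_on D) (\<lambda>x. f x *\<^sub>R g x)"
proof (rule Bochner_Integration.integrable_bound[where f="\<lambda>x. (norm (f x))\<^sup>2 + (norm (g x))\<^sup>2"])
  have "norm (f x *\<^sub>R g x) \<le> (norm (f x))\<^sup>2 + (norm (g x))\<^sup>2" for x
    using abs_inner_le_sq[of "norm (f x)" "norm (g x)"] by (simp add: abs_mult)
  then show "AE x in lebesgue_on D. norm (f x *\<^sub>R g x) \<le> norm ((norm (f x))\<^sup>2 + (norm (g x))\<^sup>2)"
    by (auto intro: order_trans[OF _ abs_ge_self])
qed (use f g in \<open>auto simp: L2_iff\<close>)

lemma continuous_L2:
  fixes h :: "pt \<Rightarrow> 'b::euclidean_space"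
  assumes "continuous_on UNIV h" "open D" "bounded D" shows "h \<in> L2 D"
  unfolding L2_iff using assms
  by (intro conjI borel_measurable_lebesgue_on borel_measurable_continuous_onI continuous_integrable_lebesgue_on continuous_intros)

lemma L2_perp:
  assumes "w \<in> L2 D" shows "(\<lambda>x. perp (w x)) \<in> L2 D"
proof -
  have "perp \<in> borel_measurable borel"
    by (rule borel_measurable_continuous_onI[OF linear_continuous_on[OF bounded_linear_perp]])
  then have "(\<lambda>x. perp (w x)) \<in> borel_measurable (lebesgue_on D)"
    using assms by (auto simp: L2_iff intro: measurable_compose)
  then show ?thesis using assms by (simp add: L2_iff)
qed

lemma L2_cong_AE:
  fixes f g :: "pt \<Rightarrow> 'b::euclidean_space"
  assumes f: "f \<in> Lp p D" and g: "g \<in> borel_measurable (lebesgue_on D)" and eq: "AE x in lebesgue_on D. f x = g x"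
  shows "g \<in> Lp p D"
proof -
  have "integrable (lebesgue_on D) (\<lambda>x. norm (g x) powr p)"
    by (rule integrable_cong_AE_imp[of _ "\<lambda>x. norm (f x) powr p"]) (use f g eq in \<open>auto simp: Lp_def elim: eventually_mono\<close>)
  then show ?thesis using g by (simp add: Lp_def)
qed

section \<open>Test functions, restriction and uniqueness of weak derivatives\<close>

lemma C1_grad_continuous:
  assumes "C1_grad \<phi> G" shows "continuous_on A \<phi>" "continuous_on A G"
proof -
  show "continuous_on A \<phi>"
    using assms unfolding C1_grad_def gderiv_def
    by (intro continuous_at_imp_continuous_on ballI has_derivative_continuous) blast
  show "continuous_on A G" using assms unfolding C1_grad_def by (blast intro: continuous_on_subset)
qed

lemma C1_grad_zero:
  assumes "C1_grad \<phi> G" "closed K" "\<And>x. x \<notin> K \<Longrightarrow> \<phi> x = 0" "x \<notin> K"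
  shows "G x = 0"
proof -
  have "((\<lambda>h. 0) has_derivative (\<lambda>h. 0)) (at x)" by simp
  then have "(\<phi> has_derivative (\<lambda>h. 0)) (at x)"
    by (rule has_derivative_transform_within_open[OF _ open_Compl[OF assms(2)]]) (use assms in auto)
  moreover have "(\<phi> has_derivative (\<lambda>h. h \<bullet> G x)) (at x)" using assms(1) by (simp add: C1_grad_def gderiv_def)
  ultimately have "(\<lambda>h. 0) = (\<lambda>h. h \<bullet> G x)" by (rule has_derivative_unique)
  from fun_cong[OF this, of "G x"] show ?thesis by simp
qed

lemma test_fun_mono: "test_fun D' \<phi> G \<Longrightarrow> D' \<subseteq> D \<Longrightarrow> test_fun D \<phi> G"
  unfolding test_fun_def by blast

lemma test_fun_zero:
  assumes "test_fun D \<phi> G" "x \<notin> D" shows "\<phi> x = 0" "G x = 0"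
proof -
  obtain K where K: "compact K" "K \<subseteq> D" "\<And>x. x \<notin> K \<Longrightarrow> \<phi> x = 0" and C: "C1_grad \<phi> G"
    using assms(1) by (auto simp: test_fun_def)
  show "\<phi> x = 0" using K assms(2) by auto
  show "G x = 0" by (rule C1_grad_zero[OF C compact_imp_closed[OF K(1)] K(3)]) (use K assms(2) in auto)
qed

lemma test_fun_L2:
  assumes "test_fun D \<phi> G" "open D" "bounded D" shows "\<phi> \<in> L2 D" "G \<in> L2 D"
  using assms by (auto simp: test_fun_def intro!: continuous_L2 C1_grad_continuous)

lemma integral_lebesgue_on_subset:
  fixes H :: "pt \<Rightarrow> 'b::euclidean_space"
  assumes "D' \<subseteq> D" "open D'" "open D" "\<And>x. x \<notin> D' \<Longrightarrow> H x = 0"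
  shows "(LINT x|lebesgue_on D'. H x) = (LINT x|lebesgue_on D. H x)"
proof -
  have "(\<lambda>x. indicator D' x *\<^sub>R H x) = H" "(\<lambda>x. indicator D x *\<^sub>R H x) = H"
    using assms by (auto simp: indicator_def fun_eq_iff)
  then show ?thesis
    using integral_restrict_space[of D' lebesgue H] integral_restrict_space[of D lebesgue H] assms by simp
qed

text \<open>A test function on the smaller set is one on the larger set, and all integrands vanish
  off the smaller set.\<close>

lemma
  assumes D: "D' \<subseteq> D" "open D'" "open D"
  shows weak_grad_subset: "weak_grad D v g \<Longrightarrow> weak_grad D' v g"
    and weak_div_subset: "weak_div D w d \<Longrightarrow> weak_div D' w d"
proof -
  note z = test_fun_zero
  show "weak_grad D' v g" if "weak_grad D v g"
    unfolding weak_grad_def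
  proof (intro allI impI)
    fix \<phi> G assume t: "test_fun D' \<phi> G"
    have "(LINT x|lebesgue_on D. v x *\<^sub>R G x) = - (LINT x|lebesgue_on D. \<phi> x *\<^sub>R g x)"
      using that test_fun_mono[OF t D(1)] by (simp add: weak_grad_def)
    then show "(LINT x|lebesgue_on D'. v x *\<^sub>R G x) = - (LINT x|lebesgue_on D'. \<phi> x *\<^sub>R g x)"
      using integral_lebesgue_on_subset[OF D, of "\<lambda>x. v x *\<^sub>R G x"] integral_lebesgue_on_subset[OF D, of "\<lambda>x. \<phi> x *\<^sub>R g x"] z[OF t]
      by simp
  qed
  show "weak_div D' w d" if "weak_div D w d"
    unfolding weak_div_def
  proof (intro allI impI)
    fix \<phi> G assume t: "test_fun D' \<phi> G"
    have "(LINT x|lebesgue_on D. w x \<bullet> G x) = - (LINT x|lebesgue_on D. d x * \<phi> x)"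
      using that test_fun_mono[OF t D(1)] by (simp add: weak_div_def)
    then show "(LINT x|lebesgue_on D'. w x \<bullet> G x) = - (LINT x|lebesgue_on D'. d x * \<phi> x)"
      using integral_lebesgue_on_subset[OF D, of "\<lambda>x. w x \<bullet> G x"] integral_lebesgue_on_subset[OF D, of "\<lambda>x. d x * \<phi> x"] z[OF t]
      by simp
  qed
qed

lemma measurable_lebesgue_on_subset:
  fixes f :: "pt \<Rightarrow> 'b::euclidean_space"
  assumes "f \<in> borel_measurable (lebesgue_on D)" "D' \<subseteq> D" "open D'" "open D"
  shows "f \<in> borel_measurable (lebesgue_on D')"
proof -
  have "(\<lambda>x. indicator D x *\<^sub>R f x) \<in> borel_measurable lebesgue"
    using borel_measurable_restrict_space_iff[of D lebesgue f] assms by simp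
  from borel_measurable_scaleR[OF borel_measurable_indicator[of D' lebesgue] this]
  have "(\<lambda>x. indicat_real D' x *\<^sub>R (indicat_real D x *\<^sub>R f x)) \<in> borel_measurable lebesgue"
    using assms(3) by simp
  moreover have "(\<lambda>x. indicator D' x *\<^sub>R (indicator D x *\<^sub>R f x)) = (\<lambda>x. indicator D' x *\<^sub>R f x)"
    using assms(2) by (auto simp: indicator_def fun_eq_iff)
  ultimately show ?thesis
    using borel_measurable_restrict_space_iff[of D' lebesgue f] assms by simp
qed

lemma Lp_subset:
  fixes f :: "pt \<Rightarrow> 'b::euclidean_space"
  assumes f: "f \<in> Lp p D" and D: "D' \<subseteq> D" "open D'" "open D"
  shows "f \<in> Lp p D'"
proof -
  have fm: "f \<in> borel_measurable (lebesgue_on D)" and fi: "integrable (lebesgue_on D) (\<lambda>x. norm (f x) powr p)"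
    using f by (auto simp: Lp_def)
  have "set_integrable lebesgue D (\<lambda>x. norm (f x) powr p)"
    using fi D integrable_restrict_space[of D lebesgue "\<lambda>x. norm (f x) powr p"] by (simp add: set_integrable_def)
  then have "set_integrable lebesgue D' (\<lambda>x. norm (f x) powr p)"
    by (rule set_integrable_subset) (use D in auto)
  then have "integrable (lebesgue_on D') (\<lambda>x. norm (f x) powr p)"
    using D integrable_restrict_space[of D' lebesgue "\<lambda>x. norm (f x) powr p"] by (simp add: set_integrable_def)
  then show ?thesis using measurable_lebesgue_on_subset[OF fm D] by (simp add: Lp_def)
qed

lemma weak_div_lincomb:
  assumes D: "open D" "bounded D" and w: "w1 \<in> L2 D" "w2 \<in> L2 D" and d: "d1 \<in> L2 D" "d2 \<in> L2 D"
    and "weak_div D w1 d1" "weak_div D w2 d2"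
  shows "weak_div D (\<lambda>x. a *\<^sub>R w1 x + b *\<^sub>R w2 x) (\<lambda>x. a * d1 x + b * d2 x)"
  unfolding weak_div_def
proof (intro allI impI)
  fix \<phi> G assume t: "test_fun D \<phi> G"
  note tL = test_fun_L2[OF t D]
  have "(LINT x|lebesgue_on D. (a *\<^sub>R w1 x + b *\<^sub>R w2 x) \<bullet> G x) = a * (LINT x|lebesgue_on D. w1 x \<bullet> G x) + b * (LINT x|lebesgue_on D. w2 x \<bullet> G x)"
    using integrable_L2_inner[OF w(1) tL(2)] integrable_L2_inner[OF w(2) tL(2)] by (simp add: inner_add_left)
  also have "\<dots> = - (a * (LINT x|lebesgue_on D. d1 x * \<phi> x) + b * (LINT x|lebesgue_on D. d2 x * \<phi> x))"
    using assms(7,8) t by (simp add: weak_div_def)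
  also have "\<dots> = - (LINT x|lebesgue_on D. (a * d1 x + b * d2 x) * \<phi> x)"
    using integrable_L2_mult[OF d(1) tL(1)] integrable_L2_mult[OF d(2) tL(1)]
    by (simp add: distrib_right mult.assoc)
  finally show "(LINT x|lebesgue_on D. (a *\<^sub>R w1 x + b *\<^sub>R w2 x) \<bullet> G x) = - (LINT x|lebesgue_on D. (a * d1 x + b * d2 x) * \<phi> x)" .
qed

text \<open>The rotation is the divergence of the field turned by a right angle, so facts about
  \<open>weak_div\<close> serve both operators.\<close>

lemma weak_rot_eq_weak_div: "weak_rot D w r \<longleftrightarrow> weak_div D (\<lambda>x. - perp (w x)) r"
  by (simp add: weak_rot_def weak_div_def perp_inner)

lemma weak_div_cong_AE:
  assumes D: "open D" "bounded D" and w: "weak_div D w d" and m: "w \<in> borel_measurable (lebesgue_on D)" "w' \<in> borel_measurable (lebesgue_on D)"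
      "d \<in> borel_measurable (lebesgue_on D)" "d' \<in> borel_measurable (lebesgue_on D)"
    and eq: "AE x in lebesgue_on D. w x = w' x" "AE x in lebesgue_on D. d x = d' x"
  shows "weak_div D w' d'"
  unfolding weak_div_def
proof (intro allI impI)
  fix \<phi> G assume t: "test_fun D \<phi> G"
  note tm = test_fun_L2[OF t D, THEN L2_measurable]
  have "(LINT x|lebesgue_on D. w' x \<bullet> G x) = (LINT x|lebesgue_on D. w x \<bullet> G x)"
    using eq(1) by (intro integral_cong_AE borel_measurable_inner m tm) (auto elim: eventually_mono)
  moreover have "(LINT x|lebesgue_on D. d' x * \<phi> x) = (LINT x|lebesgue_on D. d x * \<phi> x)"
    using eq(2) by (intro integral_cong_AE borel_measurable_times m tm) (auto elim: eventually_mono)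
  ultimately show "(LINT x|lebesgue_on D. w' x \<bullet> G x) = - (LINT x|lebesgue_on D. d' x * \<phi> x)"
    using w t by (simp add: weak_div_def)
qed

lemma weak_div_unique:
  assumes D: "open D" "bounded D" and d: "d1 \<in> L2 D" "d2 \<in> L2 D" and w: "weak_div D w d1" "weak_div D w d2"
  shows "AE x in lebesgue_on D. d1 x = d2 x"
proof -
  \<comment> \<open>\<open>AE_zero_if_test_fun\<close> is formulated for vector fields; a fixed unit
    vector carries the scalar difference.\<close>
  define e where "e = (axis 1 1 :: pt)"
  define h where "h x = (d1 x - d2 x) *\<^sub>R e" for x
  have "(\<lambda>x. 1 *\<^sub>R d1 x + (-1) *\<^sub>R d2 x) \<in> L2 D" by (rule L2_lincomb[OF d])
  then have dd: "(\<lambda>x. d1 x - d2 x) \<in> L2 D" by simp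
  have "h \<in> L2 D"
    using dd borel_measurable_scaleR[OF L2_measurable[OF dd] borel_measurable_const[of e]]
    by (simp add: L2_iff h_def[abs_def] e_def norm_axis_1)
  then have "AE x in lebesgue_on D. h x = 0"
  proof (rule AE_zero_if_test_fun[OF _ D])
    fix \<phi> G assume t: "test_fun D \<phi> G"
    note tL = test_fun_L2[OF t D]
    have "(LINT x|lebesgue_on D. (d1 x - d2 x) * \<phi> x) = (LINT x|lebesgue_on D. d1 x * \<phi> x) - (LINT x|lebesgue_on D. d2 x * \<phi> x)"
      using integrable_L2_mult[OF d(1) tL(1)] integrable_L2_mult[OF d(2) tL(1)] by (simp add: left_diff_distrib)
    also have "\<dots> = 0"
    proof -
      have "(LINT x|lebesgue_on D. w x \<bullet> G x) = - (LINT x|lebesgue_on D. d1 x * \<phi> x)"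
        "(LINT x|lebesgue_on D. w x \<bullet> G x) = - (LINT x|lebesgue_on D. d2 x * \<phi> x)"
        using w t unfolding weak_div_def by blast+
      then show ?thesis by linarith
    qed
    finally have "(LINT x|lebesgue_on D. (d1 x - d2 x) * \<phi> x) *\<^sub>R e = 0" by simp
    moreover have "(LINT x|lebesgue_on D. ((d1 x - d2 x) * \<phi> x) *\<^sub>R e) = (LINT x|lebesgue_on D. (d1 x - d2 x) * \<phi> x) *\<^sub>R e"
      by (rule integral_scaleR_left) (intro integrable_L2_mult dd tL)
    ultimately show "(LINT x|lebesgue_on D. \<phi> x *\<^sub>R h x) = 0" by (simp add: h_def mult.commute)
  qed
  then show ?thesis by eventually_elim (simp add: h_def e_def)
qed

lemma weak_grad_add:
  assumes D: "open D" "bounded D" and v: "v1 \<in> L2 D" "v2 \<in> L2 D" and g: "g1 \<in> L2 D" "g2 \<in> L2 D"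
    and "weak_grad D v1 g1" "weak_grad D v2 g2"
  shows "weak_grad D (\<lambda>x. v1 x + v2 x) (\<lambda>x. g1 x + g2 x)"
  unfolding weak_grad_def
proof (intro allI impI)
  fix \<phi> G assume t: "test_fun D \<phi> G"
  note tL = test_fun_L2[OF t D]
  show "(LINT x|lebesgue_on D. (v1 x + v2 x) *\<^sub>R G x) = - (LINT x|lebesgue_on D. \<phi> x *\<^sub>R (g1 x + g2 x))"
    using assms(7,8) t integrable_L2_scaleR[OF v(1) tL(2)] integrable_L2_scaleR[OF v(2) tL(2)]
      integrable_L2_scaleR[OF tL(1) g(1)] integrable_L2_scaleR[OF tL(1) g(2)]
    by (simp add: weak_grad_def scaleR_add_left scaleR_add_right)
qed

lemma weak_grad_unique:
  assumes D: "open D" "bounded D" and g: "g1 \<in> L2 D" "g2 \<in> L2 D" and v: "weak_grad D v g1" "weak_grad D v g2"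
  shows "AE x in lebesgue_on D. g1 x = g2 x"
proof -
  have "(\<lambda>x. 1 *\<^sub>R g1 x + (-1) *\<^sub>R g2 x) \<in> L2 D" by (rule L2_lincomb[OF g])
  then have "(\<lambda>x. g1 x - g2 x) \<in> L2 D" by simp
  then have "AE x in lebesgue_on D. g1 x - g2 x = 0"
  proof (rule AE_zero_if_test_fun[OF _ D])
    fix \<phi> G assume t: "test_fun D \<phi> G"
    note tL = test_fun_L2[OF t D]
    have "(LINT x|lebesgue_on D. \<phi> x *\<^sub>R (g1 x - g2 x)) = (LINT x|lebesgue_on D. \<phi> x *\<^sub>R g1 x) - (LINT x|lebesgue_on D. \<phi> x *\<^sub>R g2 x)"
      using integrable_L2_scaleR[OF tL(1) g(1)] integrable_L2_scaleR[OF tL(1) g(2)] by (simp add: scaleR_diff_right)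
    also have "\<dots> = 0"
    proof -
      have "(LINT x|lebesgue_on D. v x *\<^sub>R G x) = - (LINT x|lebesgue_on D. \<phi> x *\<^sub>R g1 x)"
        "(LINT x|lebesgue_on D. v x *\<^sub>R G x) = - (LINT x|lebesgue_on D. \<phi> x *\<^sub>R g2 x)"
        using v t unfolding weak_grad_def by blast+
      then show ?thesis by simp
    qed
    finally show "(LINT x|lebesgue_on D. \<phi> x *\<^sub>R (g1 x - g2 x)) = 0" .
  qed
  then show ?thesis by eventually_elim simp
qed

text \<open>\<open>grad\<close> is an arbitrary choice of representative, hence additive only almost
  everywhere; uniqueness of weak gradients supplies this.\<close>

lemma H1_add:
  assumes D: "open D" "bounded D" and v: "v1 \<in> H1 D" "v2 \<in> H1 D"
  shows "(\<lambda>x. v1 x + v2 x) \<in> H1 D"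
    and "AE x in lebesgue_on D. grad D (\<lambda>x. v1 x + v2 x) x = grad D v1 x + grad D v2 x"
proof -
  have vL: "v1 \<in> L2 D" "v2 \<in> L2 D" using v by (auto simp: H1_def)
  note g = grad_L2[OF v(1)] grad_L2[OF v(2)] and wg = weak_grad_grad[OF v(1)] weak_grad_grad[OF v(2)]
  have sL: "(\<lambda>x. v1 x + v2 x) \<in> L2 D" using L2_lincomb[OF vL, of 1 1] by simp
  have gL: "(\<lambda>x. grad D v1 x + grad D v2 x) \<in> L2 D" using L2_lincomb[OF g, of 1 1] by simp
  note ws = weak_grad_add[OF D vL g wg]
  show H: "(\<lambda>x. v1 x + v2 x) \<in> H1 D" using sL gL ws by (auto simp: H1_def)
  show "AE x in lebesgue_on D. grad D (\<lambda>x. v1 x + v2 x) x = grad D v1 x + grad D v2 x"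
    by (rule weak_grad_unique[OF D grad_L2[OF H] gL weak_grad_grad[OF H] ws])
qed

lemma grad_subset:
  assumes D: "D' \<subseteq> D" "open D'" "open D" "bounded D" and v: "v \<in> H1 D" "v \<in> H1 D'"
  shows "AE x in lebesgue_on D'. grad D v x = grad D' v x"
  by (rule weak_grad_unique[OF D(2) bounded_subset[OF D(4,1)] Lp_subset[OF grad_L2[OF v(1)] D(1-3)] grad_L2[OF v(2)]
      weak_grad_subset[OF D(1-3) weak_grad_grad[OF v(1)]] weak_grad_grad[OF v(2)]])

lemma has_trace_add:
  assumes "has_trace P v1 g1" "has_trace P v2 g2"
  shows "has_trace P (\<lambda>x. v1 x + v2 x) (\<lambda>x. g1 x + g2 x)"
  unfolding has_trace_def
proof (intro conjI allI impI)
  let ?R = "region P"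
  have v: "v1 \<in> H1 ?R" "v2 \<in> H1 ?R" and g: "continuous_on (bdry P) g1" "continuous_on (bdry P) g2"
    using assms by (auto simp: has_trace_def)
  note D = open_region bounded_region
  note H = H1_add[OF D v]
  have vL: "v1 \<in> L2 ?R" "v2 \<in> L2 ?R" using v by (auto simp: H1_def)
  show "(\<lambda>x. v1 x + v2 x) \<in> H1 ?R" by (rule H(1))
  show "continuous_on (bdry P) (\<lambda>x. g1 x + g2 x)" by (intro continuous_intros g)
  fix \<psi> J assume \<psi>: "C1_jacobian \<psi> J"
  note c = C1_jacobian_continuous[OF \<psi>]
  have L: "\<psi> \<in> L2 ?R" "(\<lambda>x. trace (J x)) \<in> L2 ?R"
    by (intro continuous_L2 c continuous_intros open_region bounded_region)+
  have "(LINT x|lebesgue_on ?R. (v1 x + v2 x) * trace (J x) + grad ?R (\<lambda>x. v1 x + v2 x) x \<bullet> \<psi> x)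
      = (LINT x|lebesgue_on ?R. (v1 x * trace (J x) + grad ?R v1 x \<bullet> \<psi> x) + (v2 x * trace (J x) + grad ?R v2 x \<bullet> \<psi> x))"
    using H(2) L2_measurable[OF grad_L2[OF v(1)]] L2_measurable[OF grad_L2[OF v(2)]] L2_measurable[OF grad_L2[OF H(1)]]
      vL[THEN L2_measurable] L[THEN L2_measurable]
    by (intro integral_cong_AE) (auto elim!: eventually_mono simp: inner_add_left distrib_right)
  also have "\<dots> = (LINT x|lebesgue_on ?R. v1 x * trace (J x) + grad ?R v1 x \<bullet> \<psi> x) + (LINT x|lebesgue_on ?R. v2 x * trace (J x) + grad ?R v2 x \<bullet> \<psi> x)"
    by (intro Bochner_Integration.integral_add Bochner_Integration.integrable_add integrable_L2_mult integrable_L2_inner vL L grad_L2 v)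
  also have "\<dots> = (\<Sum>e\<in>edges P. edge_integral e (\<lambda>x. g1 x * (\<psi> x \<bullet> edge_normal e))) + (\<Sum>e\<in>edges P. edge_integral e (\<lambda>x. g2 x * (\<psi> x \<bullet> edge_normal e)))"
    using assms \<psi> by (simp add: has_trace_def)
  also have "\<dots> = (\<Sum>e\<in>edges P. edge_integral e (\<lambda>x. (g1 x + g2 x) * (\<psi> x \<bullet> edge_normal e)))"
  proof (subst sum.distrib[symmetric], rule sum.cong[OF refl])
    fix e assume e: "e \<in> edges P"
    have cl: "continuous_on {0..1} (\<lambda>t. h (linepath (fst e) (snd e) t))" if "continuous_on (bdry P) h" for h :: "pt \<Rightarrow> real"
    proof (rule continuous_on_compose2[OF that])
      show "linepath (fst e) (snd e) ` {0..1} \<subseteq> bdry P"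
        using edge_subset_bdry[OF e] by (simp add: path_image_linepath[symmetric] path_image_def)
    qed (intro continuous_intros)
    have cp: "continuous_on {0..1} (\<lambda>t. \<psi> (linepath (fst e) (snd e) t))"
      by (rule continuous_on_compose2[OF c(1)[of UNIV]]) (auto intro!: continuous_intros)
    have i: "(\<lambda>t. h (linepath (fst e) (snd e) t) * (\<psi> (linepath (fst e) (snd e) t) \<bullet> edge_normal e)) integrable_on {0..1}"
      if "continuous_on (bdry P) h" for h :: "pt \<Rightarrow> real"
      by (intro integrable_continuous_real continuous_intros cl[OF that] cp)
    show "edge_integral e (\<lambda>x. g1 x * (\<psi> x \<bullet> edge_normal e)) + edge_integral e (\<lambda>x. g2 x * (\<psi> x \<bullet> edge_normal e))
        = edge_integral e (\<lambda>x. (g1 x + g2 x) * (\<psi> x \<bullet> edge_normal e))"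
      using integral_add[OF i[OF g(1)] i[OF g(2)]] by (simp add: edge_integral_def distrib_right distrib_left)
  qed
  finally show "(LINT x|lebesgue_on ?R. (v1 x + v2 x) * trace (J x) + grad ?R (\<lambda>x. v1 x + v2 x) x \<bullet> \<psi> x)
      = (\<Sum>e\<in>edges P. edge_integral e (\<lambda>x. (g1 x + g2 x) * (\<psi> x \<bullet> edge_normal e)))" .
qed

lemma L2_zero: "(\<lambda>x. 0 :: 'b::euclidean_space) \<in> L2 D" by (simp add: L2_iff)

text \<open>Required because the electric field in Faraday's law is the sum of the discrete unknown
  and the interpolated boundary datum.\<close>

lemma nodal_local_add:
  assumes "v1 \<in> nodal_local P" "v2 \<in> nodal_local P"
  shows "(\<lambda>x. v1 x + v2 x) \<in> nodal_local P"
proof -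
  let ?R = "region P"
  note D = open_region[of P] bounded_region[of P]
  obtain g1 where 1: "v1 \<in> H1 ?R" "has_trace P v1 g1" "weak_div ?R (grad ?R v1) (\<lambda>x. 0)"
    and l1: "\<forall>(a, b)\<in>edges P. \<forall>t\<in>{0..1}. g1 (linepath a b t) = (1 - t) * g1 a + t * g1 b"
    using assms(1) unfolding nodal_local_def by blast
  obtain g2 where 2: "v2 \<in> H1 ?R" "has_trace P v2 g2" "weak_div ?R (grad ?R v2) (\<lambda>x. 0)"
    and l2: "\<forall>(a, b)\<in>edges P. \<forall>t\<in>{0..1}. g2 (linepath a b t) = (1 - t) * g2 a + t * g2 b"
    using assms(2) unfolding nodal_local_def by blast
  note H = H1_add[OF D 1(1) 2(1)]
  note g = grad_L2[OF 1(1)] grad_L2[OF 2(1)]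
  have "weak_div ?R (\<lambda>x. grad ?R v1 x + grad ?R v2 x) (\<lambda>x. 0)"
    using weak_div_lincomb[OF D g L2_zero L2_zero 1(3) 2(3), of 1 1] by simp
  then have wd: "weak_div ?R (grad ?R (\<lambda>x. v1 x + v2 x)) (\<lambda>x. 0)"
    by (rule weak_div_cong_AE[OF D]) (use H(2) L2_measurable[OF g(1)] L2_measurable[OF g(2)] L2_measurable[OF grad_L2[OF H(1)]] in \<open>auto elim: eventually_mono\<close>)
  have "\<forall>(a, b)\<in>edges P. \<forall>t\<in>{0..1}. g1 (linepath a b t) + g2 (linepath a b t) = (1 - t) * (g1 a + g2 a) + t * (g1 b + g2 b)"
  proof (intro ballI, unfold case_prod_unfold, intro ballI)
    fix e t assume e: "e \<in> edges P" "t \<in> {0..1::real}"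
    show "g1 (linepath (fst e) (snd e) t) + g2 (linepath (fst e) (snd e) t) =
        (1 - t) * (g1 (fst e) + g2 (fst e)) + t * (g1 (snd e) + g2 (snd e))"
      using bspec[OF l1 e(1)] bspec[OF l2 e(1)] e(2) by (simp add: case_prod_unfold algebra_simps)
  qed
  then show ?thesis
    using H(1) wd has_trace_add[OF 1(2) 2(2)] unfolding nodal_local_def by blast
qed

section \<open>Steklov averages\<close>

text \<open>The mean over the segment from \<open>x\<close> to \<open>x + e\<close>. It turns the
  derivative along \<open>e\<close> into an exact difference (\<open>steklov_derivative\<close>), so
  that second derivatives of the averages can be written down explicitly.\<close>

definition steklov :: "pt \<Rightarrow> (pt \<Rightarrow> 'b::euclidean_space) \<Rightarrow> pt \<Rightarrow> 'b" where
  "steklov e \<phi> x = integral {0..1} (\<lambda>s. \<phi> (x + s *\<^sub>R e))"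

lemma steklov_integrable:
  fixes \<phi> :: "pt \<Rightarrow> 'b::euclidean_space"
  assumes "continuous_on UNIV \<phi>" shows "(\<lambda>s. \<phi> (x + s *\<^sub>R e)) integrable_on {0..1}"
  by (intro integrable_continuous_real continuous_on_compose2[OF assms] continuous_intros) auto

lemma steklov_continuous:
  fixes \<phi> :: "pt \<Rightarrow> 'b::euclidean_space"
  assumes "continuous_on UNIV \<phi>" shows "continuous_on A (steklov e \<phi>)"
proof -
  have "continuous_on (A \<times> cbox 0 1) (\<lambda>(x, s). \<phi> (x + s *\<^sub>R e))"
    unfolding case_prod_unfold by (intro continuous_on_compose2[OF assms] continuous_intros) auto
  from integral_continuous_on_param[OF this] show ?thesis by (simp add: steklov_def[abs_def])
qed

lemma steklov_component:
  assumes "continuous_on UNIV G" shows "steklov e G x $ i = steklov e (\<lambda>x. G x $ i) x"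
  using integral_linear[OF steklov_integrable[OF assms, of x e] bounded_linear_vec_nth[of i]]
  by (simp add: steklov_def o_def)

lemma steklov_C1:
  assumes \<phi>: "C1_grad \<phi> G" shows "C1_grad (steklov e \<phi>) (steklov e G)"
  unfolding C1_grad_def
proof (intro conjI allI)
  note c = C1_grad_continuous[OF \<phi>]
  show "continuous_on UNIV (steklov e G)" by (rule steklov_continuous[OF c(2)])
  fix x
  have d: "(\<phi> has_derivative (\<lambda>h. h \<bullet> G x)) (at x)" for x using \<phi> by (simp add: C1_grad_def gderiv_def)
  have "((\<lambda>x. integral (cbox 0 1) (\<lambda>s. \<phi> (x + s *\<^sub>R e))) has_derivative
      blinfun_apply (integral (cbox 0 1) (\<lambda>s. blinfun_inner_left (G (x + s *\<^sub>R e))))) (at x within UNIV)"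
  proof (rule leibniz_rule)
    show "((\<lambda>x. \<phi> (x + s *\<^sub>R e)) has_derivative blinfun_apply (blinfun_inner_left (G (x + s *\<^sub>R e)))) (at x within UNIV)" for x s
    proof -
      have "((\<lambda>x. x + s *\<^sub>R e) has_derivative (\<lambda>h. h)) (at x)" by (auto intro!: derivative_eq_intros)
      from has_derivative_compose[OF this d] show ?thesis by simp
    qed
    show "(\<lambda>s. \<phi> (x + s *\<^sub>R e)) integrable_on cbox 0 1" for x
      using steklov_integrable[OF c(1)] by simp
    show "continuous_on (UNIV \<times> cbox 0 1) (\<lambda>(x, s). blinfun_inner_left (G (x + s *\<^sub>R e)))"
      unfolding case_prod_unfold
      by (intro continuous_on_compose2[OF linear_continuous_on[OF bounded_linear_blinfun_inner_left, of UNIV]]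
          continuous_on_compose2[OF c(2)[of UNIV]] continuous_intros) auto
  qed auto
  moreover have "blinfun_apply (integral (cbox 0 1) (\<lambda>s. blinfun_inner_left (G (x + s *\<^sub>R e)))) = (\<lambda>h. h \<bullet> steklov e G x)"
  proof -
    have "integral {0..1} (\<lambda>s. blinfun_inner_left (G (x + s *\<^sub>R e))) = blinfun_inner_left (steklov e G x)"
      using integral_linear[OF steklov_integrable[OF c(2), of x e] bounded_linear_blinfun_inner_left]
      by (simp add: steklov_def o_def)
    then show ?thesis by (simp add: fun_eq_iff)
  qed
  ultimately show "GDERIV (steklov e \<phi>) x :> steklov e G x"
    by (simp add: gderiv_def steklov_def[abs_def])
qed

lemma steklov_derivative:
  assumes \<phi>: "C1_grad \<phi> G"
  shows "steklov e (\<lambda>x. G x \<bullet> e) x = \<phi> (x + e) - \<phi> x"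
proof -
  have d: "(\<phi> has_derivative (\<lambda>h. h \<bullet> G x)) (at x)" for x using \<phi> by (simp add: C1_grad_def gderiv_def)
  have "((\<lambda>s. \<phi> (x + s *\<^sub>R e)) has_vector_derivative G (x + s *\<^sub>R e) \<bullet> e) (at s within {0..1})" for s
  proof -
    have "((\<lambda>s. x + s *\<^sub>R e) has_derivative (\<lambda>h. h *\<^sub>R e)) (at s within {0..1})" by (auto intro!: derivative_eq_intros)
    from has_derivative_compose[OF this d]
    show ?thesis by (simp add: has_vector_derivative_def inner_commute)
  qed
  then have "((\<lambda>s. G (x + s *\<^sub>R e) \<bullet> e) has_integral (\<phi> (x + 1 *\<^sub>R e) - \<phi> (x + 0 *\<^sub>R e))) {0..1}"
    by (intro fundamental_theorem_of_calculus) auto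
  then show ?thesis by (simp add: steklov_def integral_unique)
qed

lemma steklov_swap:
  fixes \<phi> :: "pt \<Rightarrow> 'b::euclidean_space"
  assumes "continuous_on UNIV \<phi>"
  shows "steklov a (steklov b \<phi>) x = steklov b (steklov a \<phi>) x"
proof -
  have "continuous_on (cbox (0, 0) (1, 1)) (\<lambda>(s, t). \<phi> (x + s *\<^sub>R a + t *\<^sub>R b))"
    unfolding case_prod_unfold by (intro continuous_on_compose2[OF assms] continuous_intros) auto
  from integral_swap_continuous[OF this]
  have "integral {0..1::real} (\<lambda>s. integral {0..1::real} (\<lambda>t. \<phi> (x + s *\<^sub>R a + t *\<^sub>R b)))
      = integral {0..1} (\<lambda>t. integral {0..1} (\<lambda>s. \<phi> (x + s *\<^sub>R a + t *\<^sub>R b)))" by simp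
  moreover have "integral {0..1::real} (\<lambda>t. integral {0..1::real} (\<lambda>s. \<phi> (x + s *\<^sub>R a + t *\<^sub>R b))) = steklov b (steklov a \<phi>) x"
    unfolding steklov_def by (intro integral_cong arg_cong[where f=\<phi>]) simp
  ultimately show ?thesis by (simp add: steklov_def)
qed

lemma steklov_near:
  fixes \<phi> :: "pt \<Rightarrow> 'b::euclidean_space"
  assumes c: "continuous_on UNIV \<phi>" and near: "\<And>s. s \<in> {0..1} \<Longrightarrow> norm (\<phi> (x + s *\<^sub>R e) - z) \<le> \<eta>"
  shows "norm (steklov e \<phi> x - z) \<le> \<eta>"
proof -
  have "((\<lambda>s. \<phi> (x + s *\<^sub>R e) - z) has_integral (steklov e \<phi> x - (1 - 0) *\<^sub>R z)) {0..1}"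
    unfolding steklov_def
    using has_integral_const_real[of z 0 1]
    by (intro has_integral_diff integrable_integral steklov_integrable c) auto
  then have "norm (steklov e \<phi> x - z) \<le> \<eta> * measure lborel (cbox 0 (1::real))"
    using has_integral_bound[of \<eta> "\<lambda>s. \<phi> (x + s *\<^sub>R e) - z" "steklov e \<phi> x - z" 0 1] near[of 0] near order_trans[OF norm_ge_zero near[of 0]]
    by auto
  then show ?thesis by simp
qed

lemma steklov_difference:
  fixes k :: "pt \<Rightarrow> real"
  assumes k: "continuous_on UNIV k"
  shows "steklov a (\<lambda>x. (1 / h) * (k (x + b) - k x)) x = (steklov a k (x + b) - steklov a k x) / h"
proof -
  have "((\<lambda>s. k (x + b + s *\<^sub>R a) - k (x + s *\<^sub>R a)) has_integral (steklov a k (x + b) - steklov a k x)) {0..1}"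
    unfolding steklov_def by (intro has_integral_diff integrable_integral steklov_integrable k)
  from has_integral_mult_right[OF this, of "1 / h"]
  have "((\<lambda>s. (1 / h) * (k (x + s *\<^sub>R a + b) - k (x + s *\<^sub>R a))) has_integral (1 / h) * (steklov a k (x + b) - steklov a k x)) {0..1}"
    by (simp add: add.assoc add.commute[of b])
  then show ?thesis unfolding steklov_def by (subst integral_unique) auto
qed

text \<open>
  Averaging over a small square makes a \<open>C\<^sup>1\<close> function twice differentiable with mixed second
  derivative \<open>\<Delta>\<^sub>1 \<Delta>\<^sub>2 \<phi>\<close>, a second difference, so that symmetry is evident.
\<close>
lemma steklov_approx:
  assumes \<phi>: "C1_grad \<phi> G" and B: "bounded B" and \<eta>: "\<eta> > 0" and \<epsilon>: "\<epsilon> > 0"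
  shows "\<exists>\<phi>' G' J'. C1_grad \<phi>' G' \<and> C1_jacobian (\<lambda>x. perp (G' x)) J' \<and> (\<forall>x. trace (J' x) = 0) \<and>
    (\<forall>x\<in>B. \<bar>\<phi>' x - \<phi> x\<bar> \<le> \<eta> \<and> norm (G' x - G x) \<le> \<eta>) \<and>
    (\<forall>x. \<phi>' x \<noteq> 0 \<longrightarrow> (\<exists>z. \<phi> z \<noteq> 0 \<and> dist x z \<le> \<epsilon>))"
proof -
  note c = C1_grad_continuous[OF \<phi>, of UNIV]
  obtain R where R: "R > 0" "B \<subseteq> cball 0 R"
    using bounded_subset_ballD[OF B, of 0] ball_subset_cball by (metis order_trans)
  have unif: "\<exists>d>0. \<forall>x y. norm x \<le> R \<longrightarrow> norm (y - x) < d \<longrightarrow> norm (k y - k x) \<le> \<eta>"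
    if k: "continuous_on UNIV k" for k :: "pt \<Rightarrow> 'b::euclidean_space"
  proof -
    have "uniformly_continuous_on (cball 0 (R + 1)) k"
      by (intro compact_uniformly_continuous continuous_on_subset[OF k]) auto
    then obtain d where d: "d > 0" "\<And>x y. x \<in> cball 0 (R + 1) \<Longrightarrow> y \<in> cball 0 (R + 1) \<Longrightarrow> dist y x < d \<Longrightarrow> dist (k y) (k x) < \<eta>"
      unfolding uniformly_continuous_on_def using \<eta> by metis
    have "norm (k y - k x) \<le> \<eta>" if "norm x \<le> R" "norm (y - x) < min d 1" for x y
    proof -
      have "norm y \<le> norm x + norm (y - x)" by (metis add.commute diff_add_cancel norm_triangle_ineq)
      then show ?thesis using d(2)[of x y] that by (auto simp: dist_norm less_imp_le)
    qed
    then show ?thesis using d(1) by (intro exI[of _ "min d 1"]) auto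
  qed
  obtain d1 where d1: "d1 > 0" "\<And>x y. norm x \<le> R \<Longrightarrow> norm (y - x) < d1 \<Longrightarrow> norm (\<phi> y - \<phi> x) \<le> \<eta>"
    using unif[OF c(1)] by blast
  obtain d2 where d2: "d2 > 0" "\<And>x y. norm x \<le> R \<Longrightarrow> norm (y - x) < d2 \<Longrightarrow> norm (G y - G x) \<le> \<eta>"
    using unif[OF c(2)] by blast
  \<comment> \<open>Averaging over a square of side \<open>h\<close> moves points by at most
    \<open>2 * h\<close>, half of the smallest tolerance.\<close>
  define h where "h = min \<epsilon> (min d1 d2) / 4"
  have h: "h > 0" "2 * h < d1" "2 * h < d2" "2 * h \<le> \<epsilon>" using d1 d2 \<epsilon> by (auto simp: h_def)
  define a where "a = h *\<^sub>R (axis 1 1 :: pt)"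
  define b where "b = h *\<^sub>R (axis 2 1 :: pt)"
  have nab: "norm a = h" "norm b = h" using h by (auto simp: a_def b_def norm_axis_1)
  have disp: "norm (x + s *\<^sub>R a + t *\<^sub>R b - x) \<le> 2 * h" if "s \<in> {0..1}" "t \<in> {0..1}" for s t x
  proof -
    have "norm (s *\<^sub>R a + t *\<^sub>R b) \<le> \<bar>s\<bar> * h + \<bar>t\<bar> * h"
      using norm_triangle_ineq[of "s *\<^sub>R a" "t *\<^sub>R b"] by (simp add: nab)
    also have "\<dots> \<le> 1 * h + 1 * h" using that h by (intro add_mono mult_right_mono) auto
    finally show ?thesis by (simp add: add.assoc)
  qed
  define \<phi>' where "\<phi>' = steklov a (steklov b \<phi>)"
  define G' where "G' = steklov a (steklov b G)"
  define D1 where "D1 x = (\<phi> (x + a) - \<phi> x) / h" for x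
  define D2 where "D2 x = (\<phi> (x + b) - \<phi> x) / h" for x
  define G1 where "G1 x = (1 / h) *\<^sub>R (G (x + a) - G x)" for x
  define G2 where "G2 x = (1 / h) *\<^sub>R (G (x + b) - G x)" for x
  have d: "(\<phi> has_derivative (\<lambda>h. h \<bullet> G x)) (at x)" for x using \<phi> by (simp add: C1_grad_def gderiv_def)
  have CD: "C1_grad (\<lambda>x. (\<phi> (x + e) - \<phi> x) / h) (\<lambda>x. (1 / h) *\<^sub>R (G (x + e) - G x))" for e
    unfolding C1_grad_def gderiv_def
  proof (intro conjI allI)
    show "continuous_on UNIV (\<lambda>x. (1 / h) *\<^sub>R (G (x + e) - G x))"
      by (intro continuous_intros continuous_on_compose2[OF c(2)]) auto
    fix x
    have "((\<lambda>x. x + e) has_derivative (\<lambda>k. k)) (at x)" by (auto intro!: derivative_eq_intros)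
    from has_derivative_compose[OF this d]
    have "((\<lambda>x. \<phi> (x + e)) has_derivative (\<lambda>k. k \<bullet> G (x + e))) (at x)" .
    from has_derivative_mult_right[OF has_derivative_diff[OF this d], of "1 / h"]
    show "((\<lambda>x. (\<phi> (x + e) - \<phi> x) / h) has_derivative (\<lambda>k. k \<bullet> (1 / h) *\<^sub>R (G (x + e) - G x))) (at x)"
      by (simp add: inner_diff_right)
  qed
  have CD1: "C1_grad D1 G1" and CD2: "C1_grad D2 G2"
    using CD[of a] CD[of b] by (simp_all add: D1_def[abs_def] D2_def[abs_def] G1_def[abs_def] G2_def[abs_def])
  have Gi: "continuous_on UNIV (\<lambda>x. G x $ i)" for i by (intro continuous_intros c)
  have dir: "steklov a (\<lambda>x. G x $ 1) x = D1 x" "steklov b (\<lambda>x. G x $ 2) x = D2 x" for x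
  proof -
    have "steklov a (\<lambda>x. G x \<bullet> a) x = h * steklov a (\<lambda>x. G x $ 1) x"
      by (simp add: steklov_def a_def inner_axis)
    then show "steklov a (\<lambda>x. G x $ 1) x = D1 x" using steklov_derivative[OF \<phi>, of a x] h by (simp add: D1_def field_simps)
    have "steklov b (\<lambda>x. G x \<bullet> b) x = h * steklov b (\<lambda>x. G x $ 2) x"
      by (simp add: steklov_def b_def inner_axis)
    then show "steklov b (\<lambda>x. G x $ 2) x = D2 x" using steklov_derivative[OF \<phi>, of b x] h by (simp add: D2_def field_simps)
  qed
  have sc: "continuous_on UNIV (steklov b G)" by (rule steklov_continuous[OF c(2)])
  have comp: "G' x $ i = steklov a (steklov b (\<lambda>x. G x $ i)) x" for x i
    unfolding G'_def by (simp add: steklov_component[OF sc] steklov_component[OF c(2)])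
  \<comment> \<open>Averaging along \<open>a\<close> turns the first partial derivative into the
    quotient \<open>D1\<close>, which is again C1; averaging that along \<open>b\<close> keeps it
    so.\<close>
  have G'1: "G' x $ 1 = steklov b D1 x" for x
  proof -
    have "steklov a (\<lambda>x. G x $ 1) = D1" by (rule ext) (rule dir(1))
    moreover have "G' x $ 1 = steklov b (steklov a (\<lambda>x. G x $ 1)) x"
      unfolding comp by (rule steklov_swap[OF Gi])
    ultimately show ?thesis by simp
  qed
  have G'2: "G' x $ 2 = steklov a D2 x" for x
  proof -
    have "steklov b (\<lambda>x. G x $ 2) = D2" by (rule ext) (rule dir(2))
    then show ?thesis unfolding comp by simp
  qed
  define J' where "J' x = (vector [steklov a G2 x, - steklov b G1 x] :: real^2^2)" for x
  have CG1: "C1_grad (steklov b D1) (steklov b G1)" and CG2: "C1_grad (steklov a D2) (steklov a G2)"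
    by (rule steklov_C1[OF CD1] steklov_C1[OF CD2])+
  have CJ: "C1_jacobian (\<lambda>x. perp (G' x)) J'"
    unfolding C1_jacobian_def
  proof (intro conjI allI)
    show "continuous_on UNIV J'"
    proof -
      have "continuous_on UNIV (\<lambda>x. J' x $ i)" for i
        using exhaust_2[of i] C1_grad_continuous(2)[OF CG1] C1_grad_continuous(2)[OF CG2]
        by (auto simp: J'_def intro!: continuous_on_minus)
      then have "continuous_on UNIV (\<lambda>x. \<chi> i. J' x $ i)" by (intro continuous_on_vec_lambda)
      then show ?thesis by simp
    qed
    fix x
    have "((\<lambda>x. steklov a D2 x *\<^sub>R axis 1 1 + (- steklov b D1 x) *\<^sub>R (axis 2 1 :: pt)) has_derivative
        (\<lambda>k. (k \<bullet> steklov a G2 x) *\<^sub>R axis 1 1 + (- (k \<bullet> steklov b G1 x)) *\<^sub>R axis 2 1)) (at x)"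
      using CG1 CG2 unfolding C1_grad_def gderiv_def
      by (intro has_derivative_add has_derivative_scaleR_left has_derivative_minus) blast+
    moreover have "(\<lambda>x. steklov a D2 x *\<^sub>R axis 1 1 + (- steklov b D1 x) *\<^sub>R (axis 2 1 :: pt)) = (\<lambda>x. perp (G' x))"
      by (simp add: fun_eq_iff pt_eq_iff axis_def G'1 G'2)
    moreover have "(\<lambda>k. (k \<bullet> steklov a G2 x) *\<^sub>R axis 1 1 + (- (k \<bullet> steklov b G1 x)) *\<^sub>R axis 2 1) = (\<lambda>k. J' x *v k)"
      by (simp add: fun_eq_iff pt_eq_iff axis_def J'_def matrix_vector_mult_def sum_2 inner_pt mult.commute)
    ultimately show "((\<lambda>x. perp (G' x)) has_derivative (\<lambda>k. J' x *v k)) (at x)" by simp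
  qed
  \<comment> \<open>Both mixed derivatives equal the second difference of \<open>\<phi>\<close> over
    the corners \<open>x\<close>, \<open>x + a\<close>, \<open>x + b\<close>,
    \<open>x + a + b\<close> divided by the square of \<open>h\<close>, and they enter the trace
    with opposite signs.\<close>
  have tr: "trace (J' x) = 0" for x
  proof -
    have "steklov a G2 x $ 1 = (D1 (x + b) - D1 x) / h"
    proof -
      have "steklov a G2 x $ 1 = steklov a (\<lambda>x. G2 x $ 1) x"
        by (rule steklov_component) (rule C1_grad_continuous[OF CD2])
      also have "\<dots> = (steklov a (\<lambda>x. G x $ 1) (x + b) - steklov a (\<lambda>x. G x $ 1) x) / h"
        unfolding G2_def vector_scaleR_component vector_minus_component real_scaleR_def
        by (rule steklov_difference[OF Gi])
      finally show ?thesis by (simp add: dir)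
    qed
    moreover have "steklov b G1 x $ 2 = (D2 (x + a) - D2 x) / h"
    proof -
      have "steklov b G1 x $ 2 = steklov b (\<lambda>x. G1 x $ 2) x"
        by (rule steklov_component) (rule C1_grad_continuous[OF CD1])
      also have "\<dots> = (steklov b (\<lambda>x. G x $ 2) (x + a) - steklov b (\<lambda>x. G x $ 2) x) / h"
        unfolding G1_def vector_scaleR_component vector_minus_component real_scaleR_def
        by (rule steklov_difference[OF Gi])
      finally show ?thesis by (simp add: dir)
    qed
    ultimately show ?thesis
      by (simp add: trace_def sum_2 J'_def D1_def D2_def diff_divide_distrib algebra_simps)
  qed
  have near: "norm (steklov a (steklov b k) x - k x) \<le> \<eta>"
    if k: "continuous_on UNIV k" and "\<And>y. norm (y - x) \<le> 2 * h \<Longrightarrow> norm (k y - k x) \<le> \<eta>" for k :: "pt \<Rightarrow> 'b::euclidean_space" and x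
    by (intro steklov_near steklov_continuous k that(2) disp)
  have "\<bar>\<phi>' x - \<phi> x\<bar> \<le> \<eta> \<and> norm (G' x - G x) \<le> \<eta>" if "x \<in> B" for x
  proof -
    have x: "norm x \<le> R" using that R by auto
    have "norm (\<phi>' x - \<phi> x) \<le> \<eta>" unfolding \<phi>'_def by (intro near c d1(2) x) (use h in auto)
    moreover have "norm (G' x - G x) \<le> \<eta>" unfolding G'_def by (intro near c d2(2) x) (use h in auto)
    ultimately show ?thesis by simp
  qed
  moreover have "\<exists>z. \<phi> z \<noteq> 0 \<and> dist x z \<le> \<epsilon>" if "\<phi>' x \<noteq> 0" for x
  proof (rule ccontr)
    assume no: "\<not> (\<exists>z. \<phi> z \<noteq> 0 \<and> dist x z \<le> \<epsilon>)"
    have z: "\<phi> (x + s *\<^sub>R a + t *\<^sub>R b) = 0" if "s \<in> {0..1}" "t \<in> {0..1}" for s t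
    proof -
      have "dist x (x + s *\<^sub>R a + t *\<^sub>R b) \<le> \<epsilon>"
        using disp[OF that, of x] h(4) unfolding dist_norm norm_minus_commute[of x] by linarith
      then show ?thesis using no by blast
    qed
    have "norm (steklov a (steklov b \<phi>) x - 0) \<le> 0"
      by (intro steklov_near steklov_continuous c) (simp add: z)
    then show False using that by (simp add: \<phi>'_def)
  qed
  ultimately show ?thesis
    using steklov_C1[OF steklov_C1[OF \<phi>]] CJ tr unfolding \<phi>'_def G'_def by blast
qed

section \<open>Rotated gradients\<close>

lemma C1_jacobian_row:
  assumes F: "C1_jacobian F J" shows "C1_grad (\<lambda>x. F x $ i) (\<lambda>x. J x $ i)"
  unfolding C1_grad_def gderiv_def
proof (intro conjI allI)
  show "continuous_on UNIV (\<lambda>x. J x $ i)" by (intro continuous_intros C1_jacobian_continuous[OF F])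
  fix x
  have "(F has_derivative (\<lambda>h. J x *v h)) (at x)" using F by (simp add: C1_jacobian_def)
  from bounded_linear.has_derivative[OF bounded_linear_vec_nth this, of i]
  show "((\<lambda>x. F x $ i) has_derivative (\<lambda>h. h \<bullet> J x $ i)) (at x)"
    by (simp add: matrix_vector_mult_def inner_pt sum_2 mult.commute)
qed

text \<open>Each component of \<open>F\<close> is itself a test function; adding the two diagonal
  components gives the vector form of the weak gradient.\<close>

lemma weak_grad_divergence:
  assumes D: "open D" "bounded D" and v: "v \<in> L2 D" and g: "g \<in> L2 D" and wg: "weak_grad D v g"
    and F: "C1_jacobian F J" and K: "compact K" "K \<subseteq> D" "\<And>x. x \<notin> K \<Longrightarrow> F x = 0"
  shows "(LINT x|lebesgue_on D. v x * trace (J x)) = - (LINT x|lebesgue_on D. F x \<bullet> g x)"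
proof -
  have i: "(LINT x|lebesgue_on D. v x * J x $ i $ i) = - (LINT x|lebesgue_on D. F x $ i * g x $ i)"
    and vi: "integrable (lebesgue_on D) (\<lambda>x. v x * J x $ i $ i)"
    and gi: "integrable (lebesgue_on D) (\<lambda>x. F x $ i * g x $ i)" for i
  proof -
    have t: "test_fun D (\<lambda>x. F x $ i) (\<lambda>x. J x $ i)"
      unfolding test_fun_def using C1_jacobian_row[OF F] K by force
    note tL = test_fun_L2[OF t D]
    note I1 = integrable_L2_scaleR[OF v tL(2)] and I2 = integrable_L2_scaleR[OF tL(1) g]
    have "(LINT x|lebesgue_on D. v x *\<^sub>R J x $ i) $ i = (- (LINT x|lebesgue_on D. F x $ i *\<^sub>R g x)) $ i"
      using wg t by (simp add: weak_grad_def)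
    then show "(LINT x|lebesgue_on D. v x * J x $ i $ i) = - (LINT x|lebesgue_on D. F x $ i * g x $ i)"
      using integral_vec_nth[OF I1, of i] integral_vec_nth[OF I2, of i] by simp
    show "integrable (lebesgue_on D) (\<lambda>x. v x * J x $ i $ i)" "integrable (lebesgue_on D) (\<lambda>x. F x $ i * g x $ i)"
      using integrable_vec_nth[OF I1, of i] integrable_vec_nth[OF I2, of i] by simp_all
  qed
  have "(LINT x|lebesgue_on D. v x * trace (J x)) = (LINT x|lebesgue_on D. v x * J x $ 1 $ 1 + v x * J x $ 2 $ 2)"
    by (simp add: trace_def sum_2 distrib_left)
  also have "\<dots> = - (LINT x|lebesgue_on D. F x $ 1 * g x $ 1 + F x $ 2 * g x $ 2)"
    using vi gi by (simp add: i)
  finally show ?thesis by (simp add: inner_pt)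
qed

lemma zero_if_le_mult:
  fixes X :: real
  assumes C: "0 \<le> C" and le: "\<And>\<eta>. \<eta> > 0 \<Longrightarrow> \<bar>X\<bar> \<le> \<eta> * C"
  shows "X = 0"
proof -
  have "\<bar>X\<bar> \<le> 0 + e" if "e > 0" for e
  proof -
    have "\<bar>X\<bar> \<le> e / (C + 1) * C" using that C by (intro le) simp
    also have "\<dots> \<le> e" using that C by (simp add: field_simps)
    finally show ?thesis by simp
  qed
  then have "\<bar>X\<bar> \<le> 0" by (rule field_le_epsilon)
  then show ?thesis by simp
qed

lemma L2_norm_integrable:
  fixes g :: "pt \<Rightarrow> 'b::euclidean_space"
  assumes g: "g \<in> L2 D" and D: "open D" "bounded D"
  shows "integrable (lebesgue_on D) (\<lambda>x. norm (g x))"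
proof -
  have "(\<lambda>x. norm (g x)) \<in> L2 D"
    using g measurable_compose[OF L2_measurable[OF g] borel_measurable_norm] by (simp add: L2_iff)
  moreover have "(\<lambda>x. 1::real) \<in> L2 D" by (intro continuous_L2 D continuous_intros)
  ultimately show ?thesis using integrable_L2_mult[of "\<lambda>x. norm (g x)" D "\<lambda>x. 1"] by simp
qed

lemma integral_inner_close:
  fixes w G G' :: "pt \<Rightarrow> pt"
  assumes w: "w \<in> L2 D" and D: "open D" "bounded D" and G: "G \<in> L2 D" "G' \<in> L2 D"
    and close: "\<And>x. x \<in> D \<Longrightarrow> norm (G' x - G x) \<le> \<eta>"
  shows "\<bar>(LINT x|lebesgue_on D. w x \<bullet> G x) - (LINT x|lebesgue_on D. w x \<bullet> G' x)\<bar> \<le> \<eta> * (LINT x|lebesgue_on D. norm (w x))"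
proof -
  note I = integrable_L2_inner[OF w G(1)] integrable_L2_inner[OF w G(2)]
  have "\<bar>(LINT x|lebesgue_on D. w x \<bullet> G x) - (LINT x|lebesgue_on D. w x \<bullet> G' x)\<bar>
      = \<bar>LINT x|lebesgue_on D. w x \<bullet> G x - w x \<bullet> G' x\<bar>" using I by simp
  also have "\<dots> \<le> (LINT x|lebesgue_on D. \<bar>w x \<bullet> G x - w x \<bullet> G' x\<bar>)" by (rule integral_abs_bound)
  also have "\<dots> \<le> (LINT x|lebesgue_on D. \<eta> * norm (w x))"
  proof (rule integral_mono)
    show "\<bar>w x \<bullet> G x - w x \<bullet> G' x\<bar> \<le> \<eta> * norm (w x)" if "x \<in> space (lebesgue_on D)" for x
    proof -
      have "\<bar>w x \<bullet> G x - w x \<bullet> G' x\<bar> \<le> norm (w x) * norm (G x - G' x)"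
        unfolding inner_diff_right[symmetric] by (rule Cauchy_Schwarz_ineq2)
      also have "\<dots> \<le> norm (w x) * \<eta>"
        using close[of x] that by (intro mult_left_mono) (auto simp: norm_minus_commute)
      finally show ?thesis by (simp add: mult.commute)
    qed
  qed (use I L2_norm_integrable[OF w D] in auto)
  finally show ?thesis by simp
qed

text \<open>Moving the rotation onto the test function leaves the weak gradient tested with
  \<open>perp (G' x)\<close>, which is C1 and solenoidal for the averaged test function; the
  averages approximate the given test function uniformly.\<close>

lemma weak_div_rotated_grad:
  assumes D: "open D" "bounded D" and v: "v \<in> H1 D"
  shows "weak_div D (\<lambda>x. perp (grad D v x)) (\<lambda>x. 0)"
  unfolding weak_div_def
proof (intro allI impI)
  fix \<phi> G assume t: "test_fun D \<phi> G"
  note tL = test_fun_L2[OF t D]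
  note g = grad_L2[OF v] and wg = weak_grad_grad[OF v]
  have vL: "v \<in> L2 D" using v by (simp add: H1_def)
  have pL: "(\<lambda>x. perp (grad D v x)) \<in> L2 D" by (rule L2_perp[OF g])
  obtain K where \<phi>: "C1_grad \<phi> G" and K: "compact K" "K \<subseteq> D" "\<And>x. x \<notin> K \<Longrightarrow> \<phi> x = 0"
    using t by (auto simp: test_fun_def)
  obtain \<epsilon> where \<epsilon>: "\<epsilon> > 0" "(\<Union>x\<in>K. cball x \<epsilon>) \<subseteq> D"
    using compact_subset_open_imp_cball_epsilon_subset[OF K(1) D(1) K(2)] by metis
  \<comment> \<open>The closed \<open>\<epsilon>\<close>-neighbourhood of the support: still compact
    in \<open>D\<close>, and large enough for the averaged function.\<close>
  define K' where "K' = {x + y |x y. x \<in> K \<and> y \<in> cball 0 \<epsilon>}"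
  have K': "compact K'" unfolding K'_def by (rule compact_sums[OF K(1) compact_cball])
  have K'D: "K' \<subseteq> D"
  proof
    fix z assume "z \<in> K'"
    then obtain x y where "x \<in> K" "norm y \<le> \<epsilon>" "z = x + y" by (auto simp: K'_def)
    then have "z \<in> cball x \<epsilon>" by (simp add: dist_norm)
    then show "z \<in> D" using \<epsilon>(2) \<open>x \<in> K\<close> by blast
  qed
  have "(LINT x|lebesgue_on D. perp (grad D v x) \<bullet> G x) = 0"
  proof (rule zero_if_le_mult)
    show "0 \<le> (LINT x|lebesgue_on D. norm (perp (grad D v x)))" by simp
    fix \<eta> :: real assume \<eta>: "\<eta> > 0"
    obtain \<phi>' G' J' where \<phi>': "C1_grad \<phi>' G'" "C1_jacobian (\<lambda>x. perp (G' x)) J'" "\<forall>x. trace (J' x) = 0"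
      and close: "\<forall>x\<in>D. \<bar>\<phi>' x - \<phi> x\<bar> \<le> \<eta> \<and> norm (G' x - G x) \<le> \<eta>"
      and supp: "\<forall>x. \<phi>' x \<noteq> 0 \<longrightarrow> (\<exists>z. \<phi> z \<noteq> 0 \<and> dist x z \<le> \<epsilon>)"
      using steklov_approx[OF \<phi> D(2) \<eta> \<epsilon>(1)] by blast
    have z: "\<phi>' x = 0" if "x \<notin> K'" for x
    proof (rule ccontr)
      assume "\<phi>' x \<noteq> 0"
      then obtain z where z: "\<phi> z \<noteq> 0" "dist x z \<le> \<epsilon>" using supp by blast
      then have "z \<in> K" "norm (x - z) \<le> \<epsilon>" using K(3) by (auto simp: dist_norm)
      then have "x \<in> K'" unfolding K'_def by (intro CollectI exI[of _ z] exI[of _ "x - z"]) auto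
      then show False using that by simp
    qed
    have "perp (G' x) = 0" if "x \<notin> K'" for x
      using C1_grad_zero[OF \<phi>'(1) compact_imp_closed[OF K'] z that] by (simp add: perp_linear)
    from weak_grad_divergence[OF D vL g wg \<phi>'(2) K' K'D this]
    have "(LINT x|lebesgue_on D. perp (G' x) \<bullet> grad D v x) = 0" using \<phi>'(3) by simp
    then have "(LINT x|lebesgue_on D. perp (grad D v x) \<bullet> G' x) = 0"
      by (simp add: perp_inner inner_commute)
    moreover have "G' \<in> L2 D" by (intro continuous_L2 D C1_grad_continuous[OF \<phi>'(1)])
    ultimately show "\<bar>LINT x|lebesgue_on D. perp (grad D v x) \<bullet> G x\<bar> \<le> \<eta> * (LINT x|lebesgue_on D. norm (perp (grad D v x)))"
      using integral_inner_close[OF pL D tL(2), of G' \<eta>] close by simp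
  qed
  then show "(LINT x|lebesgue_on D. perp (grad D v x) \<bullet> G x) = - (LINT x|lebesgue_on D. 0 * \<phi> x)" by simp
qed

text \<open>Integration by parts along an edge. The tangential derivative of a linear trace is
  constant, and this is why the rotated gradient has a constant normal component.\<close>

lemma linear_trace_tangential:
  assumes \<phi>: "C1_grad \<phi> G"
  shows "integral {0..1} (\<lambda>t. ((1 - t) * ga + t * gb) * (G (linepath a b t) \<bullet> (b - a)))
    = gb * \<phi> b - ga * \<phi> a - (gb - ga) * integral {0..1} (\<lambda>t. \<phi> (linepath a b t))"
proof -
  note c = C1_grad_continuous[OF \<phi>, of UNIV]
  have cl: "continuous_on {0..1} (\<lambda>t. \<phi> (linepath a b t))" "continuous_on {0..1} (\<lambda>t. G (linepath a b t))"
    by (rule continuous_on_compose2[OF c(1)] continuous_on_compose2[OF c(2)]; auto intro!: continuous_intros)+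
  have d: "((\<lambda>t. \<phi> (linepath a b t)) has_real_derivative G (linepath a b t) \<bullet> (b - a)) (at t within {0..1})" for t
  proof -
    have "(linepath a b has_derivative (\<lambda>h. h *\<^sub>R (b - a))) (at t within {0..1})"
      unfolding linepath_def by (auto intro!: derivative_eq_intros simp: algebra_simps)
    moreover have "(\<phi> has_derivative (\<lambda>h. h \<bullet> G (linepath a b t))) (at (linepath a b t))"
      using \<phi> by (simp add: C1_grad_def gderiv_def)
    ultimately have "((\<lambda>t. \<phi> (linepath a b t)) has_derivative (\<lambda>h. (h *\<^sub>R (b - a)) \<bullet> G (linepath a b t))) (at t within {0..1})"
      by (rule has_derivative_compose)
    moreover have "(\<lambda>h. (h *\<^sub>R (b - a)) \<bullet> G (linepath a b t)) = (*) (G (linepath a b t) \<bullet> (b - a))"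
      by (simp add: fun_eq_iff inner_commute)
    ultimately show ?thesis by (simp only: has_field_derivative_def)
  qed
  have n: "((\<lambda>t. (1 - t) * ga + t * gb) has_real_derivative gb - ga) (at t within {0..1})" for t
    by (auto intro!: derivative_eq_intros)
  have "((\<lambda>t. (gb - ga) * \<phi> (linepath a b t) + (G (linepath a b t) \<bullet> (b - a)) * ((1 - t) * ga + t * gb)) has_integral
      (((1 - 1) * ga + 1 * gb) * \<phi> (linepath a b 1) - ((1 - 0) * ga + 0 * gb) * \<phi> (linepath a b 0))) {0..1}"
    by (rule fundamental_theorem_of_calculus)
       (use DERIV_mult[OF n d] in \<open>auto simp: has_real_derivative_iff_has_vector_derivative[symmetric]\<close>)
  then have 1: "integral {0..1} (\<lambda>t. (gb - ga) * \<phi> (linepath a b t) + (G (linepath a b t) \<bullet> (b - a)) * ((1 - t) * ga + t * gb))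
      = gb * \<phi> b - ga * \<phi> a" by (simp add: integral_unique linepath_0' linepath_1')
  have "integral {0..1} (\<lambda>t. (gb - ga) * \<phi> (linepath a b t) + (G (linepath a b t) \<bullet> (b - a)) * ((1 - t) * ga + t * gb))
      = integral {0..1} (\<lambda>t. (gb - ga) * \<phi> (linepath a b t)) + integral {0..1} (\<lambda>t. (G (linepath a b t) \<bullet> (b - a)) * ((1 - t) * ga + t * gb))"
    by (intro Henstock_Kurzweil_Integration.integral_add integrable_continuous_real continuous_intros cl)
  then show ?thesis using 1 by (simp add: mult.commute)
qed

text \<open>For averaged test functions the trace formula of \<open>v\<close> followed by
  integration by parts along the edges gives the claim; both sides depend continuously on the test
  function and its gradient in the uniform norm.\<close>

lemma nodal_rotated_grad_trace:
  assumes P: "simple_polygon P" and v: "v \<in> nodal_local P"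
  shows "\<exists>c. has_const_normal_trace P (\<lambda>x. perp (grad (region P) v x)) c"
proof -
  let ?R = "region P"
  note D = open_region[of P] bounded_region[of P]
  obtain g where H: "v \<in> H1 ?R" and tr: "has_trace P v g"
    and l: "\<forall>(a, b)\<in>edges P. \<forall>t\<in>{0..1}. g (linepath a b t) = (1 - t) * g a + t * g b"
    using v unfolding nodal_local_def by blast
  have pL: "(\<lambda>x. perp (grad ?R v x)) \<in> L2 ?R" by (rule L2_perp[OF grad_L2[OF H]])
  \<comment> \<open>The tangential slope of the trace: \<open>perp\<close> takes the tangent to the
    outward normal, and so takes the tangential derivative to the normal component.\<close>
  define c where "c e = (g (snd e) - g (fst e)) / edge_length e" for e
  have len: "edge_length e > 0" if "e \<in> edges P" for e
    using simple_polygon_edge_distinct[OF P that] by (simp add: edge_length_def)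
  \<comment> \<open>Here \<open>perp (G x)\<close> is a solenoidal C1 field, so the trace formula of
    \<open>v\<close> accepts it; the vertex terms telescope around the polygon.\<close>
  have smooth: "(LINT x|lebesgue_on ?R. perp (grad ?R v x) \<bullet> G x) = (\<Sum>e\<in>edges P. c e * edge_integral e \<phi>)"
    if \<phi>: "C1_grad \<phi> G" "C1_jacobian (\<lambda>x. perp (G x)) J" "\<forall>x. trace (J x) = 0" for \<phi> G J
  proof -
    have "(LINT x|lebesgue_on ?R. grad ?R v x \<bullet> perp (G x)) = (LINT x|lebesgue_on ?R. v x * trace (J x) + grad ?R v x \<bullet> perp (G x))"
      using \<phi>(3) by simp
    also have "\<dots> = (\<Sum>e\<in>edges P. edge_integral e (\<lambda>x. g x * (perp (G x) \<bullet> edge_normal e)))"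
      using tr \<phi>(2) by (simp add: has_trace_def)
    also have "\<dots> = (\<Sum>e\<in>edges P. (g (snd e) * \<phi> (snd e) - g (fst e) * \<phi> (fst e)) - c e * edge_integral e \<phi>)"
    proof (rule sum.cong[OF refl])
      fix e assume e: "e \<in> edges P"
      have "edge_integral e (\<lambda>x. g x * (perp (G x) \<bullet> edge_normal e)) =
        integral {0..1} (\<lambda>t. g (linepath (fst e) (snd e) t) * cross2 (perp (G (linepath (fst e) (snd e) t))) (snd e - fst e))"
        by (rule edge_integral_normal[OF simple_polygon_edge_distinct[OF P e], where F="\<lambda>x. perp (G x)"])
      also have "\<dots> = integral {0..1} (\<lambda>t. ((1 - t) * g (fst e) + t * g (snd e)) * (G (linepath (fst e) (snd e) t) \<bullet> (snd e - fst e)))"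
      proof (rule integral_cong)
        fix t :: real assume t: "t \<in> {0..1}"
        have "g (linepath (fst e) (snd e) t) = (1 - t) * g (fst e) + t * g (snd e)"
          using bspec[OF l e] t by (simp add: case_prod_unfold)
        then show "g (linepath (fst e) (snd e) t) * cross2 (perp (G (linepath (fst e) (snd e) t))) (snd e - fst e)
          = ((1 - t) * g (fst e) + t * g (snd e)) * (G (linepath (fst e) (snd e) t) \<bullet> (snd e - fst e))"
          by (simp only: inner_perp[symmetric] perp_inner_perp)
      qed
      also have "\<dots> = g (snd e) * \<phi> (snd e) - g (fst e) * \<phi> (fst e) - (g (snd e) - g (fst e)) * integral {0..1} (\<lambda>t. \<phi> (linepath (fst e) (snd e) t))"
        by (rule linear_trace_tangential[OF \<phi>(1)])
      also have "(g (snd e) - g (fst e)) * integral {0..1} (\<lambda>t. \<phi> (linepath (fst e) (snd e) t)) = c e * edge_integral e \<phi>"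
        using len[OF e] by (simp add: c_def edge_integral_def)
      finally show "edge_integral e (\<lambda>x. g x * (perp (G x) \<bullet> edge_normal e)) =
          (g (snd e) * \<phi> (snd e) - g (fst e) * \<phi> (fst e)) - c e * edge_integral e \<phi>" .
    qed
    also have "\<dots> = - (\<Sum>e\<in>edges P. c e * edge_integral e \<phi>)"
      using sum_edges_telescope[of P "\<lambda>x. g x * \<phi> x"] P by (simp add: sum_subtractf case_prod_unfold simple_polygon_def)
    finally show ?thesis by (simp add: perp_inner)
  qed
  have "(LINT x|lebesgue_on ?R. perp (grad ?R v x) \<bullet> G x) = (\<Sum>e\<in>edges P. c e * edge_integral e \<phi>)"
    if \<phi>: "C1_grad \<phi> G" for \<phi> G
  proof -
    \<comment> \<open>Bounds the change of both sides when \<open>\<phi>\<close> and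
      \<open>G\<close> are perturbed uniformly by at most 1.\<close>
    define C where "C = (LINT x|lebesgue_on ?R. norm (perp (grad ?R v x))) + (\<Sum>e\<in>edges P. \<bar>c e\<bar> * edge_length e)"
    have "(LINT x|lebesgue_on ?R. perp (grad ?R v x) \<bullet> G x) - (\<Sum>e\<in>edges P. c e * edge_integral e \<phi>) = 0"
    proof (rule zero_if_le_mult)
      show "0 \<le> C" unfolding C_def using len by (intro add_nonneg_nonneg sum_nonneg) (auto simp: less_imp_le)
      fix \<eta> :: real assume \<eta>: "\<eta> > 0"
      have "bounded (?R \<union> bdry P)" using D(2) compact_imp_bounded[OF compact_bdry] by simp
      from steklov_approx[OF \<phi> this \<eta> zero_less_one]
      obtain \<phi>' G' J' where \<phi>': "C1_grad \<phi>' G'" "C1_jacobian (\<lambda>x. perp (G' x)) J'" "\<forall>x. trace (J' x) = 0"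
        and close: "\<forall>x\<in>?R \<union> bdry P. \<bar>\<phi>' x - \<phi> x\<bar> \<le> \<eta> \<and> norm (G' x - G x) \<le> \<eta>" by blast
      have GL: "G \<in> L2 ?R" "G' \<in> L2 ?R"
        by (intro continuous_L2 D C1_grad_continuous[OF \<phi>] C1_grad_continuous[OF \<phi>'(1)])+
      have "\<bar>(LINT x|lebesgue_on ?R. perp (grad ?R v x) \<bullet> G x) - (LINT x|lebesgue_on ?R. perp (grad ?R v x) \<bullet> G' x)\<bar>
          \<le> \<eta> * (LINT x|lebesgue_on ?R. norm (perp (grad ?R v x)))"
        by (rule integral_inner_close[OF pL D GL]) (use close in auto)
      moreover have "\<bar>(\<Sum>e\<in>edges P. c e * edge_integral e \<phi>') - (\<Sum>e\<in>edges P. c e * edge_integral e \<phi>)\<bar> \<le> \<eta> * (\<Sum>e\<in>edges P. \<bar>c e\<bar> * edge_length e)"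
      proof -
        have "\<bar>c e * edge_integral e \<phi>' - c e * edge_integral e \<phi>\<bar> \<le> \<eta> * (\<bar>c e\<bar> * edge_length e)" if e: "e \<in> edges P" for e
        proof -
          have cl: "continuous_on {0..1} (\<lambda>t. k (linepath (fst e) (snd e) t))" if "continuous_on UNIV k" for k :: "pt \<Rightarrow> real"
            by (rule continuous_on_compose2[OF that]) (auto intro!: continuous_intros)
          note i = integrable_continuous_real[OF cl[OF C1_grad_continuous(1)[OF \<phi>]]]
            integrable_continuous_real[OF cl[OF C1_grad_continuous(1)[OF \<phi>'(1)]]]
          have "norm (integral {0..1} (\<lambda>t. \<phi>' (linepath (fst e) (snd e) t) - \<phi> (linepath (fst e) (snd e) t))) \<le> integral {0..1::real} (\<lambda>t. \<eta>)"
          proof (rule integral_norm_bound_integral)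
            fix t :: real assume "t \<in> {0..1}"
            then have "linepath (fst e) (snd e) t \<in> bdry P"
              using edge_subset_bdry[OF e] linepath_in_path[of t "fst e" "snd e"] by auto
            then show "norm (\<phi>' (linepath (fst e) (snd e) t) - \<phi> (linepath (fst e) (snd e) t)) \<le> \<eta>" using close by simp
          qed (use i in \<open>auto intro!: integrable_diff\<close>)
          then have 1: "\<bar>integral {0..1} (\<lambda>t. \<phi>' (linepath (fst e) (snd e) t)) - integral {0..1} (\<lambda>t. \<phi> (linepath (fst e) (snd e) t))\<bar> \<le> \<eta>"
            using Henstock_Kurzweil_Integration.integral_diff[OF i(2,1)] by simp
          have "\<bar>c e * edge_integral e \<phi>' - c e * edge_integral e \<phi>\<bar> = \<bar>c e\<bar> * edge_length e *
              \<bar>integral {0..1} (\<lambda>t. \<phi>' (linepath (fst e) (snd e) t)) - integral {0..1} (\<lambda>t. \<phi> (linepath (fst e) (snd e) t))\<bar>"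
            using len[OF e] by (simp add: edge_integral_def right_diff_distrib[symmetric] abs_mult)
          also have "\<dots> \<le> \<bar>c e\<bar> * edge_length e * \<eta>" using 1 len[OF e] by (intro mult_left_mono) auto
          finally show ?thesis by (simp add: mult_ac)
        qed
        then show ?thesis
          unfolding sum_subtractf[symmetric] sum_distrib_left by (intro order_trans[OF sum_abs] sum_mono)
      qed
      ultimately show "\<bar>(LINT x|lebesgue_on ?R. perp (grad ?R v x) \<bullet> G x) - (\<Sum>e\<in>edges P. c e * edge_integral e \<phi>)\<bar> \<le> \<eta> * C"
        unfolding smooth[OF \<phi>'] C_def distrib_left by linarith
    qed
    then show ?thesis by simp
  qed
  then have "has_const_normal_trace P (\<lambda>x. perp (grad ?R v x)) c"
    unfolding has_const_normal_trace_def using pL weak_div_rotated_grad[OF D H]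
    by (intro conjI bexI[of _ "\<lambda>x. 0"] allI impI) (auto simp: L2_zero)
  then show ?thesis by blast
qed

section \<open>The edge space\<close>

lemma has_const_normal_trace_lincomb:
  assumes "has_const_normal_trace P w1 c1" "has_const_normal_trace P w2 c2"
  shows "has_const_normal_trace P (\<lambda>x. a *\<^sub>R w1 x + b *\<^sub>R w2 x) (\<lambda>e. a * c1 e + b * c2 e)"
proof -
  let ?R = "region P"
  note D = open_region[of P] bounded_region[of P]
  obtain d1 where w1: "w1 \<in> L2 ?R" and d1: "d1 \<in> L2 ?R" "weak_div ?R w1 d1"
    and g1: "\<And>\<phi> G. C1_grad \<phi> G \<Longrightarrow> (LINT x|lebesgue_on ?R. w1 x \<bullet> G x + d1 x * \<phi> x) = (\<Sum>e\<in>edges P. c1 e * edge_integral e \<phi>)"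
    using assms(1) unfolding has_const_normal_trace_def by blast
  obtain d2 where w2: "w2 \<in> L2 ?R" and d2: "d2 \<in> L2 ?R" "weak_div ?R w2 d2"
    and g2: "\<And>\<phi> G. C1_grad \<phi> G \<Longrightarrow> (LINT x|lebesgue_on ?R. w2 x \<bullet> G x + d2 x * \<phi> x) = (\<Sum>e\<in>edges P. c2 e * edge_integral e \<phi>)"
    using assms(2) unfolding has_const_normal_trace_def by blast
  have dL: "(\<lambda>x. a * d1 x + b * d2 x) \<in> L2 ?R" using L2_lincomb[OF d1(1) d2(1), of a b] by simp
  have "(LINT x|lebesgue_on ?R. (a *\<^sub>R w1 x + b *\<^sub>R w2 x) \<bullet> G x + (a * d1 x + b * d2 x) * \<phi> x)
      = (\<Sum>e\<in>edges P. (a * c1 e + b * c2 e) * edge_integral e \<phi>)" if \<phi>: "C1_grad \<phi> G" for \<phi> G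
  proof -
    have L: "\<phi> \<in> L2 ?R" "G \<in> L2 ?R" by (intro continuous_L2 D C1_grad_continuous[OF \<phi>])+
    have i: "integrable (lebesgue_on ?R) (\<lambda>x. w1 x \<bullet> G x + d1 x * \<phi> x)" "integrable (lebesgue_on ?R) (\<lambda>x. w2 x \<bullet> G x + d2 x * \<phi> x)"
      by (intro Bochner_Integration.integrable_add integrable_L2_inner integrable_L2_mult w1 w2 d1 d2 L)+
    have "(LINT x|lebesgue_on ?R. (a *\<^sub>R w1 x + b *\<^sub>R w2 x) \<bullet> G x + (a * d1 x + b * d2 x) * \<phi> x)
      = (LINT x|lebesgue_on ?R. a * (w1 x \<bullet> G x + d1 x * \<phi> x) + b * (w2 x \<bullet> G x + d2 x * \<phi> x))"
      by (simp add: inner_add_left algebra_simps)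
    also have "\<dots> = a * (\<Sum>e\<in>edges P. c1 e * edge_integral e \<phi>) + b * (\<Sum>e\<in>edges P. c2 e * edge_integral e \<phi>)"
      using i by (simp add: g1[OF \<phi>] g2[OF \<phi>])
    finally show ?thesis by (simp add: sum_distrib_left sum.distrib[symmetric] algebra_simps)
  qed
  then show ?thesis
    unfolding has_const_normal_trace_def
    using L2_lincomb[OF w1 w2] dL weak_div_lincomb[OF D w1 w2 d1(1) d2(1) d1(2) d2(2)] by blast
qed

lemma has_const_normal_trace_cong_AE:
  assumes "has_const_normal_trace P w c" and m: "w' \<in> borel_measurable (lebesgue_on (region P))"
    and eq: "AE x in lebesgue_on (region P). w x = w' x"
  shows "has_const_normal_trace P w' c"
proof -
  let ?R = "region P"
  note D = open_region[of P] bounded_region[of P]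
  obtain d where w: "w \<in> L2 ?R" and d: "d \<in> L2 ?R" "weak_div ?R w d"
    and g: "\<And>\<phi> G. C1_grad \<phi> G \<Longrightarrow> (LINT x|lebesgue_on ?R. w x \<bullet> G x + d x * \<phi> x) = (\<Sum>e\<in>edges P. c e * edge_integral e \<phi>)"
    using assms(1) unfolding has_const_normal_trace_def by blast
  have w': "w' \<in> L2 ?R" by (rule L2_cong_AE[OF w m eq])
  have "weak_div ?R w' d"
    by (rule weak_div_cong_AE[OF D d(2) L2_measurable[OF w] m L2_measurable[OF d(1)] L2_measurable[OF d(1)] eq]) simp
  moreover have "(LINT x|lebesgue_on ?R. w' x \<bullet> G x + d x * \<phi> x) = (\<Sum>e\<in>edges P. c e * edge_integral e \<phi>)"
    if \<phi>: "C1_grad \<phi> G" for \<phi> G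
  proof -
    have L: "\<phi> \<in> L2 ?R" "G \<in> L2 ?R" by (intro continuous_L2 D C1_grad_continuous[OF \<phi>])+
    have "(LINT x|lebesgue_on ?R. w' x \<bullet> G x + d x * \<phi> x) = (LINT x|lebesgue_on ?R. w x \<bullet> G x + d x * \<phi> x)"
      using eq by (intro integral_cong_AE borel_measurable_add borel_measurable_inner borel_measurable_times
          m L2_measurable[OF w] L2_measurable[OF d(1)] L[THEN L2_measurable]) (auto elim: eventually_mono)
    then show ?thesis using g[OF \<phi>] by simp
  qed
  ultimately show ?thesis unfolding has_const_normal_trace_def using w' d(1) by blast
qed

lemma L2_const: "open D \<Longrightarrow> bounded D \<Longrightarrow> (\<lambda>x. c :: 'b::euclidean_space) \<in> L2 D"
  by (intro continuous_L2 continuous_intros)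

lemma edge_local_lincomb:
  assumes "w1 \<in> edge_local P" "w2 \<in> edge_local P"
  shows "(\<lambda>x. a *\<^sub>R w1 x + b *\<^sub>R w2 x) \<in> edge_local P"
proof -
  let ?R = "region P"
  let ?w = "\<lambda>x. a *\<^sub>R w1 x + b *\<^sub>R w2 x"
  note D = open_region[of P] bounded_region[of P]
  note c = L2_const[OF D]
  have wL: "w1 \<in> L2 ?R" "w2 \<in> L2 ?R" using assms by (auto simp: edge_local_def Hdiv_def)
  obtain c1 d1 where 1: "has_const_normal_trace P w1 c1" "weak_div ?R w1 (\<lambda>x. d1)" "weak_rot ?R w1 (\<lambda>x. 0)"
    using assms(1) unfolding edge_local_def by blast
  obtain c2 d2 where 2: "has_const_normal_trace P w2 c2" "weak_div ?R w2 (\<lambda>x. d2)" "weak_rot ?R w2 (\<lambda>x. 0)"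
    using assms(2) unfolding edge_local_def by blast
  have w: "?w \<in> L2 ?R" by (rule L2_lincomb[OF wL])
  have wd: "weak_div ?R ?w (\<lambda>x. a * d1 + b * d2)" by (rule weak_div_lincomb[OF D wL c c 1(2) 2(2)])
  have pL: "(\<lambda>x. - perp (w1 x)) \<in> L2 ?R" "(\<lambda>x. - perp (w2 x)) \<in> L2 ?R"
    using L2_lincomb[OF L2_perp[OF wL(1)] L2_perp[OF wL(1)], of "-1" 0] L2_lincomb[OF L2_perp[OF wL(2)] L2_perp[OF wL(2)], of "-1" 0] by simp_all
  have "weak_div ?R (\<lambda>x. a *\<^sub>R - perp (w1 x) + b *\<^sub>R - perp (w2 x)) (\<lambda>x. a * 0 + b * 0)"
    using weak_div_lincomb[OF D pL c c 1(3)[unfolded weak_rot_eq_weak_div] 2(3)[unfolded weak_rot_eq_weak_div]] .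
  then have wr: "weak_rot ?R ?w (\<lambda>x. 0)" by (simp add: weak_rot_eq_weak_div perp_linear)
  show ?thesis
    unfolding edge_local_def Hdiv_def Hrot_def
    using w wd wr c has_const_normal_trace_lincomb[OF 1(1) 2(1)] by blast
qed

lemma edge_space_L2: "w \<in> edge_space \<Omega> M \<Longrightarrow> w \<in> L2 \<Omega>"
  by (simp add: edge_space_def Hdiv_def)

text \<open>The two fields may have different integrability exponents; on a bounded domain the
  smaller one serves both.\<close>

lemma edge_space_lincomb:
  assumes D: "open \<Omega>" "bounded \<Omega>" and w: "w1 \<in> edge_space \<Omega> M" "w2 \<in> edge_space \<Omega> M"
  shows "(\<lambda>x. a *\<^sub>R w1 x + b *\<^sub>R w2 x) \<in> edge_space \<Omega> M"
proof -
  let ?w = "\<lambda>x. a *\<^sub>R w1 x + b *\<^sub>R w2 x"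
  note wL = w[THEN edge_space_L2]
  obtain d1 s1 where 1: "d1 \<in> L2 \<Omega>" "weak_div \<Omega> w1 d1" "s1 > 0" "w1 \<in> Lp (2 + s1) \<Omega>"
    using w(1) unfolding edge_space_def Hdiv_def by blast
  obtain d2 s2 where 2: "d2 \<in> L2 \<Omega>" "weak_div \<Omega> w2 d2" "s2 > 0" "w2 \<in> Lp (2 + s2) \<Omega>"
    using w(2) unfolding edge_space_def Hdiv_def by blast
  define s where "s = min s1 s2"
  have s: "s > 0" "s \<le> s1" "s \<le> s2" using 1 2 by (auto simp: s_def)
  have "?w \<in> Lp (2 + s) \<Omega>"
    using s by (intro Lp_lincomb Lp_mono_exponent[OF 1(4) D] Lp_mono_exponent[OF 2(4) D]) auto
  moreover have "?w \<in> L2 \<Omega>" by (rule L2_lincomb[OF wL])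
  moreover have "(\<lambda>x. a * d1 x + b * d2 x) \<in> L2 \<Omega>" using L2_lincomb[OF 1(1) 2(1), of a b] by simp
  moreover have "weak_div \<Omega> ?w (\<lambda>x. a * d1 x + b * d2 x)"
    by (rule weak_div_lincomb[OF D wL 1(1) 2(1) 1(2) 2(2)])
  moreover have "\<forall>P\<in>M. ?w \<in> edge_local P"
    using w unfolding edge_space_def by (blast intro: edge_local_lincomb)
  ultimately show ?thesis unfolding edge_space_def Hdiv_def using s(1) by blast
qed

text \<open>Rotation exchanges the two operators: the divergence of the rotated gradient vanishes
  for every \<open>v\<close>, its rotation by harmonicity. The field \<open>w\<close> is allowed to
  be another representative, since \<open>vrot\<close> on the whole domain uses its own choice of
  gradient.\<close>

lemma nodal_rotated_grad_edge_local:
  assumes P: "simple_polygon P" and v: "v \<in> nodal_local P"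
    and w: "w \<in> borel_measurable (lebesgue_on (region P))"
    and eq: "AE x in lebesgue_on (region P). perp (grad (region P) v x) = w x"
  shows "w \<in> edge_local P"
proof -
  let ?R = "region P"
  let ?p = "\<lambda>x. perp (grad ?R v x)"
  note D = open_region[of P] bounded_region[of P]
  have H: "v \<in> H1 ?R" and h: "weak_div ?R (grad ?R v) (\<lambda>x. 0)" using v unfolding nodal_local_def by blast+
  have pL: "?p \<in> L2 ?R" by (rule L2_perp[OF grad_L2[OF H]])
  note wL = L2_cong_AE[OF pL w eq]
  note z = L2_zero[of ?R, where 'b=real] and zm = L2_measurable[OF L2_zero[of ?R, where 'b=real]]
  have "weak_div ?R w (\<lambda>x. 0)"
    by (rule weak_div_cong_AE[OF D weak_div_rotated_grad[OF D H] L2_measurable[OF pL] w zm zm eq]) simp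
  moreover have "weak_rot ?R w (\<lambda>x. 0)"
  proof -
    have m: "(\<lambda>x. - perp (w x)) \<in> borel_measurable (lebesgue_on ?R)"
      using L2_measurable[OF L2_perp[OF wL]] by simp
    have pp: "- perp (perp a) = a" for a by (simp add: pt_eq_iff)
    have "AE x in lebesgue_on ?R. grad ?R v x = - perp (w x)"
      using eq by eventually_elim (metis pp)
    then have "weak_div ?R (\<lambda>x. - perp (w x)) (\<lambda>x. 0)"
      by (rule weak_div_cong_AE[OF D h L2_measurable[OF grad_L2[OF H]] m zm zm]) simp
    then show ?thesis by (simp add: weak_rot_eq_weak_div)
  qed
  moreover obtain c where "has_const_normal_trace P w c"
    using nodal_rotated_grad_trace[OF P v] has_const_normal_trace_cong_AE[OF _ w eq] by blast
  ultimately show ?thesis unfolding edge_local_def Hdiv_def Hrot_def using wL z by blast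
qed

section \<open>From the cells to the whole domain\<close>

locale mesh =
  fixes \<Omega> :: "pt set" and M :: "polygon set" and \<rho> :: real
  assumes domain: "open \<Omega>" "bounded \<Omega>" "polygonal \<Omega>"
    and \<rho>: "\<rho> > 0" and mesh: "polygonal_mesh \<Omega> \<rho> M"
begin

lemma finite_M: "finite M" using mesh by (simp add: polygonal_mesh_def)

lemma simple: "P \<in> M \<Longrightarrow> simple_polygon P" using mesh by (simp add: polygonal_mesh_def)

lemma star: assumes "P \<in> M" shows "\<exists>c r. star_polygon P c r"
  using shape_regular_star_polygon[OF simple[OF assms] _ \<rho>] mesh assms by (simp add: polygonal_mesh_def)

text \<open>An open subset of the closure of \<open>\<Omega>\<close> lies in the interior of that
  closure, which is \<open>\<Omega>\<close> because a polygonal domain lies on one side of its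
  boundary.\<close>

lemma region_subset: assumes "P \<in> M" shows "region P \<subseteq> \<Omega>"
proof -
  have "region P \<subseteq> closure \<Omega>" using mesh assms closure_subset[of "region P"] unfolding polygonal_mesh_def by blast
  then have "region P \<subseteq> interior (closure \<Omega>)" by (rule interior_maximal) (rule open_region)
  then show ?thesis using domain(3) unfolding polygonal_def by blast
qed

text \<open>What the open cells leave uncovered is contained in finitely many polygon
  boundaries.\<close>

lemma null_complement: "\<Omega> - (\<Union>P\<in>M. region P) \<in> null_sets lebesgue"
proof -
  have "\<Omega> \<subseteq> (\<Union>P\<in>M. closure (region P))" using mesh closure_subset[of \<Omega>] by (simp add: polygonal_mesh_def)
  moreover have "closure (region P) \<subseteq> region P \<union> bdry P" for P
    using frontier_region_subset[of P] closure_Un_frontier[of "region P"] by blast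
  ultimately have "\<Omega> - (\<Union>P\<in>M. region P) \<subseteq> (\<Union>P\<in>M. bdry P)" by blast
  moreover have "negligible (\<Union>P\<in>M. bdry P)"
    using finite_M by (intro negligible_Union) (auto simp: negligible_bdry)
  ultimately show ?thesis using negligible_iff_null_sets negligible_subset by blast
qed

lemma AE_mesh:
  assumes "\<And>P. P \<in> M \<Longrightarrow> AE x in lebesgue_on (region P). Q x" shows "AE x in lebesgue_on \<Omega>. Q x"
proof -
  have "AE x in lebesgue. x \<in> region P \<longrightarrow> Q x" if "P \<in> M" for P
    using assms[OF that] open_region[of P] by (subst (asm) AE_restrict_space_iff) auto
  then have "AE x in lebesgue. \<forall>P\<in>M. x \<in> region P \<longrightarrow> Q x"
    by (subst AE_finite_all[OF finite_M]) blast
  moreover have "AE x in lebesgue. x \<notin> \<Omega> - (\<Union>P\<in>M. region P)" by (rule AE_not_in[OF null_complement])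
  ultimately have "AE x in lebesgue. x \<in> \<Omega> \<longrightarrow> Q x" by eventually_elim blast
  then show ?thesis using domain(1) by (subst AE_restrict_space_iff) auto
qed

lemma Lp_mesh:
  fixes f :: "pt \<Rightarrow> 'b::euclidean_space"
  assumes m: "f \<in> borel_measurable (lebesgue_on \<Omega>)" and L: "\<And>P. P \<in> M \<Longrightarrow> f \<in> Lp p (region P)"
  shows "f \<in> Lp p \<Omega>"
proof -
  let ?h = "\<lambda>x. norm (f x) powr p"
  have i: "integrable lebesgue (\<lambda>x. indicator (region P) x *\<^sub>R ?h x)" if "P \<in> M" for P
    using L[OF that] integrable_restrict_space[of "region P" lebesgue ?h] open_region[of P] by (simp add: Lp_def)
  have hm: "?h \<in> borel_measurable (lebesgue_on \<Omega>)" using m by simp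
  have "integrable lebesgue (\<lambda>x. indicator \<Omega> x *\<^sub>R ?h x)"
  proof (rule Bochner_Integration.integrable_bound)
    show "integrable lebesgue (\<lambda>x. \<Sum>P\<in>M. indicator (region P) x *\<^sub>R ?h x)"
      by (rule Bochner_Integration.integrable_sum) (rule i)
    show "(\<lambda>x. indicator \<Omega> x *\<^sub>R ?h x) \<in> borel_measurable lebesgue"
      using borel_measurable_restrict_space_iff[of \<Omega> lebesgue ?h] hm domain(1) by simp
    have "AE x in lebesgue. x \<notin> \<Omega> - (\<Union>P\<in>M. region P)" by (rule AE_not_in[OF null_complement])
    then show "AE x in lebesgue. norm (indicator \<Omega> x *\<^sub>R ?h x) \<le> norm (\<Sum>P\<in>M. indicator (region P) x *\<^sub>R ?h x)"
    proof eventually_elim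
      case (elim x)
      have nn: "0 \<le> (\<Sum>P\<in>M. indicat_real (region P) x *\<^sub>R ?h x)" by (intro sum_nonneg) simp
      show ?case
      proof (cases "x \<in> \<Omega>")
        case True
        then obtain P where P: "P \<in> M" "x \<in> region P" using elim by blast
        have "indicat_real (region P) x *\<^sub>R ?h x \<le> (\<Sum>P\<in>M. indicat_real (region P) x *\<^sub>R ?h x)"
          using P finite_M by (intro member_le_sum) auto
        then show ?thesis using P True nn by simp
      qed (use nn in simp)
    qed
  qed
  then show ?thesis
    using m integrable_restrict_space[of \<Omega> lebesgue ?h] domain(1) by (simp add: Lp_def)
qed

lemma nodal_space_add:
  assumes "v1 \<in> nodal_space \<Omega> M" "v2 \<in> nodal_space \<Omega> M"
  shows "(\<lambda>x. v1 x + v2 x) \<in> nodal_space \<Omega> M"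
  using assms H1_add(1)[OF domain(1,2)] nodal_local_add unfolding nodal_space_def by blast

text \<open>The local conditions and the higher integrability come from the cells, but the
  square-integrable divergence comes from \<open>v\<close> being in \<open>H1\<close> on all of
  \<open>\<Omega>\<close>, so normal components need not be matched across edges.\<close>

lemma vrot_edge_space:
  assumes v: "v \<in> nodal_space \<Omega> M" shows "vrot \<Omega> v \<in> edge_space \<Omega> M"
proof -
  have H: "v \<in> H1 \<Omega>" and l: "\<And>P. P \<in> M \<Longrightarrow> v \<in> nodal_local P" using v by (auto simp: nodal_space_def)
  have L: "vrot \<Omega> v \<in> L2 \<Omega>" unfolding vrot_def by (rule L2_perp[OF grad_L2[OF H]])
  have eq: "AE x in lebesgue_on (region P). perp (grad (region P) v x) = vrot \<Omega> v x"
    and m: "vrot \<Omega> v \<in> borel_measurable (lebesgue_on (region P))" if P: "P \<in> M" for P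
  proof -
    have "v \<in> H1 (region P)" using l[OF P] by (simp add: nodal_local_def)
    from grad_subset[OF region_subset[OF P] open_region domain(1,2) H this]
    show "AE x in lebesgue_on (region P). perp (grad (region P) v x) = vrot \<Omega> v x"
      by eventually_elim (simp add: vrot_def)
    show "vrot \<Omega> v \<in> borel_measurable (lebesgue_on (region P))"
      by (rule measurable_lebesgue_on_subset[OF L2_measurable[OF L] region_subset[OF P] open_region domain(1)])
  qed
  have "vrot \<Omega> v \<in> Lp (2 + 1/4) \<Omega>"
  proof (rule Lp_mesh[OF L2_measurable[OF L]])
    fix P assume P: "P \<in> M"
    obtain c r where "star_polygon P c r" using star[OF P] by blast
    from grad_nodal_higher_integrability[OF this l[OF P]]
    have gL: "grad (region P) v \<in> Lp (2 + 1/4) (region P)" .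
    have "(\<lambda>x. perp (grad (region P) v x)) \<in> Lp (2 + 1/4) (region P)"
    proof -
      have "v \<in> H1 (region P)" using l[OF P] by (simp add: nodal_local_def)
      then have "(\<lambda>x. perp (grad (region P) v x)) \<in> borel_measurable (lebesgue_on (region P))"
        by (intro L2_measurable L2_perp grad_L2)
      then show ?thesis using gL by (simp add: Lp_def)
    qed
    then show "vrot \<Omega> v \<in> Lp (2 + 1/4) (region P)" by (rule L2_cong_AE[OF _ m[OF P] eq[OF P]])
  qed
  moreover have "weak_div \<Omega> (vrot \<Omega> v) (\<lambda>x. 0)"
    unfolding vrot_def by (rule weak_div_rotated_grad[OF domain(1,2) H])
  moreover have "\<forall>P\<in>M. vrot \<Omega> v \<in> edge_local P"
    using nodal_rotated_grad_edge_local[OF simple l m eq] by blast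
  moreover have "(\<exists>s>0. vrot \<Omega> v \<in> Lp (2 + s) \<Omega>)"
    using \<open>vrot \<Omega> v \<in> Lp (2 + 1/4) \<Omega>\<close> by (intro exI[of _ "1/4"]) simp
  ultimately show ?thesis unfolding edge_space_def Hdiv_def using L L2_zero by blast
qed

text \<open>\<open>Hdiv\<close> provides one divergence on all of \<open>\<Omega>\<close>;
  uniqueness on each cell shows that it vanishes off the mesh skeleton, a null set.\<close>

lemma edge_space_div_zero:
  assumes w: "w \<in> edge_space \<Omega> M" and z: "\<And>P. P \<in> M \<Longrightarrow> weak_div (region P) w (\<lambda>x. 0)"
  shows "weak_div \<Omega> w (\<lambda>x. 0)"
proof -
  obtain d where d: "d \<in> L2 \<Omega>" "weak_div \<Omega> w d" and wL: "w \<in> L2 \<Omega>" using w unfolding edge_space_def Hdiv_def by blast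
  have "AE x in lebesgue_on \<Omega>. d x = 0"
  proof (rule AE_mesh)
    fix P assume P: "P \<in> M"
    note S = region_subset[OF P] open_region[of P] domain(1)
    show "AE x in lebesgue_on (region P). d x = 0"
      by (rule weak_div_unique[OF open_region bounded_region Lp_subset[OF d(1) S] L2_zero weak_div_subset[OF S d(2)] z[OF P]])
  qed
  then show ?thesis
    by (rule weak_div_cong_AE[OF domain(1,2) d(2) L2_measurable[OF wL] L2_measurable[OF wL] L2_measurable[OF d(1)] L2_measurable[OF L2_zero] AE_I2[OF refl]])
qed

end

section \<open>The discrete inner product on the edge space\<close>

lemma region_measure_pos:
  assumes "simple_polygon P" shows "0 < (LINT x|lebesgue_on (region P). (1::real))"
proof -
  have lm: "region P \<in> lmeasurable" by (rule lmeasurable_open[OF bounded_region open_region])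
  have "measure lebesgue (region P) \<noteq> 0"
    using negligible_iff_measure0[OF lm] open_not_negligible[OF open_region region_nonempty[OF assms]] by simp
  moreover have "(LINT x|lebesgue_on (region P). (1::real)) = measure lebesgue (region P)"
    using lm by (simp add: measure_restrict_space fmeasurableD)
  ultimately show ?thesis by (simp add: zero_less_measure_iff)
qed

lemma L2_integrable:
  fixes w :: "pt \<Rightarrow> 'b::euclidean_space"
  assumes "w \<in> L2 D" "open D" "bounded D" shows "integrable (lebesgue_on D) w"
  using L2_norm_integrable[OF assms] L2_measurable[OF assms(1)] by (simp add: integrable_norm_iff)

text \<open>\<open>L2_proj\<close> is a definite description, so existence and uniqueness must be
  shown before it can be computed: orthogonality to constants singles out the mean value.\<close>

lemma edge_proj_eq:
  assumes P: "simple_polygon P" and w: "w \<in> L2 (region P)"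
  shows "edge_proj P w = (\<lambda>x. (LINT x|lebesgue_on (region P). w x) /\<^sub>R (LINT x|lebesgue_on (region P). 1))"
proof -
  let ?R = "region P"
  note D = open_region[of P] bounded_region[of P]
  define m where "m = (LINT x|lebesgue_on ?R. (1::real))"
  define I where "I = (LINT x|lebesgue_on ?R. w x)"
  have m: "m > 0" unfolding m_def by (rule region_measure_pos[OF P])
  have inner: "L2_inner ?R (\<lambda>x. w x - a) (\<lambda>x. b) = (I - m *\<^sub>R a) \<bullet> b" for a b
  proof -
    note i = L2_integrable[OF w D] L2_integrable[OF L2_const[OF D] D]
    have "(LINT x|lebesgue_on ?R. a) = m *\<^sub>R a" by (simp add: m_def)
    then have "(LINT x|lebesgue_on ?R. w x - a) = I - m *\<^sub>R a"
      by (simp only: Bochner_Integration.integral_diff[OF i] I_def)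
    moreover have "(LINT x|lebesgue_on ?R. (w x - a) \<bullet> b) = (LINT x|lebesgue_on ?R. w x - a) \<bullet> b"
      by (intro integral_inner_left Bochner_Integration.integrable_diff i)
    ultimately show ?thesis by (simp add: L2_inner_def)
  qed
  have iff: "p \<in> const_fields \<and> (\<forall>q\<in>const_fields. L2_inner ?R (\<lambda>x. w x - p x) q = 0) \<longleftrightarrow> p = (\<lambda>x. I /\<^sub>R m)" for p
  proof
    assume "p \<in> const_fields \<and> (\<forall>q\<in>const_fields. L2_inner ?R (\<lambda>x. w x - p x) q = 0)"
    then obtain a where a: "p = (\<lambda>x. a)" and z: "L2_inner ?R (\<lambda>x. w x - p x) (\<lambda>x. b) = 0" for b
      by (auto simp: const_fields_def)
    have "(I - m *\<^sub>R a) \<bullet> (I - m *\<^sub>R a) = 0" using z[of "I - m *\<^sub>R a"] unfolding a inner .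
    then have "I = m *\<^sub>R a" by simp
    then show "p = (\<lambda>x. I /\<^sub>R m)" using a m by simp
  next
    assume p: "p = (\<lambda>x. I /\<^sub>R m)"
    have "L2_inner ?R (\<lambda>x. w x - p x) q = 0" if "q \<in> const_fields" for q
    proof -
      obtain b where b: "q = (\<lambda>x. b)" using \<open>q \<in> const_fields\<close> by (auto simp: const_fields_def)
      show ?thesis unfolding b p inner using m by simp
    qed
    then show "p \<in> const_fields \<and> (\<forall>q\<in>const_fields. L2_inner ?R (\<lambda>x. w x - p x) q = 0)"
      using p by (auto simp: const_fields_def)
  qed
  show ?thesis unfolding edge_proj_def L2_proj_def iff I_def[symmetric] m_def[symmetric] by simp
qed

lemma edge_proj_add:
  assumes P: "simple_polygon P" and w: "w1 \<in> L2 (region P)" "w2 \<in> L2 (region P)"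
  shows "edge_proj P (\<lambda>x. w1 x + w2 x) = (\<lambda>x. edge_proj P w1 x + edge_proj P w2 x)"
proof -
  have "(\<lambda>x. w1 x + w2 x) \<in> L2 (region P)" using L2_lincomb[OF w, of 1 1] by simp
  then show ?thesis
    using L2_integrable[OF w(1) open_region bounded_region] L2_integrable[OF w(2) open_region bounded_region]
    by (simp add: edge_proj_eq[OF P] w scaleR_add_right)
qed

lemma edge_proj_const: "simple_polygon P \<Longrightarrow> w \<in> L2 (region P) \<Longrightarrow> \<exists>a. edge_proj P w = (\<lambda>x. a)"
  unfolding edge_proj_eq by blast

lemma edge_local_L2: "w \<in> edge_local P \<Longrightarrow> w \<in> L2 (region P)"
  by (simp add: edge_local_def Hdiv_def)

lemma remainder_mem: "w \<in> V \<Longrightarrow> (\<lambda>x. w x - \<pi> w x) \<in> remainders P V \<pi>"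
  by (auto simp: remainders_def)

text \<open>Linearity of the stabilization is granted only on the remainders, so each argument must
  first be recognised as the remainder of an element of the local space.\<close>

lemma edge_inner_add:
  assumes P: "\<And>P. P \<in> M \<Longrightarrow> simple_polygon P"
    and S: "\<forall>P\<in>M. stabilization \<alpha> \<beta> P (remainders P (edge_local P) (edge_proj P)) (S P)"
    and w: "w1 \<in> edge_space \<Omega> M" "w2 \<in> edge_space \<Omega> M" "w3 \<in> edge_space \<Omega> M"
  shows "edge_inner M S (\<lambda>x. w1 x + w2 x) w3 = edge_inner M S w1 w3 + edge_inner M S w2 w3"
  unfolding edge_inner_def sum.distrib[symmetric]
proof (rule sum.cong[OF refl])
  fix Q assume Q: "Q \<in> M"
  have e: "w1 \<in> edge_local Q" "w2 \<in> edge_local Q" "w3 \<in> edge_local Q" using w Q by (auto simp: edge_space_def)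
  note L = e[THEN edge_local_L2]
  note add = edge_proj_add[OF P[OF Q] L(1,2)]
  obtain a1 a2 a3 where a: "edge_proj Q w1 = (\<lambda>x. a1)" "edge_proj Q w2 = (\<lambda>x. a2)" "edge_proj Q w3 = (\<lambda>x. a3)"
    using edge_proj_const[OF P[OF Q]] L by metis
  have 1: "L2_inner (region Q) (edge_proj Q (\<lambda>x. w1 x + w2 x)) (edge_proj Q w3)
      = L2_inner (region Q) (edge_proj Q w1) (edge_proj Q w3) + L2_inner (region Q) (edge_proj Q w2) (edge_proj Q w3)"
    unfolding add a by (simp add: L2_inner_def inner_add_left distrib_left)
  have lin: "S Q (\<lambda>x. a *\<^sub>R y x + b *\<^sub>R z x) u = a * S Q y u + b * S Q z u"
    if "y \<in> remainders Q (edge_local Q) (edge_proj Q)" "z \<in> remainders Q (edge_local Q) (edge_proj Q)"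
      "u \<in> remainders Q (edge_local Q) (edge_proj Q)" for a b y z u
    using S Q that unfolding stabilization_def by blast
  have "S Q (\<lambda>x. 1 *\<^sub>R (w1 x - edge_proj Q w1 x) + 1 *\<^sub>R (w2 x - edge_proj Q w2 x)) (\<lambda>x. w3 x - edge_proj Q w3 x)
      = 1 * S Q (\<lambda>x. w1 x - edge_proj Q w1 x) (\<lambda>x. w3 x - edge_proj Q w3 x) + 1 * S Q (\<lambda>x. w2 x - edge_proj Q w2 x) (\<lambda>x. w3 x - edge_proj Q w3 x)"
    by (rule lin) (intro remainder_mem e)+
  moreover have "(\<lambda>x. 1 *\<^sub>R (w1 x - edge_proj Q w1 x) + 1 *\<^sub>R (w2 x - edge_proj Q w2 x)) = (\<lambda>x. w1 x + w2 x - edge_proj Q (\<lambda>x. w1 x + w2 x) x)"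
    unfolding add by (simp add: fun_eq_iff)
  ultimately show "L2_inner (region Q) (edge_proj Q (\<lambda>x. w1 x + w2 x)) (edge_proj Q w3)
      + S Q (\<lambda>x. w1 x + w2 x - edge_proj Q (\<lambda>x. w1 x + w2 x) x) (\<lambda>x. w3 x - edge_proj Q w3 x)
    = L2_inner (region Q) (edge_proj Q w1) (edge_proj Q w3) + S Q (\<lambda>x. w1 x - edge_proj Q w1 x) (\<lambda>x. w3 x - edge_proj Q w3 x)
      + (L2_inner (region Q) (edge_proj Q w2) (edge_proj Q w3) + S Q (\<lambda>x. w2 x - edge_proj Q w2 x) (\<lambda>x. w3 x - edge_proj Q w3 x))"
    using 1 by simp
qed

lemma L2_inner_self_zero:
  fixes w :: "pt \<Rightarrow> 'b::euclidean_space"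
  assumes w: "w \<in> L2 D" and z: "L2_inner D w w \<le> 0" shows "AE x in lebesgue_on D. w x = 0"
proof -
  have i: "integrable (lebesgue_on D) (\<lambda>x. (norm (w x))\<^sup>2)" using w by (simp add: L2_iff)
  have "(LINT x|lebesgue_on D. (norm (w x))\<^sup>2) \<le> 0" using z by (simp add: L2_inner_def power2_norm_eq_inner)
  moreover have "0 \<le> (LINT x|lebesgue_on D. (norm (w x))\<^sup>2)" by simp
  ultimately have "(LINT x|lebesgue_on D. (norm (w x))\<^sup>2) = 0" by linarith
  then have "AE x in lebesgue_on D. (norm (w x))\<^sup>2 = 0"
    using integral_nonneg_eq_0_iff_AE[OF i] by simp
  then show ?thesis by eventually_elim simp
qed

text \<open>All summands are nonnegative, hence zero. The projection term then kills the constant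
  part, and the lower stabilization bound kills the remainder.\<close>

lemma edge_inner_definite:
  assumes P: "\<And>P. P \<in> M \<Longrightarrow> simple_polygon P" and M: "finite M" and \<alpha>: "\<alpha> > 0"
    and S: "\<forall>P\<in>M. stabilization \<alpha> \<beta> P (remainders P (edge_local P) (edge_proj P)) (S P)"
    and w: "w \<in> edge_space \<Omega> M" and z: "edge_inner M S w w = 0" and Q: "Q \<in> M"
  shows "AE x in lebesgue_on (region Q). w x = 0"
proof -
  have e: "w \<in> edge_local K" if "K \<in> M" for K using w that by (auto simp: edge_space_def)
  have L: "w \<in> L2 (region K)" if "K \<in> M" for K by (rule edge_local_L2[OF e[OF that]])
  have mem: "(\<lambda>x. w x - edge_proj K w x) \<in> remainders K (edge_local K) (edge_proj K)" if "K \<in> M" for K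
    by (rule remainder_mem[OF e[OF that]])
  have S0: "0 \<le> S K (\<lambda>x. w x - edge_proj K w x) (\<lambda>x. w x - edge_proj K w x)"
    and S\<alpha>: "\<alpha> * L2_inner (region K) (\<lambda>x. w x - edge_proj K w x) (\<lambda>x. w x - edge_proj K w x)
      \<le> S K (\<lambda>x. w x - edge_proj K w x) (\<lambda>x. w x - edge_proj K w x)" if "K \<in> M" for K
    using S that mem[OF that] unfolding stabilization_def by blast+
  have L0: "0 \<le> L2_inner (region K) v v" for K and v :: "pt \<Rightarrow> pt" by (simp add: L2_inner_def)
  have "\<forall>K\<in>M. L2_inner (region K) (edge_proj K w) (edge_proj K w)
      + S K (\<lambda>x. w x - edge_proj K w x) (\<lambda>x. w x - edge_proj K w x) = 0"
    using z unfolding edge_inner_def by (subst (asm) sum_nonneg_eq_0_iff[OF M]) (auto intro: add_nonneg_nonneg S0 L0)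
  then have "L2_inner (region Q) (edge_proj Q w) (edge_proj Q w)
      + S Q (\<lambda>x. w x - edge_proj Q w x) (\<lambda>x. w x - edge_proj Q w x) = 0" using Q by blast
  then have a: "L2_inner (region Q) (edge_proj Q w) (edge_proj Q w) \<le> 0"
    and b: "S Q (\<lambda>x. w x - edge_proj Q w x) (\<lambda>x. w x - edge_proj Q w x) \<le> 0"
    using S0[OF Q] L0[of Q "edge_proj Q w"] by linarith+
  obtain c where c: "edge_proj Q w = (\<lambda>x. c)" using edge_proj_const[OF P[OF Q] L[OF Q]] by blast
  have cL: "(\<lambda>x. c) \<in> L2 (region Q)" by (rule L2_const[OF open_region bounded_region])
  have "\<alpha> * L2_inner (region Q) (\<lambda>x. w x - edge_proj Q w x) (\<lambda>x. w x - edge_proj Q w x) \<le> 0"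
    using S\<alpha>[OF Q] b by linarith
  then have "L2_inner (region Q) (\<lambda>x. w x - c) (\<lambda>x. w x - c) \<le> 0"
    using \<alpha> unfolding c by (simp add: mult_le_0_iff)
  moreover have "(\<lambda>x. w x - c) \<in> L2 (region Q)" using L2_lincomb[OF L[OF Q] cL, of 1 "-1"] by simp
  ultimately have "AE x in lebesgue_on (region Q). w x - c = 0" by (intro L2_inner_self_zero)
  moreover have "AE x in lebesgue_on (region Q). c = 0" using L2_inner_self_zero[OF cL] a unfolding c .
  ultimately show ?thesis by eventually_elim simp
qed

section \<open>The initial field\<close>

text \<open>Green's formula with the constant test function 1; \<open>weak_div_unique\<close>
  identifies the divergence hidden in the trace with the constant \<open>d\<close>.\<close>

lemma const_trace_div:
  assumes w: "has_const_normal_trace P w c" and d: "weak_div (region P) w (\<lambda>x. d)"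
  shows "d * (LINT x|lebesgue_on (region P). 1) = (\<Sum>e\<in>edges P. c e * edge_length e)"
proof -
  let ?R = "region P"
  note D = open_region[of P] bounded_region[of P]
  obtain d' where d': "d' \<in> L2 ?R" "weak_div ?R w d'"
    and g: "\<And>\<phi> G. C1_grad \<phi> G \<Longrightarrow> (LINT x|lebesgue_on ?R. w x \<bullet> G x + d' x * \<phi> x) = (\<Sum>e\<in>edges P. c e * edge_integral e \<phi>)"
    using w unfolding has_const_normal_trace_def by blast
  have "C1_grad (\<lambda>x. 1) (\<lambda>x. 0)" by (simp add: C1_grad_def gderiv_def)
  from g[OF this] have "(LINT x|lebesgue_on ?R. d' x) = (\<Sum>e\<in>edges P. c e * edge_length e)"
    by (simp add: edge_integral_const)
  moreover have "(LINT x|lebesgue_on ?R. d' x) = (LINT x|lebesgue_on ?R. d)"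
    using weak_div_unique[OF D d'(1) L2_const[OF D] d'(2) d]
    by (intro integral_cong_AE L2_measurable[OF d'(1)]) auto
  ultimately show ?thesis by (simp add: mult.commute)
qed

text \<open>Fluxes are limits along C1 fields, to which the divergence theorem applies; the
  divergences of these fields tend to zero in the square mean, hence so do their integrals over the
  bounded cell.\<close>

lemma (in star_polygon) edge_fluxes_sum_zero:
  assumes fl: "has_edge_fluxes P w fl" and z: "weak_div (region P) w (\<lambda>x. 0)"
  shows "(\<Sum>e\<in>edges P. fl e) = 0"
proof -
  let ?R = "region P"
  note D = open_region[of P] bounded_region[of P]
  obtain d W J where d: "d \<in> L2 ?R" "weak_div ?R w d" and W: "\<forall>k::nat. C1_jacobian (W k) (J k)"
    and Jd: "(\<lambda>k. LINT x|lebesgue_on ?R. (trace (J k x) - d x)\<^sup>2) \<longlonglongrightarrow> 0"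
    and Wc: "\<forall>e\<in>edges P. (\<lambda>k. edge_integral e (\<lambda>x. W k x \<bullet> edge_normal e)) \<longlonglongrightarrow> fl e"
    using fl unfolding has_edge_fluxes_def by blast
  have d0: "AE x in lebesgue_on ?R. d x = 0" by (rule weak_div_unique[OF D d(1) L2_zero d(2) z])
  define m where "m = (LINT x|lebesgue_on ?R. (1::real))"
  have m: "m > 0" unfolding m_def by (rule region_measure_pos[OF simple])
  define I where "I k = (LINT x|lebesgue_on ?R. trace (J k x))" for k
  define Q where "Q k = (LINT x|lebesgue_on ?R. (trace (J k x) - d x)\<^sup>2)" for k
  have IQ: "(I k)\<^sup>2 \<le> m * Q k" for k
  proof -
    have tc: "continuous_on UNIV (\<lambda>x. trace (J k x))" using W by (intro continuous_intros C1_jacobian_continuous(2)) blast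
    have tm: "(\<lambda>x. trace (J k x)) \<in> borel_measurable (lebesgue_on ?R)"
      by (rule L2_measurable[OF continuous_L2[OF tc D]])
    have i: "integrable (lebesgue_on ?R) (\<lambda>x. trace (J k x))" "integrable (lebesgue_on ?R) (\<lambda>x. (trace (J k x))\<^sup>2)"
      "integrable (lebesgue_on ?R) (\<lambda>x. 1::real)"
      by (intro continuous_integrable_lebesgue_on D continuous_intros tc)+
    have Qk: "Q k = (LINT x|lebesgue_on ?R. (trace (J k x))\<^sup>2)"
      unfolding Q_def using d0 tm L2_measurable[OF d(1)] by (intro integral_cong_AE) (auto elim: eventually_mono)
    \<comment> \<open>The nonnegative variance about the mean \<open>I k / m\<close> yields
      Cauchy-Schwarz in the form \<open>(I k)\<^sup>2 \<le> m * Q k\<close>.\<close>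
    have "0 \<le> (LINT x|lebesgue_on ?R. (trace (J k x) - I k / m)\<^sup>2)" by simp
    also have "(LINT x|lebesgue_on ?R. (trace (J k x) - I k / m)\<^sup>2)
        = (LINT x|lebesgue_on ?R. (trace (J k x))\<^sup>2 - 2 * (I k / m) * trace (J k x) + (I k / m)\<^sup>2 * 1)"
      by (simp add: power2_diff algebra_simps)
    also have "\<dots> = (LINT x|lebesgue_on ?R. (trace (J k x))\<^sup>2) - 2 * (I k / m) * I k + (I k / m)\<^sup>2 * m"
    proof -
      note l = integrable_mult_right[OF i(1), of "2 * (I k / m)"] and c = integrable_mult_right[OF i(3), of "(I k / m)\<^sup>2"]
      show ?thesis
        unfolding Bochner_Integration.integral_add[OF Bochner_Integration.integrable_diff[OF i(2) l] c]
          Bochner_Integration.integral_diff[OF i(2) l]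
        by (simp only: integral_mult_right_zero I_def m_def)
    qed
    also have "\<dots> = (LINT x|lebesgue_on ?R. (trace (J k x))\<^sup>2) - (I k)\<^sup>2 / m"
      using m by (simp add: power2_eq_square field_simps)
    finally have "(I k)\<^sup>2 / m \<le> Q k" by (simp add: Qk)
    then show ?thesis using m by (simp add: field_simps)
  qed
  have mQ: "(\<lambda>k. m * Q k) \<longlonglongrightarrow> 0"
    using tendsto_mult_left[OF Jd, of m] unfolding Q_def mult_zero_right .
  have "(\<lambda>k. (I k)\<^sup>2) \<longlonglongrightarrow> 0"
    by (rule tendsto_sandwich[OF always_eventually always_eventually tendsto_const mQ]) (simp_all add: IQ)
  from tendsto_real_sqrt[OF this] have "I \<longlonglongrightarrow> 0" by (simp add: tendsto_rabs_zero_iff)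
  moreover have "I k = (\<Sum>e\<in>edges P. edge_integral e (\<lambda>x. W k x \<bullet> edge_normal e))" for k
    unfolding I_def by (rule divergence_theorem[OF W[rule_format]])
  then have "I \<longlonglongrightarrow> (\<Sum>e\<in>edges P. fl e)"
    using tendsto_sum[OF bspec[OF Wc], of "edges P" "\<lambda>e. e"] by presburger
  ultimately show ?thesis using LIMSEQ_unique by blast
qed

context mesh
begin

text \<open>On a cell the interpolant has constant divergence, and this constant times the area is
  the total flux, which it inherits from \<open>w\<close> edge by edge.\<close>

lemma edge_interpolant_div_zero:
  assumes wI: "is_edge_interpolant \<Omega> M w wI" and z: "weak_div \<Omega> w (\<lambda>x. 0)"
  shows "weak_div \<Omega> wI (\<lambda>x. 0)"
proof (rule edge_space_div_zero)
  show E: "wI \<in> edge_space \<Omega> M" using wI by (simp add: is_edge_interpolant_def)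
  fix P assume P: "P \<in> M"
  obtain c where c: "has_edge_fluxes P w c" "has_const_normal_trace P wI (\<lambda>e. c e / edge_length e)"
    using wI P unfolding is_edge_interpolant_def by blast
  obtain y r where "star_polygon P y r" using star[OF P] by blast
  from star_polygon.edge_fluxes_sum_zero[OF this c(1) weak_div_subset[OF region_subset[OF P] open_region domain(1) z]]
  have s: "(\<Sum>e\<in>edges P. c e) = 0" .
  obtain d where d: "weak_div (region P) wI (\<lambda>x. d)" using E P unfolding edge_space_def edge_local_def by blast
  have "d * (LINT x|lebesgue_on (region P). 1) = (\<Sum>e\<in>edges P. c e / edge_length e * edge_length e)"
    by (rule const_trace_div[OF c(2) d])
  also have "\<dots> = (\<Sum>e\<in>edges P. c e)"
    using simple_polygon_edge_distinct[OF simple[OF P]] by (intro sum.cong) (auto simp: edge_length_def)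
  finally have "d = 0" using s region_measure_pos[OF simple[OF P]] by simp
  then show "weak_div (region P) wI (\<lambda>x. 0)" using d by simp
qed

lemma zero_edge_space: "(\<lambda>x. 0) \<in> edge_space \<Omega> M" if "w \<in> edge_space \<Omega> M"
  using edge_space_lincomb[OF domain(1,2) that that, of 0 0] by simp

end

text \<open>Needed to regard a continuous function as an element of \<open>interpolated\<close> with
  zero edge field. As \<open>L2_proj\<close> is a definite description, uniqueness is the point: a
  self-orthogonal element of \<open>RT0\<close> vanishes almost everywhere, hence by continuity on
  the whole cell.\<close>

lemma RT_proj_zero:
  assumes "\<And>P. P \<in> M \<Longrightarrow> simple_polygon P"
  shows "RT_proj M (\<lambda>x. 0) x = 0"
proof -
  have "L2_proj P RT0 (\<lambda>x. 0) = (\<lambda>x. 0)" if P: "P \<in> M" for P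
    unfolding L2_proj_def
  proof (rule the_equality)
    have "\<exists>a b. (\<lambda>x::pt. 0) = (\<lambda>x. a + b *\<^sub>R x)" by (intro exI[of _ 0]) simp
    then show "(\<lambda>x. 0) \<in> RT0 \<and> (\<forall>q\<in>RT0. L2_inner (region P) (\<lambda>x. 0 - 0) q = 0)"
      unfolding RT0_def by (auto simp: L2_inner_def)
    fix p assume p: "p \<in> RT0 \<and> (\<forall>q\<in>RT0. L2_inner (region P) (\<lambda>x. 0 - p x) q = 0)"
    then obtain a b where ab: "p = (\<lambda>x. a + b *\<^sub>R x)" by (auto simp: RT0_def)
    have pc: "continuous_on UNIV p" unfolding ab by (intro continuous_intros)
    have "L2_inner (region P) p p = 0" using p by (auto simp: L2_inner_def)
    then have "AE x in lebesgue_on (region P). p x = 0"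
      by (intro L2_inner_self_zero continuous_L2[OF pc open_region bounded_region]) simp
    then have AE: "AE x in lebesgue. x \<in> region P \<longrightarrow> p x = 0"
      using open_region[of P] by (subst (asm) AE_restrict_space_iff) auto
    have z: "p x = 0" if x: "x \<in> region P" for x
    proof (rule ccontr)
      assume "p x \<noteq> 0"
      define U where "U = region P \<inter> {x. p x \<noteq> 0}"
      have "open {x. p x \<noteq> 0}" by (intro open_Collect_neq pc continuous_intros)
      then have "open U" "U \<noteq> {}" using open_region[of P] x \<open>p x \<noteq> 0\<close> by (auto simp: U_def)
      then have "\<not> negligible U" by (rule open_not_negligible)
      moreover have "AE x in lebesgue. x \<notin> U" using AE by eventually_elim (auto simp: U_def)
      then have "negligible U"
        using \<open>open U\<close> by (simp add: negligible_iff_null_sets AE_iff_null_sets)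
      ultimately show False by simp
    qed
    obtain x0 where x0: "x0 \<in> region P" using region_nonempty[OF assms[OF P]] by blast
    then obtain e where e: "e > 0" "ball x0 e \<subseteq> region P" using open_region[of P] openE by blast
    \<comment> \<open>Vanishing at two distinct points of the cell forces first
      \<open>b = 0\<close>, then \<open>a = 0\<close>.\<close>
    define x1 where "x1 = x0 + (e / 2) *\<^sub>R (axis 1 1 :: pt)"
    have "x1 \<in> ball x0 e" using e by (simp add: x1_def dist_norm norm_axis_1)
    then have "p x1 = 0" "p x0 = 0" using z x0 e by auto
    then have "(a + b *\<^sub>R x1) - (a + b *\<^sub>R x0) = 0" by (simp add: ab)
    then have "b *\<^sub>R (x1 - x0) = 0" by (simp only: add_diff_add diff_self add_0_left scaleR_diff_right)
    then have "b = 0" using e by (auto simp: x1_def)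
    then show "p = (\<lambda>x. 0)" using \<open>p x0 = 0\<close> by (simp add: ab)
  qed
  then show ?thesis unfolding RT_proj_def by (intro sum.neutral) auto
qed

theorem theorem4p5:
  fixes \<Omega> :: "pt set" and M :: "polygon set" and \<rho> T \<Delta>t \<theta> \<sigma>\<^sub>l \<sigma>\<^sub>u s :: real and N :: nat
    and u :: "pt \<Rightarrow> pt" and \<sigma> :: "pt \<Rightarrow> real" and E0 :: "pt \<Rightarrow> real \<Rightarrow> real" and B0 :: "pt \<Rightarrow> pt"
    and \<pi>V :: "polygon \<Rightarrow> (pt \<Rightarrow> real) \<Rightarrow> pt \<Rightarrow> real" and C\<^sub>\<pi> :: real
    and SV :: "polygon \<Rightarrow> (pt \<Rightarrow> real) \<Rightarrow> (pt \<Rightarrow> real) \<Rightarrow> real" and \<alpha>V \<beta>V :: real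
    and SE :: "polygon \<Rightarrow> (pt \<Rightarrow> pt) \<Rightarrow> (pt \<Rightarrow> pt) \<Rightarrow> real" and \<alpha>E \<beta>E :: real
    and IV :: "(pt \<Rightarrow> real) \<Rightarrow> pt \<Rightarrow> real"
    and B :: "nat \<Rightarrow> pt \<Rightarrow> pt" and Eh :: "nat \<Rightarrow> pt \<Rightarrow> real"
  defines "B\<theta> \<equiv> \<lambda>n x. \<theta> *\<^sub>R B (Suc n) x + (1 - \<theta>) *\<^sub>R B n x"
    and "E0\<theta> \<equiv> \<lambda>n x. E0 x ((real n + \<theta>) * \<Delta>t)"
  defines "E \<equiv> \<lambda>n x. Eh n x + IV (E0\<theta> n) x"
  assumes domain: "open \<Omega>" "bounded \<Omega>" "\<Omega> \<noteq> {}" "polygonal \<Omega>"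
    and time: "T > 0" "N > 0" "\<Delta>t = T / real N"
    and theta: "0 \<le> \<theta>" "\<theta> \<le> 1"
    and mesh: "\<rho> > 0" "polygonal_mesh \<Omega> \<rho> M"
    and velocity: "u \<in> Linfty \<Omega>"
    and sigma: "0 < \<sigma>\<^sub>l" "\<sigma> \<in> borel_measurable (lebesgue_on \<Omega>)"
      "AE x in lebesgue_on \<Omega>. \<sigma>\<^sub>l \<le> \<sigma> x \<and> \<sigma> x \<le> \<sigma>\<^sub>u"
    and E0: "\<forall>t\<in>{0..T}. continuous_on (closure \<Omega>) (\<lambda>x. E0 x t)"
    and B0: "s > 0" "B0 \<in> Hdiv \<Omega> \<inter> Lp (2 + s) \<Omega>"
    and nodal_proj: "\<forall>P\<in>M. nodal_projector C\<^sub>\<pi> P (\<pi>V P)"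
    and nodal_stab: "\<alpha>V > 0" "\<beta>V > 0"
      "\<forall>P\<in>M. stabilization \<alpha>V \<beta>V P (remainders P (nodal_local P) (\<pi>V P)) (SV P)"
    and edge_stab: "\<alpha>E > 0" "\<beta>E > 0"
      "\<forall>P\<in>M. stabilization \<alpha>E \<beta>E P (remainders P (edge_local P) (edge_proj P)) (SE P)"
    and interp: "nodal_interpolation \<Omega> M u IV"
    and div_B0: "weak_div \<Omega> B0 (\<lambda>x. 0)"
    and B_in: "\<forall>n\<le>N. B n \<in> edge_space \<Omega> M"
    and Eh_in: "\<forall>n<N. Eh n \<in> nodal_space0 \<Omega> M"
    and init: "is_edge_interpolant \<Omega> M B0 (B 0)"
    and faraday: "\<forall>n<N. \<forall>w\<in>edge_space \<Omega> M.
      edge_inner M SE (\<lambda>x. (1 / \<Delta>t) *\<^sub>R (B (Suc n) x - B n x)) w +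
      edge_inner M SE (vrot \<Omega> (E n)) w = 0"
    and ohm: "\<forall>n<N. \<forall>v\<in>nodal_space0 \<Omega> M.
      nodal_inner M \<sigma> \<pi>V SV (Eh n) v +
      nodal_inner M \<sigma> \<pi>V SV (IV (\<lambda>x. cross2 (u x) (RT_proj M (B\<theta> n) x))) v -
      edge_inner M SE (B\<theta> n) (vrot \<Omega> v) =
      - nodal_inner M \<sigma> \<pi>V SV (IV (E0\<theta> n)) v"
  shows "\<forall>n\<le>N. weak_div \<Omega> (B n) (\<lambda>x. 0)"
proof -
  interpret mesh \<Omega> M \<rho> by unfold_locales (use domain mesh in auto)
  have E_in: "E n \<in> nodal_space \<Omega> M" if n: "n < N" for n
  proof -
    \<comment> \<open>Since \<open>n < N\<close> and \<open>\<theta> \<le> 1\<close>, the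
      intermediate time stays in the interval on which \<open>E0\<close> is continuous.\<close>
    have "0 \<le> (real n + \<theta>) * \<Delta>t" using time theta by simp
    moreover have "(real n + \<theta>) * \<Delta>t \<le> real N * \<Delta>t"
      using n theta time by (intro mult_right_mono) auto
    ultimately have "(real n + \<theta>) * \<Delta>t \<in> {0..T}" using time by simp
    then have c: "continuous_on (closure \<Omega>) (E0\<theta> n)" using E0 by (simp add: E0\<theta>_def)
    have zero: "(\<lambda>x. 0) \<in> edge_space \<Omega> M" by (rule zero_edge_space[of "B 0"]) (use B_in in simp)
    \<comment> \<open>Elements of \<open>interpolated\<close> are sums; the boundary datum occurs
      among them with the zero edge field.\<close>
    have "E0\<theta> n = (\<lambda>x. E0\<theta> n x + cross2 (u x) (RT_proj M (\<lambda>x. 0) x))"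
      using RT_proj_zero[OF simple] by (simp add: cross2_def)
    then have "E0\<theta> n \<in> interpolated \<Omega> M u"
      unfolding interpolated_def using c zero by blast
    then have "IV (E0\<theta> n) \<in> nodal_space \<Omega> M" using interp by (simp add: nodal_interpolation_def)
    moreover have "Eh n \<in> nodal_space \<Omega> M" using Eh_in n by (simp add: nodal_space0_def)
    ultimately show ?thesis unfolding E_def by (intro nodal_space_add)
  qed
  have "n \<le> N \<Longrightarrow> weak_div \<Omega> (B n) (\<lambda>x. 0)" for n
  proof (induction n)
    case 0
    show ?case by (rule edge_interpolant_div_zero[OF init div_B0])
  next
    case (Suc n)
    then have n: "n < N" and IH: "weak_div \<Omega> (B n) (\<lambda>x. 0)" by auto
    define A where "A x = (1 / \<Delta>t) *\<^sub>R (B (Suc n) x - B n x)" for x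
    define R where "R = vrot \<Omega> (E n)"
    define X where "X x = A x + R x" for x
    have dt: "\<Delta>t > 0" using time by simp
    have Bn: "B (Suc n) \<in> edge_space \<Omega> M" "B n \<in> edge_space \<Omega> M" using B_in Suc.prems by auto
    have A: "A \<in> edge_space \<Omega> M"
      using edge_space_lincomb[OF domain(1,2) Bn, of "1 / \<Delta>t" "- (1 / \<Delta>t)"]
      by (simp add: A_def[abs_def] scaleR_diff_right)
    have R: "R \<in> edge_space \<Omega> M" unfolding R_def by (rule vrot_edge_space[OF E_in[OF n]])
    have X: "X \<in> edge_space \<Omega> M" using edge_space_lincomb[OF domain(1,2) A R, of 1 1] by (simp add: X_def[abs_def])
    have "edge_inner M SE X X = edge_inner M SE A X + edge_inner M SE R X"
      unfolding X_def[abs_def] by (rule edge_inner_add[OF simple edge_stab(3) A R X[unfolded X_def[abs_def]]])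
    also have "\<dots> = 0" using faraday n X unfolding A_def[abs_def] R_def by blast
    finally have XX: "edge_inner M SE X X = 0" .
    have X0: "AE x in lebesgue_on \<Omega>. X x = 0"
      by (rule AE_mesh[OF edge_inner_definite[OF simple finite_M edge_stab(1,3) X XX]])
    have H: "E n \<in> H1 \<Omega>" using E_in[OF n] by (simp add: nodal_space_def)
    have divR: "weak_div \<Omega> R (\<lambda>x. 0)" unfolding R_def vrot_def by (rule weak_div_rotated_grad[OF domain(1,2) H])
    have L: "B (Suc n) \<in> L2 \<Omega>" "B n \<in> L2 \<Omega>" "R \<in> L2 \<Omega>" using Bn R by (auto intro: edge_space_L2)
    \<comment> \<open>The update \<open>B (Suc n) = B n - \<Delta>t R\<close> holds only almost
      everywhere, so its right-hand side is shown to be solenoidal and the property is then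
      transferred by \<open>weak_div_cong_AE\<close>.\<close>
    have "weak_div \<Omega> (\<lambda>x. 1 *\<^sub>R B n x + (- \<Delta>t) *\<^sub>R R x) (\<lambda>x. 1 * 0 + (- \<Delta>t) * 0)"
      by (rule weak_div_lincomb[OF domain(1,2) L(2,3) L2_zero L2_zero IH divR])
    then have "weak_div \<Omega> (\<lambda>x. B n x + (- \<Delta>t) *\<^sub>R R x) (\<lambda>x. 0)" by simp
    moreover have "AE x in lebesgue_on \<Omega>. B n x + (- \<Delta>t) *\<^sub>R R x = B (Suc n) x"
      using X0
    proof eventually_elim
      case (elim x)
      then have "\<Delta>t *\<^sub>R A x = (- \<Delta>t) *\<^sub>R R x" by (simp add: X_def add_eq_0_iff2)
      moreover have "\<Delta>t *\<^sub>R A x = B (Suc n) x - B n x" using dt by (simp add: A_def)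
      ultimately show ?case by (simp add: algebra_simps)
    qed
    moreover have "(\<lambda>x. B n x + (- \<Delta>t) *\<^sub>R R x) \<in> L2 \<Omega>" using L2_lincomb[OF L(2,3), of 1 "- \<Delta>t"] by simp
    ultimately show ?case
      using weak_div_cong_AE[OF domain(1,2), where w'="B (Suc n)" and d="\<lambda>x. 0" and d'="\<lambda>x. 0"]
        L2_measurable[OF L(1)] L2_measurable[OF L2_zero] by (auto intro: L2_measurable)
  qed
  then show ?thesis by blast
qed

end
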